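(* 1) Let $\mathfrak M$ be a Hilbert space and let $\Omega\in\mathcal{RS}(\mathfrak M)$. Then there exist a Hilbert space $\widetilde{\mathfrak M}$ containing $\mathfrak M$ as a subspace and a selfadjoint contraction $\widetilde A$ in $\widetilde{\mathfrak M}$ such that for all $z\in\mathbb C\setminus\{(-\infty,-1]\cup[1,+\infty)\}$ the equality $$\Omega(z)=P_{\mathfrak M}(zI_{\widetilde{\mathfrak M}}+\widetilde A)(I_{\widetilde{\mathfrak M}}+z\widetilde A)^{-1}\upharpoonright\mathfrak M \qquad( * )$$ holds. Moreover, the pair $\{\widetilde{\mathfrak M},\widetilde A\}$ can be chosen such that $\widetilde A$ is $\mathfrak M$-simple, i.e., $$\overline{\mathrm{span}}\{\widetilde A^n\mathfrak M:\ n\in\mathbb N_0\}=\widetilde{\mathfrak M}. \qquad( ** )$$ The function $\Omega$ is inner if and only if $\widetilde{\mathfrak M}=\mathfrak M$ in the representation $( * )$ satisfying $( ** )$. If there are two representations of the form $( * )$ with pairs $\{\widetilde{\mathfrak M}_1,\widetilde A_1\}$ and $\{\widetilde{\mathfrak M}_2,\widetilde A_2\}$ that are $\mathfrak M$-simple, then there exists a unitary operator $\widetilde U\in\mathbf B(\widetilde{\mathfrak M}_1,\widetilde{\mathfrak M}_2)$ such that $$\widetilde U\upharpoonright\mathfrak M=I_{\mathfrak M},\qquad \widetilde A_2\widetilde U=\widetilde U\widetilde A_1 .$$ 2) The formula $$\Omega(z)=\int_{-1}^{1}\frac{z+t}{1+zt}\,d\sigma(t),\qquad z\in\mathbb C\setminus\{(-\infty,-1]\cup[1,+\infty)\},$$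 gives a one-one correspondence between functions $\Omega$ from the class $\mathcal{RS}(\mathfrak M)$ and nondecreasing left-continuous $\mathbf B(\mathfrak M)$-valued functions $\sigma$ on $[-1,1]$ with $\sigma(-1)=0$, $\sigma(1)=I_{\mathfrak M}$.
   Context: Hilbert spaces are complex and separable; $\mathbf B(\cdot)$, $\mathbf B(\cdot,\cdot)$ denote spaces of bounded operators; $P_{\mathfrak M}$ is the orthogonal projection onto $\mathfrak M$, and $\upharpoonright$ denotes restriction. A $\mathbf B(\mathfrak M)$-valued function $M$ is a Nevanlinna function if it is holomorphic outside the real axis, $M(\lambda)^*=M(\bar\lambda)$, and $\operatorname{Im}\lambda\,\operatorname{Im}M(\lambda)\ge0$ for all $\lambda\in\mathbb C\setminus\mathbb R$. The class $\mathcal{RS}(\mathfrak M)$ consists of all $\mathbf B(\mathfrak M)$-valued Nevanlinna functions $\Omega$ which are holomorphic on $\mathbb C\setminus\{(-\infty,-1]\cup[1,+\infty)\}$ and satisfy $-I\le\Omega(x)\le I$ for all $x\in(-1,1)$; such functions are contractive on the open unit disk. A function $\Omega\in\mathcal{RS}(\mathfrak M)$ is called inner if $\Omega(\xi)$ is isometric for almost every $\xi$ in the unit circle $\mathbb T$ (note that $\mathbb T\setminus\{\pm1\}$ lies in the domain of $\Omega$).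
   Formalization: In part 2, σ is required to be (strongly) left-continuous only on (-1,1), not at t=1, so a jump at 1 is allowed; with left-continuity at 1 the claim fails, e.g. for the constant function Ω=I, which needs σ(t)=0 for t<1 and σ(1)=I. *)

theory Defs
  imports "HOL-Analysis.Analysis" "HOL-Library.Nonpos_Ints"
begin

section \<open>Complex separable Hilbert spaces\<close>

class scaleC =
  fixes scaleC :: "complex \<Rightarrow> 'a \<Rightarrow> 'a"  (infixr \<open>*\<^sub>C\<close> 75)

text \<open>The complex inner product \<open>cinner\<close> is linear in its first argument. The norm, hence the
  topology, comes from \<^class>\<open>real_inner\<close>, whose inner product is the real part of \<open>cinner\<close>;
  since \<open>cinner x x\<close> is real, the norm is the usual Hilbert space norm.\<close>

class hilbert_space = real_inner + complete_space + scaleC +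
  fixes cinner :: "'a \<Rightarrow> 'a \<Rightarrow> complex"
  assumes scaleC_add_right: "c *\<^sub>C (x + y) = c *\<^sub>C x + c *\<^sub>C y"
    and scaleC_add_left: "(c + d) *\<^sub>C x = c *\<^sub>C x + d *\<^sub>C x"
    and scaleC_scaleC: "c *\<^sub>C (d *\<^sub>C x) = (c * d) *\<^sub>C x"
    and scaleC_of_real: "complex_of_real r *\<^sub>C x = r *\<^sub>R x"
    and cinner_commute: "cinner x y = cnj (cinner y x)"
    and cinner_add_left: "cinner (x + y) z = cinner x z + cinner y z"
    and cinner_scaleC_left: "cinner (c *\<^sub>C x) y = c * cinner x y"
    and Re_cinner: "Re (cinner x y) = inner x y"
    and separable: "\<exists>D. countable D \<and> (\<forall>x. \<forall>e>0. \<exists>d\<in>D. dist d x < e)"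

global_interpretation complex_vector: vector_space "scaleC :: complex \<Rightarrow> 'a \<Rightarrow> 'a :: hilbert_space"
  defines csubspace = complex_vector.subspace
    and cspan = complex_vector.span
proof unfold_locales
  show "1 *\<^sub>C x = x" for x :: 'a
    using scaleC_of_real[of 1 x] by simp
qed (rule scaleC_add_right scaleC_add_left scaleC_scaleC)+

lemma cinner_self: "cinner x x = complex_of_real ((norm x)\<^sup>2)"
proof -
  have "Im (cinner x x) = 0"
    using arg_cong[OF cinner_commute[of x x], of Im] by simp
  then show ?thesis
    by (simp add: complex_eq_iff Re_cinner power2_norm_eq_inner)
qed

lemma norm_scaleC: "norm (c *\<^sub>C x) = cmod c * norm (x :: 'a :: hilbert_space)"
proof -
  have "cinner (c *\<^sub>C x) (c *\<^sub>C x) = (c * cnj c) * cinner x x"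
    by (subst cinner_scaleC_left, subst cinner_commute, subst cinner_scaleC_left,
        subst complex_cnj_mult, subst cinner_commute[of x x, symmetric]) simp
  then have "complex_of_real ((norm (c *\<^sub>C x))\<^sup>2) = complex_of_real ((cmod c * norm x)\<^sup>2)"
    by (simp add: cinner_self complex_mult_cnj cmod_power2 power_mult_distrib)
  then have "(norm (c *\<^sub>C x))\<^sup>2 = (cmod c * norm x)\<^sup>2"
    using of_real_eq_iff by blast
  then show ?thesis
    by (simp add: power2_eq_iff_nonneg)
qed

lemma bounded_linear_scaleC: "bounded_linear (\<lambda>x :: 'a :: hilbert_space. c *\<^sub>C x)"
proof (rule bounded_linear_intro)
  show "c *\<^sub>C (r *\<^sub>R x) = r *\<^sub>R (c *\<^sub>C x)" for r and x :: 'a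
    by (simp add: scaleC_of_real[symmetric] scaleC_scaleC mult.commute)
  show "norm (c *\<^sub>C x) \<le> norm x * cmod c" for x :: 'a
    by (simp add: norm_scaleC)
qed (rule scaleC_add_right)

subsection \<open>The space of square-summable sequences\<close>

typedef ell2 = "{f :: nat \<Rightarrow> complex. summable (\<lambda>n. (cmod (f n))\<^sup>2)}"
  by (rule exI[of _ "\<lambda>_. 0"]) simp

setup_lifting type_definition_ell2

lemma ell2_add:
  assumes "summable (\<lambda>n. (cmod (f n))\<^sup>2)" "summable (\<lambda>n. (cmod (g n))\<^sup>2)"
  shows "summable (\<lambda>n. (cmod (f n + g n))\<^sup>2)"
proof (rule summable_comparison_test')
  show "summable (\<lambda>n. 2 * (cmod (f n))\<^sup>2 + 2 * (cmod (g n))\<^sup>2)"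
    using assms by (intro summable_add summable_mult)
  fix n
  have "(cmod (f n + g n))\<^sup>2 \<le> (cmod (f n) + cmod (g n))\<^sup>2"
    by (intro power_mono norm_triangle_ineq) auto
  also have "\<dots> \<le> 2 * (cmod (f n))\<^sup>2 + 2 * (cmod (g n))\<^sup>2"
    using sum_squares_bound[of "cmod (f n)" "cmod (g n)"] by (simp add: power2_sum)
  finally show "norm ((cmod (f n + g n))\<^sup>2) \<le> 2 * (cmod (f n))\<^sup>2 + 2 * (cmod (g n))\<^sup>2"
    by simp
qed

lemma ell2_scale:
  assumes "summable (\<lambda>n. (cmod (f n))\<^sup>2)"
  shows "summable (\<lambda>n. (cmod (c * f n))\<^sup>2)"
  using assms by (simp add: norm_mult power_mult_distrib summable_mult)

lemma ell2_mult:
  assumes "summable (\<lambda>n. (cmod (f n))\<^sup>2)" "summable (\<lambda>n. (cmod (g n))\<^sup>2)"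
  shows "summable (\<lambda>n. f n * cnj (g n))"
proof (rule summable_comparison_test')
  show "summable (\<lambda>n. (cmod (f n))\<^sup>2 + (cmod (g n))\<^sup>2)"
    using assms by (intro summable_add)
  fix n
  have "2 * (cmod (f n) * cmod (g n)) \<le> (cmod (f n))\<^sup>2 + (cmod (g n))\<^sup>2"
    using sum_squares_bound[of "cmod (f n)" "cmod (g n)"] by simp
  moreover have "0 \<le> cmod (f n) * cmod (g n)"
    by simp
  ultimately show "norm (f n * cnj (g n)) \<le> (cmod (f n))\<^sup>2 + (cmod (g n))\<^sup>2"
    unfolding norm_mult complex_mod_cnj by linarith
qed

instantiation ell2 :: real_vector
begin
lift_definition zero_ell2 :: ell2 is "\<lambda>_. 0" by simp
lift_definition plus_ell2 :: "ell2 \<Rightarrow> ell2 \<Rightarrow> ell2" is "\<lambda>f g n. f n + g n"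
  by (rule ell2_add)
lift_definition uminus_ell2 :: "ell2 \<Rightarrow> ell2" is "\<lambda>f n. - f n" by simp
lift_definition minus_ell2 :: "ell2 \<Rightarrow> ell2 \<Rightarrow> ell2" is "\<lambda>f g n. f n - g n"
  subgoal for f g using ell2_add[of f "\<lambda>n. - g n"] by simp
  done
lift_definition scaleR_ell2 :: "real \<Rightarrow> ell2 \<Rightarrow> ell2" is "\<lambda>r f n. complex_of_real r * f n"
  by (rule ell2_scale)
instance
proof
  fix f g h :: ell2 and r s :: real
  show "f + g + h = f + (g + h)" by transfer (simp add: add.assoc)
  show "f + g = g + f" by transfer (simp add: add.commute)
  show "0 + f = f" by transfer simp
  show "- f + f = 0" by transfer simp
  show "f - g = f + - g" by transfer simp
  show "r *\<^sub>R (f + g) = r *\<^sub>R f + r *\<^sub>R g" by transfer (simp add: distrib_left)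
  show "(r + s) *\<^sub>R f = r *\<^sub>R f + s *\<^sub>R f" by transfer (simp add: distrib_right)
  show "r *\<^sub>R s *\<^sub>R f = (r * s) *\<^sub>R f" by transfer (simp add: mult.assoc)
  show "1 *\<^sub>R f = f" by transfer simp
qed
end

instantiation ell2 :: scaleC
begin
lift_definition scaleC_ell2 :: "complex \<Rightarrow> ell2 \<Rightarrow> ell2" is "\<lambda>c f n. c * f n"
  by (rule ell2_scale)
instance ..
end

definition cinner_ell2_raw :: "ell2 \<Rightarrow> ell2 \<Rightarrow> complex" where
  "cinner_ell2_raw f g = (\<Sum>n. Rep_ell2 f n * cnj (Rep_ell2 g n))"

lemma Rep_ell2_summable: "summable (\<lambda>n. (cmod (Rep_ell2 f n))\<^sup>2)"
  using Rep_ell2 by blast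

lemma cinner_raw_summable: "summable (\<lambda>n. Rep_ell2 f n * cnj (Rep_ell2 g n))"
  by (intro ell2_mult Rep_ell2_summable)

lemma cinner_raw_self: "cinner_ell2_raw f f = complex_of_real (\<Sum>n. (cmod (Rep_ell2 f n))\<^sup>2)"
proof -
  have "(\<lambda>n. Rep_ell2 f n * cnj (Rep_ell2 f n)) = (\<lambda>n. complex_of_real ((cmod (Rep_ell2 f n))\<^sup>2))"
    by (simp only: complex_norm_square)
  then show ?thesis
    unfolding cinner_ell2_raw_def by (simp only: suminf_of_real[OF Rep_ell2_summable])
qed

lemma cinner_raw_commute: "cinner_ell2_raw f g = cnj (cinner_ell2_raw g f)"
  unfolding cinner_ell2_raw_def
  using sums_unique[OF sums_cnj[THEN iffD2, OF summable_sums[OF cinner_raw_summable[of g f]]]]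
  by (simp add: mult.commute)

lemma cinner_raw_add: "cinner_ell2_raw (f + g) h = cinner_ell2_raw f h + cinner_ell2_raw g h"
  unfolding cinner_ell2_raw_def
  by (subst suminf_add[OF cinner_raw_summable cinner_raw_summable])
    (simp add: plus_ell2.rep_eq algebra_simps)

lemma cinner_raw_scaleC: "cinner_ell2_raw (c *\<^sub>C f) g = c * cinner_ell2_raw f g"
  unfolding cinner_ell2_raw_def
  by (subst suminf_mult[OF cinner_raw_summable, symmetric])
    (simp add: scaleC_ell2.rep_eq algebra_simps)

lemma scaleC_of_real_ell2: "complex_of_real r *\<^sub>C f = r *\<^sub>R (f :: ell2)"
  by transfer simp

instantiation ell2 :: real_inner
begin
definition inner_ell2 :: "ell2 \<Rightarrow> ell2 \<Rightarrow> real" where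
  "inner_ell2 f g = Re (cinner_ell2_raw f g)"
definition norm_ell2 :: "ell2 \<Rightarrow> real" where
  "norm_ell2 f = sqrt (inner f f)"
definition dist_ell2 :: "ell2 \<Rightarrow> ell2 \<Rightarrow> real" where
  "dist_ell2 f g = norm (f - g)"
definition sgn_ell2 :: "ell2 \<Rightarrow> ell2" where
  "sgn_ell2 f = inverse (norm f) *\<^sub>R f"
definition uniformity_ell2 :: "(ell2 \<times> ell2) filter" where
  "uniformity_ell2 = (INF e\<in>{0<..}. principal {(x, y). dist x y < e})"
definition open_ell2 :: "ell2 set \<Rightarrow> bool" where
  "open_ell2 U \<longleftrightarrow> (\<forall>x\<in>U. eventually (\<lambda>(x', y). x' = x \<longrightarrow> y \<in> U) uniformity)"
instance
proof
  fix f g h :: ell2 and r :: real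
  show "inner f g = inner g f"
    unfolding inner_ell2_def by (subst cinner_raw_commute) simp
  show "inner (f + g) h = inner f h + inner g h"
    by (simp add: inner_ell2_def cinner_raw_add)
  show "inner (r *\<^sub>R f) g = r * inner f g"
    by (simp add: inner_ell2_def cinner_raw_scaleC flip: scaleC_of_real_ell2)
  show "0 \<le> inner f f"
    by (simp add: inner_ell2_def cinner_raw_self suminf_nonneg Rep_ell2_summable)
  show "inner f f = 0 \<longleftrightarrow> f = 0"
    by (simp add: inner_ell2_def cinner_raw_self suminf_eq_zero_iff Rep_ell2_summable
        Rep_ell2_inject[symmetric] zero_ell2.rep_eq fun_eq_iff)
qed (simp_all add: norm_ell2_def dist_ell2_def sgn_ell2_def uniformity_ell2_def open_ell2_def)
end

lemma norm_ell2_sq: "(norm f)\<^sup>2 = (\<Sum>n. (cmod (Rep_ell2 f n))\<^sup>2)"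
  by (simp add: power2_norm_eq_inner inner_ell2_def cinner_raw_self)

lemma ell2_partial_le: "(\<Sum>n<N. (cmod (Rep_ell2 f n))\<^sup>2) \<le> (norm f)\<^sup>2"
  unfolding norm_ell2_sq by (rule sum_le_suminf) (auto simp: Rep_ell2_summable)

lemma ell2_coord_le: "cmod (Rep_ell2 f n) \<le> norm f"
proof -
  have "(cmod (Rep_ell2 f n))\<^sup>2 \<le> (\<Sum>k<Suc n. (cmod (Rep_ell2 f k))\<^sup>2)"
    by (simp add: sum_nonneg)
  also have "\<dots> \<le> (norm f)\<^sup>2" by (rule ell2_partial_le)
  finally show ?thesis by (rule power2_le_imp_le) simp
qed

instance ell2 :: complete_space
proof
  fix X :: "nat \<Rightarrow> ell2"
  assume "Cauchy X"
  then have C: "\<exists>M. \<forall>m\<ge>M. \<forall>n\<ge>M. norm (X m - X n) < e" if "e > 0" for e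
    using that by (simp add: Cauchy_iff)
  have "Cauchy (\<lambda>m. Rep_ell2 (X m) k)" for k
    unfolding Cauchy_iff
  proof (intro allI impI)
    fix e :: real assume "e > 0"
    then obtain M where "\<forall>m\<ge>M. \<forall>n\<ge>M. norm (X m - X n) < e" using C by blast
    then show "\<exists>M. \<forall>m\<ge>M. \<forall>n\<ge>M. norm (Rep_ell2 (X m) k - Rep_ell2 (X n) k) < e"
      by (metis ell2_coord_le le_less_trans minus_ell2.rep_eq)
  qed
  then have "\<exists>l. (\<lambda>m. Rep_ell2 (X m) k) \<longlonglongrightarrow> l" for k
    by (simp add: Cauchy_convergent convergent_def[symmetric])
  then obtain f where f: "\<And>k. (\<lambda>m. Rep_ell2 (X m) k) \<longlonglongrightarrow> f k" by metis
  have partial: "\<exists>M. \<forall>m\<ge>M. \<forall>N. (\<Sum>k<N. (cmod (Rep_ell2 (X m) k - f k))\<^sup>2) \<le> e\<^sup>2"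
    if e: "e > 0" for e
  proof -
    obtain M where M: "\<forall>m\<ge>M. \<forall>n\<ge>M. norm (X m - X n) < e" using C e by blast
    have "(\<Sum>k<N. (cmod (Rep_ell2 (X m) k - f k))\<^sup>2) \<le> e\<^sup>2" if m: "m \<ge> M" for m N
    proof (rule LIMSEQ_le_const2)
      show "(\<lambda>n. \<Sum>k<N. (cmod (Rep_ell2 (X m) k - Rep_ell2 (X n) k))\<^sup>2)
          \<longlonglongrightarrow> (\<Sum>k<N. (cmod (Rep_ell2 (X m) k - f k))\<^sup>2)"
        by (intro tendsto_intros f)
      have "(\<Sum>k<N. (cmod (Rep_ell2 (X m) k - Rep_ell2 (X n) k))\<^sup>2) \<le> e\<^sup>2" if "n \<ge> M" for n
      proof -
        have "(\<Sum>k<N. (cmod (Rep_ell2 (X m) k - Rep_ell2 (X n) k))\<^sup>2) \<le> (norm (X m - X n))\<^sup>2"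
          using ell2_partial_le[of "X m - X n" N] by (simp add: minus_ell2.rep_eq)
        also have "\<dots> \<le> e\<^sup>2"
          using M m that by (intro power_mono) (auto intro: less_imp_le)
        finally show ?thesis .
      qed
      then show "\<exists>K. \<forall>n\<ge>K. (\<Sum>k<N. (cmod (Rep_ell2 (X m) k - Rep_ell2 (X n) k))\<^sup>2) \<le> e\<^sup>2"
        by blast
    qed
    then show ?thesis by blast
  qed
  have sm: "summable (\<lambda>k. (cmod (Rep_ell2 (X m) k - f k))\<^sup>2)"
    if "\<forall>N. (\<Sum>k<N. (cmod (Rep_ell2 (X m) k - f k))\<^sup>2) \<le> e\<^sup>2" for m e
    using that by (intro summableI_nonneg_bounded[where x = "e\<^sup>2"]) auto
  obtain m0 where "\<forall>N. (\<Sum>k<N. (cmod (Rep_ell2 (X m0) k - f k))\<^sup>2) \<le> 1\<^sup>2"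
    using partial[of 1] by auto
  from ell2_add[OF Rep_ell2_summable[of "X m0"], of "\<lambda>k. f k - Rep_ell2 (X m0) k"] sm[OF this]
  have "summable (\<lambda>k. (cmod (f k))\<^sup>2)"
    by (simp add: norm_minus_commute)
  then have Rep: "Rep_ell2 (Abs_ell2 f) = f"
    by (simp add: Abs_ell2_inverse)
  have "X \<longlonglongrightarrow> Abs_ell2 f"
  proof (rule LIMSEQ_I)
    fix r :: real assume r: "r > 0"
    obtain M where M: "\<And>m N. m \<ge> M \<Longrightarrow> (\<Sum>k<N. (cmod (Rep_ell2 (X m) k - f k))\<^sup>2) \<le> (r/2)\<^sup>2"
      using partial[of "r/2"] r by auto
    have "norm (X m - Abs_ell2 f) < r" if "m \<ge> M" for m
    proof -
      have "(norm (X m - Abs_ell2 f))\<^sup>2 \<le> (r/2)\<^sup>2"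
        unfolding norm_ell2_sq minus_ell2.rep_eq Rep
      proof (rule suminf_le_const)
        show "summable (\<lambda>n. (cmod (Rep_ell2 (X m) n - f n))\<^sup>2)"
          using sm[of m "r/2"] M[OF that] by blast
        show "(\<Sum>i<N. (cmod (Rep_ell2 (X m) i - f i))\<^sup>2) \<le> (r/2)\<^sup>2" for N
          by (rule M[OF that])
      qed
      then have "norm (X m - Abs_ell2 f) \<le> r/2"
        using r by (auto elim: power2_le_imp_le)
      then show ?thesis using r by simp
    qed
    then show "\<exists>no. \<forall>n\<ge>no. norm (X n - Abs_ell2 f) < r" by blast
  qed
  then show "convergent X" by (rule convergentI)
qed

lemma ell2_separable: "\<exists>D :: ell2 set. countable D \<and> (\<forall>f. \<forall>e>0. \<exists>d\<in>D. dist d f < e)"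
proof -
  obtain Q :: "complex set" where Q: "countable Q" "\<And>U. open U \<Longrightarrow> U \<noteq> {} \<Longrightarrow> \<exists>q\<in>Q. q \<in> U"
    using countable_dense_setE by blast
  define E :: "complex list \<Rightarrow> ell2" where
    "E xs = Abs_ell2 (\<lambda>n. if n < length xs then xs ! n else 0)" for xs
  have RE: "Rep_ell2 (E xs) = (\<lambda>n. if n < length xs then xs ! n else 0)" for xs
  proof -
    have "summable (\<lambda>n. (cmod (if n < length xs then xs ! n else 0))\<^sup>2)"
      by (rule summable_finite[of "{..<length xs}"]) auto
    then show ?thesis by (simp add: E_def Abs_ell2_inverse)
  qed
  have "\<exists>d\<in>E ` lists Q. dist d f < e" if e: "e > 0" for f e
  proof -
    let ?a = "\<lambda>n. (cmod (Rep_ell2 f n))\<^sup>2"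
    from suminf_exist_split[OF _ Rep_ell2_summable[of f], of "e\<^sup>2/4"] e
    obtain N where N: "norm (\<Sum>i. ?a (i + N)) < e\<^sup>2/4"
      by auto
    define d where "d = e\<^sup>2 / (4 * (real N + 1))"
    have d: "d > 0" using e by (simp add: d_def)
    have "\<exists>q\<in>Q. q \<in> ball (Rep_ell2 f n) (sqrt d)" for n
      using d by (intro Q(2)) auto
    then obtain q where q: "\<And>n. q n \<in> Q" "\<And>n. dist (Rep_ell2 f n) (q n) < sqrt d"
      by (metis mem_ball)
    let ?g = "E (map q [0..<N])"
    have q2: "(cmod (q n - Rep_ell2 f n))\<^sup>2 \<le> d" for n
    proof -
      have "(cmod (q n - Rep_ell2 f n))\<^sup>2 \<le> (sqrt d)\<^sup>2"
        using q(2)[of n] by (intro power_mono) (auto simp: dist_norm norm_minus_commute)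
      then show ?thesis using d by simp
    qed
    let ?h = "\<lambda>n. (cmod (Rep_ell2 (?g - f) n))\<^sup>2"
    have "(norm (?g - f))\<^sup>2 = (\<Sum>i. ?h (i + N)) + (\<Sum>i<N. ?h i)"
      unfolding norm_ell2_sq by (rule suminf_split_initial_segment[OF Rep_ell2_summable])
    also have "(\<Sum>i. ?h (i + N)) = (\<Sum>i. ?a (i + N))"
      by (simp add: minus_ell2.rep_eq RE)
    also have "(\<Sum>i<N. ?h i) \<le> (\<Sum>i<N. d)"
      using q2 by (intro sum_mono) (simp add: minus_ell2.rep_eq RE)
    also have "(\<Sum>i<N. d) \<le> e\<^sup>2/4"
      using e by (simp add: d_def field_simps)
    finally have "(norm (?g - f))\<^sup>2 \<le> e\<^sup>2/4 + e\<^sup>2/4"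
      using N by simp
    also have "\<dots> < e\<^sup>2" using e by simp
    finally have "norm (?g - f) < e"
      using e by (simp add: power2_less_imp_less)
    moreover have "?g \<in> E ` lists Q" using q(1) by (intro imageI) (auto simp: in_lists_conv_set)
    ultimately show ?thesis
      by (auto simp: dist_norm)
  qed
  moreover have "countable (E ` lists Q)"
    using Q(1) by (intro countable_image countable_lists)
  ultimately show ?thesis by blast
qed

instantiation ell2 :: hilbert_space
begin
definition cinner_ell2 :: "ell2 \<Rightarrow> ell2 \<Rightarrow> complex" where
  "cinner f g = (\<Sum>n. Rep_ell2 f n * cnj (Rep_ell2 g n))"
instance
proof
  fix f g h :: ell2 and c d :: complex and r :: real
  have eq: "cinner = cinner_ell2_raw"
    by (simp add: fun_eq_iff cinner_ell2_def cinner_ell2_raw_def)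
  show "c *\<^sub>C (f + g) = c *\<^sub>C f + c *\<^sub>C g" "(c + d) *\<^sub>C f = c *\<^sub>C f + d *\<^sub>C f"
    "c *\<^sub>C (d *\<^sub>C f) = (c * d) *\<^sub>C f"
    by (transfer; simp add: algebra_simps)+
  show "complex_of_real r *\<^sub>C f = r *\<^sub>R f" by (rule scaleC_of_real_ell2)
  show "cinner f g = cnj (cinner g f)" unfolding eq by (rule cinner_raw_commute)
  show "cinner (f + g) h = cinner f h + cinner g h" unfolding eq by (rule cinner_raw_add)
  show "cinner (c *\<^sub>C f) g = c * cinner f g" unfolding eq by (rule cinner_raw_scaleC)
  show "Re (cinner f g) = inner f g" unfolding eq by (simp add: inner_ell2_def)
qed (rule ell2_separable)
end

section \<open>Bounded operators\<close>

text \<open>The library type \<open>'a \<Rightarrow>\<^sub>L 'b\<close> consists of the bounded real-linear maps and carries the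
  operator norm. \<open>bounded_ops\<close> is the space of bounded complex-linear operators.\<close>

definition bounded_ops :: "('a::hilbert_space \<Rightarrow>\<^sub>L 'b::hilbert_space) set" where
  "bounded_ops = {T. \<forall>c x. blinfun_apply T (c *\<^sub>C x) = c *\<^sub>C blinfun_apply T x}"

instantiation blinfun :: (real_normed_vector, hilbert_space) scaleC
begin
lift_definition scaleC_blinfun :: "complex \<Rightarrow> ('a \<Rightarrow>\<^sub>L 'b) \<Rightarrow> ('a \<Rightarrow>\<^sub>L 'b)" is
  "\<lambda>c T x. c *\<^sub>C T x"
  by (rule bounded_linear_compose[OF bounded_linear_scaleC])
instance ..
end

definition cadjoint :: "('a::hilbert_space \<Rightarrow>\<^sub>L 'a) \<Rightarrow> ('a \<Rightarrow>\<^sub>L 'a)" where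
  "cadjoint T = (THE S. \<forall>x y. cinner (blinfun_apply T x) y = cinner x (blinfun_apply S y))"

definition Im_op :: "('a::hilbert_space \<Rightarrow>\<^sub>L 'a) \<Rightarrow> ('a \<Rightarrow>\<^sub>L 'a)" where
  "Im_op T = (1 / (2 * \<i>)) *\<^sub>C (T - cadjoint T)"

text \<open>On a complex Hilbert space, \<open>cinner (T x) x\<close> being real for all \<open>x\<close> already makes
  a complex-linear \<open>T\<close> selfadjoint.\<close>

definition nonneg_op :: "('a::hilbert_space \<Rightarrow>\<^sub>L 'a) \<Rightarrow> bool" where
  "nonneg_op T \<longleftrightarrow> (\<forall>x. cinner (blinfun_apply T x) x \<in> \<real>\<^sub>\<ge>\<^sub>0)"

definition op_le :: "('a::hilbert_space \<Rightarrow>\<^sub>L 'a) \<Rightarrow> ('a \<Rightarrow>\<^sub>L 'a) \<Rightarrow> bool" where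
  "op_le S T \<longleftrightarrow> nonneg_op (T - S)"

definition op_holomorphic_on ::
    "(complex \<Rightarrow> ('a::hilbert_space \<Rightarrow>\<^sub>L 'a)) \<Rightarrow> complex set \<Rightarrow> bool" where
  "op_holomorphic_on F S \<longleftrightarrow> (\<forall>z\<in>S. \<exists>D. (F has_derivative (\<lambda>h. h *\<^sub>C D)) (at z within S))"

section \<open>Nevanlinna functions and the class RS\<close>

text \<open>Functions with values in the bounded operators are modelled as total functions on
  \<open>complex\<close>; only their values on the stated domain matter.\<close>

definition nevanlinna :: "(complex \<Rightarrow> ('a::hilbert_space \<Rightarrow>\<^sub>L 'a)) \<Rightarrow> bool" where
  "nevanlinna M \<longleftrightarrow>
     (\<forall>z\<in>-\<real>. M z \<in> bounded_ops) \<and>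
     op_holomorphic_on M (-\<real>) \<and>
     (\<forall>z\<in>-\<real>. cadjoint (M z) = M (cnj z)) \<and>
     (\<forall>z\<in>-\<real>. nonneg_op (Im z *\<^sub>R Im_op (M z)))"

definition slit_plane :: "complex set" where
  "slit_plane = - (complex_of_real ` ({..-1} \<union> {1..}))"

definition RS :: "(complex \<Rightarrow> ('a::hilbert_space \<Rightarrow>\<^sub>L 'a)) set" where
  "RS = {\<Omega>. nevanlinna \<Omega> \<and>
     (\<forall>z\<in>slit_plane. \<Omega> z \<in> bounded_ops) \<and>
     op_holomorphic_on \<Omega> slit_plane \<and>
     (\<forall>x::real. -1 < x \<and> x < 1 \<longrightarrow>
        op_le (- id_blinfun) (\<Omega> (complex_of_real x)) \<and>
        op_le (\<Omega> (complex_of_real x)) id_blinfun)}"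

text \<open>Almost everywhere on the unit circle is with respect to arc length.\<close>

definition inner_fun :: "(complex \<Rightarrow> ('a::hilbert_space \<Rightarrow>\<^sub>L 'a)) \<Rightarrow> bool" where
  "inner_fun \<Omega> \<longleftrightarrow> \<Omega> \<in> RS \<and>
     (AE \<theta> in lborel. \<theta> \<in> {0..2 * pi} \<longrightarrow> (\<forall>x. norm (blinfun_apply (\<Omega> (cis \<theta>)) x) = norm x))"

section \<open>Representations by selfadjoint contractions\<close>

text \<open>A Hilbert space containing \<open>'a\<close> as a subspace is given by a closed subspace \<open>H\<close> of some
  Hilbert space type together with an isometric embedding \<open>J\<close> of \<open>'a\<close> into \<open>H\<close>, the subspace being
  \<open>range J\<close>. Operators on \<open>H\<close> are functions of which only the values on \<open>H\<close> matter. Every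
  separable Hilbert space occurs, up to unitary equivalence, as a closed subspace of \<open>ell2\<close>.\<close>

definition clinear_on :: "'b::hilbert_space set \<Rightarrow> ('b \<Rightarrow> 'c::hilbert_space) \<Rightarrow> bool" where
  "clinear_on H T \<longleftrightarrow>
     (\<forall>x\<in>H. \<forall>y\<in>H. T (x + y) = T x + T y) \<and> (\<forall>c. \<forall>x\<in>H. T (c *\<^sub>C x) = c *\<^sub>C T x)"

definition hilbert_extension ::
    "('a::hilbert_space \<Rightarrow> 'b::hilbert_space) \<Rightarrow> 'b set \<Rightarrow> bool" where
  "hilbert_extension J H \<longleftrightarrow> csubspace H \<and> closed H \<and>
     clinear_on UNIV J \<and> (\<forall>x. norm (J x) = norm x) \<and> range J \<subseteq> H"

definition selfadjoint_contraction_on ::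
    "'b::hilbert_space set \<Rightarrow> ('b \<Rightarrow> 'b) \<Rightarrow> bool" where
  "selfadjoint_contraction_on H A \<longleftrightarrow> A ` H \<subseteq> H \<and> clinear_on H A \<and>
     (\<forall>x\<in>H. \<forall>y\<in>H. cinner (A x) y = cinner x (A y)) \<and> (\<forall>x\<in>H. norm (A x) \<le> norm x)"

definition unitary_between ::
    "'b::hilbert_space set \<Rightarrow> 'c::hilbert_space set \<Rightarrow> ('b \<Rightarrow> 'c) \<Rightarrow> bool" where
  "unitary_between H K U \<longleftrightarrow> clinear_on H U \<and> U ` H = K \<and>
     (\<forall>x\<in>H. \<forall>y\<in>H. cinner (U x) (U y) = cinner x y)"

definition orth_proj :: "'b::hilbert_space set \<Rightarrow> 'b \<Rightarrow> 'b" where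
  "orth_proj S x = (THE y. y \<in> S \<and> (\<forall>s\<in>S. cinner (x - y) s = 0))"

definition represents ::
    "(complex \<Rightarrow> ('a::hilbert_space \<Rightarrow>\<^sub>L 'a)) \<Rightarrow>
     ('a \<Rightarrow> 'b::hilbert_space) \<Rightarrow> 'b set \<Rightarrow> ('b \<Rightarrow> 'b) \<Rightarrow> bool" where
  "represents \<Omega> J H A \<longleftrightarrow> hilbert_extension J H \<and> selfadjoint_contraction_on H A \<and>
     (\<forall>z\<in>slit_plane. \<forall>x.
        J (blinfun_apply (\<Omega> z) x) =
        orth_proj (range J)
          ((\<lambda>h. z *\<^sub>C h + A h) (inv_into H (\<lambda>h. h + z *\<^sub>C A h) (J x))))"

definition simple_pair ::
    "('a::hilbert_space \<Rightarrow> 'b::hilbert_space) \<Rightarrow> 'b set \<Rightarrow> ('b \<Rightarrow> 'b) \<Rightarrow> bool" where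
  "simple_pair J H A \<longleftrightarrow> closure (cspan (\<Union>n. (A ^^ n) ` range J)) = H"

section \<open>Operator-valued Stieltjes integrals\<close>

text \<open>Riemann--Stieltjes integral over \<open>[-1, 1]\<close> of a scalar function against an operator-valued
  one, with limits in the operator norm. The sums run over the whole closed interval, so that jumps
  of \<open>\<sigma>\<close> at both end points contribute.\<close>

definition has_stieltjes_integral ::
    "(real \<Rightarrow> complex) \<Rightarrow> (real \<Rightarrow> ('a::hilbert_space \<Rightarrow>\<^sub>L 'a)) \<Rightarrow> ('a \<Rightarrow>\<^sub>L 'a) \<Rightarrow> bool" where
  "has_stieltjes_integral f \<sigma> I \<longleftrightarrow>
     (\<forall>\<epsilon>>0. \<exists>\<delta>>0. \<forall>p. p tagged_division_of {-1..1} \<and> (\<lambda>t. ball t \<delta>) fine p \<longrightarrow>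
        norm ((\<Sum>(t, k)\<in>p. f t *\<^sub>C (\<sigma> (Sup k) - \<sigma> (Inf k))) - I) < \<epsilon>)"

definition stieltjes_integral ::
    "(real \<Rightarrow> complex) \<Rightarrow> (real \<Rightarrow> ('a::hilbert_space \<Rightarrow>\<^sub>L 'a)) \<Rightarrow> ('a \<Rightarrow>\<^sub>L 'a)" where
  "stieltjes_integral f \<sigma> = (THE I. has_stieltjes_integral f \<sigma> I)"

text \<open>Left continuity is in the strong operator topology, at the interior points only: it is void at
  \<open>-1\<close>, and at \<open>1\<close> the normalisation \<open>\<sigma> 1 = I\<close> takes its place, the jump
  \<open>\<sigma> 1 - \<sigma> (1-)\<close> being the mass at \<open>1\<close>. (The constant function \<open>\<Omega> = I\<close> needs unit mass at
  \<open>1\<close>.) A function on \<open>[-1, 1]\<close> is an element of \<open>extensional {-1..1}\<close>.\<close>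

definition distribution_functions :: "(real \<Rightarrow> ('a::hilbert_space \<Rightarrow>\<^sub>L 'a)) set" where
  "distribution_functions = {\<sigma> \<in> extensional {-1..1}.
     (\<forall>t\<in>{-1..1}. \<sigma> t \<in> bounded_ops) \<and>
     (\<forall>s t. -1 \<le> s \<and> s \<le> t \<and> t \<le> 1 \<longrightarrow> op_le (\<sigma> s) (\<sigma> t)) \<and>
     (\<forall>t\<in>{-1<..<1}. \<forall>x. ((\<lambda>s. blinfun_apply (\<sigma> s) x) \<longlongrightarrow> blinfun_apply (\<sigma> t) x) (at_left t)) \<and>
     \<sigma> (-1) = 0 \<and> \<sigma> 1 = id_blinfun}"

definition mobius_kernel :: "complex \<Rightarrow> real \<Rightarrow> complex" where
  "mobius_kernel z t = (z + of_real t) / (1 + z * of_real t)"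

end

theory Submission
  imports Defs "HOL-Complex_Analysis.Complex_Analysis" "HOL-Real_Asymp.Real_Asymp"
begin

text \<open>Both the representation by a dilation and the integral formula amount to
  \<open>(I - z \<Omega> z) / (1 - z\<^sup>2) = \<Sum>n. (- z) ^ n S n\<close> near \<open>0\<close>, where the moments \<open>S n\<close> are the
  compressions of the powers of the dilation, respectively the integrals of \<open>t ^ n\<close> against \<open>\<sigma>\<close>. So
  everything is determined by the moments, and the point is that, for \<open>\<Omega>\<close> in RS, they define a positive
  functional on the polynomials on \<open>[-1, 1]\<close>. Pulled back to the unit disc by
  \<open>\<zeta> \<mapsto> 2 \<zeta> / (1 + \<zeta>\<^sup>2)\<close>, a Nevanlinna function is typically real, and Cauchy's formula on
  circles of radius below \<open>1\<close> makes the functional with moments \<open>S n - S (n + 2)\<close> positive; the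
  bounds \<open>-I \<le> \<Omega> x \<le> I\<close> for \<open>x\<close> near \<open>\<plusminus>1\<close> say that the point masses at \<open>\<plusminus>1\<close> lost through the
  factor \<open>1 - t\<^sup>2\<close> are nonnegative. The positive functional yields \<open>\<sigma>\<close> as a monotone limit, and the
  positive definite kernel \<open>S (n + m)\<close> yields the dilation. If \<open>\<Omega>\<close> is inner, its being isometric at
  \<open>\<plusminus>\<i>\<close> already forces \<open>range J\<close> to be invariant under the dilation.\<close>

section \<open>Complex Hilbert spaces\<close>

text \<open>Everything rests on
  \<open>1 - z * (z + t) / (1 + z * t) = (1 - z^2) / (1 + z * t)\<close>, for numbers
  \<open>t\<close> as for operators: up to the factor \<open>1 - z^2\<close>, which vanishes only at
  the tips of the slits, the kernel is a resolvent, and the geometric series displays its moments.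
  The obstacle is that \<open>Im ((z + t) / (1 + z * t))\<close> carries the factor
  \<open>1 - t^2\<close>, so imaginary parts near the slits are blind to atoms at
  \<open>\<plusminus>1\<close>; a polynomial has to be split into \<open>1 - t^2\<close> times a
  quotient plus a linear part. Positivity is a matter of quadratic forms: a fixed \<open>x\<close>
  reduces \<open>\<Omega>\<close> to a scalar function of total mass \<open>(norm x)^2\<close>, and
  polarization leads back to operators. As a moment depends only on \<open>n + m\<close>,
  multiplication by \<open>t\<close> becomes a symmetric shift of the kernel, and
  \<open>1 - t^2 \<ge> 0\<close> makes the shift a contraction. The dilation is to lie in
  \<open>ell2\<close>, so the kernel is realized on a countable index set by recursively computed
  vectors. At \<open>\<plusminus>\<i>\<close> the two resolvents are adjoint to each other, which is
  why these two points suffice for inner functions.\<close>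

instance hilbert_space \<subseteq> banach ..

lemma cinner_add_right: "cinner x (y + z) = cinner x y + cinner x (z :: 'a :: hilbert_space)"
  by (metis cinner_add_left cinner_commute complex_cnj_add)

lemma cinner_scaleC_right: "cinner x (c *\<^sub>C y) = cnj c * cinner x (y :: 'a :: hilbert_space)"
  by (metis cinner_scaleC_left cinner_commute complex_cnj_mult)

lemma cinner_zero [simp]: "cinner 0 y = 0" "cinner x 0 = 0" for x y :: "'a :: hilbert_space"
  using cinner_add_left[of 0 0 y] cinner_add_right[of x 0 0] by auto

lemma scaleC_minus1: "(- 1) *\<^sub>C x = - (x :: 'a :: hilbert_space)"
  using scaleC_of_real[of "- 1" x] by simp

lemma cinner_minus_left: "cinner (- x) y = - cinner x (y :: 'a :: hilbert_space)"
  by (metis cinner_scaleC_left mult_minus1 scaleC_minus1)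

lemma cinner_minus_right: "cinner x (- y) = - cinner x (y :: 'a :: hilbert_space)"
  by (metis cinner_commute cinner_minus_left complex_cnj_minus)

lemma cinner_diff_left: "cinner (x - y) z = cinner x z - cinner y (z :: 'a :: hilbert_space)"
  by (metis cinner_add_left cinner_minus_left diff_conv_add_uminus)

lemma cinner_diff_right: "cinner x (y - z) = cinner x y - cinner x (z :: 'a :: hilbert_space)"
  by (metis cinner_add_right cinner_minus_right diff_conv_add_uminus)

lemma cinner_scaleR_left: "cinner (r *\<^sub>R x) y = of_real r * cinner x (y :: 'a :: hilbert_space)"
  by (metis cinner_scaleC_left scaleC_of_real)

lemma cinner_scaleR_right: "cinner x (r *\<^sub>R y) = of_real r * cinner x (y :: 'a :: hilbert_space)"
  by (metis cinner_scaleC_right scaleC_of_real complex_cnj_complex_of_real)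

lemma cinner_sum_left: "cinner (\<Sum>i\<in>I. f i) y = (\<Sum>i\<in>I. cinner (f i) (y :: 'a :: hilbert_space))"
  by (induction I rule: infinite_finite_induct) (auto simp: cinner_add_left)

lemma cinner_sum_right: "cinner x (\<Sum>i\<in>I. f i) = (\<Sum>i\<in>I. cinner x (f i :: 'a :: hilbert_space))"
  by (induction I rule: infinite_finite_induct) (auto simp: cinner_add_right)

lemmas cinner_lin = cinner_add_left cinner_add_right cinner_scaleC_left cinner_scaleC_right
  cinner_diff_left cinner_diff_right cinner_scaleR_left cinner_scaleR_right
  cinner_minus_left cinner_minus_right cinner_sum_left cinner_sum_right

lemma cinner_self_zero: "cinner x x = 0 \<longleftrightarrow> x = (0 :: 'a :: hilbert_space)"
  by (simp add: cinner_self)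

lemma norm_eq_cinner: "(norm x)\<^sup>2 = Re (cinner x (x :: 'a :: hilbert_space))"
  by (simp add: cinner_self)

text \<open>Multiplying \<open>x\<close> by a unimodular \<open>c\<close> makes the product equal to
  its modulus, hence to a real inner product, and the real Cauchy-Schwarz inequality applies. Where
  the product vanishes, the value \<open>1\<close> merely keeps \<open>cmod c = 1\<close>.\<close>

lemma cinner_bound: "cmod (cinner x y) \<le> norm x * norm (y :: 'a :: hilbert_space)"
proof -
  define c where "c = (if cinner x y = 0 then 1 else cnj (sgn (cinner x y)))"
  have c: "cmod c = 1" by (simp add: c_def norm_sgn)
  have "c * cinner x y = of_real (cmod (cinner x y))"
  proof (cases "cinner x y = 0")
    case False
    then have "c * cinner x y = cnj (cinner x y) * cinner x y / of_real (cmod (cinner x y))"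
      by (simp add: c_def sgn_eq)
    also have "\<dots> = of_real ((cmod (cinner x y))\<^sup>2) / of_real (cmod (cinner x y))"
      by (simp only: complex_norm_square mult.commute)
    also have "\<dots> = of_real (cmod (cinner x y))"
      using False by (simp add: power2_eq_square)
    finally show ?thesis .
  qed simp
  then have "cinner (c *\<^sub>C x) y = of_real (cmod (cinner x y))"
    by (simp add: cinner_scaleC_left)
  then have "cmod (cinner x y) = inner (c *\<^sub>C x) y"
    by (metis Re_cinner Re_complex_of_real)
  also have "\<dots> \<le> norm (c *\<^sub>C x) * norm y" by (rule norm_cauchy_schwarz)
  finally show ?thesis by (simp add: norm_scaleC c)
qed

lemma bounded_bilinear_cinner: "bounded_bilinear (cinner :: 'a :: hilbert_space \<Rightarrow> 'a \<Rightarrow> complex)"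
proof
  show "\<exists>K. \<forall>a b. norm (cinner a b) \<le> norm a * norm (b :: 'a) * K"
    using cinner_bound by (intro exI[of _ 1]) auto
qed (auto simp: cinner_lin scaleR_conv_of_real)

lemmas bounded_linear_cinner_left = bounded_bilinear.bounded_linear_left[OF bounded_bilinear_cinner]
lemmas tendsto_cinner [tendsto_intros] = bounded_bilinear.tendsto[OF bounded_bilinear_cinner]
lemmas continuous_on_cinner [continuous_intros] =
  bounded_bilinear.continuous_on[OF bounded_bilinear_cinner]

lemmas tendsto_scaleC [tendsto_intros] = bounded_linear.tendsto[OF bounded_linear_scaleC]

section \<open>Subspaces, the Riesz theorem and orthogonal projections\<close>

lemma csubspaceD:
  assumes "csubspace (V :: 'a :: hilbert_space set)"
  shows "0 \<in> V" "x \<in> V \<Longrightarrow> y \<in> V \<Longrightarrow> x + y \<in> V" "x \<in> V \<Longrightarrow> c *\<^sub>C x \<in> V"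
    "x \<in> V \<Longrightarrow> y \<in> V \<Longrightarrow> x - y \<in> V" "x \<in> V \<Longrightarrow> r *\<^sub>R x \<in> V" "x \<in> V \<Longrightarrow> - x \<in> V"
  using assms complex_vector.subspace_0 complex_vector.subspace_add
    complex_vector.subspace_scale complex_vector.subspace_diff complex_vector.subspace_neg
  by (auto simp flip: scaleC_of_real)

lemma csubspace_closure:
  assumes V: "csubspace (V :: 'a :: hilbert_space set)"
  shows "csubspace (closure V)"
proof (rule complex_vector.subspaceI)
  show "0 \<in> closure V" using csubspaceD(1)[OF V] closure_subset by blast
next
  fix x y assume "x \<in> closure V" "y \<in> closure V"
  then obtain f g where "\<And>n. f n \<in> V" "f \<longlonglongrightarrow> x" "\<And>n. g n \<in> V" "g \<longlonglongrightarrow> y"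
    unfolding closure_sequential by blast
  then show "x + y \<in> closure V"
    unfolding closure_sequential
    by (intro exI[of _ "\<lambda>n. f n + g n"]) (auto intro: csubspaceD[OF V] tendsto_intros)
next
  fix c x assume "x \<in> closure V"
  then obtain f where "\<And>n. f n \<in> V" "f \<longlonglongrightarrow> x"
    unfolding closure_sequential by blast
  then show "c *\<^sub>C x \<in> closure V"
    unfolding closure_sequential
    by (intro exI[of _ "\<lambda>n. c *\<^sub>C f n"]) (auto intro: csubspaceD[OF V] tendsto_intros)
qed

lemma csubspace_cspan: "csubspace (cspan (V :: 'a :: hilbert_space set))"
  by (rule complex_vector.subspace_span)

lemma csubspace_closure_cspan: "csubspace (closure (cspan (V :: 'a :: hilbert_space set)))"
  by (intro csubspace_closure csubspace_cspan)

lemma in_closure_cspan: "x \<in> V \<Longrightarrow> x \<in> closure (cspan (V :: 'a :: hilbert_space set))"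
  by (metis closure_subset complex_vector.span_base subsetD)

text \<open>The discriminant criterion, in the form from which the Cauchy-Schwarz inequalities for
  semidefinite forms are read off later. Restricting \<open>t\<close> to real multiples of
  \<open>b\<close> leaves a real quadratic in one variable.\<close>

lemma quadratic_nonneg_imp:
  fixes b :: complex
  assumes "\<And>t. 0 \<le> A + 2 * Re (cnj t * b) + (cmod t)\<^sup>2 * C" and "0 \<le> A" "0 \<le> C"
  shows "(cmod b)\<^sup>2 \<le> A * C"
proof -
  have b: "Re (cnj b * b) = (cmod b)\<^sup>2"
    by (metis Re_complex_of_real complex_norm_square mult.commute)
  have *: "0 \<le> A - 2 * s * (cmod b)\<^sup>2 + s\<^sup>2 * (cmod b)\<^sup>2 * C" for s :: real
    using assms(1)[of "- of_real s * b"] b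
    by (simp add: norm_mult power_mult_distrib mult.assoc)
  show ?thesis
  proof (cases "C = 0")
    case True
    show ?thesis
    proof (rule ccontr)
      assume "\<not> ?thesis"
      then have "(cmod b)\<^sup>2 > 0" using True by auto
      \<comment> \<open>For \<open>C = 0\<close> the expression is affine in \<open>s\<close>, and
        this \<open>s\<close> gives it the value \<open>- 1\<close>.\<close>
      then show False
        using *[of "(A + 1) / (2 * (cmod b)\<^sup>2)"] True by simp
    qed
  next
    case False
    then have "C > 0" using assms by simp
    \<comment> \<open>\<open>s = 1 / C\<close> minimizes the quadratic.\<close>
    have "0 \<le> A - (cmod b)\<^sup>2 / C"
      using *[of "1 / C"] \<open>C > 0\<close> by (simp add: field_simps power2_eq_square)
    then show ?thesis using \<open>C > 0\<close> by (simp add: field_simps)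
  qed
qed


lemma tendsto_norm_bound:
  assumes "X \<longlonglongrightarrow> (x :: 'a :: real_normed_vector)" "\<And>n. norm (X n) \<le> b"
  shows "norm x \<le> b"
  using assms by (intro LIMSEQ_le_const2[OF tendsto_norm[OF assms(1)]]) auto

text \<open>The representing vector minimizes the energy
  \<open>(norm v)^2 - 2 * Re (\<phi> v)\<close>: a minimizing sequence is Cauchy by the
  parallelogram law, and vanishing of the first variation at the limit is the representation. The
  limit is only known to lie in the closure of \<open>V\<close>, so variations are taken at the
  approximants \<open>v n\<close>.\<close>

lemma riesz:
  fixes \<phi> :: "'a :: hilbert_space \<Rightarrow> complex"
  assumes V: "csubspace V"
    and add: "\<And>x y. x \<in> V \<Longrightarrow> y \<in> V \<Longrightarrow> \<phi> (x + y) = \<phi> x + \<phi> y"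
    and scale: "\<And>c x. x \<in> V \<Longrightarrow> \<phi> (c *\<^sub>C x) = c * \<phi> x"
    and bound: "\<And>x. x \<in> V \<Longrightarrow> cmod (\<phi> x) \<le> C * norm x" and C: "0 \<le> C"
  obtains u where "u \<in> closure V" "\<And>v. v \<in> V \<Longrightarrow> \<phi> v = cinner v u" "norm u \<le> C"
proof -
  define E where "E v = (norm v)\<^sup>2 - 2 * Re (\<phi> v)" for v
  have E_lower: "- C\<^sup>2 \<le> E v" if "v \<in> V" for v
  proof -
    have "Re (\<phi> v) \<le> C * norm v"
      using bound[OF that] complex_Re_le_cmod[of "\<phi> v"] by linarith
    moreover have "0 \<le> (norm v - C)\<^sup>2" by simp
    ultimately show ?thesis by (simp add: E_def power2_diff algebra_simps)
  qed
  define m where "m = Inf (E ` V)"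
  have bdd: "bdd_below (E ` V)" using E_lower by (intro bdd_belowI[of _ "- C\<^sup>2"]) auto
  have m: "m \<le> E v" if "v \<in> V" for v
    unfolding m_def using bdd that by (intro cINF_lower) auto
  have "\<exists>v\<in>V. E v < m + 1 / (real n + 1)" for n :: nat
  proof -
    have "Inf (E ` V) < m + 1 / (real n + 1)" by (simp add: m_def)
    moreover have "E ` V \<noteq> {}" using csubspaceD(1)[OF V] by auto
    ultimately show ?thesis using cInf_lessD[of "E ` V"] by blast
  qed
  then obtain v where v: "\<And>n. v n \<in> V" "\<And>n::nat. E (v n) < m + 1 / (real n + 1)" by metis
  \<comment> \<open>The midpoint has energy at least \<open>m\<close>; the parallelogram law turns
    this into a bound for the distance.\<close>
  have par: "(norm (a - b))\<^sup>2 \<le> 2 * (E a + E b - 2 * m)" if "a \<in> V" "b \<in> V" for a b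
  proof -
    let ?h = "(1/2) *\<^sub>R (a + b)"
    have "m \<le> E ?h" using that by (intro m csubspaceD[OF V])
    moreover have "\<phi> ?h = (\<phi> a + \<phi> b) / 2"
      using that scale[of "a + b" "1/2"] add[of a b] csubspaceD(2)[OF V, of a b]
        scaleC_of_real[of "1/2" "a + b"] by (simp del: scaleR_add_right)
    then have "Re (\<phi> ?h) = (Re (\<phi> a) + Re (\<phi> b)) / 2"
      by (simp only: Re_divide_numeral plus_complex.sel)
    moreover have "(norm ?h)\<^sup>2 = (norm (a + b))\<^sup>2 / 4"
      by (simp only: norm_scaleR) (simp add: power_divide)
    moreover have "(norm (a + b))\<^sup>2 + (norm (a - b))\<^sup>2 = 2 * (norm a)\<^sup>2 + 2 * (norm b)\<^sup>2"
      by (simp only: power2_norm_eq_inner) (simp add: inner_add inner_diff inner_commute)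
    ultimately show ?thesis unfolding E_def by argo
  qed
  have "Cauchy v"
  proof (rule CauchyI)
    fix e :: real assume e: "e > 0"
    obtain N :: nat where N: "4 / e\<^sup>2 < real N" using reals_Archimedean2 by blast
    have "norm (v i - v j) < e" if ij: "i \<ge> N" "j \<ge> N" for i j
    proof -
      have inv: "1 / (real k + 1) < e\<^sup>2 / 4" if "k \<ge> N" for k :: nat
      proof -
        have "4 / e\<^sup>2 < real k + 1" using N that by linarith
        then show ?thesis using e by (simp add: field_simps)
      qed
      have "(norm (v i - v j))\<^sup>2 \<le> 2 * (E (v i) + E (v j) - 2 * m)" by (rule par[OF v(1) v(1)])
      also have "\<dots> < 2 * (e\<^sup>2 / 4 + e\<^sup>2 / 4)"
        using v(2)[of i] v(2)[of j] inv[OF ij(1)] inv[OF ij(2)] by argo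
      also have "\<dots> = e\<^sup>2" by simp
      finally show ?thesis using e by (auto intro: power2_less_imp_less)
    qed
    then show "\<exists>M. \<forall>m\<ge>M. \<forall>n\<ge>M. norm (v m - v n) < e" by blast
  qed
  then obtain u where u: "v \<longlonglongrightarrow> u" using Cauchy_convergent convergent_def by blast
  have Ev: "(\<lambda>n. E (v n)) \<longlonglongrightarrow> m"
  proof (rule tendsto_sandwich)
    show "\<forall>\<^sub>F n in sequentially. m \<le> E (v n)" using m[OF v(1)] by simp
    show "\<forall>\<^sub>F n in sequentially. E (v n) \<le> m + 1 / (real n + 1)"
      using v(2) by (simp add: less_imp_le)
    show "(\<lambda>n. m + 1 / (real n + 1)) \<longlonglongrightarrow> m"
      using tendsto_add[OF tendsto_const LIMSEQ_inverse_real_of_nat, of m]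
      by (simp add: inverse_eq_divide add.commute)
  qed simp
  have rep: "\<phi> w = cinner w u" if w: "w \<in> V" for w
  proof -
    \<comment> \<open>The minimality at \<open>v n + t *\<^sub>C w\<close> passes to the limit with
      constant term \<open>0\<close>, so the discriminant criterion forces the linear coefficient to
      vanish.\<close>
    have "0 \<le> 0 + 2 * Re (cnj t * (cinner u w - cnj (\<phi> w))) + (cmod t)\<^sup>2 * (norm w)\<^sup>2" for t
    proof (rule LIMSEQ_le_const)
      let ?X = "\<lambda>n. E (v n) - m + 2 * Re (cnj t * (cinner (v n) w - cnj (\<phi> w)))
        + (cmod t)\<^sup>2 * (norm w)\<^sup>2"
      show "?X \<longlonglongrightarrow> 0 + 2 * Re (cnj t * (cinner u w - cnj (\<phi> w))) + (cmod t)\<^sup>2 * (norm w)\<^sup>2"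
        using tendsto_diff[OF Ev tendsto_const, of m]
        by (intro tendsto_intros u) simp
      have "0 \<le> ?X n" for n
      proof -
        have "m \<le> E (v n + t *\<^sub>C w)" using v(1) w by (intro m csubspaceD[OF V])
        also have "\<dots> = (norm (v n))\<^sup>2 + 2 * Re (cnj t * cinner (v n) w)
            + (cmod t)\<^sup>2 * (norm w)\<^sup>2 - 2 * Re (\<phi> (v n)) - 2 * Re (t * \<phi> w)"
        proof -
          have "\<phi> (v n + t *\<^sub>C w) = \<phi> (v n) + t * \<phi> w"
            using add scale v(1) w csubspaceD(3)[OF V] by metis
          moreover have "(norm (v n + t *\<^sub>C w))\<^sup>2
              = (norm (v n))\<^sup>2 + 2 * Re (cnj t * cinner (v n) w) + (cmod t)\<^sup>2 * (norm w)\<^sup>2"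
          proof -
            have "inner (v n) (t *\<^sub>C w) = Re (cnj t * cinner (v n) w)"
              by (simp only: Re_cinner[symmetric] cinner_scaleC_right)
            moreover have "(norm (v n + t *\<^sub>C w))\<^sup>2
                = (norm (v n))\<^sup>2 + 2 * inner (v n) (t *\<^sub>C w) + (norm (t *\<^sub>C w))\<^sup>2"
              by (simp only: power2_norm_eq_inner inner_add) (simp add: inner_commute)
            ultimately show ?thesis by (simp add: norm_scaleC power_mult_distrib)
          qed
          ultimately show ?thesis by (simp add: E_def)
        qed
        finally show ?thesis
          by (simp add: E_def algebra_simps)
      qed
      then show "\<exists>N. \<forall>n\<ge>N. 0 \<le> ?X n" by blast
    qed
    from quadratic_nonneg_imp[OF this] have "cinner u w - cnj (\<phi> w) = 0" by simp
    then show ?thesis by (metis cinner_commute complex_cnj_cnj eq_iff_diff_eq_0)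
  qed
  have "(norm u)\<^sup>2 \<le> C * norm u"
  proof (rule LIMSEQ_le)
    show "(\<lambda>n. cmod (cinner (v n) u)) \<longlonglongrightarrow> (norm u)\<^sup>2"
      using tendsto_norm[OF tendsto_cinner[OF u tendsto_const, of u]] by (simp add: cinner_self norm_power)
    show "(\<lambda>n. C * norm (v n)) \<longlonglongrightarrow> C * norm u" by (intro tendsto_intros u)
    show "\<exists>N. \<forall>n\<ge>N. cmod (cinner (v n) u) \<le> C * norm (v n)"
      using bound[OF v(1)] rep[OF v(1)] by auto
  qed
  then have "norm u \<le> C" using C
    by (cases "norm u = 0") (auto simp: power2_eq_square)
  moreover have "u \<in> closure V" using u v(1) closure_sequential by blast
  ultimately show thesis using rep that by blast
qed

text \<open>The projection is the Riesz vector of the functional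
  \<open>s \<mapsto> cinner s x\<close> on \<open>S\<close>; closedness keeps it inside
  \<open>S\<close>.\<close>

lemma orth_proj_ex1:
  assumes S: "csubspace S" "closed S"
  shows "\<exists>!y. y \<in> S \<and> (\<forall>s\<in>S. cinner (x - y) s = 0)"
proof -
  obtain u where u: "u \<in> closure S" "\<And>s. s \<in> S \<Longrightarrow> cinner s x = cinner s u"
    by (rule riesz[OF S(1), of "\<lambda>s. cinner s x" "norm x"])
      (auto simp: cinner_lin intro: order_trans[OF cinner_bound])
  have "cinner (x - u) s = 0" if "s \<in> S" for s
    using u(2)[OF that] by (metis cinner_commute cinner_diff_left eq_iff_diff_eq_0)
  moreover have "u \<in> S" using u(1) S(2) by simp
  moreover have "y = z" if "y \<in> S \<and> (\<forall>s\<in>S. cinner (x - y) s = 0)"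
    "z \<in> S \<and> (\<forall>s\<in>S. cinner (x - z) s = 0)" for y z
  proof -
    have "y - z \<in> S" using that csubspaceD[OF S(1)] by blast
    then have "cinner (x - z) (y - z) - cinner (x - y) (y - z) = 0" using that by auto
    then have "cinner (y - z) (y - z) = 0" by (simp add: cinner_lin algebra_simps)
    then show ?thesis by (simp add: cinner_self_zero)
  qed
  ultimately show ?thesis by blast
qed

lemma
  assumes "csubspace S" "closed S"
  shows orth_proj_in: "orth_proj S x \<in> S"
    and orth_proj_orth: "s \<in> S \<Longrightarrow> cinner (x - orth_proj S x) s = 0"
    and orth_proj_eqI: "y \<in> S \<Longrightarrow> (\<And>s. s \<in> S \<Longrightarrow> cinner (x - y) s = 0) \<Longrightarrow> orth_proj S x = y"
  unfolding orth_proj_def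
  using theI'[OF orth_proj_ex1[OF assms, of x]] the1_equality[OF orth_proj_ex1[OF assms, of x]]
  by blast+

lemma norm_orth_proj:
  assumes S: "csubspace S" "closed S"
  shows "(norm x)\<^sup>2 = (norm (orth_proj S x))\<^sup>2 + (norm (x - orth_proj S x))\<^sup>2"
proof -
  let ?p = "orth_proj S x"
  have "cinner (x - ?p) ?p = 0" by (intro orth_proj_orth orth_proj_in S)
  then have "inner (x - ?p) ?p = 0" by (simp flip: Re_cinner)
  then show ?thesis unfolding power2_norm_eq_inner by (simp add: inner_diff inner_commute)
qed

section \<open>Bounded maps prescribed on a spanning family\<close>

lemma cspan_range_iff:
  fixes f :: "'i \<Rightarrow> 'a :: hilbert_space"
  shows "v \<in> cspan (range f) \<longleftrightarrow> (\<exists>I a. finite I \<and> v = (\<Sum>i\<in>I. a i *\<^sub>C f i))"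
proof
  assume "v \<in> cspan (range f)"
  then obtain t r where t: "finite t" "t \<subseteq> range f" "v = (\<Sum>x\<in>t. r x *\<^sub>C x)"
    unfolding complex_vector.span_explicit by auto
  then obtain I where I: "inj_on f I" "t = f ` I"
    unfolding subset_image_inj by blast
  then have fin: "finite I" using t(1) finite_imageD by blast
  have "v = (\<Sum>i\<in>I. r (f i) *\<^sub>C f i)"
    using t I by (simp add: sum.reindex)
  then show "\<exists>I a. finite I \<and> v = (\<Sum>i\<in>I. a i *\<^sub>C f i)"
    using fin by (intro exI[of _ I] exI[of _ "\<lambda>i. r (f i)"]) simp
next
  assume "\<exists>I a. finite I \<and> v = (\<Sum>i\<in>I. a i *\<^sub>C f i)"
  then obtain I a where "v = (\<Sum>i\<in>I. a i *\<^sub>C f i)" by blast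
  moreover have "(\<Sum>i\<in>I. a i *\<^sub>C f i) \<in> cspan (range f)"
    by (intro complex_vector.span_sum complex_vector.span_scale complex_vector.span_base rangeI)
  ultimately show "v \<in> cspan (range f)" by simp
qed

text \<open>The bound does double work: applied to the difference of two expressions of one vector
  it makes the assignment well defined, and it makes the map Lipschitz, hence extendable to the
  closure. The shift on the dilation space, the unitary between two representations and the
  functional in the Cholesky step are all obtained in this way.\<close>

lemma extend_from_family:
  fixes f :: "'i \<Rightarrow> 'a :: hilbert_space" and g :: "'i \<Rightarrow> 'b :: hilbert_space"
  assumes bound: "\<And>I a. finite I \<Longrightarrow>
      norm (\<Sum>i\<in>I. a i *\<^sub>C g i) \<le> C * norm (\<Sum>i\<in>I. a i *\<^sub>C f i)"
    and C: "0 \<le> C"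
  obtains T where "clinear_on (closure (cspan (range f))) T" "\<And>i. T (f i) = g i"
    "\<And>h. h \<in> closure (cspan (range f)) \<Longrightarrow> norm (T h) \<le> C * norm h"
    "continuous_on (closure (cspan (range f))) T"
    "T ` closure (cspan (range f)) \<subseteq> closure (cspan (range g))"
proof -
  let ?V = "cspan (range f)"
  define rep where "rep v w \<longleftrightarrow> (\<exists>I a. finite I \<and> v = (\<Sum>i\<in>I. a i *\<^sub>C f i) \<and> w = (\<Sum>i\<in>I. a i *\<^sub>C g i))"
    for v w
  define T0 where "T0 v = (SOME w. rep v w)" for v
  \<comment> \<open>Padding with zero coefficients brings two finite sums to a common index
    set.\<close>
  have extend: "(\<Sum>i\<in>I. a i *\<^sub>C h i) = (\<Sum>i\<in>K. (if i \<in> I then a i else 0) *\<^sub>C h i)"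
    if "finite K" "I \<subseteq> K" for I K a and h :: "'i \<Rightarrow> 'c :: hilbert_space"
    using that by (intro sum.mono_neutral_cong_left) auto
  have rep_add: "rep (v + c *\<^sub>C v') (w + c *\<^sub>C w')" if r: "rep v w" "rep v' w'" for v w v' w' c
  proof -
    obtain I a where I: "finite I" "v = (\<Sum>i\<in>I. a i *\<^sub>C f i)" "w = (\<Sum>i\<in>I. a i *\<^sub>C g i)"
      using r(1) unfolding rep_def by blast
    obtain J b where J: "finite J" "v' = (\<Sum>i\<in>J. b i *\<^sub>C f i)" "w' = (\<Sum>i\<in>J. b i *\<^sub>C g i)"
      using r(2) unfolding rep_def by blast
    let ?c = "\<lambda>i. (if i \<in> I then a i else 0) + c * (if i \<in> J then b i else 0)"
    have fin: "finite (I \<union> J)" using I J by blast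
    have "v + c *\<^sub>C v' = (\<Sum>i\<in>I \<union> J. ?c i *\<^sub>C f i)" "w + c *\<^sub>C w' = (\<Sum>i\<in>I \<union> J. ?c i *\<^sub>C g i)"
      unfolding I(2,3) J(2,3) extend[OF fin Un_upper1, of a f] extend[OF fin Un_upper1, of a g]
        extend[OF fin Un_upper2, of b f] extend[OF fin Un_upper2, of b g]
      by (simp_all only: complex_vector.scale_sum_right scaleC_add_left sum.distrib scaleC_scaleC)
    then show ?thesis unfolding rep_def
      using fin by (intro exI[of _ "I \<union> J"] exI[of _ ?c] conjI)
  qed
  have rep_bound: "norm w \<le> C * norm v" if "rep v w" for v w
    using that bound unfolding rep_def by blast
  have rep_T0: "rep v (T0 v)" if "v \<in> ?V" for v
    unfolding T0_def using that by (intro someI_ex[of "rep v"]) (auto simp: rep_def cspan_range_iff)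
  \<comment> \<open>The difference of two values is a value at \<open>0\<close>, and the bound
    leaves only \<open>0\<close> there.\<close>
  have rep_unique: "w = w'" if "rep v w" "rep v w'" for v w w'
    using rep_bound[OF rep_add[OF that, of "- 1"]] by (simp add: scaleC_minus1)
  have rep_f: "rep (f i) (g i)" for i
    unfolding rep_def by (intro exI[of _ "{i}"] exI[of _ "\<lambda>_. 1"]) simp
  note V = csubspaceD[OF csubspace_cspan[of "range f"]]
  have T0_add: "T0 (x + c *\<^sub>C y) = T0 x + c *\<^sub>C T0 y" if "x \<in> ?V" "y \<in> ?V" for x y c
    using rep_unique rep_T0 rep_add V that by meson
  have T0_bound: "norm (T0 x) \<le> C * norm x" if "x \<in> ?V" for x
    using rep_bound rep_T0 that by blast
  have T0_f: "T0 (f i) = g i" for i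
    using rep_unique rep_T0 rep_f complex_vector.span_base by (meson rangeI)
  have T0_g: "T0 x \<in> cspan (range g)" if "x \<in> ?V" for x
    using rep_T0[OF that] unfolding rep_def cspan_range_iff by blast
  have "dist (T0 x) (T0 y) \<le> C * dist x y" if "x \<in> ?V" "y \<in> ?V" for x y
    using T0_add[OF that, of "- 1"] T0_bound[of "x - y"] V(4)[OF that]
    by (simp add: dist_norm scaleC_minus1)
  then have "C-lipschitz_on ?V T0" by (intro lipschitz_onI C)
  then have "uniformly_continuous_on ?V T0" by (rule lipschitz_on_uniformly_continuous)
  then obtain T where T: "uniformly_continuous_on (closure ?V) T" "\<And>x. x \<in> ?V \<Longrightarrow> T0 x = T x"
    by (rule uniformly_continuous_on_extension_on_closure) blast
  have cont: "continuous_on (closure ?V) T" using T(1) by (rule uniformly_continuous_imp_continuous)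
  have lim: "(\<lambda>n. T0 (x n)) \<longlonglongrightarrow> T h" if "\<And>n. x n \<in> ?V" "x \<longlonglongrightarrow> h" for x h
  proof -
    have "h \<in> closure ?V" using that closure_sequential by blast
    then have "(\<lambda>n. T (x n)) \<longlonglongrightarrow> T h"
      using that subsetD[OF closure_subset, of _ ?V]
      by (intro continuous_on_tendsto_compose[OF cont]) auto
    then show ?thesis using T(2) that by simp
  qed
  have lin: "T (x + c *\<^sub>C y) = T x + c *\<^sub>C T y" if xy: "x \<in> closure ?V" "y \<in> closure ?V" for x y c
  proof -
    obtain p q where p: "\<And>n. p n \<in> ?V" "p \<longlonglongrightarrow> x" and q: "\<And>n. q n \<in> ?V" "q \<longlonglongrightarrow> y"
      using xy unfolding closure_sequential by blast
    have "(\<lambda>n. T0 (p n + c *\<^sub>C q n)) \<longlonglongrightarrow> T (x + c *\<^sub>C y)"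
      using p q by (intro lim V tendsto_intros)
    moreover have "(\<lambda>n. T0 (p n + c *\<^sub>C q n)) \<longlonglongrightarrow> T x + c *\<^sub>C T y"
      using p q by (simp add: T0_add) (intro tendsto_intros lim)
    ultimately show ?thesis using LIMSEQ_unique by blast
  qed
  have T0: "T 0 = 0" using T(2)[of 0] V(1) T0_bound[of 0] by simp
  show thesis
  proof
    have "0 \<in> closure ?V" using V(1) closure_subset by blast
    then show "clinear_on (closure ?V) T"
      unfolding clinear_on_def
      using lin[of _ _ 1] lin[of 0] T0 by simp
    show "T (f i) = g i" for i
      using T0_f[of i] T(2)[of "f i"] complex_vector.span_base[of "f i" "range f"] by simp
    show "continuous_on (closure ?V) T" by (rule cont)
    show "norm (T h) \<le> C * norm h" if h: "h \<in> closure ?V" for h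
    proof -
      obtain p where p: "\<And>n. p n \<in> ?V" "p \<longlonglongrightarrow> h"
        using h unfolding closure_sequential by blast
      show ?thesis
        using T0_bound p
        by (intro LIMSEQ_le[OF tendsto_norm[OF lim[OF p]] tendsto_mult[OF tendsto_const tendsto_norm[OF p(2)]]])
          auto
    qed
    show "T ` closure ?V \<subseteq> closure (cspan (range g))"
    proof
      fix y assume "y \<in> T ` closure ?V"
      then obtain h where h: "h \<in> closure ?V" "y = T h" by blast
      then obtain p where p: "\<And>n. p n \<in> ?V" "p \<longlonglongrightarrow> h"
        unfolding closure_sequential by blast
      then show "y \<in> closure (cspan (range g))"
        unfolding closure_sequential h(2)
        using lim[OF p] T0_g[OF p(1)] by (intro exI[of _ "\<lambda>n. T0 (p n)"]) simp
    qed
  qed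
qed


subsection \<open>Bounded operators\<close>

lemma blinfun_apply_scaleC [simp]: "blinfun_apply (c *\<^sub>C T) x = c *\<^sub>C blinfun_apply T x"
  by (simp add: scaleC_blinfun.rep_eq)

lemma norm_scaleC_blinfun: "norm (c *\<^sub>C T) = cmod c * norm (T :: 'a::real_normed_vector \<Rightarrow>\<^sub>L 'b::hilbert_space)"
proof (rule antisym)
  have le: "norm (c *\<^sub>C T) \<le> cmod c * norm T" for c and T :: "'a \<Rightarrow>\<^sub>L 'b"
  proof (rule norm_blinfun_bound)
    show "norm (blinfun_apply (c *\<^sub>C T) x) \<le> cmod c * norm T * norm x" for x
      using mult_left_mono[OF norm_blinfun[of T x], of "cmod c"]
      by (simp add: norm_scaleC mult.assoc)
  qed simp
  then show "norm (c *\<^sub>C T) \<le> cmod c * norm T" .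
  show "cmod c * norm T \<le> norm (c *\<^sub>C T)"
  proof (cases "c = 0")
    case False
    have "norm (inverse c *\<^sub>C c *\<^sub>C T) \<le> cmod (inverse c) * norm (c *\<^sub>C T)" by (rule le)
    moreover have "inverse c *\<^sub>C c *\<^sub>C T = T"
      using False by (intro blinfun_eqI) (simp add: scaleC_scaleC)
    ultimately show ?thesis using False by (simp add: norm_inverse norm_divide field_simps)
  qed simp
qed

lemma bounded_linear_scaleC_blinfun_left:
  "bounded_linear (\<lambda>c. c *\<^sub>C (T :: 'a::real_normed_vector \<Rightarrow>\<^sub>L 'b::hilbert_space))"
proof (rule bounded_linear_intro)
  show "(c + d) *\<^sub>C T = c *\<^sub>C T + d *\<^sub>C T" for c d
    by (intro blinfun_eqI) (simp add: blinfun.add_left scaleC_add_left)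
  show "(r *\<^sub>R c) *\<^sub>C T = r *\<^sub>R (c *\<^sub>C T)" for r c
    by (intro blinfun_eqI) (simp add: blinfun.scaleR_left scaleC_scaleC scaleR_conv_of_real flip: scaleC_of_real)
  show "norm (c *\<^sub>C T) \<le> norm c * norm T" for c
    by (simp add: norm_scaleC_blinfun)
qed

lemma bounded_linear_quadratic:
  "bounded_linear (\<lambda>T :: 'a::hilbert_space \<Rightarrow>\<^sub>L 'a. cinner (blinfun_apply T x) y)"
  by (rule bounded_linear_compose[OF bounded_linear_cinner_left blinfun.bounded_linear_left])

lemma bounded_opsD: "T \<in> bounded_ops \<Longrightarrow> blinfun_apply T (c *\<^sub>C x) = c *\<^sub>C blinfun_apply T x"
  by (simp add: bounded_ops_def)

lemma bounded_ops_intros [intro, simp]: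
  shows "0 \<in> bounded_ops" "id_blinfun \<in> bounded_ops"
    "S \<in> bounded_ops \<Longrightarrow> T \<in> bounded_ops \<Longrightarrow> S + T \<in> bounded_ops"
    "S \<in> bounded_ops \<Longrightarrow> T \<in> bounded_ops \<Longrightarrow> S - T \<in> bounded_ops"
    "T \<in> bounded_ops \<Longrightarrow> c *\<^sub>C T \<in> bounded_ops"
    "T \<in> bounded_ops \<Longrightarrow> r *\<^sub>R T \<in> bounded_ops"
    "T \<in> bounded_ops \<Longrightarrow> - T \<in> bounded_ops"
  by (auto simp: bounded_ops_def blinfun.add_left blinfun.diff_left blinfun.scaleR_left
      blinfun.minus_left complex_vector.scale_right_distrib complex_vector.scale_right_diff_distrib
      scaleC_scaleC mult.commute simp flip: scaleC_of_real)

lemma bounded_ops_sum [intro]: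
  "(\<And>i. i \<in> I \<Longrightarrow> T i \<in> bounded_ops) \<Longrightarrow> (\<Sum>i\<in>I. T i) \<in> bounded_ops"
  by (induction I rule: infinite_finite_induct) auto

lemma bounded_ops_lim:
  fixes T :: "nat \<Rightarrow> 'a::hilbert_space \<Rightarrow>\<^sub>L 'b::hilbert_space"
  assumes "\<And>n. T n \<in> bounded_ops" "T \<longlonglongrightarrow> S"
  shows "S \<in> bounded_ops"
proof -
  have "(\<lambda>n. blinfun_apply (T n) x) \<longlonglongrightarrow> blinfun_apply S x" for x
    using assms(2) by (intro tendsto_intros)
  note lim = this
  have "blinfun_apply S (c *\<^sub>C x) = c *\<^sub>C blinfun_apply S x" for c x
    using lim[of "c *\<^sub>C x"] tendsto_scaleC[OF lim[of x], of c]
    by (intro LIMSEQ_unique[of "\<lambda>n. blinfun_apply (T n) (c *\<^sub>C x)"])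
      (simp_all add: bounded_opsD[OF assms(1)])
  then show ?thesis by (simp add: bounded_ops_def)
qed

section \<open>Sesquilinear forms, numerical radius and adjoints\<close>

locale sesquilinear_form =
  fixes B :: "'a::hilbert_space \<Rightarrow> 'a \<Rightarrow> complex"
  assumes add_left: "B (x + y) z = B x z + B y z" and scale_left: "B (c *\<^sub>C x) y = c * B x y"
    and add_right: "B x (y + z) = B x y + B x z" and scale_right: "B x (c *\<^sub>C y) = cnj c * B x y"
begin

lemma diff: "B (x - y) z = B x z - B y z" "B x (y - z) = B x y - B x z"
  using add_left[of "x - y" y z] add_right[of x "y - z" z] by simp_all

lemma polarization:
  "4 * B x y = B (x + y) (x + y) - B (x - y) (x - y)
    + \<i> * B (x + \<i> *\<^sub>C y) (x + \<i> *\<^sub>C y) - \<i> * B (x - \<i> *\<^sub>C y) (x - \<i> *\<^sub>C y)"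
  by (simp add: add_left add_right diff scale_left scale_right algebra_simps)

text \<open>Polarization and the parallelogram law bound \<open>B x y\<close> by
  \<open>C * ((norm x)^2 + (norm y)^2)\<close>, which is \<open>2 * C\<close> at unit vectors;
  homogeneity then gives the product. The \<open>2\<close> is the usual constant between numerical
  radius and norm.\<close>

lemma bound_of_quadratic_bound:
  assumes C: "\<And>x. cmod (B x x) \<le> C * (norm x)\<^sup>2"
  shows "cmod (B x y) \<le> 2 * C * norm x * norm y"
proof -
  have form: "cmod (B x y) \<le> C * ((norm x)\<^sup>2 + (norm y)\<^sup>2)" for x y
  proof -
    let ?q = "\<lambda>x. B x x"
    have "4 * cmod (B x y) = cmod (4 * B x y)"
      by (simp add: norm_mult)
    also have "\<dots> \<le> cmod (?q (x + y)) + cmod (?q (x - y)) + cmod (?q (x + \<i> *\<^sub>C y)) + cmod (?q (x - \<i> *\<^sub>C y))"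
      unfolding polarization
      by (rule order_trans[OF norm_triangle_ineq4] order_trans[OF norm_triangle_ineq] add_mono order_refl
          | simp add: norm_mult)+
    also have "\<dots> \<le> C * (norm (x + y))\<^sup>2 + C * (norm (x - y))\<^sup>2
        + C * (norm (x + \<i> *\<^sub>C y))\<^sup>2 + C * (norm (x - \<i> *\<^sub>C y))\<^sup>2"
      by (intro add_mono C)
    also have "\<dots> = 4 * (C * ((norm x)\<^sup>2 + (norm y)\<^sup>2))"
    proof -
      have par: "(norm (x + y))\<^sup>2 + (norm (x - y))\<^sup>2 = 2 * (norm x)\<^sup>2 + 2 * (norm y)\<^sup>2" for x y :: 'a
        by (simp only: power2_norm_eq_inner) (simp add: inner_add inner_diff inner_commute)
      have "C * (norm (x + y))\<^sup>2 + C * (norm (x - y))\<^sup>2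
        + C * (norm (x + \<i> *\<^sub>C y))\<^sup>2 + C * (norm (x - \<i> *\<^sub>C y))\<^sup>2
        = C * (((norm (x + y))\<^sup>2 + (norm (x - y))\<^sup>2) + ((norm (x + \<i> *\<^sub>C y))\<^sup>2 + (norm (x - \<i> *\<^sub>C y))\<^sup>2))"
        by (simp add: algebra_simps)
      then show ?thesis unfolding par by (simp add: norm_scaleC)
    qed
    finally show ?thesis by simp
  qed
  show ?thesis
  proof (cases "x = 0 \<or> y = 0")
    case True
    then show ?thesis using form[of 0 0] scale_left[of 0 0 y] scale_right[of x 0 0] by auto
  next
    case False
    let ?u = "complex_of_real (1 / norm x) *\<^sub>C x" and ?v = "complex_of_real (1 / norm y) *\<^sub>C y"
    have "norm ?u = 1" "norm ?v = 1" using False by (simp_all add: norm_scaleC norm_divide)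
    then have "cmod (B ?u ?v) \<le> 2 * C" using form[of ?u ?v] by simp
    moreover have "cmod (B ?u ?v) = cmod (B x y) / (norm x * norm y)"
      by (simp add: scale_left scale_right norm_mult norm_divide)
    ultimately show ?thesis using False by (simp add: divide_le_eq mult_ac)
  qed
qed

end

lemma sesquilinear_form_operator:
  "T \<in> bounded_ops \<Longrightarrow> sesquilinear_form (\<lambda>x y. cinner (blinfun_apply T x) y)"
  by unfold_locales (simp_all add: blinfun.add_right bounded_opsD cinner_lin)

text \<open>Complex polarization recovers the form from its diagonal. This is what lets scalar
  function theory, applied to one vector at a time, decide operator equations.\<close>

lemma quadratic_form_eq_imp:
  fixes S T :: "'a::hilbert_space \<Rightarrow>\<^sub>L 'a"
  assumes "S \<in> bounded_ops" "T \<in> bounded_ops"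
    and "\<And>x. cinner (blinfun_apply S x) x = cinner (blinfun_apply T x) x"
  shows "S = T"
proof (rule blinfun_eqI)
  fix x
  have "4 * cinner (blinfun_apply S x) y = 4 * cinner (blinfun_apply T x) y" for y
    unfolding sesquilinear_form.polarization[OF sesquilinear_form_operator[OF assms(1)]]
      sesquilinear_form.polarization[OF sesquilinear_form_operator[OF assms(2)]] assms(3) ..
  then have "cinner (blinfun_apply S x - blinfun_apply T x) y = 0" for y
    by (simp add: cinner_lin)
  then show "blinfun_apply S x = blinfun_apply T x"
    using cinner_self_zero by (metis eq_iff_diff_eq_0)
qed

lemma norm_le_numerical_radius:
  fixes T :: "'a::hilbert_space \<Rightarrow>\<^sub>L 'a"
  assumes T: "T \<in> bounded_ops" and B: "\<And>x. cmod (cinner (blinfun_apply T x) x) \<le> B * (norm x)\<^sup>2"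
    and "0 \<le> B"
  shows "norm T \<le> 2 * B"
proof (rule norm_blinfun_bound)
  show "norm (blinfun_apply T x) \<le> 2 * B * norm x" for x
  proof (cases "blinfun_apply T x = 0")
    case False
    let ?y = "blinfun_apply T x"
    have "norm ?y * norm ?y \<le> 2 * B * norm x * norm ?y"
      using sesquilinear_form.bound_of_quadratic_bound[OF sesquilinear_form_operator[OF T] B, of x ?y]
      by (simp add: cinner_self norm_mult power2_eq_square)
    then show ?thesis using False by (simp add: mult_right_le_imp_le)
  qed (use assms(3) in auto)
qed (use assms(3) in auto)

text \<open>Riesz in the second argument for each fixed \<open>x\<close>, the conjugate making that
  argument linear. Linearity of the resulting map follows because a vector is determined by its
  products.\<close>

lemma operator_of_form:
  fixes B :: "'a::hilbert_space \<Rightarrow> 'a \<Rightarrow> complex"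
  assumes "sesquilinear_form B"
    and bound: "\<And>x y. cmod (B x y) \<le> C * norm x * norm y" and C: "0 \<le> C"
  obtains T where "T \<in> bounded_ops" "\<And>x y. cinner (blinfun_apply T x) y = B x y"
proof -
  interpret sesquilinear_form B by fact
  have "\<exists>u. (\<forall>y. B x y = cinner u y) \<and> norm u \<le> C * norm x" for x
  proof -
    obtain u where "\<And>y. cnj (B x y) = cinner y u" "norm u \<le> C * norm x"
    proof (rule riesz[of UNIV "\<lambda>y. cnj (B x y)" "C * norm x"])
      show "csubspace (UNIV :: 'a set)" by (rule complex_vector.subspace_UNIV)
      show "cmod (cnj (B x y)) \<le> C * norm x * norm y" for y using bound by simp
    qed (use add_right scale_right C in auto)
    then show ?thesis by (metis cinner_commute complex_cnj_cnj)
  qed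
  then obtain t where t: "\<And>x y. B x y = cinner (t x) y" "\<And>x. norm (t x) \<le> C * norm x" by metis
  have eqI: "u = v" if "\<And>y. cinner u y = cinner v y" for u v :: 'a
  proof -
    have "cinner (u - v) (u - v) = 0" using that by (simp add: cinner_diff_left)
    then show ?thesis by (simp add: cinner_self_zero)
  qed
  have "bounded_linear t"
  proof (rule bounded_linear_intro[of _ C])
    show "t (x + y) = t x + t y" for x y by (rule eqI) (simp add: t(1)[symmetric] add_left cinner_lin)
    show "t (r *\<^sub>R x) = r *\<^sub>R t x" for r x
      by (rule eqI) (simp add: t(1)[symmetric] scale_left cinner_lin flip: scaleC_of_real)
  qed (use t(2) in \<open>auto simp: mult_ac\<close>)
  then have T: "blinfun_apply (Blinfun t) x = t x" for x by (simp add: bounded_linear_Blinfun_apply)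
  have "t (c *\<^sub>C x) = c *\<^sub>C t x" for c x
    by (rule eqI) (simp add: t(1)[symmetric] scale_left cinner_lin)
  then have "Blinfun t \<in> bounded_ops" by (simp add: bounded_ops_def T)
  then show thesis using that[of "Blinfun t"] by (simp add: T t(1))
qed

lemma cadjoint_eqI:
  fixes S T :: "'a::hilbert_space \<Rightarrow>\<^sub>L 'a"
  assumes "\<And>x y. cinner (blinfun_apply T x) y = cinner x (blinfun_apply S y)"
  shows "cadjoint T = S"
  unfolding cadjoint_def
proof (rule the_equality)
  fix S' assume "\<forall>x y. cinner (blinfun_apply T x) y = cinner x (blinfun_apply S' y)"
  then have "cinner x (blinfun_apply S' y - blinfun_apply S y) = 0" for x y
    using assms by (simp add: cinner_lin)
  then show "S' = S"
    by (intro blinfun_eqI) (metis cinner_self_zero eq_iff_diff_eq_0)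
qed (use assms in blast)

text \<open>\<open>cadjoint\<close> is a definite description, so its defining identity needs a
  witness; the bounded form \<open>cinner x (T y)\<close> supplies one.\<close>

lemma cinner_cadjoint:
  fixes T :: "'a::hilbert_space \<Rightarrow>\<^sub>L 'a"
  assumes "T \<in> bounded_ops"
  shows "cinner (blinfun_apply T x) y = cinner x (blinfun_apply (cadjoint T) y)"
proof -
  obtain S where S: "S \<in> bounded_ops" "\<And>x y. cinner (blinfun_apply S x) y = cinner x (blinfun_apply T y)"
  proof (rule operator_of_form[of "\<lambda>x y. cinner x (blinfun_apply T y)" "norm T"])
    show "cmod (cinner x (blinfun_apply T y)) \<le> norm T * norm x * norm y" for x y
      using order_trans[OF cinner_bound mult_left_mono[OF norm_blinfun[of T y], of "norm x"]]
      by (simp add: mult_ac)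
    show "sesquilinear_form (\<lambda>x y. cinner x (blinfun_apply T y))"
      by unfold_locales (simp_all add: blinfun.add_right cinner_lin bounded_opsD[OF assms])
  qed auto
  have "cinner (blinfun_apply T x) y = cinner x (blinfun_apply S y)" for x y
    by (metis S(2) cinner_commute)
  then show ?thesis using cadjoint_eqI by metis
qed

lemma Im_op_quadratic:
  fixes T :: "'a::hilbert_space \<Rightarrow>\<^sub>L 'a"
  assumes "T \<in> bounded_ops"
  shows "cinner (blinfun_apply (Im_op T) x) x = of_real (Im (cinner (blinfun_apply T x) x))"
proof -
  have "cinner (blinfun_apply (cadjoint T) x) x = cnj (cinner (blinfun_apply T x) x)"
    by (metis cinner_cadjoint[OF assms] cinner_commute)
  then show ?thesis
    by (simp add: Im_op_def blinfun.diff_left cinner_lin complex_eq_iff)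
qed

lemma nonneg_op_iff:
  "nonneg_op T \<longleftrightarrow> (\<forall>x. Im (cinner (blinfun_apply T x) x) = 0 \<and> 0 \<le> Re (cinner (blinfun_apply T x) x))"
  by (auto simp: nonneg_op_def complex_nonneg_Reals_iff)

lemma op_le_iff:
  "op_le S T \<longleftrightarrow> (\<forall>x. Im (cinner (blinfun_apply T x) x) = Im (cinner (blinfun_apply S x) x) \<and>
     Re (cinner (blinfun_apply S x) x) \<le> Re (cinner (blinfun_apply T x) x))"
  by (simp add: op_le_def nonneg_op_iff blinfun.diff_left cinner_lin)

text \<open>The adjoint has the conjugate quadratic form; where that form is real, polarization
  identifies the two operators.\<close>

lemma symmetric_of_real_quadratic:
  fixes T :: "'a::hilbert_space \<Rightarrow>\<^sub>L 'a"
  assumes T: "T \<in> bounded_ops" and "\<And>x. Im (cinner (blinfun_apply T x) x) = 0"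
  shows "cinner (blinfun_apply T x) y = cinner x (blinfun_apply T y)"
proof -
  have "cadjoint T \<in> bounded_ops"
    unfolding bounded_ops_def
  proof safe
    fix c and x :: 'a
    have "cinner y (blinfun_apply (cadjoint T) (c *\<^sub>C x) - c *\<^sub>C blinfun_apply (cadjoint T) x) = 0" for y
      unfolding cinner_diff_right cinner_scaleC_right cinner_cadjoint[OF T, symmetric] by simp
    then show "blinfun_apply (cadjoint T) (c *\<^sub>C x) = c *\<^sub>C blinfun_apply (cadjoint T) x"
      by (metis cinner_self_zero eq_iff_diff_eq_0)
  qed
  moreover have "cinner (blinfun_apply (cadjoint T) x) x = cinner (blinfun_apply T x) x" for x
  proof -
    have "cinner (blinfun_apply (cadjoint T) x) x = cnj (cinner (blinfun_apply T x) x)"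
      by (metis cinner_cadjoint[OF T] cinner_commute)
    then show ?thesis using assms(2)[of x] by (simp add: complex_eq_iff)
  qed
  ultimately have "cadjoint T = T" using T by (intro quadratic_form_eq_imp) auto
  then show ?thesis using cinner_cadjoint[OF T] by simp
qed

text \<open>This is \<open>T^2 \<le> T\<close> for \<open>0 \<le> T \<le> I\<close>: Cauchy-Schwarz
  for the form of \<open>T\<close> at \<open>x\<close> and \<open>T x\<close> bounds
  \<open>(norm (T x))^4\<close> by the product of its values there, and the value at
  \<open>T x\<close> is at most \<open>(norm (T x))^2\<close>. It upgrades convergence of monotone
  quadratic forms to strong convergence.\<close>

lemma norm_sq_le_quadratic:
  fixes T :: "'a::hilbert_space \<Rightarrow>\<^sub>L 'a"
  assumes T: "T \<in> bounded_ops" and pos: "nonneg_op T" and le: "op_le T id_blinfun"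
  shows "(norm (blinfun_apply T x))\<^sup>2 \<le> Re (cinner (blinfun_apply T x) x)"
proof -
  let ?q = "\<lambda>x. Re (cinner (blinfun_apply T x) x)"
  let ?y = "blinfun_apply T x"
  have im: "Im (cinner (blinfun_apply T x) x) = 0" and re: "0 \<le> ?q x" for x
    using pos by (auto simp: nonneg_op_iff)
  note sym = symmetric_of_real_quadratic[OF T im]
  have "(cmod (cinner ?y ?y))\<^sup>2 \<le> ?q x * ?q ?y"
  proof (rule quadratic_nonneg_imp)
    fix t
    have "0 \<le> ?q (x + t *\<^sub>C ?y)" by (rule re)
    also have "\<dots> = ?q x + Re (cnj t * cinner ?y ?y) + Re (t * cinner (blinfun_apply T ?y) x)
       + Re (t * cnj t * cinner (blinfun_apply T ?y) ?y)"
      by (simp add: blinfun.add_right bounded_opsD[OF T] cinner_lin algebra_simps)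
    also have "cinner (blinfun_apply T ?y) x = cnj (cinner ?y ?y)"
      by (metis sym cinner_commute)
    also have "Re (t * cnj (cinner ?y ?y)) = Re (cnj t * cinner ?y ?y)" by simp
    also have "t * cnj t = of_real ((cmod t)\<^sup>2)" by (simp only: complex_norm_square)
    finally show "0 \<le> ?q x + 2 * Re (cnj t * cinner ?y ?y) + (cmod t)\<^sup>2 * ?q ?y" by simp
  qed (use re in auto)
  also have "?q ?y \<le> (norm ?y)\<^sup>2" using le by (auto simp: op_le_iff cinner_self)
  finally have "(norm ?y)\<^sup>2 * (norm ?y)\<^sup>2 \<le> ?q x * (norm ?y)\<^sup>2"
    using re by (simp add: cinner_self norm_power mult_left_mono flip: power_add)
  moreover have "a \<le> b" if "a * a \<le> b * a" "0 \<le> a" "0 \<le> b" for a b :: real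
    using that mult_right_le_imp_le[of a a b] by (cases "a = 0") auto
  ultimately show ?thesis using re[of x] by simp
qed

section \<open>Operator-valued Stieltjes integrals\<close>

lemma scaleC_one_blinfun [simp]: "1 *\<^sub>C T = (T :: 'a::real_normed_vector \<Rightarrow>\<^sub>L 'b::hilbert_space)"
  by (rule blinfun_eqI) simp

text \<open>Nonnegative operators with sum \<open>I\<close> act as weights: at each vector the form
  of the combination is, up to \<open>(norm x)^2\<close>, a weighted mean of the coefficients. Only
  coefficients with nonzero weight are bounded, so that pairs of disjoint cells may be ignored
  later.\<close>

lemma norm_weighted_sum_le:
  fixes T :: "'i \<Rightarrow> 'a::hilbert_space \<Rightarrow>\<^sub>L 'a"
  assumes ops: "\<And>i. i \<in> I \<Longrightarrow> T i \<in> bounded_ops" and pos: "\<And>i. i \<in> I \<Longrightarrow> nonneg_op (T i)"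
    and c: "\<And>i. i \<in> I \<Longrightarrow> T i \<noteq> 0 \<Longrightarrow> cmod (c i) \<le> B" and B: "0 \<le> B"
    and total: "(\<Sum>i\<in>I. T i) = id_blinfun"
  shows "cmod (cinner (blinfun_apply (\<Sum>i\<in>I. c i *\<^sub>C T i) x) x) \<le> B * (norm x)\<^sup>2"
    and "norm (\<Sum>i\<in>I. c i *\<^sub>C T i) \<le> 2 * B"
proof -
  show *: "cmod (cinner (blinfun_apply (\<Sum>i\<in>I. c i *\<^sub>C T i) x) x) \<le> B * (norm x)\<^sup>2" for x
  proof -
    have "cinner (blinfun_apply (\<Sum>i\<in>I. c i *\<^sub>C T i) x) x
        = (\<Sum>i\<in>I. c i * cinner (blinfun_apply (T i) x) x)"
      by (simp add: blinfun.sum_left cinner_lin)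
    also have "cmod \<dots> \<le> (\<Sum>i\<in>I. B * Re (cinner (blinfun_apply (T i) x) x))"
    proof (rule sum_norm_le)
      fix i assume i: "i \<in> I"
      have "cmod (cinner (blinfun_apply (T i) x) x) = Re (cinner (blinfun_apply (T i) x) x)"
        using pos[OF i] by (simp add: nonneg_op_iff cmod_eq_Re)
      then show "cmod (c i * cinner (blinfun_apply (T i) x) x) \<le> B * Re (cinner (blinfun_apply (T i) x) x)"
        using c[OF i] pos[OF i]
        by (cases "T i = 0") (auto simp: norm_mult nonneg_op_iff intro: mult_right_mono)
    qed
    also have "\<dots> = B * Re (cinner (blinfun_apply (\<Sum>i\<in>I. T i) x) x)"
      by (simp add: blinfun.sum_left cinner_lin sum_distrib_left)
    also have "\<dots> = B * (norm x)\<^sup>2" by (simp add: total cinner_self)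
    finally show ?thesis .
  qed
  show "norm (\<Sum>i\<in>I. c i *\<^sub>C T i) \<le> 2 * B"
    using ops by (intro norm_le_numerical_radius bounded_ops_sum * B) auto
qed

lemma tagged_division_cell:
  assumes "p tagged_division_of {-1..1::real}" "x \<in> p"
  shows "snd x = {Inf (snd x)..Sup (snd x)}" "Inf (snd x) \<le> fst x" "fst x \<le> Sup (snd x)"
    "- 1 \<le> Inf (snd x)" "Sup (snd x) \<le> 1"
proof -
  obtain t k where x: "x = (t, k)" by force
  obtain a b where k: "k = {a..b}" "t \<in> k" "k \<subseteq> {-1..1}"
    using tagged_division_ofD(2,3,4)[OF assms(1) assms(2)[unfolded x]] by auto
  then show "snd x = {Inf (snd x)..Sup (snd x)}" "Inf (snd x) \<le> fst x" "fst x \<le> Sup (snd x)"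
    "- 1 \<le> Inf (snd x)" "Sup (snd x) \<le> 1"
    by (auto simp: x)
qed

lemma fine_cell:
  assumes "p tagged_division_of {-1..1::real}" "(\<lambda>t. ball t \<delta>) fine p" "x \<in> p" "u \<in> snd x"
  shows "\<bar>fst x - u\<bar> < \<delta>"
  using assms(2-4) fineD[of "\<lambda>t. ball t \<delta>" p "fst x" "snd x"] by (auto simp: dist_real_def)

lemma tagged_division_telescope:
  fixes h :: "real \<Rightarrow> 'a::real_normed_vector"
  assumes "p tagged_division_of {-1..1::real}"
  shows "(\<Sum>x\<in>p. h (Sup (snd x)) - h (Inf (snd x))) = h 1 - h (- 1)"
  using additive_tagged_division_1[OF _ assms, of h] by (simp add: case_prod_beta)

definition stieltjes_sum ::
    "(real \<Rightarrow> 'a::hilbert_space \<Rightarrow>\<^sub>L 'a) \<Rightarrow> (real \<times> real set) set \<Rightarrow> (real \<Rightarrow> complex) \<Rightarrow> 'a \<Rightarrow>\<^sub>L 'a" where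
  "stieltjes_sum \<sigma> p f = (\<Sum>x\<in>p. f (fst x) *\<^sub>C (\<sigma> (Sup (snd x)) - \<sigma> (Inf (snd x))))"

lemma has_stieltjes_integral_alt:
  "has_stieltjes_integral f \<sigma> I \<longleftrightarrow>
     (\<forall>\<epsilon>>0. \<exists>\<delta>>0. \<forall>p. p tagged_division_of {-1..1} \<and> (\<lambda>t. ball t \<delta>) fine p \<longrightarrow>
        norm (stieltjes_sum \<sigma> p f - I) < \<epsilon>)"
  by (simp add: has_stieltjes_integral_def stieltjes_sum_def case_prod_beta)

text \<open>One fixed sequence of divisions turns the integral into an ordinary limit, so that
  linearity and bounds pass from Riemann sums to integrals by limit rules.\<close>

definition fine_division :: "nat \<Rightarrow> (real \<times> real set) set" where
  "fine_division n = (SOME p. p tagged_division_of {-1..1} \<and> (\<lambda>t. ball t (1 / (real n + 1))) fine p)"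

lemma fine_division:
  "fine_division n tagged_division_of {-1..1}" "(\<lambda>t. ball t (1 / (real n + 1))) fine fine_division n"
proof -
  have "gauge (\<lambda>t::real. ball t (1 / (real n + 1)))" by (intro gauge_ball) simp
  then obtain p where "p tagged_division_of cbox (-1) (1::real)" "(\<lambda>t. ball t (1 / (real n + 1))) fine p"
    by (rule fine_division_exists)
  then have "\<exists>p. p tagged_division_of {-1..1::real} \<and> (\<lambda>t. ball t (1 / (real n + 1))) fine p" by auto
  from someI_ex[OF this] show "fine_division n tagged_division_of {-1..1}"
    "(\<lambda>t. ball t (1 / (real n + 1))) fine fine_division n"
    by (auto simp: fine_division_def)
qed

lemma fine_division_finer:
  assumes "\<delta> > 0"
  shows "\<exists>N. \<forall>n\<ge>N. (\<lambda>t. ball t \<delta>) fine fine_division n"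
proof -
  obtain N :: nat where N: "1 / \<delta> < real N" using reals_Archimedean2 by blast
  have "(\<lambda>t. ball t \<delta>) fine fine_division n" if "n \<ge> N" for n
  proof -
    have "1 / \<delta> < real n + 1" using N that by linarith
    then have "1 / (real n + 1) \<le> \<delta>" using assms by (simp add: field_simps)
    then show ?thesis using fine_division(2)[of n] unfolding fine_def by fastforce
  qed
  then show ?thesis by blast
qed

lemma has_stieltjes_integral_imp_lim:
  assumes "has_stieltjes_integral f \<sigma> I"
  shows "(\<lambda>n. stieltjes_sum \<sigma> (fine_division n) f) \<longlonglongrightarrow> I"
proof (rule LIMSEQ_I)
  fix r :: real assume "r > 0"
  then obtain \<delta> where "\<delta> > 0" and \<delta>: "\<And>p. p tagged_division_of {-1..1} \<Longrightarrow> (\<lambda>t. ball t \<delta>) fine p \<Longrightarrow>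
        norm (stieltjes_sum \<sigma> p f - I) < r"
    using assms unfolding has_stieltjes_integral_alt by meson
  then show "\<exists>no. \<forall>n\<ge>no. norm (stieltjes_sum \<sigma> (fine_division n) f - I) < r"
    using fine_division_finer fine_division(1) by meson
qed

lemma stieltjes_integral_eqI: "has_stieltjes_integral f \<sigma> I \<Longrightarrow> stieltjes_integral f \<sigma> = I"
  unfolding stieltjes_integral_def
  using LIMSEQ_unique[OF has_stieltjes_integral_imp_lim has_stieltjes_integral_imp_lim]
  by (intro the_equality)

lemma stieltjes_sum_lin:
  "stieltjes_sum \<sigma> p (\<lambda>t. f t + g t) = stieltjes_sum \<sigma> p f + stieltjes_sum \<sigma> p g"
  "stieltjes_sum \<sigma> p (\<lambda>t. c * f t) = c *\<^sub>C stieltjes_sum \<sigma> p f"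
proof -
  show "stieltjes_sum \<sigma> p (\<lambda>t. f t + g t) = stieltjes_sum \<sigma> p f + stieltjes_sum \<sigma> p g"
    unfolding stieltjes_sum_def sum.distrib[symmetric]
    by (intro sum.cong refl blinfun_eqI) (simp add: blinfun.add_left scaleC_add_left)
  show "stieltjes_sum \<sigma> p (\<lambda>t. c * f t) = c *\<^sub>C stieltjes_sum \<sigma> p f"
    unfolding stieltjes_sum_def
    by (intro blinfun_eqI) (simp add: blinfun.sum_left complex_vector.scale_sum_right scaleC_scaleC)
qed

text \<open>The expression is the increment of \<open>m\<close> over the intersection of
  \<open>[a, b]\<close> and \<open>[c, d]\<close>, and it cancels to \<open>0\<close> when they are
  disjoint.\<close>

lemma mono_overlap:
  fixes m :: "real \<Rightarrow> real"
  assumes m: "\<And>s t. - 1 \<le> s \<Longrightarrow> s \<le> t \<Longrightarrow> t \<le> 1 \<Longrightarrow> m s \<le> m t"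
    and "- 1 \<le> a" "a \<le> b" "b \<le> 1" "- 1 \<le> c" "c \<le> d" "d \<le> 1"
  shows "0 \<le> m (min b d) - m (min b c) - m (min a d) + m (min a c)"
  using assms(2-) m[of "min b c" "min b d"] m[of "min a d" "min b d"]
  by (cases "a \<le> c") (auto simp: min_def split: if_splits)

locale distribution =
  fixes \<sigma> :: "real \<Rightarrow> 'a::hilbert_space \<Rightarrow>\<^sub>L 'a"
  assumes \<sigma>: "\<sigma> \<in> distribution_functions"
begin

abbreviation "q t x \<equiv> Re (cinner (blinfun_apply (\<sigma> t) x) x)"

lemma ops: "-1 \<le> t \<Longrightarrow> t \<le> 1 \<Longrightarrow> \<sigma> t \<in> bounded_ops"
  using \<sigma> by (simp add: distribution_functions_def)

lemma ends: "\<sigma> (-1) = 0" "\<sigma> 1 = id_blinfun"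
  using \<sigma> by (auto simp: distribution_functions_def)

lemma le: "-1 \<le> s \<Longrightarrow> s \<le> t \<Longrightarrow> t \<le> 1 \<Longrightarrow> op_le (\<sigma> s) (\<sigma> t)"
  using \<sigma> by (simp add: distribution_functions_def)

lemma q_real: "-1 \<le> t \<Longrightarrow> t \<le> 1 \<Longrightarrow> Im (cinner (blinfun_apply (\<sigma> t) x) x) = 0"
  using le[of "-1" t] by (simp add: ends op_le_iff)

lemma q_mono: "-1 \<le> s \<Longrightarrow> s \<le> t \<Longrightarrow> t \<le> 1 \<Longrightarrow> q s x \<le> q t x"
  using le[of s t] by (simp add: op_le_iff)

text \<open>The increment of \<open>\<sigma>\<close> over the intersection of two cells, written so as to telescope in either
  cell. It replaces the common refinement when two Riemann sums are compared.\<close>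

definition overlap :: "real \<times> real set \<Rightarrow> real \<times> real set \<Rightarrow> 'a \<Rightarrow>\<^sub>L 'a" where
  "overlap x y =
     (let a = Inf (snd x); b = Sup (snd x); c = Inf (snd y); d = Sup (snd y)
      in \<sigma> (min b d) - \<sigma> (min b c) - \<sigma> (min a d) + \<sigma> (min a c))"

lemma overlap_commute: "overlap x y = overlap y x"
  by (simp add: overlap_def Let_def min.commute)

context
  fixes p assumes p: "p tagged_division_of {-1..1::real}"
begin

lemma increment:
  assumes "x \<in> p"
  shows "\<sigma> (Sup (snd x)) - \<sigma> (Inf (snd x)) \<in> bounded_ops"
    "nonneg_op (\<sigma> (Sup (snd x)) - \<sigma> (Inf (snd x)))"
proof -
  note c = tagged_division_cell[OF p assms]
  show "\<sigma> (Sup (snd x)) - \<sigma> (Inf (snd x)) \<in> bounded_ops"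
    using c by (intro bounded_ops_intros ops) auto
  show "nonneg_op (\<sigma> (Sup (snd x)) - \<sigma> (Inf (snd x)))"
    using le[of "Inf (snd x)" "Sup (snd x)"] c by (simp add: op_le_def)
qed

lemma increment_sum: "(\<Sum>x\<in>p. \<sigma> (Sup (snd x)) - \<sigma> (Inf (snd x))) = id_blinfun"
  using tagged_division_telescope[OF p, of \<sigma>] by (simp add: ends)

lemma stieltjes_sum_ops: "stieltjes_sum \<sigma> p f \<in> bounded_ops"
  unfolding stieltjes_sum_def by (intro bounded_ops_sum bounded_ops_intros increment)

lemma stieltjes_sum_bound:
  assumes "\<And>t. t \<in> {-1..1} \<Longrightarrow> cmod (f t) \<le> B" "0 \<le> B"
  shows "norm (stieltjes_sum \<sigma> p f) \<le> 2 * B"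
    "cmod (cinner (blinfun_apply (stieltjes_sum \<sigma> p f) x) x) \<le> B * (norm x)\<^sup>2"
proof -
  have c: "cmod (f (fst x)) \<le> B" if "x \<in> p" for x
    using tagged_division_cell[OF p that] by (intro assms) auto
  show "norm (stieltjes_sum \<sigma> p f) \<le> 2 * B"
    unfolding stieltjes_sum_def by (rule norm_weighted_sum_le(2)[OF increment c assms(2) increment_sum])
  show "cmod (cinner (blinfun_apply (stieltjes_sum \<sigma> p f) x) x) \<le> B * (norm x)\<^sup>2"
    unfolding stieltjes_sum_def by (rule norm_weighted_sum_le(1)[OF increment c assms(2) increment_sum])
qed

lemma overlap_sum:
  assumes "-1 \<le> Inf (snd x)" "Sup (snd x) \<le> 1" "Inf (snd x) \<le> Sup (snd x)"
  shows "(\<Sum>y\<in>p. overlap x y) = \<sigma> (Sup (snd x)) - \<sigma> (Inf (snd x))"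
proof -
  \<comment> \<open>At \<open>u = -1\<close> both minima are \<open>-1\<close>, at
    \<open>u = 1\<close> they are the end points of the cell, so the telescoped sum is the full
    increment.\<close>
  let ?h = "\<lambda>u. \<sigma> (min (Sup (snd x)) u) - \<sigma> (min (Inf (snd x)) u)"
  have "(\<Sum>y\<in>p. overlap x y) = (\<Sum>y\<in>p. ?h (Sup (snd y)) - ?h (Inf (snd y)))"
    by (intro sum.cong) (auto simp: overlap_def Let_def)
  also have "\<dots> = \<sigma> (Sup (snd x)) - \<sigma> (Inf (snd x))"
    by (subst tagged_division_telescope[OF p, of ?h]) (use assms in \<open>simp add: min_absorb1 min_absorb2\<close>)
  finally show ?thesis .
qed

end

lemma overlap_props:
  assumes p: "p tagged_division_of {-1..1::real}" "x \<in> p" and r: "r tagged_division_of {-1..1::real}" "y \<in> r"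
  shows "overlap x y \<in> bounded_ops" "nonneg_op (overlap x y)"
    "overlap x y \<noteq> 0 \<Longrightarrow> \<exists>u. u \<in> snd x \<and> u \<in> snd y"
proof -
  note x = tagged_division_cell[OF p] and y = tagged_division_cell[OF r]
  let ?a = "Inf (snd x)" and ?b = "Sup (snd x)" and ?c = "Inf (snd y)" and ?d = "Sup (snd y)"
  have ab: "?a \<le> ?b" "?c \<le> ?d" using x y by linarith+
  show "overlap x y \<in> bounded_ops"
    unfolding overlap_def Let_def using x(4,5) y(4,5) ab
    by (intro bounded_ops_intros ops) (auto simp: min_def)
  show "nonneg_op (overlap x y)"
    unfolding nonneg_op_iff
  proof
    fix v
    have "0 \<le> q (min ?b ?d) v - q (min ?b ?c) v - q (min ?a ?d) v + q (min ?a ?c) v"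
      using x y ab by (intro mono_overlap[of "\<lambda>t. q t v"] q_mono) auto
    moreover have "Im (cinner (blinfun_apply (\<sigma> (min s t)) v) v) = 0"
      if "-1 \<le> s" "s \<le> 1" "-1 \<le> t" for s t
      using that by (intro q_real) auto
    ultimately show "Im (cinner (blinfun_apply (overlap x y) v) v) = 0
        \<and> 0 \<le> Re (cinner (blinfun_apply (overlap x y) v) v)"
      using x(4,5) y(4,5) ab
      by (simp add: overlap_def Let_def blinfun.add_left blinfun.diff_left cinner_lin)
  qed
  show "\<exists>u. u \<in> snd x \<and> u \<in> snd y" if nz: "overlap x y \<noteq> 0"
  proof (rule ccontr)
    assume "\<not> ?thesis"
    then have "\<not> (max ?a ?c \<le> min ?b ?d)"
      using x(1) y(1) ab by (metis atLeastAtMost_iff max.cobounded1 max.cobounded2 min.boundedE)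
    then have "?b < ?c \<or> ?d < ?a" using ab by linarith
    then show False using nz ab by (auto simp: overlap_def Let_def min_def split: if_splits)
  qed
qed

text \<open>Both sums are rewritten over pairs of cells, weighted by overlaps. A pair with nonzero
  weight shares a point, which is within \<open>\<delta>\<close> of either tag, so its coefficient
  is a difference of values of \<open>f\<close> at distance less than
  \<open>2 * \<delta>\<close>.\<close>

lemma stieltjes_sum_diff_bound:
  assumes p: "p tagged_division_of {-1..1}" "(\<lambda>t. ball t \<delta>) fine p"
    and r: "r tagged_division_of {-1..1}" "(\<lambda>t. ball t \<delta>) fine r"
    and f: "\<And>s t. s \<in> {-1..1} \<Longrightarrow> t \<in> {-1..1} \<Longrightarrow> \<bar>s - t\<bar> < 2 * \<delta> \<Longrightarrow> cmod (f s - f t) \<le> B" and "0 \<le> B"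
  shows "norm (stieltjes_sum \<sigma> p f - stieltjes_sum \<sigma> r f) \<le> 2 * B"
proof -
  have "stieltjes_sum \<sigma> p f = (\<Sum>x\<in>p. \<Sum>y\<in>r. f (fst x) *\<^sub>C overlap x y)"
    unfolding stieltjes_sum_def
  proof (intro sum.cong refl)
    fix x assume "x \<in> p"
    then have "\<sigma> (Sup (snd x)) - \<sigma> (Inf (snd x)) = (\<Sum>y\<in>r. overlap x y)"
      using tagged_division_cell[OF p(1), of x] by (intro overlap_sum[symmetric] r(1)) auto
    then show "f (fst x) *\<^sub>C (\<sigma> (Sup (snd x)) - \<sigma> (Inf (snd x))) = (\<Sum>y\<in>r. f (fst x) *\<^sub>C overlap x y)"
      by (intro blinfun_eqI) (simp add: blinfun.sum_left complex_vector.scale_sum_right)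
  qed
  moreover have "stieltjes_sum \<sigma> r f = (\<Sum>y\<in>r. \<Sum>x\<in>p. f (fst y) *\<^sub>C overlap x y)"
    unfolding stieltjes_sum_def
  proof (intro sum.cong refl)
    fix y assume "y \<in> r"
    then have "\<sigma> (Sup (snd y)) - \<sigma> (Inf (snd y)) = (\<Sum>x\<in>p. overlap x y)"
      using tagged_division_cell[OF r(1), of y] overlap_sum[OF p(1), of y] by (simp add: overlap_commute)
    then show "f (fst y) *\<^sub>C (\<sigma> (Sup (snd y)) - \<sigma> (Inf (snd y))) = (\<Sum>x\<in>p. f (fst y) *\<^sub>C overlap x y)"
      by (intro blinfun_eqI) (simp add: blinfun.sum_left complex_vector.scale_sum_right)
  qed
  ultimately have "stieltjes_sum \<sigma> p f - stieltjes_sum \<sigma> r f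
      = (\<Sum>x\<in>p. \<Sum>y\<in>r. f (fst x) *\<^sub>C overlap x y - f (fst y) *\<^sub>C overlap x y)"
    by (simp add: sum_subtractf sum.swap[of _ p r])
  also have "\<dots> = (\<Sum>z\<in>p \<times> r. (f (fst (fst z)) - f (fst (snd z))) *\<^sub>C overlap (fst z) (snd z))"
    unfolding sum.cartesian_product
    by (intro sum.cong refl blinfun_eqI)
      (auto simp: blinfun.diff_left complex_vector.scale_left_diff_distrib)
  also have "norm \<dots> \<le> 2 * B"
  proof (rule norm_weighted_sum_le(2))
    fix z assume z: "z \<in> p \<times> r"
    then have xy: "fst z \<in> p" "snd z \<in> r" by auto
    note pr = overlap_props[OF p(1) xy(1) r(1) xy(2)]
    show "overlap (fst z) (snd z) \<in> bounded_ops" "nonneg_op (overlap (fst z) (snd z))"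
      by (rule pr)+
    assume "overlap (fst z) (snd z) \<noteq> 0"
    then obtain u where "u \<in> snd (fst z)" "u \<in> snd (snd z)" using pr(3) by blast
    then have "\<bar>fst (fst z) - fst (snd z)\<bar> < 2 * \<delta>"
      using fine_cell[OF p xy(1), of u] fine_cell[OF r xy(2), of u] by linarith
    then show "cmod (f (fst (fst z)) - f (fst (snd z))) \<le> B"
      using tagged_division_cell[OF p(1) xy(1)] tagged_division_cell[OF r(1) xy(2)]
      by (intro f) auto
  next
    have "(\<Sum>z\<in>p \<times> r. overlap (fst z) (snd z)) = (\<Sum>x\<in>p. \<Sum>y\<in>r. overlap x y)"
      by (simp add: sum.cartesian_product case_prod_beta)
    also have "\<dots> = (\<Sum>x\<in>p. \<sigma> (Sup (snd x)) - \<sigma> (Inf (snd x)))"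
      using tagged_division_cell[OF p(1)] by (intro sum.cong refl overlap_sum r(1)) force+
    finally show "(\<Sum>z\<in>p \<times> r. overlap (fst z) (snd z)) = id_blinfun"
      using increment_sum[OF p(1)] by simp
  qed (rule assms)
  finally show ?thesis .
qed

text \<open>Uniform continuity yields a Cauchy criterion over all fine divisions; the limit is taken
  along \<open>fine_division\<close>, and a second use of the criterion frees it from that
  sequence.\<close>

lemma has_stieltjes_integral_exists:
  assumes f: "continuous_on {-1..1} f"
  shows "has_stieltjes_integral f \<sigma> (stieltjes_integral f \<sigma>)"
proof -
  let ?S = "\<lambda>n. stieltjes_sum \<sigma> (fine_division n) f"
  have cauchy: "\<exists>\<delta>>0. \<forall>(p :: (real \<times> real set) set) r. p tagged_division_of {-1..1} \<and> (\<lambda>t. ball t \<delta>) fine p \<and>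
      r tagged_division_of {-1..1} \<and> (\<lambda>t. ball t \<delta>) fine r \<longrightarrow>
      norm (stieltjes_sum \<sigma> p f - stieltjes_sum \<sigma> r f) < e" if "e > 0" for e
  proof -
    have "uniformly_continuous_on {-1..1} f"
      using f by (intro compact_uniformly_continuous) auto
    then obtain d where d: "d > 0" "\<And>s t. s \<in> {-1..1} \<Longrightarrow> t \<in> {-1..1} \<Longrightarrow> dist s t < d \<Longrightarrow> dist (f s) (f t) < e / 4"
      unfolding uniformly_continuous_on_def using \<open>e > 0\<close> by (metis divide_pos_pos zero_less_numeral)
    show ?thesis
    proof (intro exI[of _ "d / 2"] conjI allI impI)
      fix p r :: "(real \<times> real set) set"
      assume "p tagged_division_of {-1..1} \<and> (\<lambda>t. ball t (d/2)) fine p \<and>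
        r tagged_division_of {-1..1} \<and> (\<lambda>t. ball t (d/2)) fine r"
      then have "norm (stieltjes_sum \<sigma> p f - stieltjes_sum \<sigma> r f) \<le> 2 * (e / 4)"
        using d(2) \<open>e > 0\<close>
        by (intro stieltjes_sum_diff_bound[where \<delta> = "d / 2"])
          (auto simp: dist_norm real_norm_def intro!: less_imp_le)
      then show "norm (stieltjes_sum \<sigma> p f - stieltjes_sum \<sigma> r f) < e" using \<open>e > 0\<close> by linarith
    qed (use d in auto)
  qed
  have "Cauchy ?S"
  proof (rule CauchyI)
    fix e :: real assume "e > 0"
    then obtain \<delta> where "\<delta> > 0" and \<delta>: "\<And>p r. p tagged_division_of {-1..1} \<Longrightarrow> (\<lambda>t. ball t \<delta>) fine p \<Longrightarrow>
      r tagged_division_of {-1..1} \<Longrightarrow> (\<lambda>t. ball t \<delta>) fine r \<Longrightarrow>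
      norm (stieltjes_sum \<sigma> p f - stieltjes_sum \<sigma> r f) < e" using cauchy by meson
    obtain N where "\<forall>n\<ge>N. (\<lambda>t. ball t \<delta>) fine fine_division n"
      using fine_division_finer[OF \<open>\<delta> > 0\<close>] by blast
    then show "\<exists>M. \<forall>m\<ge>M. \<forall>n\<ge>M. norm (?S m - ?S n) < e"
      by (intro exI[of _ N] allI impI \<delta> fine_division(1)) auto
  qed
  then obtain I where I: "?S \<longlonglongrightarrow> I" using Cauchy_convergent[of ?S] unfolding convergent_def by blast
  have "has_stieltjes_integral f \<sigma> I"
    unfolding has_stieltjes_integral_alt
  proof (intro allI impI)
    fix e :: real assume "e > 0"
    then have "e / 2 > 0" by simp
    then obtain \<delta> where "\<delta> > 0" and \<delta>: "\<And>p r. p tagged_division_of {-1..1} \<Longrightarrow> (\<lambda>t. ball t \<delta>) fine p \<Longrightarrow>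
      r tagged_division_of {-1..1} \<Longrightarrow> (\<lambda>t. ball t \<delta>) fine r \<Longrightarrow>
      norm (stieltjes_sum \<sigma> p f - stieltjes_sum \<sigma> r f) < e / 2" using cauchy by meson
    obtain N where N: "\<forall>n\<ge>N. (\<lambda>t. ball t \<delta>) fine fine_division n"
      using fine_division_finer[OF \<open>\<delta> > 0\<close>] by blast
    obtain M where M: "\<forall>n\<ge>M. norm (?S n - I) < e / 2"
      using LIMSEQ_D[OF I \<open>e / 2 > 0\<close>] by blast
    show "\<exists>\<delta>>0. \<forall>p. p tagged_division_of {-1..1} \<and> (\<lambda>t. ball t \<delta>) fine p \<longrightarrow>
        norm (stieltjes_sum \<sigma> p f - I) < e"
    proof (intro exI[of _ \<delta>] conjI allI impI \<open>\<delta> > 0\<close>)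
      fix p :: "(real \<times> real set) set"
      assume "p tagged_division_of {-1..1} \<and> (\<lambda>t. ball t \<delta>) fine p"
      then have "norm (stieltjes_sum \<sigma> p f - ?S (max M N)) < e / 2"
        using N fine_division(1) by (intro \<delta>) auto
      moreover have "norm (?S (max M N) - I) < e / 2" using M by simp
      ultimately show "norm (stieltjes_sum \<sigma> p f - I) < e"
        using norm_triangle_ineq[of "stieltjes_sum \<sigma> p f - ?S (max M N)" "?S (max M N) - I"] by simp
    qed
  qed
  then show ?thesis using stieltjes_integral_eqI by metis
qed

section \<open>The integral as a positive linear map on continuous functions\<close>

abbreviation "\<Phi> f \<equiv> stieltjes_integral f \<sigma>"

lemma \<Phi>_lim: "continuous_on {-1..1} f \<Longrightarrow> (\<lambda>n. stieltjes_sum \<sigma> (fine_division n) f) \<longlonglongrightarrow> \<Phi> f"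
  by (intro has_stieltjes_integral_imp_lim has_stieltjes_integral_exists)

lemma \<Phi>_ops [intro, simp]: "continuous_on {-1..1} f \<Longrightarrow> \<Phi> f \<in> bounded_ops"
  by (rule bounded_ops_lim[OF _ \<Phi>_lim]) (intro stieltjes_sum_ops fine_division)

lemma \<Phi>_cong: "(\<And>t. t \<in> {-1..1} \<Longrightarrow> f t = g t) \<Longrightarrow> \<Phi> f = \<Phi> g"
proof -
  assume *: "\<And>t. t \<in> {-1..1} \<Longrightarrow> f t = g t"
  have "stieltjes_sum \<sigma> p f = stieltjes_sum \<sigma> p g" if "p tagged_division_of {-1..1}" for p
    unfolding stieltjes_sum_def using tagged_division_cell[OF that] * by (intro sum.cong refl) force
  then have "(p tagged_division_of {-1..1} \<and> (\<lambda>t. ball t \<delta>) fine p \<longrightarrow> norm (stieltjes_sum \<sigma> p f - I) < e)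
     \<longleftrightarrow> (p tagged_division_of {-1..1} \<and> (\<lambda>t. ball t \<delta>) fine p \<longrightarrow> norm (stieltjes_sum \<sigma> p g - I) < e)"
    for p \<delta> I e by auto
  then have "has_stieltjes_integral f \<sigma> = has_stieltjes_integral g \<sigma>"
    unfolding has_stieltjes_integral_alt fun_eq_iff by simp
  then show ?thesis unfolding stieltjes_integral_def by simp
qed

lemma \<Phi>_add:
  assumes "continuous_on {-1..1} f" "continuous_on {-1..1} g"
  shows "\<Phi> (\<lambda>t. f t + g t) = \<Phi> f + \<Phi> g"
proof (rule LIMSEQ_unique[OF \<Phi>_lim])
  show "(\<lambda>n. stieltjes_sum \<sigma> (fine_division n) (\<lambda>t. f t + g t)) \<longlonglongrightarrow> \<Phi> f + \<Phi> g"
    unfolding stieltjes_sum_lin using assms by (intro tendsto_add \<Phi>_lim)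
qed (intro continuous_intros assms)

lemma \<Phi>_scaleC:
  assumes "continuous_on {-1..1} f"
  shows "\<Phi> (\<lambda>t. c * f t) = c *\<^sub>C \<Phi> f"
proof (rule blinfun_eqI)
  fix x
  have "(\<lambda>n. blinfun_apply (stieltjes_sum \<sigma> (fine_division n) (\<lambda>t. c * f t)) x) \<longlonglongrightarrow> blinfun_apply (\<Phi> (\<lambda>t. c * f t)) x"
    using assms by (intro tendsto_intros \<Phi>_lim continuous_intros)
  moreover have "(\<lambda>n. c *\<^sub>C blinfun_apply (stieltjes_sum \<sigma> (fine_division n) f) x) \<longlonglongrightarrow> c *\<^sub>C blinfun_apply (\<Phi> f) x"
    using assms by (intro tendsto_intros \<Phi>_lim)
  ultimately show "blinfun_apply (\<Phi> (\<lambda>t. c * f t)) x = blinfun_apply (c *\<^sub>C \<Phi> f) x"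
    using LIMSEQ_unique by (simp add: stieltjes_sum_lin)
qed

lemma \<Phi>_diff:
  assumes "continuous_on {-1..1} f" "continuous_on {-1..1} g"
  shows "\<Phi> (\<lambda>t. f t - g t) = \<Phi> f - \<Phi> g"
proof -
  have "\<Phi> (\<lambda>t. f t + - 1 * g t) = \<Phi> f + (- 1) *\<^sub>C \<Phi> g"
    using assms by (simp only: \<Phi>_add \<Phi>_scaleC continuous_on_mult_left)
  moreover have "(- 1) *\<^sub>C \<Phi> g = - \<Phi> g"
    by (rule blinfun_eqI) (simp add: blinfun.minus_left scaleC_minus1)
  ultimately show ?thesis by simp
qed

lemma \<Phi>_bound:
  assumes f: "continuous_on {-1..1} f" and B: "\<And>t. t \<in> {-1..1} \<Longrightarrow> cmod (f t) \<le> B" "0 \<le> B"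
  shows "norm (\<Phi> f) \<le> 2 * B"
  by (rule tendsto_norm_bound[OF \<Phi>_lim[OF f]]) (intro stieltjes_sum_bound fine_division B)

lemma \<Phi>_quadratic_bound:
  assumes f: "continuous_on {-1..1} f" and B: "\<And>t. t \<in> {-1..1} \<Longrightarrow> cmod (f t) \<le> B" "0 \<le> B"
  shows "cmod (cinner (blinfun_apply (\<Phi> f) x) x) \<le> B * (norm x)\<^sup>2"
  by (rule tendsto_norm_bound[OF bounded_linear.tendsto[OF bounded_linear_quadratic \<Phi>_lim[OF f]]])
    (intro stieltjes_sum_bound fine_division B)

lemma \<Phi>_one: "\<Phi> (\<lambda>_. 1) = id_blinfun"
proof -
  have "stieltjes_sum \<sigma> (fine_division n) (\<lambda>_. 1) = id_blinfun" for n
    using increment_sum[OF fine_division(1)]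
    by (simp add: stieltjes_sum_def)
  then show ?thesis using \<Phi>_lim[of "\<lambda>_. 1"] by (simp add: LIMSEQ_const_iff)
qed

lemma \<Phi>_adjoint:
  assumes f: "continuous_on {-1..1} f"
  shows "cinner (blinfun_apply (\<Phi> f) x) y = cinner x (blinfun_apply (\<Phi> (\<lambda>t. cnj (f t))) y)"
proof -
  have "cinner (blinfun_apply (stieltjes_sum \<sigma> p f) x) y
      = cinner x (blinfun_apply (stieltjes_sum \<sigma> p (\<lambda>t. cnj (f t))) y)"
    if p: "p tagged_division_of {-1..1}" for p
    unfolding stieltjes_sum_def blinfun.sum_left cinner_sum_left cinner_sum_right
    using symmetric_of_real_quadratic[OF increment(1)[OF p]] increment(2)[OF p]
    by (intro sum.cong refl) (simp add: cinner_lin nonneg_op_iff)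
  note eq = this[OF fine_division(1)]
  have "(\<lambda>n. cinner (blinfun_apply (stieltjes_sum \<sigma> (fine_division n) f) x) y)
     \<longlonglongrightarrow> cinner (blinfun_apply (\<Phi> f) x) y"
    by (intro tendsto_intros \<Phi>_lim f)
  moreover have "(\<lambda>n. cinner (blinfun_apply (stieltjes_sum \<sigma> (fine_division n) f) x) y)
     \<longlonglongrightarrow> cinner x (blinfun_apply (\<Phi> (\<lambda>t. cnj (f t))) y)"
    unfolding eq by (intro tendsto_intros \<Phi>_lim continuous_intros f)
  ultimately show ?thesis by (rule LIMSEQ_unique)
qed

text \<open>The operator-valued Hankel kernel of the moments of \<open>f * \<sigma>\<close> is
  positive semidefinite. With \<open>f = 1\<close> it supplies the inner product of the dilation
  space, with \<open>f t = 1 - t^2\<close> the contractivity of the shift on it.\<close>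

lemma \<Phi>_positive_family:
  fixes y :: "'i \<Rightarrow> 'a" and n :: "'i \<Rightarrow> nat"
  assumes f: "continuous_on {-1..1} f" and pos: "\<And>t. t \<in> {-1..1} \<Longrightarrow> 0 \<le> f t"
  shows "0 \<le> Re (\<Sum>i\<in>I. \<Sum>j\<in>I. cinner (blinfun_apply (\<Phi> (\<lambda>t. of_real (f t * t ^ (n i + n j)))) (y i)) (y j))"
proof (rule LIMSEQ_le_const)
  let ?X = "\<lambda>k. Re (\<Sum>i\<in>I. \<Sum>j\<in>I. cinner (blinfun_apply
    (stieltjes_sum \<sigma> (fine_division k) (\<lambda>t. of_real (f t * t ^ (n i + n j)))) (y i)) (y j))"
  show "?X \<longlonglongrightarrow> Re (\<Sum>i\<in>I. \<Sum>j\<in>I. cinner (blinfun_apply (\<Phi> (\<lambda>t. of_real (f t * t ^ (n i + n j)))) (y i)) (y j))"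
    by (intro tendsto_intros \<Phi>_lim continuous_intros f)
  have "0 \<le> ?X k" for k
  proof -
    let ?p = "fine_division k"
    define D where "D x = \<sigma> (Sup (snd x)) - \<sigma> (Inf (snd x))" for x :: "real \<times> real set"
    \<comment> \<open>At a tag \<open>t\<close> the double sum collapses to the form of the
      increment at the single vector with terms \<open>t ^ n i\<close> times
      \<open>y i\<close>.\<close>
    define w where "w x = (\<Sum>i\<in>I. (fst x ^ n i) *\<^sub>R y i)" for x :: "real \<times> real set"
    have "(\<Sum>i\<in>I. \<Sum>j\<in>I. cinner (blinfun_apply (stieltjes_sum \<sigma> ?p (\<lambda>t. of_real (f t * t ^ (n i + n j)))) (y i)) (y j))
      = (\<Sum>i\<in>I. \<Sum>j\<in>I. \<Sum>x\<in>?p. of_real (f (fst x) * fst x ^ (n i + n j)) * cinner (blinfun_apply (D x) (y i)) (y j))"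
      by (simp add: stieltjes_sum_def D_def blinfun.sum_left cinner_lin)
    also have "\<dots> = (\<Sum>i\<in>I. \<Sum>x\<in>?p. \<Sum>j\<in>I. of_real (f (fst x) * fst x ^ (n i + n j)) * cinner (blinfun_apply (D x) (y i)) (y j))"
      by (intro sum.cong refl sum.swap)
    also have "\<dots> = (\<Sum>x\<in>?p. \<Sum>i\<in>I. \<Sum>j\<in>I. of_real (f (fst x) * fst x ^ (n i + n j)) * cinner (blinfun_apply (D x) (y i)) (y j))"
      by (rule sum.swap)
    also have "\<dots> = (\<Sum>x\<in>?p. of_real (f (fst x)) * cinner (blinfun_apply (D x) (w x)) (w x))"
      unfolding w_def blinfun.sum_right cinner_sum_left unfolding cinner_sum_right
      by (intro sum.cong refl)
        (simp add: blinfun.scaleR_right cinner_scaleR_left cinner_scaleR_right sum_distrib_left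
          power_add mult_ac)
    also have "Re \<dots> = (\<Sum>x\<in>?p. f (fst x) * Re (cinner (blinfun_apply (D x) (w x)) (w x)))"
      by simp
    also have "\<dots> \<ge> 0"
    proof (intro sum_nonneg mult_nonneg_nonneg pos)
      fix x assume x: "x \<in> ?p"
      show "fst x \<in> {-1..1}"
        using tagged_division_cell[OF fine_division(1) x] by auto
      show "0 \<le> Re (cinner (blinfun_apply (D x) (w x)) (w x))"
        using increment(2)[OF fine_division(1) x] by (simp add: D_def nonneg_op_iff)
    qed
    finally show ?thesis .
  qed
  then show "\<exists>N. \<forall>n\<ge>N. 0 \<le> ?X n" by blast
qed

lemma \<Phi>_nonneg:
  assumes f: "continuous_on {-1..1} f" and pos: "\<And>t. t \<in> {-1..1} \<Longrightarrow> 0 \<le> f t"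
  shows "nonneg_op (\<Phi> (\<lambda>t. of_real (f t)))"
  unfolding nonneg_op_iff
proof
  fix x
  let ?T = "\<Phi> (\<lambda>t. of_real (f t))"
  have "cinner (blinfun_apply ?T x) x = cinner x (blinfun_apply ?T x)"
    using \<Phi>_adjoint[of "\<lambda>t. of_real (f t)" x x] f by (simp add: continuous_on_of_real)
  then have "Im (cinner (blinfun_apply ?T x) x) = 0"
    using arg_cong[OF cinner_commute[of x "blinfun_apply ?T x"], of Im] by simp
  moreover have "0 \<le> Re (cinner (blinfun_apply ?T x) x)"
    using \<Phi>_positive_family[OF assms, where I = "{()}" and n = "\<lambda>_. 0" and y = "\<lambda>_. x"] by simp
  ultimately show "Im (cinner (blinfun_apply ?T x) x) = 0 \<and> 0 \<le> Re (cinner (blinfun_apply ?T x) x)" ..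
qed

end

section \<open>Power series and the slit plane\<close>

lemma powser_summable_of_bound:
  fixes a :: "nat \<Rightarrow> complex"
  assumes "\<And>n. cmod (a n) \<le> B * 2 ^ n" "0 < x" "x < 1 / 4"
  shows "summable (\<lambda>n. a n * of_real x ^ n)"
proof (rule summable_comparison_test')
  show "summable (\<lambda>n. B * (2 * x) ^ n)" using assms by (intro summable_mult summable_geometric) auto
  show "norm (a n * of_real x ^ n) \<le> B * (2 * x) ^ n" for n
    using mult_right_mono[OF assms(1)[of n], of "x ^ n"] assms(2)
    by (simp add: norm_mult norm_power power_mult_distrib mult_ac)
qed

text \<open>All terms but the first contribute at most \<open>4 * B * x\<close>, uniformly in
  \<open>k\<close>; so \<open>x\<close> is fixed small against \<open>e\<close> first, and
  \<open>k\<close> is chosen afterwards. Below \<open>1 / 4\<close> the ratio \<open>2 * x\<close>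
  stays under \<open>1 / 2\<close>, so the geometric tail at most doubles its first term.\<close>

lemma powser_head_tendsto_zero:
  fixes d :: "nat \<Rightarrow> nat \<Rightarrow> complex"
  assumes bound: "\<And>k n. cmod (d k n) \<le> B * 2 ^ n"
    and lim: "\<And>x. 0 < x \<Longrightarrow> x < 1 / 4 \<Longrightarrow> (\<lambda>k. \<Sum>n. d k n * of_real x ^ n) \<longlonglongrightarrow> 0"
  shows "(\<lambda>k. d k 0) \<longlonglongrightarrow> 0"
proof (rule tendstoI)
  have B: "0 \<le> B" using order_trans[OF norm_ge_zero bound[of 0 0]] by simp
  fix e :: real assume e: "e > 0"
  define x where "x = min (1 / 8) (e / (8 * (B + 1)))"
  have x: "0 < x" "x < 1 / 4" "4 * B * x < e"
  proof -
    show "0 < x" using e B by (simp add: x_def)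
    show "x < 1 / 4" by (simp add: x_def)
    have "4 * B * x \<le> 4 * B * (e / (8 * (B + 1)))"
      using B by (intro mult_left_mono) (auto simp: x_def)
    also have "\<dots> = (e / 2) * (B / (B + 1))" using B by (simp add: field_simps)
    also have "\<dots> \<le> (e / 2) * 1" using e B by (intro mult_left_mono) auto
    also have "\<dots> < e" using e by simp
    finally show "4 * B * x < e" .
  qed
  have tail: "cmod (d k 0) \<le> cmod (\<Sum>n. d k n * of_real x ^ n) + 4 * B * x" for k
  proof -
    let ?f = "\<lambda>n. d k n * of_real x ^ n"
    have sf: "summable ?f" by (rule powser_summable_of_bound[OF bound x(1,2)])
    have g: "(\<lambda>n. B * 2 * x * (2 * x) ^ n) sums (B * 2 * x * (1 / (1 - 2 * x)))"
      using x by (intro sums_mult geometric_sums) auto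
    have le: "cmod (?f (Suc n)) \<le> B * 2 * x * (2 * x) ^ n" for n
      using mult_right_mono[OF bound[of k "Suc n"], of "x ^ Suc n"] x(1)
      by (simp add: norm_mult norm_power power_mult_distrib mult_ac)
    have sn: "summable (\<lambda>n. cmod (?f (Suc n)))"
      using le by (intro summable_comparison_test'[OF sums_summable[OF g]]) simp
    have "cmod (\<Sum>n. ?f (Suc n)) \<le> (\<Sum>n. cmod (?f (Suc n)))" by (rule summable_norm[OF sn])
    also have "\<dots> \<le> (\<Sum>n. B * 2 * x * (2 * x) ^ n)"
      by (intro suminf_le le sn sums_summable[OF g])
    also have "\<dots> = B * 2 * x * (1 / (1 - 2 * x))" using g by (simp add: sums_iff)
    also have "\<dots> \<le> B * 2 * x * 2" using x B by (intro mult_left_mono) (auto simp: field_simps)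
    finally have *: "cmod (\<Sum>n. ?f (Suc n)) \<le> 4 * B * x" by simp
    have "cmod (d k 0) = cmod ((\<Sum>n. ?f n) - (\<Sum>n. ?f (Suc n)))"
      using suminf_split_head[OF sf] by simp
    also have "\<dots> \<le> cmod (\<Sum>n. ?f n) + cmod (\<Sum>n. ?f (Suc n))" by (rule norm_triangle_ineq4)
    also have "\<dots> \<le> cmod (\<Sum>n. ?f n) + 4 * B * x" using * by (rule add_left_mono)
    finally show ?thesis .
  qed
  have "\<forall>\<^sub>F k in sequentially. dist (\<Sum>n. d k n * of_real x ^ n) 0 < e - 4 * B * x"
    using lim[OF x(1,2)] x(3) by (intro tendstoD) auto
  then show "\<forall>\<^sub>F k in sequentially. dist (d k 0) 0 < e"
  proof eventually_elim
    case (elim k)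
    then show ?case using tail[of k] by (simp add: dist_norm)
  qed
qed

text \<open>Removing the head, which is already known to tend to \<open>0\<close>, and dividing by
  \<open>x\<close> shifts the coefficients by one; the shift costs a factor \<open>2\<close> in
  \<open>B\<close>. Pointwise convergence for small real arguments thus reaches every
  coefficient.\<close>

lemma powser_coeff_tendsto_zero:
  fixes d :: "nat \<Rightarrow> nat \<Rightarrow> complex"
  assumes "\<And>k n. cmod (d k n) \<le> B * 2 ^ n"
    and "\<And>x. 0 < x \<Longrightarrow> x < 1 / 4 \<Longrightarrow> (\<lambda>k. \<Sum>n. d k n * of_real x ^ n) \<longlonglongrightarrow> 0"
  shows "(\<lambda>k. d k n) \<longlonglongrightarrow> 0"
  using assms
proof (induction n arbitrary: d B)
  case 0
  then show ?case by (rule powser_head_tendsto_zero)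
next
  case (Suc n)
  show ?case
  proof (rule Suc.IH)
    show "cmod (d k (Suc n)) \<le> (2 * B) * 2 ^ n" for k n
      using Suc.prems(1)[of k "Suc n"] by (simp add: mult_ac)
    fix x :: real assume x: "0 < x" "x < 1 / 4"
    have "(\<Sum>n. d k (Suc n) * of_real x ^ n) = ((\<Sum>n. d k n * of_real x ^ n) - d k 0) / of_real x" for k
    proof -
      have "summable (\<lambda>n. d k (Suc n) * of_real x ^ n)"
        using Suc.prems(1)[of k "Suc _"]
        by (intro powser_summable_of_bound[where B = "2 * B"] x) (simp add: mult_ac)
      from suminf_mult[OF this, of "of_real x"]
      have "(\<Sum>n. d k (Suc n) * of_real x ^ Suc n) = of_real x * (\<Sum>n. d k (Suc n) * of_real x ^ n)"
        by (simp add: mult_ac)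
      then show ?thesis
        using suminf_split_head[OF powser_summable_of_bound[OF Suc.prems(1)[of k] x]] x
        by (simp add: field_simps)
    qed
    moreover have "(\<lambda>k. ((\<Sum>n. d k n * of_real x ^ n) - d k 0) / of_real x) \<longlonglongrightarrow> (0 - 0) / of_real x"
      using x by (intro tendsto_intros Suc.prems(2) powser_head_tendsto_zero[OF Suc.prems]) auto
    ultimately show "(\<lambda>k. \<Sum>n. d k (Suc n) * of_real x ^ n) \<longlonglongrightarrow> 0" by simp
  qed
qed

text \<open>The convergence statement for a sequence that is constant in \<open>k\<close>.\<close>

lemma powser_coeff_unique:
  fixes a b :: "nat \<Rightarrow> complex"
  assumes a: "\<And>n. cmod (a n) \<le> A" and b: "\<And>n. cmod (b n) \<le> A"
    and eq: "\<And>x. 0 < x \<Longrightarrow> x < 1 / 4 \<Longrightarrow> (\<Sum>n. a n * of_real x ^ n) = (\<Sum>n. b n * of_real x ^ n)"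
  shows "a n = b n"
proof -
  have A: "A \<ge> 0" using order_trans[OF norm_ge_zero a] .
  have A2: "A \<le> A * 2 ^ n" for n using mult_left_mono[OF one_le_power[of 2 n] A] by simp
  have "(\<lambda>k::nat. a n - b n) \<longlonglongrightarrow> 0"
  proof (rule powser_coeff_tendsto_zero)
    show "cmod (a n - b n) \<le> (2 * A) * 2 ^ n" for n
      using norm_triangle_ineq4[of "a n" "b n"] a[of n] b[of n] A2[of n] by linarith
    fix x :: real assume x: "0 < x" "x < 1 / 4"
    have "(\<Sum>n. (a n - b n) * of_real x ^ n) = (\<Sum>n. a n * of_real x ^ n) - (\<Sum>n. b n * of_real x ^ n)"
      unfolding left_diff_distrib
      by (intro suminf_diff[symmetric] powser_summable_of_bound[OF _ x, of _ A])
        (use a b A2 order_trans in blast)+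
    then show "(\<lambda>k::nat. \<Sum>n. (a n - b n) * of_real x ^ n) \<longlonglongrightarrow> 0" using eq[OF x] by simp
  qed
  then show ?thesis by (simp add: LIMSEQ_const_iff)
qed

section \<open>Geometry of the slit plane\<close>

lemma slit_plane_iff: "z \<in> slit_plane \<longleftrightarrow> Im z \<noteq> 0 \<or> \<bar>Re z\<bar> < 1"
proof
  assume "z \<in> slit_plane"
  then have "z \<noteq> of_real (Re z) \<or> \<not> (Re z \<le> -1 \<or> 1 \<le> Re z)" unfolding slit_plane_def by auto
  then show "Im z \<noteq> 0 \<or> \<bar>Re z\<bar> < 1" by (auto simp: complex_eq_iff)
qed (auto simp: slit_plane_def)

lemma slit_planeI: "cmod z < 1 \<Longrightarrow> z \<in> slit_plane"
  using abs_Re_le_cmod[of z] by (auto simp: slit_plane_iff)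

lemma zero_in_slit_plane [simp]: "0 \<in> slit_plane" by (rule slit_planeI) simp

lemma cnj_slit_plane [simp]: "cnj z \<in> slit_plane \<longleftrightarrow> z \<in> slit_plane"
  by (simp add: slit_plane_iff)

lemma not_real_slit_plane: "z \<in> - \<real> \<Longrightarrow> z \<in> slit_plane"
  by (auto simp: slit_plane_iff complex_is_Real_iff)

lemma open_slit_plane: "open slit_plane"
proof -
  have "slit_plane = {z. Im z < 0} \<union> {z. 0 < Im z} \<union> ({z. -1 < Re z} \<inter> {z. Re z < 1})"
    by (auto simp: slit_plane_iff)
  then show ?thesis
    by (metis open_Un open_Int open_halfspace_Im_lt open_halfspace_Im_gt
        open_halfspace_Re_lt open_halfspace_Re_gt)
qed

lemma connected_slit_plane: "connected slit_plane"
proof (rule starlike_imp_connected)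
  show "starlike slit_plane"
    unfolding starlike_def
  proof (intro bexI[of _ 0] ballI subsetI)
    fix z w assume z: "z \<in> slit_plane" and "w \<in> closed_segment 0 z"
    then obtain u where u: "0 \<le> u" "u \<le> 1" "w = u *\<^sub>R z"
      by (auto simp: in_segment)
    have "u * \<bar>Re z\<bar> \<le> \<bar>Re z\<bar>" using u by (intro mult_left_le_one_le) auto
    then show "w \<in> slit_plane"
      using z u by (cases "u = 0") (auto simp: slit_plane_iff abs_mult)
  qed simp
qed

lemma slit_plane_identity:
  assumes f: "f holomorphic_on slit_plane" and g: "g holomorphic_on slit_plane"
    and eq: "\<And>z. cmod z < r \<Longrightarrow> f z = g z" and "0 < r" "r \<le> 1" and z: "z \<in> slit_plane"
  shows "f z = g z"
proof (rule analytic_continuation_open[of "ball 0 r" slit_plane f g])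
  show "ball 0 r \<subseteq> slit_plane" using slit_planeI assms(5) by auto
qed (use assms open_slit_plane connected_slit_plane in auto)

text \<open>At \<open>z0\<close> the denominator has a positive minimum over the compact interval;
  since \<open>\<bar>t\<bar> \<le> 1\<close>, moving \<open>z\<close> by less than half of it leaves
  the other half.\<close>

lemma slit_denominator_bound:
  assumes z0: "z0 \<in> slit_plane"
  obtains c where "c > 0" "\<And>z t. cmod (z - z0) < c \<Longrightarrow> t \<in> {-1..1} \<Longrightarrow> c \<le> cmod (1 + z * of_real t)"
proof -
  have nz: "1 + z0 * of_real t \<noteq> 0" if t: "t \<in> {-1..1}" for t :: real
  proof
    assume 0: "1 + z0 * of_real t = 0"
    then have "Im z0 * t = 0" "Re z0 * t = - 1" by (auto simp: complex_eq_iff)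
    then have "t \<noteq> 0" "Im z0 = 0" by auto
    then have "\<bar>Re z0\<bar> < 1" using z0 by (simp add: slit_plane_iff)
    then have "\<bar>Re z0\<bar> * \<bar>t\<bar> < 1"
      using t \<open>t \<noteq> 0\<close> mult_less_le_imp_less[of "\<bar>Re z0\<bar>" 1 "\<bar>t\<bar>" 1] by auto
    then show False using \<open>Re z0 * t = - 1\<close> by (simp flip: abs_mult)
  qed
  have "continuous_on {-1..1} (\<lambda>t. cmod (1 + z0 * of_real t))" by (intro continuous_intros)
  then have "\<exists>t0\<in>{-1..1}. \<forall>t\<in>{-1..1}. cmod (1 + z0 * of_real t0) \<le> cmod (1 + z0 * of_real t)"
    by (intro continuous_attains_inf) auto
  then obtain t0 where t0: "t0 \<in> {-1..1}" "\<And>t. t \<in> {-1..1} \<Longrightarrow> cmod (1 + z0 * of_real t0) \<le> cmod (1 + z0 * of_real t)"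
    by blast
  define c where "c = cmod (1 + z0 * of_real t0) / 2"
  have "c > 0" using nz t0(1) by (simp add: c_def)
  moreover have "c \<le> cmod (1 + z * of_real t)" if "cmod (z - z0) < c" "t \<in> {-1..1}" for z t
  proof -
    have "2 * c \<le> cmod (1 + z0 * of_real t)" using t0(2)[OF that(2)] by (simp add: c_def)
    also have "1 + z0 * of_real t = (1 + z * of_real t) - (z - z0) * of_real t" by (simp add: algebra_simps)
    also have "cmod \<dots> \<le> cmod (1 + z * of_real t) + cmod (z - z0) * \<bar>t\<bar>"
      using norm_triangle_ineq4[of "1 + z * of_real t" "(z - z0) * of_real t"] by (simp add: norm_mult)
    also have "cmod (z - z0) * \<bar>t\<bar> \<le> cmod (z - z0) * 1" using that(2) by (intro mult_left_mono) auto
    finally show ?thesis using that(1) by simp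
  qed
  ultimately show thesis using that by blast
qed

lemma slit_denominator_nz: "z \<in> slit_plane \<Longrightarrow> t \<in> {-1..1} \<Longrightarrow> 1 + z * of_real t \<noteq> 0"
  using slit_denominator_bound[of z] by (metis diff_self norm_eq_zero not_le)

lemma continuous_on_kernel [continuous_intros]:
  assumes "z \<in> slit_plane"
  shows "continuous_on {-1..1} (mobius_kernel z)"
    "continuous_on {-1..1} (\<lambda>t. 1 / (1 + z * of_real t))"
  unfolding mobius_kernel_def using slit_denominator_nz[OF assms]
  by (auto intro!: continuous_intros)

lemma op_holomorphic_imp_holomorphic:
  assumes "op_holomorphic_on F S"
  shows "(\<lambda>z. cinner (blinfun_apply (F z) x) y) holomorphic_on S"
proof (rule holomorphic_onI)
  fix z assume "z \<in> S"
  then obtain D where D: "(F has_derivative (\<lambda>h. h *\<^sub>C D)) (at z within S)"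
    using assms by (auto simp: op_holomorphic_on_def)
  have "((\<lambda>z. cinner (blinfun_apply (F z) x) y) has_derivative
      (\<lambda>h. cinner (blinfun_apply (h *\<^sub>C D) x) y)) (at z within S)"
    by (rule bounded_linear.has_derivative[OF bounded_linear_quadratic D])
  then have "((\<lambda>z. cinner (blinfun_apply (F z) x) y) has_field_derivative
      cinner (blinfun_apply D x) y) (at z within S)"
    by (simp add: has_field_derivative_def cinner_lin mult.commute[of "cinner _ _"] mult_commute_abs)
  then show "(\<lambda>z. cinner (blinfun_apply (F z) x) y) field_differentiable at z within S"
    by (auto simp: field_differentiable_def)
qed

section \<open>From distribution functions to the class RS\<close>

context distribution
begin

lemma \<Phi>_sum:
  assumes "\<And>i. i \<in> I \<Longrightarrow> continuous_on {-1..1} (f i)"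
  shows "\<Phi> (\<lambda>t. \<Sum>i\<in>I. c i * f i t) = (\<Sum>i\<in>I. c i *\<^sub>C \<Phi> (f i))"
  using assms
proof (induction I rule: infinite_finite_induct)
  case (insert i I)
  then show ?case
    by (simp add: \<Phi>_add \<Phi>_scaleC continuous_intros)
next
  case empty
  have "\<Phi> (\<lambda>_. 0 * 1) = 0 *\<^sub>C \<Phi> (\<lambda>_. 1)" by (rule \<Phi>_scaleC) (rule continuous_on_const)
  then show ?case by (simp add: blinfun_eqI)
next
  case (infinite I)
  have "\<Phi> (\<lambda>_. 0 * 1) = 0 *\<^sub>C \<Phi> (\<lambda>_. 1)" by (rule \<Phi>_scaleC) (rule continuous_on_const)
  then show ?case using infinite by (simp add: blinfun_eqI)
qed

text \<open>Differentiation under the integral: the second-order remainder of the kernel is bounded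
  by a multiple of \<open>(cmod (z - z0))^2\<close> uniformly in \<open>t\<close>, and
  \<open>\<Phi>_bound\<close> carries this to the operator norm.\<close>

lemma op_holomorphic_\<Phi>: "op_holomorphic_on (restrict (\<lambda>z. \<Phi> (mobius_kernel z)) slit_plane) slit_plane"
  unfolding op_holomorphic_on_def
proof
  fix z0 assume z0: "z0 \<in> slit_plane"
  obtain c where c: "c > 0" "\<And>z t. cmod (z - z0) < c \<Longrightarrow> t \<in> {-1..1} \<Longrightarrow> c \<le> cmod (1 + z * of_real t)"
    using slit_denominator_bound[OF z0] by blast
  \<comment> \<open>The derivative of the kernel in \<open>z\<close> at \<open>z0\<close>.\<close>
  define k where "k = (\<lambda>t::real. of_real (1 - t\<^sup>2) / (1 + z0 * of_real t)\<^sup>2)"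
  have k: "continuous_on {-1..1} k"
    unfolding k_def using slit_denominator_nz[OF z0] by (auto intro!: continuous_intros)
  have "((restrict (\<lambda>z. \<Phi> (mobius_kernel z)) slit_plane) has_derivative (\<lambda>h. h *\<^sub>C \<Phi> k)) (at z0 within slit_plane)"
  proof (rule has_derivativeI_sandwich[where e = c and H = "\<lambda>z. 2 / c ^ 3 * cmod (z - z0)"])
    show "c > 0" by fact
    show "bounded_linear (\<lambda>h. h *\<^sub>C \<Phi> k)" by (rule bounded_linear_scaleC_blinfun_left)
    show "((\<lambda>z. 2 / c ^ 3 * cmod (z - z0)) \<longlongrightarrow> 0) (at z0 within slit_plane)"
      using c(1) by (auto intro!: tendsto_eq_intros)
    fix z assume z: "z \<in> slit_plane" "z \<noteq> z0" "dist z z0 < c"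
    have z0c: "cmod (z0 - z0) < c" using c(1) by simp
    have zc: "cmod (z - z0) < c" using z(3) by (simp add: dist_norm)
    have "\<Phi> (mobius_kernel z) - \<Phi> (mobius_kernel z0) - (z - z0) *\<^sub>C \<Phi> k
        = \<Phi> (\<lambda>t. mobius_kernel z t - mobius_kernel z0 t - (z - z0) * k t)"
      using z z0 k by (simp add: \<Phi>_diff \<Phi>_scaleC continuous_intros)
    also have "norm \<dots> \<le> 2 * (cmod (z - z0) ^ 2 / c ^ 3)"
    proof (rule \<Phi>_bound)
      show "continuous_on {-1..1} (\<lambda>t. mobius_kernel z t - mobius_kernel z0 t - (z - z0) * k t)"
        using z z0 k by (intro continuous_intros)
      show "0 \<le> cmod (z - z0) ^ 2 / c ^ 3" using c(1) by simp
      fix t :: real assume t: "t \<in> {-1..1}"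
      define a where "a = 1 + z * of_real t"
      define b where "b = 1 + z0 * of_real t"
      have nz: "a \<noteq> 0" "b \<noteq> 0" using slit_denominator_nz[OF z(1) t] slit_denominator_nz[OF z0 t]
        by (auto simp: a_def b_def)
      have ab: "c \<le> cmod a" "c \<le> cmod b" using c(2)[OF zc t] c(2)[OF z0c t] by (auto simp: a_def b_def)
      have kd: "mobius_kernel z t - mobius_kernel z0 t = (z - z0) * of_real (1 - t\<^sup>2) / (a * b)"
      proof -
        have "(z + of_real t) * b - (z0 + of_real t) * a = (z - z0) * of_real (1 - t\<^sup>2)"
          by (simp add: a_def b_def algebra_simps power2_eq_square)
        then show ?thesis using nz
          by (simp add: mobius_kernel_def diff_frac_eq flip: a_def b_def)
      qed
      have "mobius_kernel z t - mobius_kernel z0 t - (z - z0) * k t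
          = (z - z0) * of_real (1 - t\<^sup>2) * (1 / (a * b) - 1 / b\<^sup>2)"
        unfolding kd k_def b_def[symmetric]
        by (simp only: right_diff_distrib times_divide_eq_right mult_1_right)
      also have "1 / (a * b) - 1 / b\<^sup>2 = (b - a) / (a * b\<^sup>2)"
        using nz by (simp add: field_simps power2_eq_square)
      also have "b - a = - ((z - z0) * of_real t)" by (simp add: a_def b_def algebra_simps)
      also have "cmod ((z - z0) * of_real (1 - t\<^sup>2) * (- ((z - z0) * of_real t) / (a * b\<^sup>2)))
        = (cmod (z - z0))\<^sup>2 * (\<bar>1 - t\<^sup>2\<bar> * \<bar>t\<bar>) / (cmod a * (cmod b)\<^sup>2)"
        by (simp add: norm_mult norm_divide norm_power power2_eq_square del: of_real_diff of_real_power)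
      also have "\<dots> \<le> (cmod (z - z0))\<^sup>2 * 1 / (c * c\<^sup>2)"
      proof (intro frac_le mult_left_mono mult_mono power_mono ab)
        have "t\<^sup>2 \<le> 1" using t by (auto simp: abs_square_le_1)
        then show "\<bar>1 - t\<^sup>2\<bar> * \<bar>t\<bar> \<le> 1" using t mult_mono[of "\<bar>1 - t\<^sup>2\<bar>" 1 "\<bar>t\<bar>" 1] by auto
      qed (use c(1) in auto)
      finally show "cmod (mobius_kernel z t - mobius_kernel z0 t - (z - z0) * k t) \<le> cmod (z - z0) ^ 2 / c ^ 3"
        by (simp add: power3_eq_cube power2_eq_square mult_ac)
    qed
    finally show "norm (restrict (\<lambda>z. \<Phi> (mobius_kernel z)) slit_plane z -
        restrict (\<lambda>z. \<Phi> (mobius_kernel z)) slit_plane z0 - (z - z0) *\<^sub>C \<Phi> k) / norm (z - z0)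
        \<le> 2 / c ^ 3 * cmod (z - z0)"
      using z z0 by (simp add: field_simps power2_eq_square)
  qed
  then show "\<exists>D. ((restrict (\<lambda>z. \<Phi> (mobius_kernel z)) slit_plane) has_derivative (\<lambda>h. h *\<^sub>C D)) (at z0 within slit_plane)"
    by blast
qed

lemma mobius_kernel_cnj: "cnj (mobius_kernel z t) = mobius_kernel (cnj z) t"
  by (simp add: mobius_kernel_def)

lemma Im_mobius_kernel: "Im (mobius_kernel z t) = Im z * ((1 - t\<^sup>2) / (cmod (1 + z * of_real t))\<^sup>2)"
proof -
  have "Im (mobius_kernel z t) = Im ((z + of_real t) * cnj (1 + z * of_real t)) / (cmod (1 + z * of_real t))\<^sup>2"
    unfolding mobius_kernel_def by (subst complex_div_cnj) (simp add: Im_divide_of_real flip: of_real_power)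
  also have "Im ((z + of_real t) * cnj (1 + z * of_real t)) = Im z * (1 - t\<^sup>2)"
    by (simp add: algebra_simps power2_eq_square)
  finally show ?thesis by simp
qed

text \<open>Each order condition of the class is the image under \<open>\<Phi>\<close> of the
  nonnegativity of a scalar function on \<open>[-1, 1]\<close>: \<open>Im z * Im\<close> of the
  kernel, and \<open>1\<close> plus or minus the kernel at real \<open>z\<close>.\<close>

lemma RS_of_distribution: "restrict (\<lambda>z. \<Phi> (mobius_kernel z)) slit_plane \<in> RS"
proof -
  let ?O = "restrict (\<lambda>z. \<Phi> (mobius_kernel z)) slit_plane"
  have adj: "cadjoint (\<Phi> (mobius_kernel z)) = \<Phi> (mobius_kernel (cnj z))" if "z \<in> slit_plane" for z
    using \<Phi>_adjoint[OF continuous_on_kernel(1)[OF that]] by (intro cadjoint_eqI) (simp add: mobius_kernel_cnj)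
  have pos: "nonneg_op (Im z *\<^sub>R Im_op (\<Phi> (mobius_kernel z)))" if z: "z \<in> slit_plane" for z
  proof -
    let ?f = "\<lambda>t. Im z * Im (mobius_kernel z t)"
    have eq: "complex_of_real (?f t) = of_real (Im z) * (1 / (2 * \<i>)) * (mobius_kernel z t - mobius_kernel (cnj z) t)" for t
      by (simp add: complex_eq_iff flip: mobius_kernel_cnj)
    have lin: "\<Phi> (\<lambda>t. c * (mobius_kernel z t - mobius_kernel (cnj z) t))
        = c *\<^sub>C (\<Phi> (mobius_kernel z) - \<Phi> (mobius_kernel (cnj z)))" for c
      using z by (simp add: \<Phi>_scaleC \<Phi>_diff continuous_intros)
    have "\<Phi> (\<lambda>t. of_real (?f t)) = (of_real (Im z) * (1 / (2 * \<i>))) *\<^sub>C (\<Phi> (mobius_kernel z) - \<Phi> (mobius_kernel (cnj z)))"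
      unfolding eq by (rule lin)
    also have "\<dots> = Im z *\<^sub>R Im_op (\<Phi> (mobius_kernel z))"
      unfolding Im_op_def adj[OF z]
      by (intro blinfun_eqI) (simp add: blinfun.scaleR_left scaleC_scaleC flip: scaleC_of_real)
    moreover have "nonneg_op (\<Phi> (\<lambda>t. of_real (?f t)))"
    proof (rule \<Phi>_nonneg)
      show "continuous_on {-1..1} ?f" using z by (intro continuous_intros)
      fix t :: real assume "t \<in> {-1..1}"
      then have "t\<^sup>2 \<le> 1" by (auto simp: abs_square_le_1)
      moreover have "?f t = (Im z)\<^sup>2 * ((1 - t\<^sup>2) / (cmod (1 + z * of_real t))\<^sup>2)"
        by (simp add: Im_mobius_kernel power2_eq_square)
      ultimately show "0 \<le> ?f t" by simp
    qed
    ultimately show ?thesis by simp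
  qed
  have real: "op_le (- id_blinfun) (\<Phi> (mobius_kernel x)) \<and> op_le (\<Phi> (mobius_kernel x)) id_blinfun"
    if x: "- 1 < x" "x < 1" for x :: real
  proof -
    have xs: "complex_of_real x \<in> slit_plane" using x by (intro slit_planeI) auto
    have nz: "1 + x * t > 0" if "t \<in> {-1..1}" for t
    proof -
      have "\<bar>x * t\<bar> \<le> \<bar>x\<bar> * 1" unfolding abs_mult using that by (intro mult_left_mono) auto
      then show ?thesis using x by linarith
    qed
    have k: "mobius_kernel x t = of_real ((x + t) / (1 + x * t))" for t
      by (simp add: mobius_kernel_def)
    have c: "continuous_on {-1..1} (\<lambda>t. (x + t) / (1 + x * t))"
      using nz by (force intro!: continuous_intros)
    have "nonneg_op (\<Phi> (\<lambda>t. of_real (1 + (x + t) / (1 + x * t))))"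
    proof (rule \<Phi>_nonneg)
      show "0 \<le> 1 + (x + t) / (1 + x * t)" if "t \<in> {-1..1}" for t
      proof -
        \<comment> \<open>The factorization shows the sign: all three factors are
          nonnegative.\<close>
        have "1 + (x + t) / (1 + x * t) = (1 + x) * (1 + t) / (1 + x * t)"
          using nz[OF that] by (simp add: field_simps)
        then show ?thesis using nz[OF that] that x by simp
      qed
    qed (intro continuous_intros c)
    moreover have "nonneg_op (\<Phi> (\<lambda>t. of_real (1 - (x + t) / (1 + x * t))))"
    proof (rule \<Phi>_nonneg)
      show "0 \<le> 1 - (x + t) / (1 + x * t)" if "t \<in> {-1..1}" for t
      proof -
        have "1 - (x + t) / (1 + x * t) = (1 - x) * (1 - t) / (1 + x * t)"
          using nz[OF that] by (simp add: field_simps)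
        then show ?thesis using nz[OF that] that x by simp
      qed
    qed (intro continuous_intros c)
    moreover have "\<Phi> (\<lambda>t. of_real (1 + (x + t) / (1 + x * t))) = \<Phi> (mobius_kernel x) + id_blinfun"
      "\<Phi> (\<lambda>t. of_real (1 - (x + t) / (1 + x * t))) = id_blinfun - \<Phi> (mobius_kernel x)"
      using \<Phi>_add[OF continuous_on_const continuous_on_kernel(1)[OF xs], of 1]
        \<Phi>_diff[OF continuous_on_const continuous_on_kernel(1)[OF xs], of 1]
      by (simp_all only: k \<Phi>_one of_real_add of_real_diff of_real_1 add.commute)
    ultimately show ?thesis by (simp only: op_le_def diff_minus_eq_add)
  qed
  show ?thesis
    unfolding RS_def nevanlinna_def
  proof (intro CollectI conjI ballI allI impI)
    show "op_holomorphic_on ?O slit_plane" by (rule op_holomorphic_\<Phi>)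
    show "op_holomorphic_on ?O (- \<real>)"
      unfolding op_holomorphic_on_def
    proof
      fix z :: complex assume "z \<in> - \<real>"
      then obtain D where "(?O has_derivative (\<lambda>h. h *\<^sub>C D)) (at z within slit_plane)"
        using op_holomorphic_\<Phi> not_real_slit_plane unfolding op_holomorphic_on_def by blast
      then have "(?O has_derivative (\<lambda>h. h *\<^sub>C D)) (at z within - \<real>)"
        by (rule has_derivative_subset) (auto intro: not_real_slit_plane)
      then show "\<exists>D. (?O has_derivative (\<lambda>h. h *\<^sub>C D)) (at z within - \<real>)" by blast
    qed
    show "op_le (- id_blinfun) (?O x)" "op_le (?O x) id_blinfun" if "- 1 < x \<and> x < 1" for x :: real
      using real[of x] that by (auto simp: slit_plane_iff)
    show "cadjoint (?O z) = ?O (cnj z)" if "z \<in> - \<real>" for z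
      using adj not_real_slit_plane[OF that] by simp
    show "nonneg_op (Im z *\<^sub>R Im_op (?O z))" if "z \<in> - \<real>" for z
      using pos not_real_slit_plane[OF that] by simp
  qed (use not_real_slit_plane continuous_on_kernel in \<open>auto intro!: \<Phi>_ops\<close>)
qed


lemma resolvent_identity_\<Phi>:
  assumes z: "z \<in> slit_plane"
  shows "(1 - z\<^sup>2) *\<^sub>C \<Phi> (\<lambda>t. 1 / (1 + z * of_real t)) = id_blinfun - z *\<^sub>C \<Phi> (mobius_kernel z)"
proof -
  have "(1 - z\<^sup>2) * (1 / (1 + z * of_real t)) = 1 - z * mobius_kernel z t" if "t \<in> {-1..1}" for t
    using slit_denominator_nz[OF z that] by (simp add: mobius_kernel_def field_simps power2_eq_square)
  then have "\<Phi> (\<lambda>t. (1 - z\<^sup>2) * (1 / (1 + z * of_real t))) = \<Phi> (\<lambda>t. 1 - z * mobius_kernel z t)"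
    by (rule \<Phi>_cong)
  moreover have "\<Phi> (\<lambda>t. (1 - z\<^sup>2) * (1 / (1 + z * of_real t))) = (1 - z\<^sup>2) *\<^sub>C \<Phi> (\<lambda>t. 1 / (1 + z * of_real t))"
    by (intro \<Phi>_scaleC continuous_intros z)
  moreover have "\<Phi> (\<lambda>t. 1 - z * mobius_kernel z t) = id_blinfun - z *\<^sub>C \<Phi> (mobius_kernel z)"
    using continuous_on_kernel(1)[OF z] by (simp add: \<Phi>_diff \<Phi>_scaleC \<Phi>_one continuous_intros)
  ultimately show ?thesis by simp
qed

section \<open>Moments and the resolvent series\<close>

abbreviation "moment n \<equiv> \<Phi> (\<lambda>t. of_real (t ^ n))"

lemma cmod_moment_le: "cmod (cinner (blinfun_apply (moment n) x) y) \<le> 2 * norm x * norm y"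
proof -
  have "cmod (complex_of_real (t ^ n)) \<le> 1" if "t \<in> {-1..1}" for t
    using that power_le_one[of "\<bar>t\<bar>" n] by (auto simp: norm_power)
  then have "norm (moment n) \<le> 2 * 1" by (intro \<Phi>_bound continuous_intros) auto
  then have "norm (blinfun_apply (moment n) x) \<le> 2 * norm x"
    using order_trans[OF norm_blinfun mult_right_mono] by fastforce
  then show ?thesis
    using order_trans[OF cinner_bound mult_right_mono] by fastforce
qed

text \<open>The remainder of the geometric series is small uniformly in \<open>t\<close>, hence
  small in operator norm after integration.\<close>

lemma resolvent_sums:
  assumes z: "cmod z < 1"
  shows "(\<lambda>n. (- z) ^ n *\<^sub>C moment n) sums \<Phi> (\<lambda>t. 1 / (1 + z * of_real t))"
  unfolding sums_def
proof (rule Lim_null[THEN iffD2], rule tendsto_norm_zero_cancel, rule tendsto_sandwich)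
  note zs = slit_planeI[OF z]
  let ?R = "\<Phi> (\<lambda>t. 1 / (1 + z * of_real t))"
  show "\<forall>\<^sub>F N in sequentially. 0 \<le> norm ((\<Sum>n<N. (- z) ^ n *\<^sub>C moment n) - ?R)" by simp
  show "(\<lambda>N. 2 * (cmod z ^ N / (1 - cmod z))) \<longlonglongrightarrow> 0"
    using z by (intro tendsto_eq_intros LIMSEQ_power_zero) auto
  have "norm ((\<Sum>n<N. (- z) ^ n *\<^sub>C moment n) - ?R) \<le> 2 * (cmod z ^ N / (1 - cmod z))" for N
  proof -
    have "(\<Sum>n<N. (- z) ^ n *\<^sub>C moment n) - ?R
        = \<Phi> (\<lambda>t. (\<Sum>n<N. (- z) ^ n * of_real (t ^ n)) - 1 / (1 + z * of_real t))"
      by (subst \<Phi>_diff) (simp_all only: \<Phi>_sum continuous_intros zs)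
    also have "norm \<dots> \<le> 2 * (cmod z ^ N / (1 - cmod z))"
    proof (rule \<Phi>_bound)
      fix t :: real assume t: "t \<in> {-1..1}"
      have w: "cmod (z * of_real t) \<le> cmod z"
        using t mult_left_mono[of "\<bar>t\<bar>" 1 "cmod z"] by (auto simp: norm_mult)
      have d: "1 - cmod z \<le> cmod (1 + z * of_real t)"
        using norm_triangle_ineq2[of 1 "- (z * of_real t)"] w by simp
      then have nz: "1 + z * of_real t \<noteq> 0" using z by auto
      have "(\<Sum>n<N. (- z) ^ n * of_real (t ^ n)) = (\<Sum>n<N. (- (z * of_real t)) ^ n)"
        by (intro sum.cong refl) (simp add: power_mult_distrib[symmetric])
      also have "\<dots> = (1 - (- (z * of_real t)) ^ N) / (1 + z * of_real t)"
        using nz by (subst sum_gp_strict) (auto simp: add_eq_0_iff2)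
      finally have "(\<Sum>n<N. (- z) ^ n * of_real (t ^ n)) - 1 / (1 + z * of_real t)
          = - ((- (z * of_real t)) ^ N / (1 + z * of_real t))"
        by (simp add: diff_divide_distrib)
      also have "cmod \<dots> = cmod (z * of_real t) ^ N / cmod (1 + z * of_real t)"
        by (simp add: norm_divide norm_power)
      also have "\<dots> \<le> cmod z ^ N / (1 - cmod z)"
        using w d z by (intro frac_le power_mono) auto
      finally show "cmod ((\<Sum>n<N. (- z) ^ n * of_real (t ^ n)) - 1 / (1 + z * of_real t)) \<le> cmod z ^ N / (1 - cmod z)" .
    qed (use z zs in \<open>auto intro!: continuous_intros\<close>)
    finally show ?thesis .
  qed
  then show "\<forall>\<^sub>F N in sequentially. norm ((\<Sum>n<N. (- z) ^ n *\<^sub>C moment n) - ?R) \<le> 2 * (cmod z ^ N / (1 - cmod z))"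
    by simp
qed simp

text \<open>Once the mesh is below \<open>a' - a\<close>, each cell starting to the left of
  \<open>a\<close> has its tag in the region where \<open>g = 1\<close>, so no part of the increment
  up to \<open>a\<close> is lost. Together with the mirrored upper estimate this locates
  \<open>\<sigma>\<close> between integrals of continuous functions.\<close>

lemma q_le_\<Phi>:
  assumes g: "continuous_on {-1..1} g" "\<And>t. t \<in> {-1..1} \<Longrightarrow> 0 \<le> g t" "\<And>t. t \<in> {-1..a'} \<Longrightarrow> g t = 1"
    and a: "- 1 \<le> a" "a < a'" "a \<le> 1"
  shows "q a x \<le> Re (cinner (blinfun_apply (\<Phi> (\<lambda>t. of_real (g t))) x) x)"
proof (rule LIMSEQ_le_const)
  let ?X = "\<lambda>k. Re (cinner (blinfun_apply (stieltjes_sum \<sigma> (fine_division k) (\<lambda>t. of_real (g t))) x) x)"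
  show "?X \<longlonglongrightarrow> Re (cinner (blinfun_apply (\<Phi> (\<lambda>t. of_real (g t))) x) x)"
    by (intro tendsto_intros \<Phi>_lim continuous_intros g)
  obtain N where N: "\<And>n. n \<ge> N \<Longrightarrow> (\<lambda>t. ball t (a' - a)) fine fine_division n"
    using fine_division_finer[of "a' - a"] a by auto
  have "q a x \<le> ?X n" if n: "n \<ge> N" for n
  proof -
    note p = fine_division(1)[of n]
    let ?h = "\<lambda>u. q (min a u) x"
    have "q a x = (\<Sum>c\<in>fine_division n. ?h (Sup (snd c)) - ?h (Inf (snd c)))"
      by (subst tagged_division_telescope[OF p, of ?h]) (use a in \<open>simp add: min_absorb1 min_absorb2 ends\<close>)
    also have "\<dots> \<le> (\<Sum>c\<in>fine_division n. g (fst c) * (q (Sup (snd c)) x - q (Inf (snd c)) x))"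
    proof (rule sum_mono)
      fix c assume c: "c \<in> fine_division n"
      note cell = tagged_division_cell[OF p c]
      have inc: "q (Inf (snd c)) x \<le> q (Sup (snd c)) x" using cell by (intro q_mono) auto
      show "?h (Sup (snd c)) - ?h (Inf (snd c)) \<le> g (fst c) * (q (Sup (snd c)) x - q (Inf (snd c)) x)"
      proof (cases "Inf (snd c) < a")
        case True
        have "\<bar>fst c - Inf (snd c)\<bar> < a' - a"
          using cell by (intro fine_cell[OF p N[OF n] c]) (metis atLeastAtMost_iff order.refl order.trans)
        then have "g (fst c) = 1" using True cell by (intro g) auto
        moreover have "q (min a (Sup (snd c))) x \<le> q (Sup (snd c)) x"
          using cell a by (intro q_mono) auto
        ultimately show ?thesis using True by (simp add: min_absorb2)
      next
        case False
        then have "min a (Sup (snd c)) = a" "min a (Inf (snd c)) = a" using cell by auto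
        then show ?thesis using inc g(2)[of "fst c"] cell by simp
      qed
    qed
    also have "\<dots> = ?X n"
      by (simp add: stieltjes_sum_def blinfun.sum_left blinfun.diff_left cinner_lin)
    finally show ?thesis .
  qed
  then show "\<exists>N. \<forall>n\<ge>N. q a x \<le> ?X n" by blast
qed

text \<open>Here a cell reaching beyond \<open>b\<close> has its tag where \<open>g = 0\<close>, so
  no increment past \<open>b\<close> is counted.\<close>

lemma \<Phi>_le_q:
  assumes g: "continuous_on {-1..1} g" "\<And>t. t \<in> {-1..1} \<Longrightarrow> g t \<le> 1" "\<And>t. t \<in> {b'..1} \<Longrightarrow> g t = 0"
    and b: "- 1 \<le> b" "b' < b" "b \<le> 1"
  shows "Re (cinner (blinfun_apply (\<Phi> (\<lambda>t. of_real (g t))) x) x) \<le> q b x"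
proof (rule LIMSEQ_le_const2)
  let ?X = "\<lambda>k. Re (cinner (blinfun_apply (stieltjes_sum \<sigma> (fine_division k) (\<lambda>t. of_real (g t))) x) x)"
  show "?X \<longlonglongrightarrow> Re (cinner (blinfun_apply (\<Phi> (\<lambda>t. of_real (g t))) x) x)"
    by (intro tendsto_intros \<Phi>_lim continuous_intros g)
  obtain N where N: "\<And>n. n \<ge> N \<Longrightarrow> (\<lambda>t. ball t (b - b')) fine fine_division n"
    using fine_division_finer[of "b - b'"] b by auto
  have "?X n \<le> q b x" if n: "n \<ge> N" for n
  proof -
    note p = fine_division(1)[of n]
    let ?h = "\<lambda>u. q (min b u) x"
    have "?X n = (\<Sum>c\<in>fine_division n. g (fst c) * (q (Sup (snd c)) x - q (Inf (snd c)) x))"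
      by (simp add: stieltjes_sum_def blinfun.sum_left blinfun.diff_left cinner_lin)
    also have "\<dots> \<le> (\<Sum>c\<in>fine_division n. ?h (Sup (snd c)) - ?h (Inf (snd c)))"
    proof (rule sum_mono)
      fix c assume c: "c \<in> fine_division n"
      note cell = tagged_division_cell[OF p c]
      have inc: "q (Inf (snd c)) x \<le> q (Sup (snd c)) x" using cell by (intro q_mono) auto
      show "g (fst c) * (q (Sup (snd c)) x - q (Inf (snd c)) x) \<le> ?h (Sup (snd c)) - ?h (Inf (snd c))"
      proof (cases "b < Sup (snd c)")
        case True
        have "\<bar>fst c - Sup (snd c)\<bar> < b - b'"
          using cell by (intro fine_cell[OF p N[OF n] c]) (metis atLeastAtMost_iff order.refl order.trans)
        then have "g (fst c) = 0" using True cell by (intro g) auto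
        moreover have "q (min b (Inf (snd c))) x \<le> q (min b (Sup (snd c))) x"
          using cell b by (intro q_mono) auto
        ultimately show ?thesis by simp
      next
        case False
        then have "min b (Sup (snd c)) = Sup (snd c)" "min b (Inf (snd c)) = Inf (snd c)"
          using cell by auto
        then show ?thesis
          using mult_right_mono[OF g(2)[of "fst c"], of "q (Sup (snd c)) x - q (Inf (snd c)) x"] inc cell
          by simp
      qed
    qed
    also have "\<dots> = q b x"
      by (subst tagged_division_telescope[OF p, of ?h]) (use b in \<open>simp add: min_absorb1 min_absorb2 ends\<close>)
    finally show ?thesis .
  qed
  then show "\<exists>N. \<forall>n\<ge>N. ?X n \<le> q b x" by blast
qed

end

section \<open>A distribution function is determined by its moments\<close>

lemma stieltjes_integral_eq_of_moments:
  assumes \<sigma>: "distribution \<sigma>" and \<tau>: "distribution \<tau>"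
    and moments: "\<And>n. stieltjes_integral (\<lambda>t. of_real (t ^ n)) \<sigma> = stieltjes_integral (\<lambda>t. of_real (t ^ n)) \<tau>"
    and g: "continuous_on {-1..1} g"
  shows "stieltjes_integral (\<lambda>t. of_real (g t)) \<sigma> = stieltjes_integral (\<lambda>t. of_real (g t)) \<tau>"
proof -
  interpret S: distribution \<sigma> by fact
  interpret T: distribution \<tau> by fact
  let ?s = "stieltjes_integral (\<lambda>t. of_real (g t)) \<sigma>" and ?t = "stieltjes_integral (\<lambda>t. of_real (g t)) \<tau>"
  have "norm (?s - ?t) \<le> e" if "e > 0" for e
  proof -
    have e4: "0 < e / 4" using that by simp
    obtain h where h: "real_polynomial_function h" "\<And>x. x \<in> {-1..1} \<Longrightarrow> \<bar>g x - h x\<bar> < e / 4"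
      by (rule Stone_Weierstrass_real_polynomial_function[OF compact_Icc g e4]) blast
    obtain a n where hp: "h = (\<lambda>x. \<Sum>i\<le>n. a i * x ^ i)"
      using h(1) real_polynomial_function_iff_sum by blast
    have hc: "complex_of_real (h t) = (\<Sum>i\<le>n. of_real (a i) * of_real (t ^ i))" for t by (simp add: hp)
    have heq: "stieltjes_integral (\<lambda>t. of_real (h t)) \<sigma> = stieltjes_integral (\<lambda>t. of_real (h t)) \<tau>"
      unfolding hc by (subst S.\<Phi>_sum T.\<Phi>_sum; (intro continuous_intros)?)+ (simp only: moments)
    have cont: "continuous_on {-1..1} (\<lambda>t. complex_of_real (g t))" "continuous_on {-1..1} (\<lambda>t. complex_of_real (h t))"
      unfolding hc by (intro continuous_intros g)+
    have close: "cmod (of_real (g t) - of_real (h t)) \<le> e / 4" if "t \<in> {-1..1}" for t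
      using h(2)[OF that] by (metis less_imp_le norm_of_real of_real_diff)
    have "norm (?s - stieltjes_integral (\<lambda>t. of_real (h t)) \<sigma>) \<le> 2 * (e / 4)"
      using that by (subst S.\<Phi>_diff[OF cont, symmetric]) (intro S.\<Phi>_bound close continuous_on_diff cont; simp)
    moreover have "norm (?t - stieltjes_integral (\<lambda>t. of_real (h t)) \<tau>) \<le> 2 * (e / 4)"
      using that by (subst T.\<Phi>_diff[OF cont, symmetric]) (intro T.\<Phi>_bound close continuous_on_diff cont; simp)
    ultimately show ?thesis
      using norm_triangle_ineq4[of "?s - stieltjes_integral (\<lambda>t. of_real (h t)) \<sigma>" "?t - stieltjes_integral (\<lambda>t. of_real (h t)) \<tau>"]
      by (simp add: heq)
  qed
  then have "norm (?s - ?t) \<le> 0" using field_le_epsilon[of "norm (?s - ?t)" 0] by simp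
  then show ?thesis by simp
qed

text \<open>For \<open>s < t\<close> a continuous function falling from \<open>1\<close> to
  \<open>0\<close> between them separates \<open>\<sigma> s\<close> from \<open>\<tau> t\<close>,
  and its two integrals agree. Left continuity then lets \<open>s\<close> tend to
  \<open>t\<close>.\<close>

lemma distribution_le_of_moments:
  assumes \<sigma>: "distribution \<sigma>" and \<tau>: "distribution \<tau>"
    and moments: "\<And>n. stieltjes_integral (\<lambda>t. of_real (t ^ n)) \<sigma> = stieltjes_integral (\<lambda>t. of_real (t ^ n)) \<tau>"
    and t: "- 1 < t" "t < 1"
  shows "Re (cinner (blinfun_apply (\<sigma> t) x) x) \<le> Re (cinner (blinfun_apply (\<tau> t) x) x)"
proof (rule tendsto_upperbound)
  interpret S: distribution \<sigma> by fact
  interpret T: distribution \<tau> by fact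
  have "((\<lambda>s. blinfun_apply (\<sigma> s) x) \<longlongrightarrow> blinfun_apply (\<sigma> t) x) (at_left t)"
    using S.\<sigma> t by (simp add: distribution_functions_def)
  then show "((\<lambda>s. S.q s x) \<longlongrightarrow> S.q t x) (at_left t)"
    by (intro tendsto_Re tendsto_cinner tendsto_const)
  have "S.q s x \<le> T.q t x" if s: "- 1 < s" "s < t" for s
  proof -
    \<comment> \<open>Thirds of \<open>[s, t]\<close>: the descent takes place in the middle,
      leaving on each side the margin that the comparison with an integral requires.\<close>
    define a' b' where "a' = (2 * s + t) / 3" and "b' = (s + 2 * t) / 3"
    have ab: "s < a'" "a' < b'" "b' < t" using s by (auto simp: a'_def b'_def)
    define g where "g u = max 0 (min 1 ((b' - u) / (b' - a')))" for u
    have g: "continuous_on {-1..1} g" unfolding g_def using ab by (intro continuous_intros) auto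
    have "S.q s x \<le> Re (cinner (blinfun_apply (stieltjes_integral (\<lambda>t. of_real (g t)) \<sigma>) x) x)"
      using ab s t by (intro S.q_le_\<Phi>[of g a'] g) (auto simp: g_def field_simps)
    also have "\<dots> = Re (cinner (blinfun_apply (stieltjes_integral (\<lambda>t. of_real (g t)) \<tau>) x) x)"
      using stieltjes_integral_eq_of_moments[OF \<sigma> \<tau> moments g] by simp
    also have "\<dots> \<le> T.q t x"
      using ab s t by (intro T.\<Phi>_le_q[of g b'] g) (auto simp: g_def field_simps)
    finally show ?thesis .
  qed
  then show "\<forall>\<^sub>F s in at_left t. S.q s x \<le> T.q t x"
    unfolding eventually_at_left_field using t by blast
qed simp

text \<open>The comparison is symmetric in the two functions, so it holds in both directions at
  interior points; at \<open>\<plusminus>1\<close> the values are prescribed.\<close>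

lemma distribution_eq_of_moments:
  assumes \<sigma>: "distribution \<sigma>" and \<tau>: "distribution \<tau>"
    and moments: "\<And>n. stieltjes_integral (\<lambda>t. of_real (t ^ n)) \<sigma> = stieltjes_integral (\<lambda>t. of_real (t ^ n)) \<tau>"
  shows "\<sigma> = \<tau>"
proof (rule extensionalityI)
  interpret S: distribution \<sigma> by fact
  interpret T: distribution \<tau> by fact
  show "\<sigma> \<in> extensional {-1..1}" "\<tau> \<in> extensional {-1..1}"
    using S.\<sigma> T.\<sigma> by (auto simp: distribution_functions_def)
  fix t :: real assume t: "t \<in> {-1..1}"
  show "\<sigma> t = \<tau> t"
  proof (cases "t = -1 \<or> t = 1")
    case True
    then show ?thesis using S.ends T.ends by auto
  next
    case False
    show ?thesis
    proof (rule quadratic_form_eq_imp)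
      show "cinner (blinfun_apply (\<sigma> t) x) x = cinner (blinfun_apply (\<tau> t) x) x" for x
        using distribution_le_of_moments[OF \<sigma> \<tau> moments, of t x] t False
          distribution_le_of_moments[OF \<tau> \<sigma> moments[symmetric], of t x] S.q_real[of t x] T.q_real[of t x]
        by (auto simp: complex_eq_iff)
    qed (use t S.ops T.ops in auto)
  qed
qed

text \<open>After division by \<open>1 - z^2\<close> the kernel integrals become resolvent
  integrals, whose expansions at \<open>0\<close> have the signed moments as coefficients.\<close>

lemma distribution_eq_of_kernel_integrals:
  assumes \<sigma>: "distribution \<sigma>" and \<tau>: "distribution \<tau>"
    and eq: "\<And>z. z \<in> slit_plane \<Longrightarrow> stieltjes_integral (mobius_kernel z) \<sigma> = stieltjes_integral (mobius_kernel z) \<tau>"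
  shows "\<sigma> = \<tau>"
proof (rule distribution_eq_of_moments[OF \<sigma> \<tau>])
  interpret S: distribution \<sigma> by fact
  interpret T: distribution \<tau> by fact
  fix n
  have "cinner (blinfun_apply (S.moment n) x) x = cinner (blinfun_apply (T.moment n) x) x" for x
  proof -
    let ?a = "\<lambda>n. (- 1) ^ n * cinner (blinfun_apply (S.moment n) x) x"
    let ?b = "\<lambda>n. (- 1) ^ n * cinner (blinfun_apply (T.moment n) x) x"
    have "?a n = ?b n"
    proof (rule powser_coeff_unique)
      show "cmod (?a n) \<le> 2 * norm x * norm x" "cmod (?b n) \<le> 2 * norm x * norm x" for n
        using S.cmod_moment_le T.cmod_moment_le by (simp_all add: norm_mult norm_power)
      fix r :: real assume r: "0 < r" "r < 1 / 4"
      let ?z = "complex_of_real r"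
      have z: "cmod ?z < 1" using r by simp
      note zs = slit_planeI[OF z]
      have nz: "1 - ?z\<^sup>2 \<noteq> 0"
      proof
        assume "1 - ?z\<^sup>2 = 0"
        then have "r\<^sup>2 = 1" by (metis eq_iff_diff_eq_0 of_real_1 of_real_eq_iff of_real_power)
        then show False using r by (simp add: power2_eq_1_iff)
      qed
      let ?f = "\<lambda>t. 1 / (1 + ?z * complex_of_real t)"
      have "(1 - ?z\<^sup>2) *\<^sub>C stieltjes_integral ?f \<sigma> = (1 - ?z\<^sup>2) *\<^sub>C stieltjes_integral ?f \<tau>"
        using S.resolvent_identity_\<Phi>[OF zs] T.resolvent_identity_\<Phi>[OF zs] eq[OF zs] by simp
      then have "(1 - ?z\<^sup>2) *\<^sub>C blinfun_apply (stieltjes_integral ?f \<sigma>) v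
          = (1 - ?z\<^sup>2) *\<^sub>C blinfun_apply (stieltjes_integral ?f \<tau>) v" for v
        by (simp only: blinfun_apply_scaleC[symmetric])
      then have f: "stieltjes_integral ?f \<sigma> = stieltjes_integral ?f \<tau>"
        by (rule blinfun_eqI[OF complex_vector.scale_left_imp_eq[OF nz]])
      have s: "(\<lambda>n. (-1) ^ n * cinner (blinfun_apply (M n) x) x * ?z ^ n) sums cinner (blinfun_apply F x) x"
        if "(\<lambda>n. (- ?z) ^ n *\<^sub>C M n) sums F" for M F
        using bounded_linear.sums[OF bounded_linear_quadratic that, of x x]
        by (simp add: cinner_lin power_minus[of ?z] mult_ac)
      show "(\<Sum>n. ?a n * ?z ^ n) = (\<Sum>n. ?b n * ?z ^ n)"
        using s[OF S.resolvent_sums[OF z]] s[OF T.resolvent_sums[OF z]]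
        unfolding f by (simp only: sums_iff)
    qed
    then show ?thesis by simp
  qed
  then show "S.moment n = T.moment n"
    by (intro quadratic_form_eq_imp S.\<Phi>_ops T.\<Phi>_ops continuous_intros)
qed

section \<open>Scalar functions of the class RS\<close>

text \<open>The Cauchy kernel at \<open>\<zeta>\<close> minus its reflection in the circle is twice
  the conjugate Poisson kernel up to a factor \<open>- \<i>\<close>. Being purely imaginary, it
  makes the real part of the integral depend on \<open>Im F\<close> alone.\<close>

lemma cis_kernel_identity:
  assumes \<zeta>: "\<bar>\<zeta>\<bar> < (1::real)"
  shows "cis \<theta> / (cis \<theta> - of_real \<zeta>) - 1 / (1 - of_real \<zeta> * cis \<theta>)
     = of_real (2 * \<zeta> * sin \<theta> / (1 - 2 * \<zeta> * cos \<theta> + \<zeta>\<^sup>2)) * (- \<i>)"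
proof -
  define u v where "u = cis \<theta>" and "v = cis (- \<theta>)"
  have uv: "u * v = 1" by (simp add: u_def v_def cis_mult)
  have c: "of_real (cos \<theta>) = (u + v) / 2" and s: "of_real (sin \<theta>) = (u - v) / (2 * \<i>)"
    by (auto simp: u_def v_def complex_eq_iff)
  have u1: "cmod u = 1" by (simp add: u_def)
  have nz: "u - of_real \<zeta> \<noteq> 0" "1 - of_real \<zeta> * u \<noteq> 0"
  proof -
    show "u - of_real \<zeta> \<noteq> 0" using u1 \<zeta> by auto
    have "cmod (of_real \<zeta> * u) < 1" using u1 \<zeta> by (simp add: norm_mult)
    then show "1 - of_real \<zeta> * u \<noteq> 0" by auto
  qed
  let ?D = "complex_of_real (1 - 2 * \<zeta> * cos \<theta> + \<zeta>\<^sup>2)"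
  have D: "(u - of_real \<zeta>) * (1 - of_real \<zeta> * u) = u * ?D"
  proof -
    have "u * ?D = u - of_real \<zeta> * (u * u + u * v) + (of_real \<zeta>)\<^sup>2 * u"
      by (simp add: c algebra_simps)
    then show ?thesis unfolding uv by (simp add: algebra_simps power2_eq_square)
  qed
  have nzD: "u \<noteq> 0" "?D \<noteq> 0" using D nz by auto
  have "u / (u - of_real \<zeta>) - 1 / (1 - of_real \<zeta> * u)
      = (u * (1 - of_real \<zeta> * u) - (u - of_real \<zeta>)) / (u * ?D)"
    using nz by (simp add: diff_frac_eq D)
  also have "u * (1 - of_real \<zeta> * u) - (u - of_real \<zeta>) = u * (of_real \<zeta> * (v - u))"
    using uv by (simp add: algebra_simps)
  also have "\<dots> / (u * ?D) = of_real \<zeta> * (v - u) / ?D" using nzD by simp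
  also have "of_real \<zeta> * (v - u) = of_real (2 * \<zeta> * sin \<theta>) * (- \<i>)"
    by (simp add: s field_simps)
  finally show ?thesis by (simp add: u_def)
qed

text \<open>The Cauchy kernel reproduces \<open>F \<zeta>\<close>; the reflected one has its pole
  outside the disc, so that it gives the value at the centre, \<open>F 0\<close>.\<close>

lemma has_integral_disc_kernel:
  fixes F :: "complex \<Rightarrow> complex"
  assumes F: "F holomorphic_on ball 0 R" and R: "1 < R" and \<zeta>: "\<bar>\<zeta>\<bar> < (1::real)"
  shows "((\<lambda>\<theta>. F (cis \<theta>) * (of_real (2 * \<zeta> * sin \<theta> / (1 - 2 * \<zeta> * cos \<theta> + \<zeta>\<^sup>2)) * (- \<i>)))
    has_integral 2 * pi * (F (of_real \<zeta>) - F 0)) {0..2 * pi}"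
proof -
  have sub: "cball 0 1 \<subseteq> ball 0 R" "ball 0 1 \<subseteq> ball (0::complex) R" using R by auto
  have cont: "continuous_on (cball 0 1) F"
    by (rule holomorphic_on_imp_continuous_on[OF holomorphic_on_subset[OF F sub(1)]])
  have hol: "F holomorphic_on ball 0 1" by (rule holomorphic_on_subset[OF F sub(2)])
  have nz: "1 - of_real \<zeta> * u \<noteq> 0" if "u \<in> cball 0 1" for u :: complex
  proof -
    have "cmod (of_real \<zeta> * u) \<le> \<bar>\<zeta>\<bar> * 1"
      unfolding norm_mult using that by (intro mult_mono) auto
    then show ?thesis using \<zeta> by auto
  qed
  have "((\<lambda>u. F u / (u - of_real \<zeta>)) has_contour_integral 2 * of_real pi * \<i> * F (of_real \<zeta>)) (circlepath 0 1)"
    using \<zeta> by (intro Cauchy_integral_circlepath cont hol) auto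
  \<comment> \<open>The division by \<open>u\<close> turns integration in the angle into Cauchy's
    formula at \<open>0\<close>.\<close>
  moreover have "((\<lambda>u. (F u / (1 - of_real \<zeta> * u)) / (u - 0)) has_contour_integral
      2 * of_real pi * \<i> * (F 0 / (1 - of_real \<zeta> * 0))) (circlepath 0 1)"
    using nz by (intro Cauchy_integral_circlepath[of 0 1 "\<lambda>u. F u / (1 - of_real \<zeta> * u)"]
        continuous_intros holomorphic_intros cont hol) auto
  ultimately have "((\<lambda>u. F u / (u - of_real \<zeta>) - (F u / (1 - of_real \<zeta> * u)) / (u - 0)) has_contour_integral
      2 * of_real pi * \<i> * F (of_real \<zeta>) - 2 * of_real pi * \<i> * (F 0 / (1 - of_real \<zeta> * 0))) (circlepath 0 1)"
    by (rule has_contour_integral_diff)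
  then have "((\<lambda>\<theta>. (F (cis \<theta>) / (cis \<theta> - of_real \<zeta>) - (F (cis \<theta>) / (1 - of_real \<zeta> * cis \<theta>)) / cis \<theta>) * \<i> * cis \<theta>)
     has_integral 2 * of_real pi * \<i> * (F (of_real \<zeta>) - F 0)) {0..2*pi}"
    unfolding circlepath_def by (simp add: has_contour_integral_part_circlepath_iff right_diff_distrib)
  from has_integral_mult_right[OF this, of "- \<i>"]
  have "((\<lambda>\<theta>. - \<i> * ((F (cis \<theta>) / (cis \<theta> - of_real \<zeta>) - (F (cis \<theta>) / (1 - of_real \<zeta> * cis \<theta>)) / cis \<theta>) * \<i> * cis \<theta>))
     has_integral 2 * pi * (F (of_real \<zeta>) - F 0)) {0..2*pi}"
    by (simp add: algebra_simps)
  then show ?thesis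
  proof (rule has_integral_eq[rotated])
    fix \<theta>
    have "- \<i> * ((F (cis \<theta>) / (cis \<theta> - of_real \<zeta>) - (F (cis \<theta>) / (1 - of_real \<zeta> * cis \<theta>)) / cis \<theta>) * \<i> * cis \<theta>)
      = F (cis \<theta>) * (cis \<theta> / (cis \<theta> - of_real \<zeta>) - 1 / (1 - of_real \<zeta> * cis \<theta>))"
    proof -
      have "- \<i> * ((a - b / w) * \<i> * w) = a * w - b" if "w \<noteq> 0" for a b w :: complex
        using that by (simp add: field_simps)
      from this[of "cis \<theta>" "F (cis \<theta>) / (cis \<theta> - of_real \<zeta>)" "F (cis \<theta>) / (1 - of_real \<zeta> * cis \<theta>)"]
      show ?thesis by (simp add: right_diff_distrib)
    qed
    then show "- \<i> * ((F (cis \<theta>) / (cis \<theta> - of_real \<zeta>) - (F (cis \<theta>) / (1 - of_real \<zeta> * cis \<theta>)) / cis \<theta>) * \<i> * cis \<theta>)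
      = F (cis \<theta>) * (of_real (2 * \<zeta> * sin \<theta> / (1 - 2 * \<zeta> * cos \<theta> + \<zeta>\<^sup>2)) * (- \<i>))"
      unfolding cis_kernel_identity[OF \<zeta>] .
  qed
qed

text \<open>The conformal map of the unit disc onto the slit plane; it takes \<open>cis \<theta>\<close> to \<open>1 / cos \<theta>\<close>,
  so the two boundary slits correspond to the kernel parameter \<open>t = - cos \<theta>\<close>.\<close>

definition slit_map :: "complex \<Rightarrow> complex" where
  "slit_map \<zeta> = 2 * \<zeta> / (1 + \<zeta>\<^sup>2)"

lemma slit_map_denominator: "cmod \<zeta> < 1 \<Longrightarrow> 1 + \<zeta>\<^sup>2 \<noteq> 0"
proof
  assume "cmod \<zeta> < 1" "1 + \<zeta>\<^sup>2 = 0"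
  then have "cmod (\<zeta>\<^sup>2) = 1" by (metis add_eq_0_iff norm_minus_cancel norm_one)
  moreover have "(cmod \<zeta>)\<^sup>2 < 1" using \<open>cmod \<zeta> < 1\<close> by (simp add: abs_square_less_1)
  ultimately show False by (simp add: norm_power)
qed

text \<open>In the open disc the factor in parentheses is positive, so the map preserves the upper
  and the lower half.\<close>

lemma Im_slit_map: "Im (slit_map \<zeta>) = 2 * Im \<zeta> * ((1 - (cmod \<zeta>)\<^sup>2) / (cmod (1 + \<zeta>\<^sup>2))\<^sup>2)"
proof -
  have "Im (slit_map \<zeta>) = Im (2 * \<zeta> * cnj (1 + \<zeta>\<^sup>2)) / (cmod (1 + \<zeta>\<^sup>2))\<^sup>2"
    unfolding slit_map_def by (subst complex_div_cnj) (simp add: Im_divide_of_real flip: of_real_power)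
  also have "Im (2 * \<zeta> * cnj (1 + \<zeta>\<^sup>2)) = 2 * Im \<zeta> * (1 - (cmod \<zeta>)\<^sup>2)"
    unfolding cmod_power2 by (simp add: algebra_simps power2_eq_square)
  finally show ?thesis by simp
qed

lemma slit_map_in: "cmod \<zeta> < 1 \<Longrightarrow> slit_map \<zeta> \<in> slit_plane"
proof -
  assume z: "cmod \<zeta> < 1"
  have sq: "(cmod \<zeta>)\<^sup>2 < 1" using z by (simp add: abs_square_less_1)
  show ?thesis
  proof (cases "Im \<zeta> = 0")
    case False
    then have "Im (slit_map \<zeta>) \<noteq> 0"
      unfolding Im_slit_map using sq slit_map_denominator[OF z] by simp
    then show ?thesis by (simp add: slit_plane_iff)
  next
    case True
    then obtain x where x: "\<zeta> = of_real x" by (metis complex_is_Real_iff Reals_cases)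
    have "\<bar>x\<bar> < 1" using z x by simp
    then have "0 < (1 - \<bar>x\<bar>)\<^sup>2" by simp
    then have "2 * \<bar>x\<bar> < 1 + x\<^sup>2" by (simp add: power2_diff)
    then have "\<bar>2 * x / (1 + x\<^sup>2)\<bar> < 1" by (simp add: abs_mult)
    moreover have "slit_map \<zeta> = of_real (2 * x / (1 + x\<^sup>2))" by (simp add: slit_map_def x)
    ultimately show ?thesis by (simp add: slit_plane_iff del: of_real_divide)
  qed
qed

lemma slit_map_holomorphic: "slit_map holomorphic_on ball 0 1"
  unfolding slit_map_def using slit_map_denominator by (intro holomorphic_intros) auto

lemma slit_map_surj_real:
  assumes "\<bar>x\<bar> < (1::real)"
  obtains \<zeta> where "\<bar>\<zeta>\<bar> < 1" "2 * \<zeta> / (1 + \<zeta>\<^sup>2) = x"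
proof -
  \<comment> \<open>The smaller root of \<open>x * \<zeta>^2 - 2 * \<zeta> + x = 0\<close>, written
    as \<open>x / (1 + s)\<close> so that \<open>x = 0\<close> needs no separate case.\<close>
  define s where "s = sqrt (1 - x\<^sup>2)"
  have x2: "x\<^sup>2 < 1" using assms by (simp add: abs_square_less_1)
  have s: "0 < s" "s\<^sup>2 = 1 - x\<^sup>2" using x2 by (auto simp: s_def)
  define \<zeta> where "\<zeta> = x / (1 + s)"
  have "\<bar>\<zeta>\<bar> < 1" using assms s(1) by (simp add: \<zeta>_def)
  moreover have "1 + \<zeta>\<^sup>2 = 2 / (1 + s)"
  proof -
    have "(1 + s)\<^sup>2 + x\<^sup>2 = 2 * (1 + s)" using s(2) by (simp add: power2_sum)
    then have "1 + \<zeta>\<^sup>2 = 2 * (1 + s) / (1 + s)\<^sup>2"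
      using s(1) by (simp add: \<zeta>_def power_divide add_divide_eq_iff)
    also have "2 * w / w\<^sup>2 = 2 / w" if "w \<noteq> 0" for w :: real
      using that by (simp add: power2_eq_square)
    finally show ?thesis using s(1) by simp
  qed
  then have "2 * \<zeta> / (1 + \<zeta>\<^sup>2) = x" using s(1) by (simp add: \<zeta>_def)
  ultimately show thesis using that by blast
qed

text \<open>Models the quadratic form of a function of the class RS at a vector \<open>x\<close>,
  with \<open>\<kappa> = (norm x)^2\<close>.\<close>

locale scalar_RS =
  fixes f :: "complex \<Rightarrow> complex" and \<kappa> :: real
  assumes holomorphic: "f holomorphic_on slit_plane"
    and Im_nonneg: "\<And>z. Im z \<noteq> 0 \<Longrightarrow> 0 \<le> Im z * Im (f z)"
    and real: "\<And>x. \<bar>x\<bar> < 1 \<Longrightarrow> Im (f (of_real x)) = 0"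
    and bounded: "\<And>x. \<bar>x\<bar> < 1 \<Longrightarrow> \<bar>Re (f (of_real x))\<bar> \<le> \<kappa>"
begin

text \<open>If \<open>f\<close> is the integral of \<open>(z + t) / (1 + z * t)\<close> against a
  measure of mass \<open>\<kappa>\<close>, this is the integral of \<open>1 / (1 + z * t)\<close>,
  and the signed Taylor coefficients are the moments. They are defined this way before any measure
  is known.\<close>

definition G where "G z = (of_real \<kappa> - z * f z) / (1 - z\<^sup>2)"

definition s :: "nat \<Rightarrow> complex" where "s n = (- 1) ^ n * ((deriv ^^ n) G 0 / fact n)"

definition \<nu> :: "nat \<Rightarrow> complex" where "\<nu> n = s n - s (n + 2)"

lemma one_minus_square_nz: "cmod z < 1 \<Longrightarrow> 1 - z\<^sup>2 \<noteq> 0"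
proof
  assume "cmod z < 1" "1 - z\<^sup>2 = 0"
  then have "cmod (z\<^sup>2) = 1" by simp
  moreover have "(cmod z)\<^sup>2 < 1" using \<open>cmod z < 1\<close> by (simp add: abs_square_less_1)
  ultimately show False by (simp add: norm_power)
qed

lemma G_sums: "cmod z < 1 \<Longrightarrow> (\<lambda>n. s n * (- z) ^ n) sums G z"
proof -
  assume z: "cmod z < 1"
  have "f holomorphic_on ball 0 1" using slit_planeI by (intro holomorphic_on_subset[OF holomorphic]) auto
  then have "G holomorphic_on ball 0 1"
    unfolding G_def using one_minus_square_nz by (intro holomorphic_intros) auto
  from holomorphic_power_series[OF this, of z] z
  have "(\<lambda>n. (deriv ^^ n) G 0 / fact n * z ^ n) sums G z" by simp
  moreover have "(deriv ^^ n) G 0 / fact n * z ^ n = s n * (- z) ^ n" for n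
    by (simp add: s_def power_minus[of z])
  ultimately show ?thesis by simp
qed

lemma s_0: "s 0 = of_real \<kappa>" by (simp add: s_def G_def)

lemma s_1: "s (Suc 0) = f 0"
proof -
  have "f field_differentiable at 0"
    using holomorphic open_slit_plane zero_in_slit_plane holomorphic_on_imp_differentiable_at by blast
  then obtain f' where f': "(f has_field_derivative f') (at 0)" by (auto simp: field_differentiable_def)
  have "(G has_field_derivative - f 0) (at 0)"
    unfolding G_def by (rule derivative_eq_intros f' refl | simp)+
  then show ?thesis by (simp add: s_def DERIV_imp_deriv)
qed

text \<open>For a measure this expresses
  \<open>((x + t) / (1 + x * t) - t) / x = (1 - t^2) / (1 + x * t)\<close>. Here it comes from
  subtracting the series of \<open>G\<close>, shifted by two places, from itself; \<open>s 0\<close>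
  and \<open>s 1\<close> account for the two terms lost in the shift.\<close>

lemma \<nu>_sums:
  assumes x: "\<bar>x\<bar> < 1" "x \<noteq> (0::real)"
  shows "(\<lambda>n. \<nu> n * (- of_real x) ^ n) sums ((f (of_real x) - f 0) / of_real x)"
proof -
  let ?z = "complex_of_real x"
  have z: "cmod ?z < 1" "?z \<noteq> 0" using x by auto
  note G = G_sums[OF z(1)]
  have "(\<lambda>n. s (n + 2) * (- ?z) ^ (n + 2)) sums (G ?z - (\<Sum>i<2. s i * (- ?z) ^ i))"
    using sums_split_initial_segment[OF G, of 2] by simp
  then have "(\<lambda>n. s (n + 2) * (- ?z) ^ (n + 2) / ?z\<^sup>2) sums ((G ?z - (\<Sum>i<2. s i * (- ?z) ^ i)) / ?z\<^sup>2)"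
    by (rule sums_divide)
  moreover have "s (n + 2) * (- ?z) ^ (n + 2) / ?z\<^sup>2 = s (n + 2) * (- ?z) ^ n" for n
    using z(2) by (simp add: power_add power2_eq_square)
  ultimately have "(\<lambda>n. s (n + 2) * (- ?z) ^ n) sums ((G ?z - (\<Sum>i<2. s i * (- ?z) ^ i)) / ?z\<^sup>2)"
    by simp
  from sums_diff[OF G this]
  have "(\<lambda>n. \<nu> n * (- ?z) ^ n) sums (G ?z - (G ?z - (\<Sum>i<2. s i * (- ?z) ^ i)) / ?z\<^sup>2)"
    by (simp only: \<nu>_def left_diff_distrib)
  also have "(\<Sum>i<2. s i * (- ?z) ^ i) = of_real \<kappa> - f 0 * ?z"
    by (simp add: numeral_2_eq_2 s_0 s_1)
  also have "G ?z - (G ?z - (of_real \<kappa> - f 0 * ?z)) / ?z\<^sup>2 = (f ?z - f 0) / ?z"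
  proof -
    have "G ?z * (1 - ?z\<^sup>2) = of_real \<kappa> - ?z * f ?z"
      using one_minus_square_nz[OF z(1)] by (simp add: G_def)
    then have "?z\<^sup>2 * G ?z - (G ?z - (of_real \<kappa> - f 0 * ?z)) = ?z * (f ?z - f 0)"
      by (simp add: algebra_simps)
    then show ?thesis using z(2) by (simp add: field_simps power2_eq_square)
  qed
  finally show ?thesis .
qed

section \<open>Positive functionals from circles inside the unit disc\<close>

definition radius :: "nat \<Rightarrow> real" where "radius k = 1 - 1 / (real k + 2)"

lemma radius: "0 < radius k" "radius k < 1" "radius \<longlonglongrightarrow> 1"
proof -
  show "0 < radius k" "radius k < 1" by (auto simp: radius_def)
  have "(\<lambda>k. 1 / (real k + 2)) \<longlonglongrightarrow> 0" by real_asymp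
  then have "(\<lambda>k. 1 - 1 / (real k + 2)) \<longlonglongrightarrow> 1 - 0" by (intro tendsto_diff) auto
  then show "radius \<longlonglongrightarrow> 1" by (simp add: radius_def[abs_def])
qed

definition F where "F k \<zeta> = f (slit_map (of_real (radius k) * \<zeta>))"

lemma F_holomorphic: "F k holomorphic_on ball 0 (1 / radius k)"
proof -
  have *: "cmod (of_real (radius k) * \<zeta>) < 1" if "\<zeta> \<in> ball 0 (1 / radius k)" for \<zeta>
    using that radius(1)[of k] by (simp add: norm_mult field_simps)
  have "(f \<circ> (slit_map \<circ> (\<lambda>\<zeta>. complex_of_real (radius k) * \<zeta>))) holomorphic_on ball 0 (1 / radius k)"
  proof (rule holomorphic_on_compose_gen[OF holomorphic_on_compose_gen])
    show "slit_map holomorphic_on ball 0 1" by (rule slit_map_holomorphic)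
    show "f holomorphic_on slit_plane" by (rule holomorphic)
    show "(slit_map \<circ> (\<lambda>\<zeta>. complex_of_real (radius k) * \<zeta>)) ` ball 0 (1 / radius k) \<subseteq> slit_plane"
      using * slit_map_in by auto
    show "(\<lambda>\<zeta>. complex_of_real (radius k) * \<zeta>) ` ball 0 (1 / radius k) \<subseteq> ball 0 1"
      using * by (force simp: dist_norm)
  qed (intro holomorphic_intros)
  then show ?thesis by (simp add: F_def[abs_def] o_def)
qed

text \<open>In the conjugate Poisson kernel \<open>sin \<theta>\<close> is the only factor that
  changes sign with the half plane; joined to \<open>Im (F k)\<close> it gives a nonnegative
  density, while the remaining factor is a function of \<open>cos \<theta>\<close>.\<close>

definition density :: "nat \<Rightarrow> real \<Rightarrow> real" where
  "density k \<theta> = sin \<theta> * Im (F k (cis \<theta>)) / (2 * pi)"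

lemma density_continuous: "continuous_on {0..2*pi} (density k)"
proof -
  have "continuous_on (ball 0 (1 / radius k)) (F k)"
    using F_holomorphic by (rule holomorphic_on_imp_continuous_on)
  then have "continuous_on {0..2*pi} (\<lambda>\<theta>. F k (cis \<theta>))"
    by (rule continuous_on_compose2) (use radius(1,2)[of k] in \<open>auto intro!: continuous_intros\<close>)
  then show ?thesis unfolding density_def by (intro continuous_intros) auto
qed

text \<open>On a circle inside the disc, \<open>slit_map\<close> has imaginary part a positive
  multiple of \<open>sin \<theta>\<close>, and the Nevanlinna property passes the sign on to
  \<open>f\<close>.\<close>

lemma density_nonneg: "0 \<le> density k \<theta>"
proof -
  let ?\<zeta> = "of_real (radius k) * cis \<theta>"
  have m: "cmod ?\<zeta> < 1" using radius(1,2)[of k] by (simp add: norm_mult)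
  have "0 \<le> sin \<theta> * Im (f (slit_map ?\<zeta>))"
  proof (cases "sin \<theta> = 0")
    case False
    define c where "c = 2 * radius k * ((1 - (cmod ?\<zeta>)\<^sup>2) / (cmod (1 + ?\<zeta>\<^sup>2))\<^sup>2)"
    have "(cmod ?\<zeta>)\<^sup>2 < 1" using m by (simp add: abs_square_less_1)
    then have c: "0 < c" unfolding c_def using radius(1,2)[of k] slit_map_denominator[OF m] by simp
    have Z: "Im (slit_map ?\<zeta>) = c * sin \<theta>" unfolding Im_slit_map c_def by simp
    then have "0 \<le> c * sin \<theta> * Im (f (slit_map ?\<zeta>))" using Im_nonneg[of "slit_map ?\<zeta>"] c False by simp
    then show ?thesis using c by (simp add: mult.assoc zero_le_mult_iff)
  qed simp
  then show ?thesis by (simp add: density_def F_def)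
qed

text \<open>The positive functionals which the functions \<open>F k\<close> represent; they converge on polynomials to
  the functional with moments \<open>\<nu>\<close>, which is the functional \<open>s\<close> multiplied by \<open>1 - t\<^sup>2\<close>.\<close>

definition N :: "nat \<Rightarrow> (real \<Rightarrow> real) \<Rightarrow> real" where
  "N k g = integral {0..2*pi} (\<lambda>\<theta>. g (- cos \<theta>) * density k \<theta>)"

lemma minus_cos_in: "- cos (\<theta> :: real) \<in> {-1..1}"
  using cos_le_one[of \<theta>] cos_ge_minus_one[of \<theta>] by simp

lemma N_integrable:
  assumes "continuous_on {-1..1} g"
  shows "(\<lambda>\<theta>. g (- cos \<theta>) * density k \<theta>) integrable_on {0..2*pi}"
proof (rule integrable_continuous_real)
  have "continuous_on {0..2*pi} (\<lambda>\<theta>. g (- cos \<theta>))"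
    by (rule continuous_on_compose2[OF assms]) (auto intro!: continuous_intros)
  then show "continuous_on {0..2*pi} (\<lambda>\<theta>. g (- cos \<theta>) * density k \<theta>)"
    by (intro continuous_on_mult density_continuous)
qed

lemma N_add:
  assumes "continuous_on {-1..1} g" "continuous_on {-1..1} h"
  shows "N k (\<lambda>t. g t + h t) = N k g + N k h"
  unfolding N_def distrib_right by (intro integral_add N_integrable assms)

lemma N_mult: "N k (\<lambda>t. c * g t) = c * N k g"
  unfolding N_def by (simp add: mult.assoc)

lemma N_diff:
  assumes "continuous_on {-1..1} g" "continuous_on {-1..1} h"
  shows "N k (\<lambda>t. g t - h t) = N k g - N k h"
  unfolding N_def left_diff_distrib by (intro integral_diff N_integrable assms)

lemma N_sum:
  assumes "\<And>i. i \<in> I \<Longrightarrow> continuous_on {-1..1} (g i)"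
  shows "N k (\<lambda>t. \<Sum>i\<in>I. a i * g i t) = (\<Sum>i\<in>I. a i * N k (g i))"
  using assms
proof (induction I rule: infinite_finite_induct)
  case (insert i I)
  then show ?case by (simp add: N_add N_mult continuous_intros)
qed (simp_all add: N_def)

lemma N_mono:
  assumes "continuous_on {-1..1} g" "continuous_on {-1..1} h" "\<And>t. t \<in> {-1..1} \<Longrightarrow> g t \<le> h t"
  shows "N k g \<le> N k h"
  unfolding N_def
  by (intro integral_le N_integrable assms mult_right_mono density_nonneg minus_cos_in)

lemma N_abs_le:
  assumes "continuous_on {-1..1} g" "\<And>t. t \<in> {-1..1} \<Longrightarrow> \<bar>g t\<bar> \<le> c"
  shows "\<bar>N k g\<bar> \<le> c * N k (\<lambda>_. 1)"
proof -
  have "N k g \<le> N k (\<lambda>t. c * 1)" "N k (\<lambda>t. - c * 1) \<le> N k g"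
    using assms by (intro N_mono continuous_intros; fastforce)+
  then show ?thesis unfolding N_mult by linarith
qed

text \<open>With \<open>x = 2 * \<zeta> / (1 + \<zeta>^2)\<close> and
  \<open>t = - cos \<theta>\<close> the conjugate Poisson kernel at \<open>\<zeta>\<close> becomes
  \<open>x / (1 + x * t)\<close> times \<open>sin \<theta>\<close>. The integral is therefore
  \<open>Re (F k \<zeta>) - Re (F k 0)\<close> exactly, and only the continuity of \<open>f\<close>
  is left for the limit.\<close>

lemma N_kernel_tendsto:
  assumes x: "\<bar>x\<bar> < 1"
  shows "(\<lambda>k. N k (\<lambda>t. x / (1 + x * t))) \<longlonglongrightarrow> Re (f (of_real x)) - Re (f 0)"
proof -
  obtain \<zeta> where \<zeta>: "\<bar>\<zeta>\<bar> < 1" "2 * \<zeta> / (1 + \<zeta>\<^sup>2) = x" using slit_map_surj_real[OF x] .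
  have N: "N k (\<lambda>t. x / (1 + x * t)) = Re (F k (of_real \<zeta>)) - Re (F k 0)" for k
  proof -
    have R: "1 < 1 / radius k" using radius(1,2)[of k] by simp
    let ?K = "\<lambda>\<theta>. 2 * \<zeta> * sin \<theta> / (1 - 2 * \<zeta> * cos \<theta> + \<zeta>\<^sup>2)"
    from has_integral_Re[OF has_integral_disc_kernel[OF F_holomorphic R \<zeta>(1)]]
    have "((\<lambda>\<theta>. Im (F k (cis \<theta>)) * ?K \<theta>) has_integral 2 * pi * (Re (F k (of_real \<zeta>)) - Re (F k 0))) {0..2*pi}"
      by (simp del: of_real_mult of_real_divide of_real_add of_real_diff of_real_power)
    from has_integral_mult_right[OF this, of "1 / (2 * pi)"]
    have "((\<lambda>\<theta>. 1 / (2 * pi) * (Im (F k (cis \<theta>)) * ?K \<theta>)) has_integral Re (F k (of_real \<zeta>)) - Re (F k 0)) {0..2*pi}"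
      by simp
    moreover have "1 / (2 * pi) * (Im (F k (cis \<theta>)) * ?K \<theta>) = x / (1 + x * - cos \<theta>) * density k \<theta>" for \<theta>
    proof -
      have p: "0 < 1 + \<zeta>\<^sup>2" by (simp add: add_pos_nonneg)
      have "1 + x * - cos \<theta> = (1 - 2 * \<zeta> * cos \<theta> + \<zeta>\<^sup>2) / (1 + \<zeta>\<^sup>2)"
        using p by (simp add: \<zeta>(2)[symmetric] field_simps)
      then have "x / (1 + x * - cos \<theta>) = 2 * \<zeta> / (1 - 2 * \<zeta> * cos \<theta> + \<zeta>\<^sup>2)"
        using p by (simp add: \<zeta>(2)[symmetric])
      then show ?thesis by (simp add: density_def mult_ac)
    qed
    ultimately show ?thesis unfolding N_def by (simp add: integral_unique)
  qed
  have lim: "(\<lambda>k. F k (of_real y)) \<longlonglongrightarrow> f (slit_map (of_real y))" if y: "\<bar>y\<bar> < 1" for y :: real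
  proof -
    have 1: "isCont slit_map (of_real y)"
      using slit_map_holomorphic y holomorphic_on_imp_continuous_on continuous_on_eq_continuous_at[of "ball 0 1"] by force
    have "slit_map (of_real y) \<in> slit_plane" using slit_map_in y by simp
    then have 2: "isCont f (slit_map (of_real y))"
      using holomorphic_on_imp_continuous_on[OF holomorphic] continuous_on_eq_continuous_at[OF open_slit_plane] by blast
    have "(\<lambda>k. of_real (radius k) * complex_of_real y) \<longlonglongrightarrow> of_real 1 * of_real y"
      by (intro tendsto_intros radius)
    then have "(\<lambda>k. of_real (radius k) * complex_of_real y) \<longlonglongrightarrow> of_real y" by simp
    then show ?thesis unfolding F_def by (intro isCont_tendsto_compose[OF 2] isCont_tendsto_compose[OF 1])
  qed
  have "slit_map (of_real \<zeta>) = of_real x" by (simp add: slit_map_def \<zeta>(2)[symmetric])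
  then show ?thesis unfolding N
    using lim[OF \<zeta>(1)] lim[of 0] by (auto intro!: tendsto_intros simp: slit_map_def)
qed

lemma kernel_continuous: "\<bar>x\<bar> < 1 \<Longrightarrow> continuous_on {-1..1} (\<lambda>t::real. c / (1 + x * t))"
  and kernel_pos: "\<bar>x\<bar> < 1 \<Longrightarrow> t \<in> {-1..1} \<Longrightarrow> 1 - \<bar>x\<bar> \<le> 1 + x * (t::real)"
proof -
  show *: "1 - \<bar>x\<bar> \<le> 1 + x * t" if "\<bar>x\<bar> < 1" "t \<in> {-1..1}" for x t :: real
  proof -
    have "\<bar>x * t\<bar> \<le> \<bar>x\<bar> * 1" unfolding abs_mult using that by (intro mult_left_mono) auto
    then show ?thesis by linarith
  qed
  show "continuous_on {-1..1} (\<lambda>t. c / (1 + x * t))" if "\<bar>x\<bar> < 1"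
    using *[OF that] that by (intro continuous_intros) force
qed

text \<open>The constant function is dominated by three times the kernel at \<open>x = 1/2\<close>,
  whose least value on \<open>[-1, 1]\<close> is \<open>1/3\<close>, and integrals of that kernel
  converge.\<close>

lemma N_one_bounded: "\<exists>B. \<forall>k. N k (\<lambda>_. 1) \<le> B"
proof -
  have "Bseq (\<lambda>k. N k (\<lambda>t. (1/2) / (1 + (1/2) * t)))"
    by (rule convergent_imp_Bseq) (use N_kernel_tendsto[of "1/2"] in \<open>auto simp: convergent_def\<close>)
  then obtain B where B: "\<And>k. \<bar>N k (\<lambda>t. (1/2) / (1 + (1/2) * t))\<bar> \<le> B"
    unfolding Bseq_def by auto
  have "(1/3) * N k (\<lambda>_. 1) \<le> N k (\<lambda>t. (1/2) / (1 + (1/2) * t))" for k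
    unfolding N_mult[symmetric]
    by (intro N_mono kernel_continuous) (auto simp: field_simps)
  then have "N k (\<lambda>_. 1) \<le> 3 * B" for k
    using order_trans[OF _ order_trans[OF abs_ge_self B[of k]]] by fastforce
  then show ?thesis by blast
qed

lemma N_kernel_sums:
  assumes x: "0 < x" "x < 1"
  shows "(\<lambda>n. (- x) ^ n * N k (\<lambda>t. t ^ n)) sums N k (\<lambda>t. 1 / (1 + x * t))"
  unfolding sums_def
proof (rule Lim_null[THEN iffD2], rule tendsto_rabs_zero_cancel, rule tendsto_sandwich)
  have ax: "\<bar>x\<bar> < 1" using x by simp
  show "\<forall>\<^sub>F m in sequentially. 0 \<le> \<bar>(\<Sum>n<m. (- x) ^ n * N k (\<lambda>t. t ^ n)) - N k (\<lambda>t. 1 / (1 + x * t))\<bar>"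
    by simp
  show "(\<lambda>m. x ^ m / (1 - x) * N k (\<lambda>_. 1)) \<longlonglongrightarrow> 0"
    using x by (auto intro!: tendsto_eq_intros LIMSEQ_power_zero)
  have "\<bar>(\<Sum>n<m. (- x) ^ n * N k (\<lambda>t. t ^ n)) - N k (\<lambda>t. 1 / (1 + x * t))\<bar> \<le> x ^ m / (1 - x) * N k (\<lambda>_. 1)" for m
  proof -
    have "(\<Sum>n<m. (- x) ^ n * N k (\<lambda>t. t ^ n)) - N k (\<lambda>t. 1 / (1 + x * t))
        = N k (\<lambda>t. (\<Sum>n<m. (- x) ^ n * t ^ n) - 1 / (1 + x * t))"
    proof -
      have "N k (\<lambda>t. \<Sum>n<m. (- x) ^ n * t ^ n) = (\<Sum>n<m. (- x) ^ n * N k (\<lambda>t. t ^ n))"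
        by (rule N_sum) (intro continuous_intros)
      then show ?thesis by (subst N_diff) (auto intro!: continuous_intros kernel_continuous ax)
    qed
    also have "\<bar>\<dots>\<bar> \<le> x ^ m / (1 - x) * N k (\<lambda>_. 1)"
    proof (rule N_abs_le)
      fix t :: real assume t: "t \<in> {-1..1}"
      have p: "1 - x \<le> 1 + x * t" using kernel_pos[OF ax t] x by simp
      then have nz: "1 + x * t \<noteq> 0" using x by auto
      have "(\<Sum>n<m. (- x) ^ n * t ^ n) = (\<Sum>n<m. (- (x * t)) ^ n)"
        by (intro sum.cong refl) (simp flip: power_mult_distrib)
      also have "\<dots> = (1 - (- (x * t)) ^ m) / (1 + x * t)"
        using nz by (subst sum_gp_strict) (auto simp: add_eq_0_iff2)
      finally have "(\<Sum>n<m. (- x) ^ n * t ^ n) - 1 / (1 + x * t) = - ((- (x * t)) ^ m / (1 + x * t))"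
        by (simp add: diff_divide_distrib)
      also have "\<bar>\<dots>\<bar> = \<bar>x * t\<bar> ^ m / (1 + x * t)" using p x by (simp add: power_abs)
      also have "\<dots> \<le> x ^ m / (1 - x)"
        using p x t by (intro frac_le power_mono) (auto simp: abs_mult mult_left_le)
      finally show "\<bar>(\<Sum>n<m. (- x) ^ n * t ^ n) - 1 / (1 + x * t)\<bar> \<le> x ^ m / (1 - x)" .
    qed (intro continuous_intros kernel_continuous ax)
    finally show ?thesis .
  qed
  then show "\<forall>\<^sub>F m in sequentially. \<bar>(\<Sum>n<m. (- x) ^ n * N k (\<lambda>t. t ^ n)) - N k (\<lambda>t. 1 / (1 + x * t))\<bar>
      \<le> x ^ m / (1 - x) * N k (\<lambda>_. 1)" by simp
qed simp

text \<open>For small \<open>x\<close> the integrals of \<open>1 / (1 + x * t)\<close> converge to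
  the generating function of \<open>\<nu>\<close>; both sides are power series with coefficients
  bounded by a multiple of \<open>2 ^ n\<close>, so the coefficients converge too.\<close>

lemma N_power_tendsto_complex: "(\<lambda>k. of_real (N k (\<lambda>t. t ^ n))) \<longlonglongrightarrow> \<nu> n"
proof -
  obtain B where B: "\<And>k. N k (\<lambda>_. 1) \<le> B" using N_one_bounded by blast
  \<comment> \<open>Convergence of the series at \<open>1/2\<close> bounds its terms, which gives
    the growth rate \<open>2 ^ n\<close>.\<close>
  have "summable (\<lambda>n. \<nu> n * (- of_real (1/2)) ^ n)" using \<nu>_sums[of "1/2"] by (auto simp: sums_iff)
  then have "Bseq (\<lambda>n. \<nu> n * (- of_real (1/2)) ^ n)"
    using summable_LIMSEQ_zero convergent_imp_Bseq convergentI by blast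
  then obtain C where C: "\<And>n. cmod (\<nu> n * (- of_real (1/2)) ^ n) \<le> C" unfolding Bseq_def by auto
  have \<nu>_bound: "cmod (\<nu> n) \<le> C * 2 ^ n" for n
    using C[of n] by (simp add: norm_mult norm_power power_divide field_simps)
  have N_bound: "\<bar>N k (\<lambda>t. t ^ n)\<bar> \<le> B" for k n
  proof -
    have "\<bar>N k (\<lambda>t. t ^ n)\<bar> \<le> 1 * N k (\<lambda>_. 1)"
      by (intro N_abs_le continuous_intros) (auto simp: power_abs intro!: power_le_one)
    then show ?thesis using B[of k] by simp
  qed
  have B0: "0 \<le> B" using order_trans[OF abs_ge_zero N_bound] .
  have "(\<lambda>k. (- 1) ^ n * (of_real (N k (\<lambda>t. t ^ n)) - \<nu> n)) \<longlonglongrightarrow> 0"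
  proof (rule powser_coeff_tendsto_zero)
    show "cmod ((- 1) ^ n * (of_real (N k (\<lambda>t. t ^ n)) - \<nu> n)) \<le> (B + C) * 2 ^ n" for k n
    proof -
      have "cmod ((- 1) ^ n * (of_real (N k (\<lambda>t. t ^ n)) - \<nu> n)) \<le> \<bar>N k (\<lambda>t. t ^ n)\<bar> + cmod (\<nu> n)"
        using norm_triangle_ineq4[of "of_real (N k (\<lambda>t. t ^ n))" "\<nu> n"] by (simp add: norm_mult norm_power)
      also have "\<dots> \<le> B * 2 ^ n + C * 2 ^ n"
        using N_bound[of k n] \<nu>_bound[of n] mult_left_mono[OF one_le_power[of "2::real" n] B0] by simp
      finally show ?thesis by (simp add: algebra_simps)
    qed
    fix x :: real assume x: "0 < x" "x < 1 / 4"
    have x1: "\<bar>x\<bar> < 1" "x \<noteq> 0" using x by auto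
    have "(\<Sum>n. (- 1) ^ n * (of_real (N k (\<lambda>t. t ^ n)) - \<nu> n) * of_real x ^ n)
        = of_real (N k (\<lambda>t. x / (1 + x * t)) / x) - (f (of_real x) - f 0) / of_real x" for k
    proof -
      have "(\<lambda>n. (- x) ^ n * N k (\<lambda>t. t ^ n)) sums N k (\<lambda>t. 1 / (1 + x * t))"
        using x by (intro N_kernel_sums) auto
      also have "N k (\<lambda>t. 1 / (1 + x * t)) = N k (\<lambda>t. x / (1 + x * t)) / x"
        using N_mult[of k x "\<lambda>t. 1 / (1 + x * t)"] x by (simp add: field_simps)
      finally have "(\<lambda>n. of_real ((- x) ^ n * N k (\<lambda>t. t ^ n)) :: complex) sums of_real (N k (\<lambda>t. x / (1 + x * t)) / x)"
        by (simp only: sums_of_real_iff)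
      from sums_diff[OF this \<nu>_sums[OF x1]] show ?thesis
        by (intro sums_unique[symmetric]) (simp add: power_minus[of x] power_minus[of "of_real x"] algebra_simps)
    qed
    moreover have "(\<lambda>k. of_real (N k (\<lambda>t. x / (1 + x * t)) / x) - (f (of_real x) - f 0) / of_real x) \<longlonglongrightarrow> 0"
    proof -
      have "complex_of_real (Re (f (of_real x)) - Re (f 0)) = f (of_real x) - f 0"
        using real[OF x1(1)] real[of 0] by (simp add: complex_eq_iff)
      then have "complex_of_real ((Re (f (of_real x)) - Re (f 0)) / x) = (f (of_real x) - f 0) / of_real x"
        by simp
      then show ?thesis
        using x by (intro LIM_zero) (auto intro!: tendsto_eq_intros N_kernel_tendsto[OF x1(1)])
    qed
    ultimately show "(\<lambda>k. \<Sum>n. (- 1) ^ n * (of_real (N k (\<lambda>t. t ^ n)) - \<nu> n) * of_real x ^ n) \<longlonglongrightarrow> 0"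
      by simp
  qed
  then have "(\<lambda>k. (- 1) ^ n * ((- 1) ^ n * (of_real (N k (\<lambda>t. t ^ n)) - \<nu> n))) \<longlonglongrightarrow> (- 1) ^ n * 0"
    by (intro tendsto_intros)
  then have "(\<lambda>k. of_real (N k (\<lambda>t. t ^ n)) - \<nu> n) \<longlonglongrightarrow> 0"
    by (simp flip: mult.assoc power_mult_distrib)
  then show ?thesis by (rule LIM_zero_cancel)
qed

lemma \<nu>_real: "Im (\<nu> n) = 0"
  using tendsto_Im[OF N_power_tendsto_complex[of n]] by (simp add: LIMSEQ_const_iff)

lemma N_power_tendsto: "(\<lambda>k. N k (\<lambda>t. t ^ n)) \<longlonglongrightarrow> Re (\<nu> n)"
  using tendsto_Re[OF N_power_tendsto_complex[of n]] by simp

text \<open>Two initial values are real, and \<open>s (n + 2) = s n - \<nu> n\<close>, where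
  \<open>\<nu>\<close> is real as a limit of real integrals.\<close>

lemma s_real: "Im (s n) = 0"
proof (induction n rule: induct_nat_012)
  case 0
  then show ?case by (simp add: s_0)
next
  case 1
  then show ?case using real[of 0] by (simp add: s_1)
next
  case (ge2 n)
  then show ?case using \<nu>_real[of n] by (simp add: \<nu>_def)
qed

text \<open>The quotient by \<open>1 - t^2\<close> of \<open>t ^ n\<close> minus its linear
  interpolant at \<open>\<plusminus>1\<close>; the recursion reflects
  \<open>t ^ (n + 2) = t ^ n - (1 - t^2) * t ^ n\<close>.\<close>

fun quot :: "nat \<Rightarrow> real \<Rightarrow> real" where
  "quot 0 t = 0"
| "quot (Suc 0) t = 0"
| "quot (Suc (Suc n)) t = quot n t - t ^ n"

lemma quot_continuous: "continuous_on A (quot n)"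
  by (induction n rule: induct_nat_012) (auto intro!: continuous_intros)

lemma quot_eq: "t ^ n = (- 1) ^ n * (1 - t) / 2 + (1 + t) / 2 + (1 - t\<^sup>2) * quot n t"
  by (induction n rule: induct_nat_012) (auto simp: field_simps power2_eq_square)

text \<open>The limit is the prospective functional applied to \<open>t ^ n\<close> minus its
  interpolant, the functional being \<open>\<kappa>\<close> at \<open>1\<close> and
  \<open>f 0\<close> at \<open>t\<close>.\<close>

lemma N_quot_tendsto:
  "(\<lambda>k. N k (quot n)) \<longlonglongrightarrow> Re (s n) - ((- 1) ^ n * (\<kappa> - Re (f 0)) / 2 + (\<kappa> + Re (f 0)) / 2)"
proof (induction n rule: induct_nat_012)
  case 0
  then show ?case by (simp add: N_def s_0 flip: add_divide_distrib)
next
  case 1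
  have "Re (f 0) - ((- 1) ^ Suc 0 * (\<kappa> - Re (f 0)) / 2 + (\<kappa> + Re (f 0)) / 2) = 0"
    by (simp add: field_simps)
  then show ?case unfolding s_1 by (simp only: N_def) simp
next
  case (ge2 n)
  have "(\<lambda>k. N k (quot n) - N k (\<lambda>t. t ^ n)) \<longlonglongrightarrow>
      Re (s n) - ((- 1) ^ n * (\<kappa> - Re (f 0)) / 2 + (\<kappa> + Re (f 0)) / 2) - Re (\<nu> n)"
    by (intro tendsto_diff ge2 N_power_tendsto)
  then show ?case
    by (simp add: N_diff quot_continuous continuous_intros \<nu>_def algebra_simps)
qed

text \<open>These are the kernels at \<open>x = \<plusminus>1 / u\<close>, where \<open>f\<close> is
  bounded by \<open>\<kappa>\<close>. For a representing measure, the defect in the first inequality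
  tends to twice the mass at \<open>-1\<close> as \<open>u\<close> tends to \<open>1\<close>, in the
  second to twice the mass at \<open>1\<close>; the bounds thus say that both masses are
  nonnegative.\<close>

lemma end_masses:
  assumes u: "u > 1"
  obtains l r where "(\<lambda>k. N k (\<lambda>t. 1 / (u + t))) \<longlonglongrightarrow> l" "l \<le> \<kappa> - Re (f 0)"
    "(\<lambda>k. N k (\<lambda>t. 1 / (u - t))) \<longlonglongrightarrow> r" "r \<le> \<kappa> + Re (f 0)"
proof -
  have x: "\<bar>1 / u\<bar> < 1" "\<bar>- 1 / u\<bar> < 1" using u by auto
  have "(1 / u) / (1 + (1 / u) * t) = 1 / (u + t)" for t
  proof -
    have "1 + (1 / u) * t = (u + t) / u" using u by (simp add: field_simps)
    then show ?thesis using u by simp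
  qed
  with N_kernel_tendsto[OF x(1)]
  have 1: "(\<lambda>k. N k (\<lambda>t. 1 / (u + t))) \<longlonglongrightarrow> Re (f (of_real (1/u))) - Re (f 0)" by simp
  have "(- 1 / u) / (1 + (- 1 / u) * t) = - 1 * (1 / (u - t))" for t
  proof -
    have "1 + (- 1 / u) * t = (u - t) / u" using u by (simp add: field_simps)
    then show ?thesis using u by simp
  qed
  then have "(\<lambda>k. - 1 * N k (\<lambda>t. 1 / (u - t))) \<longlonglongrightarrow> Re (f (of_real (-1/u))) - Re (f 0)"
    using N_kernel_tendsto[OF x(2)] by (simp only: N_mult)
  then have 2: "(\<lambda>k. N k (\<lambda>t. 1 / (u - t))) \<longlonglongrightarrow> - (Re (f (of_real (-1/u))) - Re (f 0))"
    using tendsto_minus by fastforce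
  show thesis
    using bounded[OF x(1)] bounded[OF x(2)] by (intro that[OF 1 _ 2]) auto
qed

theorem moment_functional_nonneg:
  assumes pos: "\<And>t. t \<in> {-1..1} \<Longrightarrow> 0 \<le> (\<Sum>i\<le>n. a i * t ^ i)"
  shows "0 \<le> (\<Sum>i\<le>n. a i * Re (s i))"
proof -
  \<comment> \<open>With \<open>p = l + (1 - t\<^sup>2) q\<close>, \<open>l\<close> the linear interpolant of \<open>p\<close> at \<open>\<plusminus>1\<close>, the values
    \<open>\<kappa> \<mp> f 0\<close> of the functional at \<open>1 \<mp> t\<close> dominate the limits of \<open>N k (1 / (u \<plusminus> t))\<close>, and
    \<open>q + p (-1) / (2 (u + t)) + p 1 / (2 (u - t))\<close> is nearly \<open>p / (u\<^sup>2 - t\<^sup>2)\<close> for \<open>u\<close> near \<open>1\<close>.\<close>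
  define q where "q t = (\<Sum>i\<le>n. a i * quot i t)" for t
  define p where "p t = (\<Sum>i\<le>n. a i * t ^ i)" for t
  define L where "L = (\<Sum>i\<le>n. a i * Re (s i))"
  have qc: "continuous_on {-1..1} q" unfolding q_def by (intro continuous_intros quot_continuous)
  have pq: "p t = p (-1) * (1 - t) / 2 + p 1 * (1 + t) / 2 + (1 - t\<^sup>2) * q t" for t
  proof -
    have "p t = (\<Sum>i\<le>n. a i * ((- 1) ^ i * (1 - t) / 2 + (1 + t) / 2 + (1 - t\<^sup>2) * quot i t))"
      unfolding p_def by (intro sum.cong refl arg_cong[where f = "\<lambda>x. _ * x"] quot_eq)
    also have "\<dots> = (\<Sum>i\<le>n. a i * (- 1) ^ i) * ((1 - t) / 2) + (\<Sum>i\<le>n. a i * 1 ^ i) * ((1 + t) / 2)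
        + (1 - t\<^sup>2) * q t"
      unfolding q_def sum_distrib_left sum_distrib_right sum.distrib[symmetric]
      by (intro sum.cong refl) (simp add: algebra_simps)
    finally show ?thesis by (simp add: p_def)
  qed
  have "bounded (q ` {-1..1})" using qc by (intro compact_imp_bounded compact_continuous_image) auto
  then obtain Q where "\<forall>y\<in>q ` {-1..1}. norm y \<le> Q" unfolding bounded_iff by blast
  then have Q: "\<bar>q t\<bar> \<le> Q" if "t \<in> {-1..1}" for t using that by auto
  have Q0: "0 \<le> Q" using order_trans[OF abs_ge_zero Q[of 0]] by simp
  have \<kappa>0: "0 \<le> \<kappa>" using order_trans[OF abs_ge_zero bounded[of 0]] by simp
  have Nq: "(\<lambda>k. N k q) \<longlonglongrightarrow> L - (p (-1) * (\<kappa> - Re (f 0)) / 2 + p 1 * (\<kappa> + Re (f 0)) / 2)"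
  proof -
    have "(\<lambda>k. \<Sum>i\<le>n. a i * N k (quot i)) \<longlonglongrightarrow>
      (\<Sum>i\<le>n. a i * (Re (s i) - ((- 1) ^ i * (\<kappa> - Re (f 0)) / 2 + (\<kappa> + Re (f 0)) / 2)))"
      by (intro tendsto_intros N_quot_tendsto)
    also have "(\<Sum>i\<le>n. a i * (Re (s i) - ((- 1) ^ i * (\<kappa> - Re (f 0)) / 2 + (\<kappa> + Re (f 0)) / 2)))
      = L - ((\<Sum>i\<le>n. a i * (- 1) ^ i) * ((\<kappa> - Re (f 0)) / 2) + (\<Sum>i\<le>n. a i * 1 ^ i) * ((\<kappa> + Re (f 0)) / 2))"
      unfolding L_def sum_distrib_left sum_distrib_right sum.distrib[symmetric] sum_subtractf[symmetric]
      by (intro sum.cong refl) (simp add: algebra_simps)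
    finally show ?thesis
      unfolding q_def[abs_def] by (simp add: N_sum quot_continuous p_def)
  qed
  have lower: "- ((u\<^sup>2 - 1) * Q * \<kappa>) \<le> L" if u: "u > 1" for u
  proof -
    obtain l r where l: "(\<lambda>k. N k (\<lambda>t. 1 / (u + t))) \<longlonglongrightarrow> l" "l \<le> \<kappa> - Re (f 0)"
      and r: "(\<lambda>k. N k (\<lambda>t. 1 / (u - t))) \<longlonglongrightarrow> r" "r \<le> \<kappa> + Re (f 0)"
      using end_masses[OF u] by blast
    \<comment> \<open>Added to both weights, \<open>c\<close> contributes
      \<open>2 * u * c = (u\<^sup>2 - 1) * Q\<close> after clearing denominators, enough to absorb a
      negative \<open>(u\<^sup>2 - 1) * q t\<close>; it vanishes as \<open>u\<close> tends to
      \<open>1\<close>.\<close>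
    define c where "c = (u\<^sup>2 - 1) * Q / (2 * u)"
    have c0: "0 \<le> c" using u Q0 by (simp add: c_def)
    have cont: "continuous_on {-1..1} (\<lambda>t. 1 / (u + t))" "continuous_on {-1..1} (\<lambda>t. 1 / (u - t))"
      using u by (auto intro!: continuous_intros)
    have ineq: "0 \<le> q t + (p (-1) / 2 + c) * (1 / (u + t)) + (p 1 / 2 + c) * (1 / (u - t))"
      if t: "t \<in> {-1..1}" for t
    proof -
      have ut: "0 < u + t" "0 < u - t" using t u by auto
      have "(q t + (p (-1) / 2 + c) * (1 / (u + t)) + (p 1 / 2 + c) * (1 / (u - t))) * ((u + t) * (u - t))
         = q t * ((u + t) * (u - t)) + (p (-1) / 2 + c) * (u - t) + (p 1 / 2 + c) * (u + t)"
      proof -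
        have "(y + A * (1 / a) + B * (1 / b)) * (a * b) = y * (a * b) + A * b + B * a"
          if "a \<noteq> 0" "b \<noteq> 0" for y A B a b :: real
          using that by (simp add: field_simps)
        then show ?thesis using ut by simp
      qed
      also have "\<dots> = p t + (u\<^sup>2 - 1) * q t + (u - 1) * (p (-1) + p 1) / 2 + c * (2 * u)"
        unfolding pq[of t] by (simp add: field_simps power2_eq_square)
      also have "c * (2 * u) = (u\<^sup>2 - 1) * Q" using u by (simp add: c_def)
      also have "p t + (u\<^sup>2 - 1) * q t + (u - 1) * (p (-1) + p 1) / 2 + (u\<^sup>2 - 1) * Q
        = p t + (u\<^sup>2 - 1) * (q t + Q) + (u - 1) * (p (-1) + p 1) / 2" by (simp add: algebra_simps)
      also have "0 \<le> \<dots>"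
      proof (intro add_nonneg_nonneg)
        have "0 \<le> q t + Q" using Q[OF t] by linarith
        then show "0 \<le> (u\<^sup>2 - 1) * (q t + Q)" using u by simp
        show "0 \<le> (u - 1) * (p (-1) + p 1) / 2"
          using pos[of "-1"] pos[of 1] u by (simp add: p_def)
      qed (use pos[OF t] in \<open>simp add: p_def\<close>)
      finally show ?thesis using ut mult_pos_pos[OF ut] by (metis zero_le_mult_iff not_le)
    qed
    have "0 \<le> (L - (p (-1) * (\<kappa> - Re (f 0)) / 2 + p 1 * (\<kappa> + Re (f 0)) / 2)) + (p (-1) / 2 + c) * l + (p 1 / 2 + c) * r"
    proof (rule LIMSEQ_le_const)
      show "(\<lambda>k. N k q + (p (-1) / 2 + c) * N k (\<lambda>t. 1 / (u + t)) + (p 1 / 2 + c) * N k (\<lambda>t. 1 / (u - t))) \<longlonglongrightarrow>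
        (L - (p (-1) * (\<kappa> - Re (f 0)) / 2 + p 1 * (\<kappa> + Re (f 0)) / 2)) + (p (-1) / 2 + c) * l + (p 1 / 2 + c) * r"
        by (intro tendsto_intros Nq l r)
      have "0 \<le> N k q + (p (-1) / 2 + c) * N k (\<lambda>t. 1 / (u + t)) + (p 1 / 2 + c) * N k (\<lambda>t. 1 / (u - t))" for k
      proof -
        have "N k (\<lambda>_. 0) \<le> N k (\<lambda>t. q t + (p (-1) / 2 + c) * (1 / (u + t)) + (p 1 / 2 + c) * (1 / (u - t)))"
          by (intro N_mono ineq continuous_on_add continuous_on_mult_left continuous_on_const cont qc)
        also have "\<dots> = N k q + (p (-1) / 2 + c) * N k (\<lambda>t. 1 / (u + t)) + (p 1 / 2 + c) * N k (\<lambda>t. 1 / (u - t))"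
          by (simp only: N_add N_mult continuous_on_add continuous_on_mult_left cont qc)
        finally show ?thesis by (simp add: N_def)
      qed
      then show "\<exists>m. \<forall>k\<ge>m. 0 \<le> N k q + (p (-1) / 2 + c) * N k (\<lambda>t. 1 / (u + t)) + (p 1 / 2 + c) * N k (\<lambda>t. 1 / (u - t))"
        by blast
    qed
    \<comment> \<open>As the weights are nonnegative, \<open>l\<close> and \<open>r\<close> may be
      replaced by their bounds; the end terms then cancel and only the correction
      \<open>c * (2 * \<kappa>)\<close> remains.\<close>
    moreover have "(p (-1) / 2 + c) * l \<le> (p (-1) / 2 + c) * (\<kappa> - Re (f 0))"
      "(p 1 / 2 + c) * r \<le> (p 1 / 2 + c) * (\<kappa> + Re (f 0))"
      using pos[of "-1"] pos[of 1] c0 l(2) r(2) by (intro mult_left_mono; simp add: p_def)+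
    ultimately have "0 \<le> L + c * (2 * \<kappa>)" by (simp add: algebra_simps)
    moreover have "c * (2 * \<kappa>) \<le> (u\<^sup>2 - 1) * Q * \<kappa>"
    proof -
      have "c * (2 * \<kappa>) = (u\<^sup>2 - 1) * Q * \<kappa> * (1 / u)" using u by (simp add: c_def)
      also have "\<dots> \<le> (u\<^sup>2 - 1) * Q * \<kappa> * 1"
        using u Q0 \<kappa>0 by (intro mult_left_mono) auto
      finally show ?thesis by simp
    qed
    ultimately show ?thesis by linarith
  qed
  have "0 \<le> L"
  proof (rule LIMSEQ_le_const2)
    show "(\<lambda>k. - (((1 + 1 / (real k + 1))\<^sup>2 - 1) * Q * \<kappa>)) \<longlonglongrightarrow> 0"
    proof -
      have "(\<lambda>k. (1 + 1 / (real k + 1))\<^sup>2 - 1) \<longlonglongrightarrow> 0" by real_asymp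
      then have "(\<lambda>k. - (((1 + 1 / (real k + 1))\<^sup>2 - 1) * Q * \<kappa>)) \<longlonglongrightarrow> - (0 * Q * \<kappa>)"
        by (intro tendsto_intros)
      then show ?thesis by simp
    qed
    show "\<exists>m. \<forall>k\<ge>m. - (((1 + 1 / (real k + 1))\<^sup>2 - 1) * Q * \<kappa>) \<le> L"
      using lower by (intro exI allI impI) auto
  qed
  then show ?thesis by (simp add: L_def)
qed

end

section \<open>From moments to distribution functions\<close>

lemma tendsto_quadratic:
  fixes T :: "nat \<Rightarrow> 'a::hilbert_space \<Rightarrow>\<^sub>L 'a"
  shows "T \<longlonglongrightarrow> S \<Longrightarrow> (\<lambda>n. cinner (blinfun_apply (T n) x) y) \<longlonglongrightarrow> cinner (blinfun_apply S x) y"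
  by (rule bounded_linear.tendsto[OF bounded_linear_quadratic])

locale moment_sequence =
  fixes S :: "nat \<Rightarrow> 'a::hilbert_space \<Rightarrow>\<^sub>L 'a"
  assumes S_ops: "S n \<in> bounded_ops" and S_0: "S 0 = id_blinfun"
    and S_pos: "(\<And>t. t \<in> {-1..1} \<Longrightarrow> 0 \<le> poly p t) \<Longrightarrow>
      nonneg_op (\<Sum>i\<le>degree p. coeff p i *\<^sub>R S i)"
begin

definition L :: "real poly \<Rightarrow> 'a \<Rightarrow>\<^sub>L 'a" where
  "L p = (\<Sum>i\<le>degree p. coeff p i *\<^sub>R S i)"

lemma L_eq: "degree p \<le> n \<Longrightarrow> L p = (\<Sum>i\<le>n. coeff p i *\<^sub>R S i)"
  unfolding L_def by (intro sum.mono_neutral_left) (auto simp: coeff_eq_0)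

lemma L_ops: "L p \<in> bounded_ops"
  unfolding L_def by (intro bounded_ops_sum bounded_ops_intros S_ops)

lemma L_add: "L (p + q) = L p + L q"
proof -
  let ?n = "max (degree p) (degree q)"
  have "degree (p + q) \<le> ?n" by (rule degree_add_le_max)
  then show ?thesis by (simp add: L_eq[of _ ?n] sum.distrib scaleR_add_left)
qed

lemma L_smult: "L (smult c p) = c *\<^sub>R L p"
  by (simp add: L_eq[OF degree_smult_le] L_def scaleR_sum_right)

lemma L_diff: "L (p - q) = L p - L q"
  using L_add[of p "smult (- 1) q"] L_smult[of "- 1" q] by simp

lemma L_const: "L [:c:] = c *\<^sub>R id_blinfun"
  by (simp add: L_def S_0)

lemma L_monom: "L (monom 1 n) = S n"
proof -
  have "L (monom 1 n) = (\<Sum>i\<le>n. (if i = n then S i else 0))"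
    unfolding L_eq[OF degree_monom_le] by (intro sum.cong refl) auto
  then show ?thesis by simp
qed

abbreviation "Q T x \<equiv> Re (cinner (blinfun_apply T x) x)"

text \<open>Subtracting a lower bound from \<open>p\<close> leaves a polynomial nonnegative on
  \<open>[-1, 1]\<close>. Since every polynomial has such a bound there, each \<open>L p\<close>
  differs from a nonnegative operator by a real multiple of the identity.\<close>

lemma L_real: "Im (cinner (blinfun_apply (L p) x) x) = 0"
  and L_lower: "(\<And>t. t \<in> {-1..1} \<Longrightarrow> c \<le> poly p t) \<Longrightarrow> c * (norm x)\<^sup>2 \<le> Q (L p) x"
proof -
  have *: "Im (cinner (blinfun_apply (L p) x) x) = 0 \<and> c * (norm x)\<^sup>2 \<le> Q (L p) x"
    if "\<And>t. t \<in> {-1..1} \<Longrightarrow> c \<le> poly p t" for c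
  proof -
    have "nonneg_op (L (p - [:c:]))"
      unfolding L_def by (intro S_pos) (use that in simp)
    then show ?thesis
      by (simp add: nonneg_op_iff L_diff L_const blinfun.diff_left blinfun.scaleR_left cinner_lin cinner_self)
  qed
  then show "c * (norm x)\<^sup>2 \<le> Q (L p) x" if "\<And>t. t \<in> {-1..1} \<Longrightarrow> c \<le> poly p t" using that by blast
  have "bounded (poly p ` {-1..1})"
    by (intro compact_imp_bounded compact_continuous_image continuous_intros) auto
  then obtain B where "\<forall>y\<in>poly p ` {-1..1}. norm y \<le> B" unfolding bounded_iff by blast
  then have "norm (poly p t) \<le> B" if "t \<in> {-1..1}" for t using that by blast
  then have "- B \<le> poly p t" if "t \<in> {-1..1}" for t using that by (fastforce simp: abs_le_iff)
  then show "Im (cinner (blinfun_apply (L p) x) x) = 0" using *[of "- B"] by blast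
qed

lemma norm_L_le:
  assumes "\<And>t. t \<in> {-1..1} \<Longrightarrow> \<bar>poly p t\<bar> \<le> B"
  shows "norm (L p) \<le> 2 * B"
proof (rule norm_le_numerical_radius[OF L_ops])
  show "0 \<le> B" using order_trans[OF abs_ge_zero assms[of 0]] by simp
  fix x
  have "- B * (norm x)\<^sup>2 \<le> Q (L p) x" using assms by (intro L_lower) fastforce
  moreover have "- B * (norm x)\<^sup>2 \<le> Q (L (smult (- 1) p)) x" using assms by (intro L_lower) fastforce
  ultimately have "\<bar>Q (L p) x\<bar> \<le> B * (norm x)\<^sup>2"
    by (simp add: L_smult blinfun.minus_left cinner_lin del: smult_minus_left)
  then show "cmod (cinner (blinfun_apply (L p) x) x) \<le> B * (norm x)\<^sup>2"
    using L_real by (simp add: cmod_eq_Re)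
qed

section \<open>Extension of the functional to continuous functions\<close>

definition close :: "(real \<Rightarrow> real) \<Rightarrow> real \<Rightarrow> real poly \<Rightarrow> bool" where
  "close f e p \<longleftrightarrow> (\<forall>t\<in>{-1..1}. \<bar>f t - poly p t\<bar> \<le> e)"

lemma close_exists:
  assumes f: "continuous_on {-1..1} f" and e: "0 < e"
  shows "\<exists>p. close f e p"
proof -
  obtain g where g: "real_polynomial_function g" "\<And>x. x \<in> {-1..1} \<Longrightarrow> \<bar>f x - g x\<bar> < e"
    by (rule Stone_Weierstrass_real_polynomial_function[OF compact_Icc f e]) blast
  obtain a n where a: "g = (\<lambda>x. \<Sum>i\<le>n. a i * x ^ i)"
    using g(1) real_polynomial_function_iff_sum by blast
  have "poly (\<Sum>i\<le>n. monom (a i) i) x = g x" for x by (simp add: a poly_sum poly_monom)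
  then show ?thesis
    using g(2) unfolding close_def
    by (intro exI[of _ "\<Sum>i\<le>n. monom (a i) i"]) (auto intro: less_imp_le)
qed

lemma L_close:
  assumes "close f d p" "close f e r"
  shows "norm (L p - L r) \<le> 2 * (d + e)"
  unfolding L_diff[symmetric]
proof (rule norm_L_le)
  show "\<bar>poly (p - r) t\<bar> \<le> d + e" if "t \<in> {-1..1}" for t
    using bspec[OF assms(1)[unfolded close_def] that] bspec[OF assms(2)[unfolded close_def] that] by simp
qed

definition approx :: "(real \<Rightarrow> real) \<Rightarrow> nat \<Rightarrow> real poly" where
  "approx f n = (SOME p. close f (1 / (real n + 1)) p)"

definition Lc :: "(real \<Rightarrow> real) \<Rightarrow> 'a \<Rightarrow>\<^sub>L 'a" where
  "Lc f = lim (\<lambda>n. L (approx f n))"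

lemma close_approx: "continuous_on {-1..1} f \<Longrightarrow> close f (1 / (real n + 1)) (approx f n)"
  unfolding approx_def by (rule someI_ex[OF close_exists]) auto

lemma Lc_lim:
  assumes f: "continuous_on {-1..1} f"
  shows "(\<lambda>n. L (approx f n)) \<longlonglongrightarrow> Lc f"
proof -
  have "Cauchy (\<lambda>n. L (approx f n))"
  proof (rule CauchyI)
    fix e :: real assume e: "e > 0"
    obtain N :: nat where N: "4 / e < real N" using reals_Archimedean2 by blast
    have "norm (L (approx f m) - L (approx f n)) < e" if "m \<ge> N" "n \<ge> N" for m n
    proof -
      have small: "1 / (real k + 1) < e / 4" if "k \<ge> N" for k :: nat
      proof -
        have "4 / e < real k + 1" using N that by linarith
        then show ?thesis using e by (simp add: field_simps)
      qed
      have "norm (L (approx f m) - L (approx f n)) \<le> 2 * (1 / (real m + 1) + 1 / (real n + 1))"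
        by (rule L_close[OF close_approx[OF f] close_approx[OF f]])
      also have "\<dots> < 2 * (e / 4 + e / 4)" using small[OF that(1)] small[OF that(2)] by argo
      finally show ?thesis by simp
    qed
    then show "\<exists>M. \<forall>m\<ge>M. \<forall>n\<ge>M. norm (L (approx f m) - L (approx f n)) < e" by blast
  qed
  then show ?thesis unfolding Lc_def by (simp add: Cauchy_convergent_iff convergent_LIMSEQ_iff)
qed

lemma Lc_close:
  assumes f: "continuous_on {-1..1} f" and p: "close f e p"
  shows "norm (Lc f - L p) \<le> 2 * e"
proof (rule LIMSEQ_le)
  show "(\<lambda>n. norm (L (approx f n) - L p)) \<longlonglongrightarrow> norm (Lc f - L p)"
    by (intro tendsto_intros Lc_lim f)
  show "(\<lambda>n. 2 * (1 / (real n + 1) + e)) \<longlonglongrightarrow> 2 * e" by real_asymp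
  show "\<exists>N. \<forall>n\<ge>N. norm (L (approx f n) - L p) \<le> 2 * (1 / (real n + 1) + e)"
    using L_close[OF close_approx[OF f] p] by blast
qed

text \<open>Linearity and congruence of \<open>Lc\<close> are all proved through this: one
  sufficiently close polynomial identifies the value, so the arbitrarily chosen approximants never
  have to be compared.\<close>

lemma Lc_eqI:
  assumes f: "continuous_on {-1..1} f"
    and T: "\<And>e. e > 0 \<Longrightarrow> \<exists>p d. close f d p \<and> 2 * d + norm (T - L p) \<le> e"
  shows "Lc f = T"
proof -
  have "norm (Lc f - T) \<le> e" if e: "e > 0" for e
  proof -
    obtain p d where p: "close f d p" "2 * d + norm (T - L p) \<le> e" using T[OF e] by blast
    have "norm (Lc f - T) \<le> norm (Lc f - L p) + norm (T - L p)"
      using norm_triangle_ineq4[of "Lc f - L p" "T - L p"] by simp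
    also have "\<dots> \<le> e" using Lc_close[OF f p(1)] p(2) by linarith
    finally show ?thesis .
  qed
  then have "norm (Lc f - T) \<le> 0" using field_le_epsilon[of "norm (Lc f - T)" 0] by simp
  then show ?thesis by simp
qed

lemma Lc_ops: "continuous_on {-1..1} f \<Longrightarrow> Lc f \<in> bounded_ops"
  by (rule bounded_ops_lim[OF L_ops Lc_lim])

lemma Lc_poly: "Lc (poly p) = L p"
proof (rule Lc_eqI)
  show "\<exists>r d. close (poly p) d r \<and> 2 * d + norm (L p - L r) \<le> e" if "e > 0" for e
    using that by (intro exI[of _ p] exI[of _ 0]) (simp add: close_def)
qed (intro continuous_intros)

lemma Lc_add:
  assumes f: "continuous_on {-1..1} f" and g: "continuous_on {-1..1} g"
  shows "Lc (\<lambda>t. f t + g t) = Lc f + Lc g"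
proof (rule Lc_eqI)
  fix e :: real assume "e > 0"
  then have e: "0 < e / 8" by simp
  obtain p q where p: "close f (e / 8) p" and q: "close g (e / 8) q"
    using close_exists[OF f e] close_exists[OF g e] by blast
  have "close (\<lambda>t. f t + g t) (e / 4) (p + q)"
    unfolding close_def
  proof
    show "\<bar>f t + g t - poly (p + q) t\<bar> \<le> e / 4" if "t \<in> {-1..1}" for t
      unfolding poly_add
      using bspec[OF p[unfolded close_def] that] bspec[OF q[unfolded close_def] that] by linarith
  qed
  moreover have "norm (Lc f + Lc g - L (p + q)) \<le> 2 * (e / 8) + 2 * (e / 8)"
    using norm_triangle_mono[OF Lc_close[OF f p] Lc_close[OF g q]] by (simp add: L_add add_diff_add)
  ultimately show "\<exists>p d. close (\<lambda>t. f t + g t) d p \<and> 2 * d + norm (Lc f + Lc g - L p) \<le> e"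
    by (intro exI[of _ "p + q"] exI[of _ "e / 4"]) simp
qed (intro continuous_intros f g)

lemma Lc_mult:
  assumes f: "continuous_on {-1..1} f"
  shows "Lc (\<lambda>t. c * f t) = c *\<^sub>R Lc f"
proof (rule Lc_eqI)
  fix e :: real assume "e > 0"
  define d where "d = e / (4 * (\<bar>c\<bar> + 1))"
  have d: "0 < d" "\<bar>c\<bar> * d \<le> e / 4"
  proof -
    show "0 < d" using \<open>e > 0\<close> by (simp add: d_def add_nonneg_pos)
    have "\<bar>c\<bar> * d = (e / 4) * (\<bar>c\<bar> / (\<bar>c\<bar> + 1))" by (simp add: d_def field_simps)
    also have "\<dots> \<le> (e / 4) * 1" using \<open>e > 0\<close> by (intro mult_left_mono) auto
    finally show "\<bar>c\<bar> * d \<le> e / 4" by simp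
  qed
  obtain p where p: "close f d p" using close_exists[OF f d(1)] by blast
  have "close (\<lambda>t. c * f t) (e / 4) (smult c p)"
    unfolding close_def
  proof
    show "\<bar>c * f t - poly (smult c p) t\<bar> \<le> e / 4" if "t \<in> {-1..1}" for t
      using mult_left_mono[OF bspec[OF p[unfolded close_def] that], of "\<bar>c\<bar>"] d(2)
      by (simp add: abs_mult[symmetric] right_diff_distrib)
  qed
  moreover have "norm (c *\<^sub>R Lc f - L (smult c p)) \<le> e / 2"
  proof -
    have "norm (c *\<^sub>R Lc f - L (smult c p)) = \<bar>c\<bar> * norm (Lc f - L p)"
      by (simp add: L_smult flip: scaleR_diff_right)
    also have "\<dots> \<le> \<bar>c\<bar> * (2 * d)" by (intro mult_left_mono Lc_close f p) auto
    finally show ?thesis using d(2) by simp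
  qed
  ultimately show "\<exists>p d. close (\<lambda>t. c * f t) d p \<and> 2 * d + norm (c *\<^sub>R Lc f - L p) \<le> e"
    by (intro exI[of _ "smult c p"] exI[of _ "e / 4"]) simp
qed (intro continuous_intros f)

lemma Lc_cong:
  assumes f: "continuous_on {-1..1} f" and eq: "\<And>t. t \<in> {-1..1} \<Longrightarrow> f t = g t"
  shows "Lc f = Lc g"
proof (rule Lc_eqI[OF f])
  have "continuous_on {-1..1} f = continuous_on {-1..1} g" by (rule continuous_on_cong[OF refl eq])
  then have g: "continuous_on {-1..1} g" using f by simp
  fix e :: real assume "e > 0"
  then have e: "0 < e / 4" by simp
  obtain p where p: "close g (e / 4) p" using close_exists[OF g e] by blast
  moreover have "close f (e / 4) p" using p eq by (simp add: close_def)
  ultimately show "\<exists>p d. close f d p \<and> 2 * d + norm (Lc g - L p) \<le> e"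
    using Lc_close[OF g p] by (intro exI[of _ p] exI[of _ "e / 4"]) simp
qed

lemma Lc_diff:
  assumes f: "continuous_on {-1..1} f" and g: "continuous_on {-1..1} g"
  shows "Lc (\<lambda>t. f t - g t) = Lc f - Lc g"
  using Lc_add[OF f continuous_on_mult_left[OF g], of "- 1"] Lc_mult[OF g, of "- 1"] by simp

lemma Lc_const: "Lc (\<lambda>_. c) = c *\<^sub>R id_blinfun"
proof -
  have "poly [:c:] = (\<lambda>_. c)" by (simp add: fun_eq_iff)
  then show ?thesis using Lc_poly[of "[:c:]"] L_const[of c] by simp
qed

lemma Lc_sum:
  assumes "\<And>i. i \<in> I \<Longrightarrow> continuous_on {-1..1} (f i)"
  shows "Lc (\<lambda>t. \<Sum>i\<in>I. c i * f i t) = (\<Sum>i\<in>I. c i *\<^sub>R Lc (f i))"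
  using assms
proof (induction I rule: infinite_finite_induct)
  case (insert i I)
  then show ?case by (simp add: Lc_add Lc_mult continuous_intros)
qed (simp_all add: Lc_const)

lemma Lc_real:
  assumes f: "continuous_on {-1..1} f"
  shows "Im (cinner (blinfun_apply (Lc f) x) x) = 0"
  using tendsto_Im[OF tendsto_quadratic[OF Lc_lim[OF f], of x x]] by (simp add: L_real LIMSEQ_const_iff)

lemma Lc_lower:
  assumes f: "continuous_on {-1..1} f" and c: "\<And>t. t \<in> {-1..1} \<Longrightarrow> c \<le> f t"
  shows "c * (norm x)\<^sup>2 \<le> Q (Lc f) x"
proof (rule LIMSEQ_le)
  show "(\<lambda>n. Q (L (approx f n)) x) \<longlonglongrightarrow> Q (Lc f) x"
    by (intro tendsto_Re tendsto_quadratic Lc_lim f)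
  have "(\<lambda>n. c - 1 / (real n + 1)) \<longlonglongrightarrow> c" by real_asymp
  then show "(\<lambda>n. (c - 1 / (real n + 1)) * (norm x)\<^sup>2) \<longlonglongrightarrow> c * (norm x)\<^sup>2"
    by (intro tendsto_intros)
  have "(c - 1 / (real n + 1)) * (norm x)\<^sup>2 \<le> Q (L (approx f n)) x" for n
  proof (rule L_lower)
    show "c - 1 / (real n + 1) \<le> poly (approx f n) t" if "t \<in> {-1..1}" for t
      using bspec[OF close_approx[OF f, of n, unfolded close_def] that] c[OF that] by linarith
  qed
  then show "\<exists>N. \<forall>n\<ge>N. (c - 1 / (real n + 1)) * (norm x)\<^sup>2 \<le> Q (L (approx f n)) x" by blast
qed

lemma Lc_le:
  assumes f: "continuous_on {-1..1} f" and g: "continuous_on {-1..1} g"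
    and le: "\<And>t. t \<in> {-1..1} \<Longrightarrow> f t \<le> g t + c"
  shows "Q (Lc f) x \<le> Q (Lc g) x + c * (norm x)\<^sup>2"
proof -
  have "- c * (norm x)\<^sup>2 \<le> Q (Lc (\<lambda>t. g t - f t)) x"
    using le by (intro Lc_lower continuous_intros f g) (simp add: algebra_simps)
  then show ?thesis by (simp add: Lc_diff f g blinfun.diff_left cinner_lin)
qed

lemma Lc_abs_le:
  assumes f: "continuous_on {-1..1} f" and g: "continuous_on {-1..1} g"
    and le: "\<And>t. t \<in> {-1..1} \<Longrightarrow> \<bar>f t - g t\<bar> \<le> c"
  shows "\<bar>Q (Lc f) x - Q (Lc g) x\<bar> \<le> c * (norm x)\<^sup>2"
proof -
  have "Q (Lc f) x \<le> Q (Lc g) x + c * (norm x)\<^sup>2"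
    using le by (intro Lc_le f g) (fastforce simp: abs_le_iff)
  moreover have "Q (Lc g) x \<le> Q (Lc f) x + c * (norm x)\<^sup>2"
    using le by (intro Lc_le f g) (fastforce simp: abs_le_iff)
  ultimately show ?thesis by linarith
qed

text \<open>Continuous functions increasing with \<open>k\<close> to the indicator function of \<open>[-1, t)\<close>, or of
  \<open>[-1, 1]\<close> for \<open>t = 1\<close>, which puts the mass at \<open>1\<close> into the last jump.\<close>

definition ramp :: "nat \<Rightarrow> real \<Rightarrow> real \<Rightarrow> real" where
  "ramp k t u = (if t \<ge> 1 then 1 else max 0 (min 1 ((real k + 1) * (t - u))))"

lemma ramp_continuous: "continuous_on A (ramp k t)"
  unfolding ramp_def by (cases "t \<ge> 1") (auto intro!: continuous_intros)

lemma ramp_range: "0 \<le> ramp k t u" "ramp k t u \<le> 1"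
  by (auto simp: ramp_def)

lemma ramp_mono:
  assumes "s \<le> t"
  shows "ramp k s u \<le> ramp k t u"
proof -
  have "(real k + 1) * (s - u) \<le> (real k + 1) * (t - u)" using assms by (intro mult_left_mono) auto
  then have "max 0 (min 1 ((real k + 1) * (s - u))) \<le> max 0 (min 1 ((real k + 1) * (t - u)))"
    by (intro max.mono min.mono order_refl)
  then show ?thesis using assms ramp_range(2)[of k s u] by (simp add: ramp_def)
qed

lemma ramp_mono_index:
  assumes "k \<le> m"
  shows "ramp k t u \<le> ramp m t u"
proof (cases "u \<le> t")
  case True
  then have "(real k + 1) * (t - u) \<le> (real m + 1) * (t - u)" using assms by (intro mult_right_mono) auto
  then show ?thesis by (auto simp: ramp_def)
next
  case False
  then have "(real k + 1) * (t - u) \<le> 0" by (intro mult_nonneg_nonpos) auto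
  then show ?thesis by (auto simp: ramp_def)
qed

lemma ramp_eq_0: "t \<le> u \<Longrightarrow> t < 1 \<Longrightarrow> ramp k t u = 0"
  using mult_nonneg_nonpos[of "real k + 1" "t - u"] by (auto simp: ramp_def)

lemma ramp_eq_1: "u \<le> t - 1 / (real k + 1) \<Longrightarrow> ramp k t u = 1"
proof -
  assume "u \<le> t - 1 / (real k + 1)"
  then have "(real k + 1) * (1 / (real k + 1)) \<le> (real k + 1) * (t - u)" by (intro mult_left_mono) auto
  then show ?thesis by (auto simp: ramp_def)
qed

lemma ramp_lipschitz: "s \<le> t \<Longrightarrow> t < 1 \<Longrightarrow> ramp k t u \<le> ramp k s u + (real k + 1) * (t - s)"
proof -
  assume st: "s \<le> t" "t < 1"
  have "(real k + 1) * (t - u) = (real k + 1) * (s - u) + (real k + 1) * (t - s)" by (simp add: algebra_simps)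
  moreover have "0 \<le> (real k + 1) * (t - s)" using st by simp
  moreover have "max 0 (min 1 (a + d)) \<le> max 0 (min 1 a) + d" if "0 \<le> d" for a d :: real
    using that by (simp add: max_def min_def)
  ultimately show ?thesis using st by (simp add: ramp_def)
qed

section \<open>The distribution function as a monotone strong limit\<close>

definition V where "V k t = Lc (ramp k t)"

lemma V_ops: "V k t \<in> bounded_ops" unfolding V_def by (intro Lc_ops ramp_continuous)

lemma V_mono: "s \<le> t \<Longrightarrow> Q (V k s) x \<le> Q (V k t) x"
  using Lc_le[OF ramp_continuous ramp_continuous, of k s k t 0 x] ramp_mono[of s t k] by (simp add: V_def)

lemma V_mono_index: "k \<le> m \<Longrightarrow> Q (V k t) x \<le> Q (V m t) x"
  using Lc_le[OF ramp_continuous ramp_continuous, of k t m t 0 x] ramp_mono_index[of k m t] by (simp add: V_def)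

lemma V_range: "0 \<le> Q (V k t) x" "Q (V k t) x \<le> (norm x)\<^sup>2"
proof -
  show "0 \<le> Q (V k t) x"
    using Lc_lower[OF ramp_continuous, of 0 k t x] ramp_range(1)[of k t] by (simp add: V_def)
  show "Q (V k t) x \<le> (norm x)\<^sup>2"
    using Lc_le[OF ramp_continuous continuous_on_const, of k t 0 1 x] ramp_range(2)[of k t]
    by (simp add: V_def Lc_const)
qed

lemma V_real: "Im (cinner (blinfun_apply (V k t) x) x) = 0"
  unfolding V_def by (intro Lc_real ramp_continuous)

text \<open>The difference lies between \<open>0\<close> and \<open>I\<close>, so its form dominates
  the square of its norm at \<open>x\<close>. Convergence of the bounded increasing forms thereby
  forces the vectors \<open>V k t x\<close> to be Cauchy.\<close>

lemma V_increment: "k \<le> m \<Longrightarrow> (norm (blinfun_apply (V m t) x - blinfun_apply (V k t) x))\<^sup>2 \<le> Q (V m t) x - Q (V k t) x"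
proof -
  assume km: "k \<le> m"
  have "(norm (blinfun_apply (V m t - V k t) x))\<^sup>2 \<le> Q (V m t - V k t) x"
  proof (rule norm_sq_le_quadratic)
    show "nonneg_op (V m t - V k t)"
      using V_mono_index[OF km] by (simp add: nonneg_op_iff blinfun.diff_left cinner_lin V_real)
    have "Q (V m t) x \<le> Q (V k t) x + (norm x)\<^sup>2" for x
      using V_range(2)[of m t x] V_range(1)[of k t x] by linarith
    then show "op_le (V m t - V k t) id_blinfun"
      by (simp add: op_le_iff blinfun.diff_left cinner_lin V_real cinner_self algebra_simps)
  qed (intro bounded_ops_intros V_ops)
  then show ?thesis by (simp add: blinfun.diff_left cinner_lin)
qed

lemma V_convergent: "convergent (\<lambda>k. blinfun_apply (V k t) x)"
proof -
  have "convergent (\<lambda>k. Q (V k t) x)"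
    using V_range(2)[of _ t x] V_mono_index[of _ _ t x]
    by (intro Bseq_mono_convergent BseqI'[of _ "(norm x)\<^sup>2"]) (auto simp: V_range(1) abs_of_nonneg)
  then have "Cauchy (\<lambda>k. Q (V k t) x)" by (rule convergent_Cauchy)
  then have C: "\<exists>M. \<forall>m\<ge>M. \<forall>n\<ge>M. \<bar>Q (V m t) x - Q (V n t) x\<bar> < e" if "e > 0" for e
    using that by (simp add: Cauchy_iff)
  have "Cauchy (\<lambda>k. blinfun_apply (V k t) x)"
  proof (rule CauchyI)
    fix e :: real assume e: "e > 0"
    then obtain M where M: "\<And>m n. m \<ge> M \<Longrightarrow> n \<ge> M \<Longrightarrow> \<bar>Q (V m t) x - Q (V n t) x\<bar> < e\<^sup>2"
      using C[of "e\<^sup>2"] by auto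
    have "norm (blinfun_apply (V m t) x - blinfun_apply (V n t) x) < e" if "m \<ge> M" "n \<ge> M" "n \<le> m" for m n
    proof -
      have "(norm (blinfun_apply (V m t) x - blinfun_apply (V n t) x))\<^sup>2 < e\<^sup>2"
        using V_increment[OF that(3), of t x] M[OF that(1,2)] by linarith
      then show ?thesis using e by (auto intro: power2_less_imp_less)
    qed
    then show "\<exists>M. \<forall>m\<ge>M. \<forall>n\<ge>M. norm (blinfun_apply (V m t) x - blinfun_apply (V n t) x) < e"
      by (metis linear norm_minus_commute)
  qed
  then show ?thesis by (rule Cauchy_convergent)
qed

text \<open>The limit exists only strongly, so the operator is assembled from limits of
  vectors.\<close>

definition \<rho> :: "real \<Rightarrow> 'a \<Rightarrow>\<^sub>L 'a" where
  "\<rho> t = Blinfun (\<lambda>x. lim (\<lambda>k. blinfun_apply (V k t) x))"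

lemma \<rho>_lim: "(\<lambda>k. blinfun_apply (V k t) x) \<longlonglongrightarrow> blinfun_apply (\<rho> t) x"
proof -
  let ?l = "\<lambda>x. lim (\<lambda>k. blinfun_apply (V k t) x)"
  have lim: "(\<lambda>k. blinfun_apply (V k t) x) \<longlonglongrightarrow> ?l x" for x
    using V_convergent by (simp add: convergent_LIMSEQ_iff)
  have norm_V: "norm (V k t) \<le> 2 * 1" for k
  proof (rule norm_le_numerical_radius[OF V_ops])
    show "cmod (cinner (blinfun_apply (V k t) x) x) \<le> 1 * (norm x)\<^sup>2" for x
      using V_range[of k t x] V_real[of k t x] by (simp add: cmod_eq_Re)
  qed simp
  have "bounded_linear ?l"
  proof (rule bounded_linear_intro)
    show "?l (x + y) = ?l x + ?l y" for x y
      by (rule limI) (use tendsto_add[OF lim lim] in \<open>simp add: blinfun.add_right\<close>)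
    show "?l (r *\<^sub>R x) = r *\<^sub>R ?l x" for r x
      by (rule limI) (use tendsto_scaleR[OF tendsto_const lim] in \<open>simp add: blinfun.scaleR_right\<close>)
    show "norm (?l x) \<le> norm x * 2" for x
    proof (rule tendsto_norm_bound[OF lim])
      show "norm (blinfun_apply (V k t) x) \<le> norm x * 2" for k
        using order_trans[OF norm_blinfun mult_right_mono[OF norm_V[of k]]] by (simp add: mult.commute)
    qed
  qed
  then have "blinfun_apply (\<rho> t) x = ?l x" by (simp add: \<rho>_def bounded_linear_Blinfun_apply)
  then show ?thesis using lim by simp
qed

lemma \<rho>_ops: "\<rho> t \<in> bounded_ops"
proof -
  have "blinfun_apply (\<rho> t) (c *\<^sub>C x) = c *\<^sub>C blinfun_apply (\<rho> t) x" for c x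
    using \<rho>_lim[of t "c *\<^sub>C x"] tendsto_scaleC[OF \<rho>_lim[of t x], of c]
    by (simp add: bounded_opsD[OF V_ops] LIMSEQ_unique)
  then show ?thesis by (simp add: bounded_ops_def)
qed

lemma Q_\<rho>_lim: "(\<lambda>k. Q (V k t) x) \<longlonglongrightarrow> Q (\<rho> t) x"
  by (intro tendsto_Re tendsto_cinner \<rho>_lim tendsto_const)

lemma \<rho>_real: "Im (cinner (blinfun_apply (\<rho> t) x) x) = 0"
  using tendsto_Im[OF tendsto_cinner[OF \<rho>_lim[of t x] tendsto_const, of x]]
  by (simp add: V_real LIMSEQ_const_iff)

lemma \<rho>_mono: "s \<le> t \<Longrightarrow> Q (\<rho> s) x \<le> Q (\<rho> t) x"
  using V_mono[of s t] by (intro LIMSEQ_le[OF Q_\<rho>_lim Q_\<rho>_lim]) blast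

lemma \<rho>_range: "0 \<le> Q (\<rho> t) x" "Q (\<rho> t) x \<le> (norm x)\<^sup>2"
  using V_range by (intro LIMSEQ_le_const[OF Q_\<rho>_lim] LIMSEQ_le_const2[OF Q_\<rho>_lim]; blast)+

lemma V_le_\<rho>: "Q (V k t) x \<le> Q (\<rho> t) x"
  using V_mono_index[of k _ t x] by (intro LIMSEQ_le_const[OF Q_\<rho>_lim]) blast

lemma \<rho>_increment:
  assumes st: "s \<le> t"
  shows "(norm (blinfun_apply (\<rho> t) x - blinfun_apply (\<rho> s) x))\<^sup>2 \<le> Q (\<rho> t) x - Q (\<rho> s) x"
proof -
  have "(norm (blinfun_apply (\<rho> t - \<rho> s) x))\<^sup>2 \<le> Q (\<rho> t - \<rho> s) x"
  proof (rule norm_sq_le_quadratic)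
    show "nonneg_op (\<rho> t - \<rho> s)"
      using \<rho>_mono[OF st] by (simp add: nonneg_op_iff blinfun.diff_left cinner_lin \<rho>_real)
    have "Q (\<rho> t) x \<le> Q (\<rho> s) x + (norm x)\<^sup>2" for x
      using \<rho>_range(2)[of t x] \<rho>_range(1)[of s x] by linarith
    then show "op_le (\<rho> t - \<rho> s) id_blinfun"
      by (simp add: op_le_iff blinfun.diff_left cinner_lin \<rho>_real cinner_self algebra_simps)
  qed (intro bounded_ops_intros \<rho>_ops)
  then show ?thesis by (simp add: blinfun.diff_left cinner_lin)
qed

text \<open>The form is a supremum of functions that are Lipschitz in \<open>t\<close>, hence lower
  semicontinuous, and monotonicity makes this continuity from the left. At \<open>t = 1\<close> the
  ramp is constant by convention and the Lipschitz estimate breaks down.\<close>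

lemma Q_\<rho>_left_continuous:
  assumes t: "t < 1"
  shows "((\<lambda>s. Q (\<rho> s) x) \<longlongrightarrow> Q (\<rho> t) x) (at_left t)"
proof (rule tendstoI)
  fix e :: real assume e: "e > 0"
  have "\<forall>\<^sub>F k in sequentially. dist (Q (V k t) x) (Q (\<rho> t) x) < e / 2"
    using Q_\<rho>_lim e by (intro tendstoD) auto
  then obtain k where "dist (Q (V k t) x) (Q (\<rho> t) x) < e / 2"
    using eventually_happens'[OF sequentially_bot] by blast
  then have k: "Q (\<rho> t) x - e / 2 < Q (V k t) x" unfolding dist_real_def by linarith
  \<comment> \<open>Chosen so that the Lipschitz constant \<open>real k + 1\<close>, times
    \<open>d\<close> and \<open>(norm x)\<^sup>2 + 1\<close>, is \<open>e / 2\<close>; the added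
    \<open>1\<close> covers \<open>x = 0\<close>.\<close>
  define d where "d = e / (2 * (real k + 1) * ((norm x)\<^sup>2 + 1))"
  have d: "d > 0" using e by (simp add: d_def add_nonneg_pos)
  have "dist (Q (\<rho> s) x) (Q (\<rho> t) x) < e" if s: "t - d < s" "s < t" for s
  proof -
    have "Q (V k t) x \<le> Q (V k s) x + (real k + 1) * (t - s) * (norm x)\<^sup>2"
      unfolding V_def using ramp_lipschitz[of s t k] s t by (intro Lc_le ramp_continuous) auto
    moreover have "(real k + 1) * (t - s) * (norm x)\<^sup>2 \<le> e / 2"
    proof -
      have "(real k + 1) * (t - s) * (norm x)\<^sup>2 \<le> (real k + 1) * d * ((norm x)\<^sup>2 + 1)"
        using s d by (intro mult_mono) auto
      also have "\<dots> = e / 2" 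
      proof -
        have "K * (e / (2 * K * P)) * P = e / 2" if "K > 0" "P > 0" for K P :: real
          using that by simp
        moreover have "0 < (norm x)\<^sup>2 + 1" by (simp add: add_nonneg_pos)
        moreover have "0 < real k + 1" by simp
        ultimately show ?thesis unfolding d_def by blast
      qed
      finally show ?thesis .
    qed
    ultimately have "Q (\<rho> t) x - e < Q (\<rho> s) x" using k V_le_\<rho>[of k s x] by linarith
    then show ?thesis using \<rho>_mono[of s t x] s by (simp add: dist_real_def)
  qed
  then show "\<forall>\<^sub>F s in at_left t. dist (Q (\<rho> s) x) (Q (\<rho> t) x) < e"
    unfolding eventually_at_left_field using d by (intro exI[of _ "t - d"]) auto
qed

lemma \<rho>_left_continuous:
  assumes t: "t < 1"
  shows "((\<lambda>s. blinfun_apply (\<rho> s) x) \<longlongrightarrow> blinfun_apply (\<rho> t) x) (at_left t)"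
proof (rule Lim_null[THEN iffD2], rule tendsto_norm_zero_cancel)
  have "((\<lambda>s. sqrt (Q (\<rho> t) x - Q (\<rho> s) x)) \<longlongrightarrow> sqrt (Q (\<rho> t) x - Q (\<rho> t) x)) (at_left t)"
    by (intro tendsto_real_sqrt tendsto_diff tendsto_const Q_\<rho>_left_continuous t)
  then have lim: "((\<lambda>s. sqrt (Q (\<rho> t) x - Q (\<rho> s) x)) \<longlongrightarrow> 0) (at_left t)" by simp
  show "((\<lambda>s. norm (blinfun_apply (\<rho> s) x - blinfun_apply (\<rho> t) x)) \<longlongrightarrow> 0) (at_left t)"
  proof (rule tendsto_sandwich[OF _ _ tendsto_const lim])
    show "\<forall>\<^sub>F s in at_left t. norm (blinfun_apply (\<rho> s) x - blinfun_apply (\<rho> t) x) \<le> sqrt (Q (\<rho> t) x - Q (\<rho> s) x)"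
      unfolding eventually_at_left_field
      using \<rho>_increment[of _ t x] by (intro exI[of _ "t - 1"]) (auto intro!: real_le_rsqrt simp: norm_minus_commute)
  qed simp
qed

definition \<sigma> where "\<sigma> = restrict \<rho> {-1..1}"

lemma distribution_\<sigma>: "distribution \<sigma>"
proof
  \<comment> \<open>On \<open>[-1, 1]\<close> the ramp at \<open>-1\<close> is \<open>0\<close> and
    the ramp at \<open>1\<close> is \<open>1\<close>, so both end values hold already for every
    \<open>k\<close>.\<close>
  have "Lc (ramp k (-1)) = Lc (\<lambda>_. 0)" for k
    by (intro Lc_cong ramp_continuous ramp_eq_0) auto
  then have "V k (-1) = 0" for k by (simp add: V_def Lc_const)
  then have m1: "\<rho> (-1) = 0"
    using \<rho>_lim[of "-1"] by (intro blinfun_eqI) (simp add: LIMSEQ_const_iff)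
  have "ramp k 1 = (\<lambda>_. 1)" for k by (simp add: ramp_def fun_eq_iff)
  then have "V k 1 = id_blinfun" for k by (simp add: V_def Lc_const)
  then have p1: "\<rho> 1 = id_blinfun"
    using \<rho>_lim[of 1] by (intro blinfun_eqI) (simp add: LIMSEQ_const_iff)
  have "((\<lambda>s. blinfun_apply (\<sigma> s) x) \<longlongrightarrow> blinfun_apply (\<sigma> t) x) (at_left t)"
    if t: "t \<in> {-1<..<1}" for t x
  proof -
    have "\<forall>\<^sub>F s in at_left t. blinfun_apply (\<rho> s) x = blinfun_apply (\<sigma> s) x"
      unfolding eventually_at_left_field using t by (intro exI[of _ "-1"]) (auto simp: \<sigma>_def)
    moreover have "\<sigma> t = \<rho> t" using t by (simp add: \<sigma>_def)
    ultimately show ?thesis using \<rho>_left_continuous[of t x] t by (simp add: tendsto_cong)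
  qed
  moreover have "op_le (\<sigma> s) (\<sigma> t)" if "-1 \<le> s" "s \<le> t" "t \<le> 1" for s t
    using that \<rho>_mono[of s t] by (simp add: \<sigma>_def op_le_iff \<rho>_real)
  ultimately show "\<sigma> \<in> distribution_functions"
    unfolding distribution_functions_def using m1 p1 by (auto simp: \<sigma>_def \<rho>_ops)
qed

text \<open>Before the limit in \<open>k\<close>, the Riemann sum is the form of \<open>Lc\<close>
  at a combination of ramp differences. These form a partition of unity on \<open>[-1, 1]\<close>,
  each supported near its cell, so the combination is uniformly close to \<open>f\<close>.\<close>

lemma \<sigma>_sum_approx:
  assumes f: "continuous_on {-1..1} f"
    and p: "p tagged_division_of {-1..1}" "(\<lambda>t. ball t \<delta>) fine p" and \<delta>: "\<delta> > 0"
    and \<omega>: "\<And>u v. u \<in> {-1..1} \<Longrightarrow> v \<in> {-1..1} \<Longrightarrow> \<bar>u - v\<bar> < 2 * \<delta> \<Longrightarrow> \<bar>f u - f v\<bar> \<le> \<omega>"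
  shows "\<bar>Q (stieltjes_sum \<sigma> p (\<lambda>t. of_real (f t))) x - Q (Lc f) x\<bar> \<le> \<omega> * (norm x)\<^sup>2"
proof (rule LIMSEQ_le_const2)
  let ?X = "\<lambda>k. \<Sum>c\<in>p. f (fst c) * (Q (V k (Sup (snd c))) x - Q (V k (Inf (snd c))) x)"
  have "?X \<longlonglongrightarrow> (\<Sum>c\<in>p. f (fst c) * (Q (\<rho> (Sup (snd c))) x - Q (\<rho> (Inf (snd c))) x))"
    by (intro tendsto_intros Q_\<rho>_lim)
  also have "(\<Sum>c\<in>p. f (fst c) * (Q (\<rho> (Sup (snd c))) x - Q (\<rho> (Inf (snd c))) x))
      = Q (stieltjes_sum \<sigma> p (\<lambda>t. of_real (f t))) x"
  proof -
    have "\<sigma> (Sup (snd c)) = \<rho> (Sup (snd c))" "\<sigma> (Inf (snd c)) = \<rho> (Inf (snd c))" if "c \<in> p" for c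
      using tagged_division_cell[OF p(1) that] by (auto simp: \<sigma>_def)
    then show ?thesis
      by (simp add: stieltjes_sum_def blinfun.sum_left blinfun.diff_left cinner_lin)
  qed
  finally show "(\<lambda>k. \<bar>?X k - Q (Lc f) x\<bar>) \<longlonglongrightarrow> \<bar>Q (stieltjes_sum \<sigma> p (\<lambda>t. of_real (f t))) x - Q (Lc f) x\<bar>"
    by (intro tendsto_intros)
  obtain K :: nat where K: "1 / \<delta> < real K" using reals_Archimedean2 by blast
  have "\<bar>?X k - Q (Lc f) x\<bar> \<le> \<omega> * (norm x)\<^sup>2" if k: "k \<ge> K" for k
  proof -
    \<comment> \<open>A ramp descends over a width \<open>1 / (real k + 1)\<close>; for such
      \<open>k\<close> its difference over a cell lives within \<open>\<delta>\<close> of the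
      cell.\<close>
    have k\<delta>: "1 / (real k + 1) < \<delta>"
    proof -
      have "1 / \<delta> < real k + 1" using K k by linarith
      then show ?thesis using \<delta> by (simp add: field_simps)
    qed
    let ?F = "\<lambda>u. \<Sum>c\<in>p. f (fst c) * (ramp k (Sup (snd c)) u - ramp k (Inf (snd c)) u)"
    have Fc: "continuous_on {-1..1} ?F" by (intro continuous_intros ramp_continuous)
    have "Lc ?F = (\<Sum>c\<in>p. f (fst c) *\<^sub>R (V k (Sup (snd c)) - V k (Inf (snd c))))"
      by (subst Lc_sum) (auto simp: V_def Lc_diff ramp_continuous intro!: continuous_intros)
    then have "?X k = Q (Lc ?F) x"
      by (simp add: blinfun.sum_left blinfun.scaleR_left blinfun.diff_left cinner_lin)
    moreover have "\<bar>Q (Lc ?F) x - Q (Lc f) x\<bar> \<le> \<omega> * (norm x)\<^sup>2"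
    proof (rule Lc_abs_le[OF Fc f])
      fix u :: real assume u: "u \<in> {-1..1}"
      let ?D = "\<lambda>c. ramp k (Sup (snd c)) u - ramp k (Inf (snd c)) u"
      have D1: "(\<Sum>c\<in>p. ?D c) = 1"
        using tagged_division_telescope[OF p(1), of "\<lambda>t. ramp k t u"] u ramp_eq_0[of "-1" u k]
        by (simp add: ramp_def)
      have "?F u - f u = (\<Sum>c\<in>p. (f (fst c) - f u) * ?D c)"
        using D1 by (simp add: left_diff_distrib sum_subtractf flip: sum_distrib_left)
      also have "\<bar>\<dots>\<bar> \<le> (\<Sum>c\<in>p. \<omega> * ?D c)"
      proof (rule order_trans[OF sum_abs sum_mono])
        fix c assume c: "c \<in> p"
        note cell = tagged_division_cell[OF p(1) c]
        have D0: "0 \<le> ?D c" using ramp_mono[of "Inf (snd c)" "Sup (snd c)" k u] cell by simp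
        show "\<bar>(f (fst c) - f u) * ?D c\<bar> \<le> \<omega> * ?D c"
        proof (cases "?D c = 0")
          case False
          have "u \<le> Sup (snd c)"
          proof (rule ccontr)
            assume "\<not> ?thesis"
            then have "ramp k (Sup (snd c)) u = 0" "ramp k (Inf (snd c)) u = 0"
              using u cell by (auto intro!: ramp_eq_0)
            then show False using False by simp
          qed
          moreover have "Inf (snd c) - 1 / (real k + 1) < u"
          proof (rule ccontr)
            assume "\<not> ?thesis"
            then have "ramp k (Sup (snd c)) u = 1" "ramp k (Inf (snd c)) u = 1"
              using cell by (auto intro!: ramp_eq_1)
            then show False using False by simp
          qed
          moreover have "\<bar>fst c - Inf (snd c)\<bar> < \<delta>" "\<bar>fst c - Sup (snd c)\<bar> < \<delta>"
            using cell by (intro fine_cell[OF p c]; metis atLeastAtMost_iff order.refl order.trans)+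
          ultimately have "\<bar>fst c - u\<bar> < 2 * \<delta>" using k\<delta> \<delta> by linarith
          then have "\<bar>f (fst c) - f u\<bar> \<le> \<omega>" using u cell by (intro \<omega>) auto
          then show ?thesis unfolding abs_mult using D0 by (simp add: mult_right_mono)
        qed simp
      qed
      also have "\<dots> = \<omega>" using D1 by (simp flip: sum_distrib_left)
      finally show "\<bar>?F u - f u\<bar> \<le> \<omega>" .
    qed
    ultimately show ?thesis by simp
  qed
  then show "\<exists>K. \<forall>k\<ge>K. \<bar>?X k - Q (Lc f) x\<bar> \<le> \<omega> * (norm x)\<^sup>2" by blast
qed

lemma stieltjes_integral_\<sigma>:
  assumes f: "continuous_on {-1..1} f"
  shows "stieltjes_integral (\<lambda>t. of_real (f t)) \<sigma> = Lc f"
proof (rule quadratic_form_eq_imp)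
  interpret D: distribution \<sigma> by (rule distribution_\<sigma>)
  have fc: "continuous_on {-1..1} (\<lambda>t. complex_of_real (f t))" by (intro continuous_intros f)
  then show "D.\<Phi> (\<lambda>t. of_real (f t)) \<in> bounded_ops" by (rule D.\<Phi>_ops)
  show "Lc f \<in> bounded_ops" by (rule Lc_ops[OF f])
  fix x
  let ?S = "\<lambda>n. stieltjes_sum \<sigma> (fine_division n) (\<lambda>t. of_real (f t))"
  have "(\<lambda>n. Q (?S n) x) \<longlonglongrightarrow> Q (Lc f) x"
  proof (rule LIMSEQ_I)
    fix e :: real assume e: "e > 0"
    define w where "w = e / (2 * ((norm x)\<^sup>2 + 1))"
    have pos: "(norm x)\<^sup>2 + 1 > 0" using add_nonneg_pos[of "(norm x)\<^sup>2" 1] by simp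
    have w: "w > 0" using e pos by (simp add: w_def)
    have we: "w * (norm x)\<^sup>2 < e"
    proof -
      have "w * (norm x)\<^sup>2 \<le> w * ((norm x)\<^sup>2 + 1)" using w by (intro mult_left_mono) auto
      also have "\<dots> = e / 2"
      proof -
        have "e / (2 * P) * P = e / 2" if "P > 0" for P using that by simp
        then show ?thesis unfolding w_def using pos .
      qed
      finally show ?thesis using e by simp
    qed
    have "uniformly_continuous_on {-1..1} f" using f by (intro compact_uniformly_continuous) auto
    then obtain d where d: "d > 0" "\<And>u v. u \<in> {-1..1} \<Longrightarrow> v \<in> {-1..1} \<Longrightarrow> dist u v < d \<Longrightarrow> dist (f u) (f v) < w"
      unfolding uniformly_continuous_on_def using w by metis
    have \<omega>: "\<bar>f u - f v\<bar> \<le> w" if "u \<in> {-1..1}" "v \<in> {-1..1}" "\<bar>u - v\<bar> < 2 * (d / 2)" for u v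
      using d(2)[OF that(1,2)] that(3) by (simp add: dist_real_def)
    obtain N where N: "\<And>n. n \<ge> N \<Longrightarrow> (\<lambda>t. ball t (d / 2)) fine fine_division n"
      using fine_division_finer[of "d / 2"] d by auto
    have "\<bar>Q (?S n) x - Q (Lc f) x\<bar> < e" if "n \<ge> N" for n
      using \<sigma>_sum_approx[OF f fine_division(1) N[OF that] _ \<omega>] d(1) we by (meson half_gt_zero order.strict_trans1)
    then show "\<exists>N. \<forall>n\<ge>N. norm (Q (?S n) x - Q (Lc f) x) < e" by auto
  qed
  moreover have "(\<lambda>n. Q (?S n) x) \<longlonglongrightarrow> Q (D.\<Phi> (\<lambda>t. of_real (f t))) x"
    by (intro tendsto_Re tendsto_quadratic D.\<Phi>_lim fc)
  ultimately have "Q (D.\<Phi> (\<lambda>t. of_real (f t))) x = Q (Lc f) x" using LIMSEQ_unique by blast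
  moreover have "Im (cinner (blinfun_apply (D.\<Phi> (\<lambda>t. of_real (f t))) x) x) = 0"
    using D.\<Phi>_adjoint[OF fc, of x x] arg_cong[OF cinner_commute[of x "blinfun_apply (D.\<Phi> (\<lambda>t. of_real (f t))) x"], of Im]
    by simp
  ultimately show "cinner (blinfun_apply (D.\<Phi> (\<lambda>t. of_real (f t))) x) x = cinner (blinfun_apply (Lc f) x) x"
    using Lc_real[OF f] by (simp add: complex_eq_iff)
qed

lemma moments_\<sigma>: "stieltjes_integral (\<lambda>t. of_real (t ^ n)) \<sigma> = S n"
proof -
  have "poly (monom 1 n) = (\<lambda>t::real. t ^ n)" by (simp add: poly_monom fun_eq_iff)
  then have "Lc (\<lambda>t. t ^ n) = S n" using Lc_poly[of "monom 1 n"] by (simp add: L_monom)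
  then show ?thesis using stieltjes_integral_\<sigma>[of "\<lambda>t. t ^ n"] by (simp add: continuous_intros)
qed

end

section \<open>From the class RS to distribution functions\<close>

locale RS_function =
  fixes \<Omega> :: "complex \<Rightarrow> 'a::hilbert_space \<Rightarrow>\<^sub>L 'a"
  assumes RS: "\<Omega> \<in> RS"
begin

lemma ops: "z \<in> slit_plane \<Longrightarrow> \<Omega> z \<in> bounded_ops"
  using RS by (simp add: RS_def)

lemma holomorphic: "(\<lambda>z. cinner (blinfun_apply (\<Omega> z) x) y) holomorphic_on slit_plane"
  using RS by (intro op_holomorphic_imp_holomorphic) (simp add: RS_def)

lemma scalar: "scalar_RS (\<lambda>z. cinner (blinfun_apply (\<Omega> z) x) x) ((norm x)\<^sup>2)"
proof
  show "(\<lambda>z. cinner (blinfun_apply (\<Omega> z) x) x) holomorphic_on slit_plane" by (rule holomorphic)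
  show "0 \<le> Im z * Im (cinner (blinfun_apply (\<Omega> z) x) x)" if "Im z \<noteq> 0" for z
  proof -
    have z: "z \<in> - \<real>" using that by (auto simp: complex_is_Real_iff)
    then have "nonneg_op (Im z *\<^sub>R Im_op (\<Omega> z))" using RS by (simp add: RS_def nevanlinna_def)
    then have "0 \<le> Im z * Re (cinner (blinfun_apply (Im_op (\<Omega> z)) x) x)"
      by (simp add: nonneg_op_iff blinfun.scaleR_left cinner_lin)
    then show ?thesis
      by (simp add: Im_op_quadratic[OF ops[OF not_real_slit_plane[OF z]]])
  qed
  have *: "op_le (- id_blinfun) (\<Omega> r) \<and> op_le (\<Omega> r) id_blinfun" if "\<bar>r\<bar> < 1" for r :: real
    using RS that by (auto simp: RS_def abs_less_iff)
  show "Im (cinner (blinfun_apply (\<Omega> r) x) x) = 0" if "\<bar>r\<bar> < 1" for r :: real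
    using *[OF that] by (auto simp: op_le_iff cinner_self)
  show "\<bar>Re (cinner (blinfun_apply (\<Omega> r) x) x)\<bar> \<le> (norm x)\<^sup>2" if "\<bar>r\<bar> < 1" for r :: real
  proof -
    have "- (norm x)\<^sup>2 \<le> Re (cinner (blinfun_apply (\<Omega> r) x) x)" "Re (cinner (blinfun_apply (\<Omega> r) x) x) \<le> (norm x)\<^sup>2"
      using *[OF that] by (auto simp: op_le_iff cinner_self blinfun.minus_left cinner_lin)
    then show ?thesis by linarith
  qed
qed

definition G where "G x y z = (cinner x y - z * cinner (blinfun_apply (\<Omega> z) x) y) / (1 - z\<^sup>2)"

text \<open>The moments as forms in two vectors: their sesquilinearity makes them operators, and on
  the diagonal they are the scalar moments, for which positivity is known.\<close>

definition coefficient where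
  "coefficient n x y = (- 1) ^ n * ((deriv ^^ n) (G x y) 0 / fact n)"

lemma G_holomorphic: "G x y holomorphic_on ball 0 1"
proof -
  have "(\<lambda>z. cinner (blinfun_apply (\<Omega> z) x) y) holomorphic_on ball 0 1"
    using slit_planeI by (intro holomorphic_on_subset[OF holomorphic]) auto
  then show ?thesis
    unfolding G_def[abs_def] using scalar_RS.one_minus_square_nz[OF scalar]
    by (intro holomorphic_intros) auto
qed

lemma coefficient_self: "coefficient n x x = scalar_RS.s (\<lambda>z. cinner (blinfun_apply (\<Omega> z) x) x) ((norm x)\<^sup>2) n"
proof -
  have "G x x = scalar_RS.G (\<lambda>z. cinner (blinfun_apply (\<Omega> z) x) x) ((norm x)\<^sup>2)"
    by (simp add: fun_eq_iff G_def scalar_RS.G_def[OF scalar] cinner_self)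
  then show ?thesis by (simp add: coefficient_def scalar_RS.s_def[OF scalar])
qed

lemma coefficient_sesquilinear: "sesquilinear_form (coefficient n)"
proof
  fix x y z :: 'a and c :: complex
  have [simp]: "(0::complex) \<in> ball 0 1" by simp
  have slit: "blinfun_apply (\<Omega> w) (c *\<^sub>C x) = c *\<^sub>C blinfun_apply (\<Omega> w) x" if "w \<in> ball 0 1" for w
    using ops[OF slit_planeI] that by (simp add: bounded_opsD)
  \<comment> \<open>Complex linearity of \<open>\<Omega> w\<close> is available only on the slit
    plane, so the derivatives are compared through agreement near \<open>0\<close>.\<close>
  have cong: "(deriv ^^ n) f 0 = (deriv ^^ n) g 0" if "\<And>w. w \<in> ball 0 1 \<Longrightarrow> f w = g w" for f g :: "complex \<Rightarrow> complex"
    using that by (intro higher_deriv_cong_ev eventually_nhds_in_open[of "ball 0 1", THEN eventually_mono]) auto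
  have "G (x + y) z = (\<lambda>w. G x z w + G y z w)" "G x (y + z) = (\<lambda>w. G x y w + G x z w)"
    by (simp_all add: fun_eq_iff G_def blinfun.add_right cinner_lin add_divide_distrib[symmetric] algebra_simps)
  then show "coefficient n (x + y) z = coefficient n x z + coefficient n y z"
    "coefficient n x (y + z) = coefficient n x y + coefficient n x z"
    using higher_deriv_add[OF G_holomorphic G_holomorphic open_ball]
    by (simp_all add: coefficient_def add_divide_distrib distrib_left)
  have "(deriv ^^ n) (G (c *\<^sub>C x) y) 0 = (deriv ^^ n) (\<lambda>w. c * G x y w) 0"
    by (rule cong) (simp add: G_def slit cinner_lin right_diff_distrib mult_ac)
  then show "coefficient n (c *\<^sub>C x) y = c * coefficient n x y"
    using higher_deriv_cmult[OF G_holomorphic _ open_ball] by (simp add: coefficient_def)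
  have "(deriv ^^ n) (G x (c *\<^sub>C y)) 0 = (deriv ^^ n) (\<lambda>w. cnj c * G x y w) 0"
    by (rule cong) (simp add: G_def cinner_lin right_diff_distrib mult_ac)
  then show "coefficient n x (c *\<^sub>C y) = cnj c * coefficient n x y"
    using higher_deriv_cmult[OF G_holomorphic _ open_ball] by (simp add: coefficient_def)
qed

text \<open>The polynomials \<open>1 + t ^ n\<close> and \<open>1 - t ^ n\<close> are nonnegative on
  \<open>[-1, 1]\<close>, so the \<open>n\<close>-th moment is at most the zeroth in
  modulus.\<close>

lemma coefficient_quadratic_bound: "cmod (coefficient n x x) \<le> 1 * (norm x)\<^sup>2"
proof -
  interpret f: scalar_RS "\<lambda>z. cinner (blinfun_apply (\<Omega> z) x) x" "(norm x)\<^sup>2" by (rule scalar)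
  have *: "0 \<le> (norm x)\<^sup>2 + c * Re (f.s n)" if c: "\<bar>c\<bar> \<le> 1" for c
  proof -
    \<comment> \<open>Written as a sum so that the two coefficients add up when
      \<open>n = 0\<close>.\<close>
    define a where "a i = (if i = 0 then 1 else 0) + (if i = n then c else 0)" for i :: nat
    have "0 \<le> (\<Sum>i\<le>n. a i * Re (f.s i))"
    proof (rule f.moment_functional_nonneg)
      fix t :: real assume t: "t \<in> {-1..1}"
      have "(\<Sum>i\<le>n. a i * t ^ i) = (\<Sum>i\<le>n. if i = 0 then t ^ i else 0) + (\<Sum>i\<le>n. if i = n then c * t ^ i else 0)"
        unfolding sum.distrib[symmetric] a_def by (intro sum.cong) (auto simp: algebra_simps)
      also have "\<dots> = 1 + c * t ^ n" by simp
      finally have "(\<Sum>i\<le>n. a i * t ^ i) = 1 + c * t ^ n" .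
      moreover have "\<bar>c * t ^ n\<bar> \<le> 1 * 1"
        unfolding abs_mult power_abs using t c by (intro mult_mono power_le_one) auto
      ultimately show "0 \<le> (\<Sum>i\<le>n. a i * t ^ i)" by linarith
    qed
    also have "(\<Sum>i\<le>n. a i * Re (f.s i)) = (\<Sum>i\<le>n. if i = 0 then Re (f.s i) else 0) + (\<Sum>i\<le>n. if i = n then c * Re (f.s i) else 0)"
      unfolding sum.distrib[symmetric] a_def by (intro sum.cong) (auto simp: algebra_simps)
    also have "\<dots> = (norm x)\<^sup>2 + c * Re (f.s n)" by (simp add: f.s_0)
    finally show ?thesis .
  qed
  show ?thesis
    using *[of 1] *[of "- 1"] f.s_real[of n] by (simp add: coefficient_self cmod_eq_Re abs_le_iff)
qed

definition moment_op :: "nat \<Rightarrow> 'a \<Rightarrow>\<^sub>L 'a" where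
  "moment_op n = (SOME T. T \<in> bounded_ops \<and> (\<forall>x y. cinner (blinfun_apply T x) y = coefficient n x y))"

lemma moment_op: "moment_op n \<in> bounded_ops" "cinner (blinfun_apply (moment_op n) x) y = coefficient n x y"
proof -
  obtain T where "T \<in> bounded_ops" "\<And>x y. cinner (blinfun_apply T x) y = coefficient n x y"
    by (rule operator_of_form[OF coefficient_sesquilinear
          sesquilinear_form.bound_of_quadratic_bound[OF coefficient_sesquilinear coefficient_quadratic_bound]]) auto
  then have "\<exists>T. T \<in> bounded_ops \<and> (\<forall>x y. cinner (blinfun_apply T x) y = coefficient n x y)" by blast
  from someI_ex[OF this] show "moment_op n \<in> bounded_ops"
    "cinner (blinfun_apply (moment_op n) x) y = coefficient n x y"
    unfolding moment_op_def by auto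
qed

lemma moment_sequence: "moment_sequence moment_op"
proof
  show "moment_op n \<in> bounded_ops" for n by (rule moment_op)
  show "moment_op 0 = id_blinfun"
    by (rule quadratic_form_eq_imp) (simp_all add: moment_op coefficient_def G_def)
  fix p :: "real poly" assume p: "\<And>t. t \<in> {-1..1} \<Longrightarrow> 0 \<le> poly p t"
  show "nonneg_op (\<Sum>i\<le>degree p. coeff p i *\<^sub>R moment_op i)"
    unfolding nonneg_op_iff
  proof
    fix x
    interpret f: scalar_RS "\<lambda>z. cinner (blinfun_apply (\<Omega> z) x) x" "(norm x)\<^sup>2" by (rule scalar)
    have eq: "cinner (blinfun_apply (\<Sum>i\<le>degree p. coeff p i *\<^sub>R moment_op i) x) x
       = (\<Sum>i\<le>degree p. of_real (coeff p i) * f.s i)"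
      by (simp add: blinfun.sum_left blinfun.scaleR_left cinner_lin moment_op coefficient_self)
    have "0 \<le> (\<Sum>i\<le>degree p. coeff p i * Re (f.s i))"
      using p by (intro f.moment_functional_nonneg) (simp add: poly_altdef)
    then show "Im (cinner (blinfun_apply (\<Sum>i\<le>degree p. coeff p i *\<^sub>R moment_op i) x) x) = 0 \<and>
       0 \<le> Re (cinner (blinfun_apply (\<Sum>i\<le>degree p. coeff p i *\<^sub>R moment_op i) x) x)"
      unfolding eq by (simp add: f.s_real)
  qed
qed

text \<open>In the unit disc both functions have the same resolvent series, because
  \<open>\<sigma>\<close> was built with the Taylor coefficients of \<open>\<Omega>\<close> as
  moments; analytic continuation covers the rest of the slit plane.\<close>

theorem distribution_exists:
  obtains \<sigma> where "distribution \<sigma>" "\<And>z. z \<in> slit_plane \<Longrightarrow> stieltjes_integral (mobius_kernel z) \<sigma> = \<Omega> z"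
proof -
  interpret M: moment_sequence moment_op by (rule moment_sequence)
  interpret D: distribution M.\<sigma> by (rule M.distribution_\<sigma>)
  have "D.\<Phi> (mobius_kernel z) = \<Omega> z" if z: "z \<in> slit_plane" for z
  proof (rule quadratic_form_eq_imp)
    show "D.\<Phi> (mobius_kernel z) \<in> bounded_ops" by (intro D.\<Phi>_ops continuous_on_kernel z)
    show "\<Omega> z \<in> bounded_ops" by (rule ops[OF z])
    fix x
    interpret f: scalar_RS "\<lambda>z. cinner (blinfun_apply (\<Omega> z) x) x" "(norm x)\<^sup>2" by (rule scalar)
    show "cinner (blinfun_apply (D.\<Phi> (mobius_kernel z)) x) x = cinner (blinfun_apply (\<Omega> z) x) x"
    proof (rule slit_plane_identity[where r = 1, OF _ holomorphic _ _ _ z])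
      show "(\<lambda>z. cinner (blinfun_apply (D.\<Phi> (mobius_kernel z)) x) x) holomorphic_on slit_plane"
        using op_holomorphic_imp_holomorphic[OF D.op_holomorphic_\<Phi>, of x x]
        by (rule holomorphic_transform) simp
      fix w :: complex assume w: "cmod w < 1"
      note ws = slit_planeI[OF w]
      show "cinner (blinfun_apply (D.\<Phi> (mobius_kernel w)) x) x = cinner (blinfun_apply (\<Omega> w) x) x"
      \<comment> \<open>The resolvent identity determines \<open>w\<close> times the function and
        says nothing at \<open>w = 0\<close>; there the kernel is \<open>t\<close>, the first
        moment.\<close>
      proof (cases "w = 0")
        case True
        have "mobius_kernel 0 = (\<lambda>t. of_real (t ^ 1))" by (simp add: mobius_kernel_def fun_eq_iff)
        then have "D.\<Phi> (mobius_kernel 0) = moment_op 1" by (simp only: M.moments_\<sigma>)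
        then show ?thesis using True by (simp add: moment_op coefficient_self f.s_1)
      next
        case False
        have "(\<lambda>n. cinner (blinfun_apply ((- w) ^ n *\<^sub>C D.moment n) x) x) sums
            cinner (blinfun_apply (D.\<Phi> (\<lambda>t. 1 / (1 + w * of_real t))) x) x"
          by (rule bounded_linear.sums[OF bounded_linear_quadratic D.resolvent_sums[OF w]])
        then have "(\<lambda>n. f.s n * (- w) ^ n) sums cinner (blinfun_apply (D.\<Phi> (\<lambda>t. 1 / (1 + w * of_real t))) x) x"
          by (simp add: M.moments_\<sigma> moment_op coefficient_self cinner_lin mult.commute del: of_real_power)
        then have eq: "cinner (blinfun_apply (D.\<Phi> (\<lambda>t. 1 / (1 + w * of_real t))) x) x = f.G w"
          using f.G_sums[OF w] sums_unique2 by blast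
        have "(1 - w\<^sup>2) * cinner (blinfun_apply (D.\<Phi> (\<lambda>t. 1 / (1 + w * of_real t))) x) x
          = cinner x x - w * cinner (blinfun_apply (D.\<Phi> (mobius_kernel w)) x) x"
          using arg_cong[OF D.resolvent_identity_\<Phi>[OF ws], of "\<lambda>T. cinner (blinfun_apply T x) x"]
          by (simp add: blinfun.diff_left cinner_lin)
        moreover have "(1 - w\<^sup>2) * f.G w = cinner x x - w * cinner (blinfun_apply (\<Omega> w) x) x"
          using f.one_minus_square_nz[OF w] by (simp add: f.G_def cinner_self)
        ultimately show ?thesis using False unfolding eq by simp
      qed
    qed auto
  qed
  then show thesis using that M.distribution_\<sigma> by blast
qed

end

section \<open>Dilations\<close>

lemma clinear_onD:
  assumes "clinear_on H T"
  shows "x \<in> H \<Longrightarrow> y \<in> H \<Longrightarrow> T (x + y) = T x + T y" "x \<in> H \<Longrightarrow> T (c *\<^sub>C x) = c *\<^sub>C T x"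
  using assms by (auto simp: clinear_on_def)

lemma clinear_on_zero: "clinear_on H T \<Longrightarrow> 0 \<in> H \<Longrightarrow> T 0 = 0"
  using clinear_onD(2)[of H T 0 0] by simp

lemma clinear_on_diff:
  assumes "clinear_on H T" "csubspace H" "x \<in> H" "y \<in> H"
  shows "T (x - y) = T x - T y"
  using clinear_onD(1)[OF assms(1), of "x - y" y] csubspaceD(4)[OF assms(2-4)] assms(4) by simp

lemma closure_cspan_induct:
  assumes h: "h \<in> closure (cspan S)"
    and base: "\<And>x. x \<in> S \<Longrightarrow> P x" and zero: "P 0"
    and add: "\<And>x y. x \<in> closure (cspan S) \<Longrightarrow> y \<in> closure (cspan S) \<Longrightarrow> P x \<Longrightarrow> P y \<Longrightarrow> P (x + y)"
    and scale: "\<And>c x. x \<in> closure (cspan S) \<Longrightarrow> P x \<Longrightarrow> P (c *\<^sub>C x)"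
    and lim: "\<And>X l. (\<And>n. X n \<in> closure (cspan S)) \<Longrightarrow> (\<And>n. P (X n)) \<Longrightarrow> X \<longlonglongrightarrow> l \<Longrightarrow>
       l \<in> closure (cspan S) \<Longrightarrow> P l"
  shows "P (h :: 'b :: hilbert_space)"
proof -
  let ?Z = "{x \<in> closure (cspan S). P x}"
  have "csubspace ?Z"
    using csubspaceD[OF csubspace_closure_cspan[of S]] zero add scale
    by (intro complex_vector.subspaceI) auto
  moreover have "S \<subseteq> ?Z" using base in_closure_cspan by blast
  ultimately have sub: "cspan S \<subseteq> ?Z" by (intro complex_vector.span_minimal)
  obtain X where "\<And>n. X n \<in> cspan S" "X \<longlonglongrightarrow> h" using h unfolding closure_sequential by blast
  then show ?thesis using sub h by (intro lim[of X h]) auto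
qed

lemma continuous_on_seq:
  assumes "continuous_on H T" "\<And>n. X n \<in> H" "X \<longlonglongrightarrow> l" "l \<in> H"
  shows "(\<lambda>n. T (X n)) \<longlonglongrightarrow> T l"
  using assms by (intro continuous_on_tendsto_compose[OF assms(1)]) auto

section \<open>Vectors in \<open>ell2\<close> with a prescribed Gram matrix\<close>

definition ell2_unit :: "nat \<Rightarrow> ell2" where
  "ell2_unit n = Abs_ell2 (\<lambda>m. if m = n then 1 else 0)"

lemma Rep_ell2_unit: "Rep_ell2 (ell2_unit n) m = (if m = n then 1 else 0)"
proof -
  have "summable (\<lambda>m. (cmod (if m = n then 1 else 0))\<^sup>2)"
    by (rule summable_finite[of "{n}"]) auto
  then show ?thesis by (simp add: ell2_unit_def Abs_ell2_inverse)
qed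

lemma cinner_ell2_unit: "cinner v (ell2_unit n) = Rep_ell2 v n"
proof -
  have "cinner v (ell2_unit n) = (\<Sum>m\<in>{n}. Rep_ell2 v m * cnj (Rep_ell2 (ell2_unit n) m))"
    unfolding cinner_ell2_def by (rule suminf_finite) (auto simp: Rep_ell2_unit)
  then show ?thesis by (simp add: Rep_ell2_unit)
qed

text \<open>One step of the Cholesky decomposition of \<open>K\<close>.\<close>

lemma gram_vector_step:
  fixes w :: "nat \<Rightarrow> ell2"
  assumes hermitian: "\<And>i j. K i j = cnj (K j i)"
    and psd: "\<And>N a. 0 \<le> Re (\<Sum>i<N. \<Sum>j<N. a i * cnj (a j) * K i j)"
    and w: "\<And>i j. i < n \<Longrightarrow> j < n \<Longrightarrow> cinner (w i) (w j) = K i j"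
    and supp: "\<And>i m. i < n \<Longrightarrow> n \<le> m \<Longrightarrow> Rep_ell2 (w i) m = 0"
  obtains v where "\<And>i. i < n \<Longrightarrow> cinner (w i) v = K i n" "cinner v v = K n n"
    "\<And>m. n < m \<Longrightarrow> Rep_ell2 v m = 0"
proof -
  define f where "f i = (if i < n then w i else 0)" for i
  \<comment> \<open>The prescribed products \<open>K i n\<close> are placed on the line of
    \<open>ell2_unit 0\<close>, so that extending a map of vectors also extends the scalar
    functional whose Riesz vector is sought.\<close>
  define g where "g i = (if i < n then K i n *\<^sub>C ell2_unit 0 else 0)" for i
  define C where "C = Re (K n n)"
  have Knn: "K n n = of_real C" using hermitian[of n n] by (auto simp: C_def complex_eq_iff)
  have C0: "0 \<le> C"
  proof -
    have "0 \<le> Re (\<Sum>i<Suc n. \<Sum>j<Suc n. (if i = n then 1 else 0) * cnj (if j = n then 1 else 0) * K i j)"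
      by (rule psd)
    also have "(\<Sum>i<Suc n. \<Sum>j<Suc n. (if i = n then 1 else 0) * cnj (if j = n then 1 else 0) * K i j) = K n n"
      by simp
    finally show ?thesis by (simp add: C_def)
  qed
  have unit: "norm (ell2_unit 0) = 1"
    using cinner_self[of "ell2_unit 0"] norm_ge_zero[of "ell2_unit 0"]
    by (simp add: cinner_ell2_unit Rep_ell2_unit power2_eq_1_iff flip: of_real_power)
  have bound: "norm (\<Sum>i\<in>I. a i *\<^sub>C g i) \<le> sqrt C * norm (\<Sum>i\<in>I. a i *\<^sub>C f i)" if I: "finite I" for I a
  proof -
    define c where "c i = (if i \<in> I then a i else 0)" for i
    have F: "(\<Sum>i\<in>I. a i *\<^sub>C f i) = (\<Sum>i<n. c i *\<^sub>C w i)"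
    proof -
      have "(\<Sum>i\<in>I. a i *\<^sub>C f i) = (\<Sum>i\<in>I \<inter> {..<n}. a i *\<^sub>C f i)"
        using I by (intro sum.mono_neutral_right) (auto simp: f_def)
      also have "\<dots> = (\<Sum>i\<in>I \<inter> {..<n}. c i *\<^sub>C w i)" by (intro sum.cong) (auto simp: c_def f_def)
      also have "\<dots> = (\<Sum>i<n. c i *\<^sub>C w i)"
        by (intro sum.mono_neutral_left) (auto simp: c_def)
      finally show ?thesis .
    qed
    have G: "(\<Sum>i\<in>I. a i *\<^sub>C g i) = (\<Sum>i<n. c i * K i n) *\<^sub>C ell2_unit 0"
    proof -
      have "(\<Sum>i\<in>I. a i *\<^sub>C g i) = (\<Sum>i\<in>I \<inter> {..<n}. a i *\<^sub>C g i)"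
        using I by (intro sum.mono_neutral_right) (auto simp: g_def)
      also have "\<dots> = (\<Sum>i\<in>I \<inter> {..<n}. (c i * K i n) *\<^sub>C ell2_unit 0)"
        by (intro sum.cong) (auto simp: c_def g_def scaleC_scaleC)
      also have "\<dots> = (\<Sum>i<n. (c i * K i n) *\<^sub>C ell2_unit 0)"
        by (intro sum.mono_neutral_left) (auto simp: c_def)
      finally show ?thesis by (simp add: complex_vector.scale_sum_left)
    qed
    define b where "b = (\<Sum>i<n. c i * K i n)"
    let ?X = "\<Sum>i<n. c i *\<^sub>C w i"
    have X: "(\<Sum>i<n. \<Sum>j<n. c i * cnj (c j) * K i j) = cinner ?X ?X"
      unfolding cinner_sum_left unfolding cinner_sum_right
      by (intro sum.cong refl) (simp add: cinner_lin w mult_ac)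
    have "(cmod b)\<^sup>2 \<le> (norm ?X)\<^sup>2 * C"
    proof (rule quadratic_nonneg_imp)
      fix t
      \<comment> \<open>Positivity tested at the coefficients \<open>c\<close> with last entry
        \<open>t\<close>; as \<open>t\<close> varies this is the Schur complement condition for the
        new row.\<close>
      define e where "e i = (if i = n then t else c i)" for i
      have "0 \<le> Re (\<Sum>i<Suc n. \<Sum>j<Suc n. e i * cnj (e j) * K i j)" by (rule psd)
      also have "(\<Sum>i<Suc n. \<Sum>j<Suc n. e i * cnj (e j) * K i j)
        = (\<Sum>i<n. \<Sum>j<n. c i * cnj (c j) * K i j) + (\<Sum>i<n. c i * cnj t * K i n)
          + ((\<Sum>j<n. t * cnj (c j) * K n j) + t * cnj t * K n n)"
        by (simp add: e_def sum.distrib)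
      also have "(\<Sum>i<n. c i * cnj t * K i n) = cnj t * b"
        by (simp add: b_def sum_distrib_left mult_ac)
      also have "(\<Sum>j<n. t * cnj (c j) * K n j) = cnj (cnj t * b)"
        using hermitian[of n] by (simp add: b_def sum_distrib_left mult_ac)
      also have "t * cnj t * K n n = of_real ((cmod t)\<^sup>2 * C)"
        by (simp add: Knn flip: complex_norm_square)
      finally show "0 \<le> (norm ?X)\<^sup>2 + 2 * Re (cnj t * b) + (cmod t)\<^sup>2 * C"
        unfolding X by (simp add: cinner_self algebra_simps)
    qed (use C0 in auto)
    then have "cmod b \<le> sqrt ((norm ?X)\<^sup>2 * C)" by (rule real_le_rsqrt)
    then show ?thesis unfolding F G norm_scaleC unit b_def[symmetric] by (simp add: real_sqrt_mult mult.commute)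
  qed
  let ?V = "closure (cspan (range f))"
  obtain T where T: "clinear_on ?V T" "\<And>i. T (f i) = g i" "\<And>h. h \<in> ?V \<Longrightarrow> norm (T h) \<le> sqrt C * norm h"
    by (rule extend_from_family[OF bound]) (use C0 in auto)
  obtain u where u: "u \<in> closure ?V" "\<And>v. v \<in> ?V \<Longrightarrow> cinner (T v) (ell2_unit 0) = cinner v u" "norm u \<le> sqrt C"
  proof (rule riesz[OF csubspace_closure_cspan, of "range f" "\<lambda>v. cinner (T v) (ell2_unit 0)" "sqrt C"])
    show "cmod (cinner (T v) (ell2_unit 0)) \<le> sqrt C * norm v" if "v \<in> ?V" for v
      using order_trans[OF cinner_bound[of "T v" "ell2_unit 0"]] T(3)[OF that] unit by simp
  qed (use C0 clinear_onD[OF T(1)] in \<open>auto simp: cinner_lin\<close>)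
  have wu: "cinner (w i) u = K i n" if "i < n" for i
    using u(2)[of "f i"] T(2)[of i] that in_closure_cspan[of "f i" "range f"]
    by (simp add: f_def g_def cinner_ell2_unit Rep_ell2_unit scaleC_ell2.rep_eq)
  have usupp: "Rep_ell2 u m = 0" if m: "n \<le> m" for m
  proof -
    have "u \<in> ?V" using u(1) by simp
    then have "cinner u (ell2_unit m) = 0"
    proof (rule closure_cspan_induct)
      show "cinner x (ell2_unit m) = 0" if "x \<in> range f" for x
        using that supp m by (auto simp: f_def cinner_ell2_unit zero_ell2.rep_eq)
      show "cinner l (ell2_unit m) = 0" if "\<And>n. cinner (X n) (ell2_unit m) = 0" "X \<longlonglongrightarrow> l" for X l
        using tendsto_cinner[OF that(2) tendsto_const, of "ell2_unit m"] that(1) by (simp add: LIMSEQ_const_iff)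
    qed (auto simp: cinner_lin)
    then show ?thesis by (simp add: cinner_ell2_unit)
  qed
  have uC: "(norm u)\<^sup>2 \<le> C" using power_mono[OF u(3), of 2] C0 by simp
  \<comment> \<open>\<open>u\<close> has the required products but may be too short; the missing
    length goes onto the fresh coordinate \<open>n\<close>, where all earlier vectors and
    \<open>u\<close> vanish.\<close>
  define r where "r = sqrt (C - (norm u)\<^sup>2)"
  define v where "v = u + complex_of_real r *\<^sub>C ell2_unit n"
  show thesis
  proof
    show "cinner (w i) v = K i n" if "i < n" for i
      using that wu supp[of i n] by (simp add: v_def cinner_lin cinner_ell2_unit)
    have un: "cinner u (ell2_unit n) = 0" "cinner (ell2_unit n) u = 0"
      using usupp[of n] cinner_commute[of "ell2_unit n" u] by (simp_all add: cinner_ell2_unit)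
    have uu: "cinner (ell2_unit n) (ell2_unit n) = 1" by (simp add: cinner_ell2_unit Rep_ell2_unit)
    have "cinner v v = of_real ((norm u)\<^sup>2) + of_real (r * r)"
      by (simp add: v_def cinner_lin un cinner_self[of u] uu)
    also have "r * r = C - (norm u)\<^sup>2" using uC by (simp add: r_def)
    finally show "cinner v v = K n n" by (simp add: Knn)
    show "Rep_ell2 v m = 0" if "n < m" for m
      using that usupp[of m] by (simp add: v_def plus_ell2.rep_eq scaleC_ell2.rep_eq Rep_ell2_unit)
  qed
qed

text \<open>The vectors are the rows of an infinite triangular Cholesky factor. Each extension keeps
  the earlier rows, so the choices are coherent and the diagonal sequence has all the prescribed
  products. Finite support of the rows is what leaves a free coordinate at every stage.\<close>

lemma gram_vectors:
  assumes hermitian: "\<And>i j. K i j = cnj (K j i)"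
    and psd: "\<And>N a. 0 \<le> Re (\<Sum>i<N. \<Sum>j<N. a i * cnj (a j) * K i j)"
  obtains w :: "nat \<Rightarrow> ell2" where "\<And>i j. cinner (w i) (w j) = K i j"
proof -
  define P where "P n w \<longleftrightarrow> (\<forall>i<n. \<forall>j<n. cinner (w i) (w j) = K i j) \<and> (\<forall>i<n. \<forall>m\<ge>n. Rep_ell2 (w i) m = 0)"
    for n and w :: "nat \<Rightarrow> ell2"
  have "\<exists>W. \<forall>n. P n (W n) \<and> (\<forall>i<n. W (Suc n) i = W n i)"
  proof (rule dependent_nat_choice)
    show "\<exists>w. P 0 w" by (simp add: P_def)
    fix w n assume w: "P n w"
    obtain v where v: "\<And>i. i < n \<Longrightarrow> cinner (w i) v = K i n" "cinner v v = K n n"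
      "\<And>m. n < m \<Longrightarrow> Rep_ell2 v m = 0"
    proof (rule gram_vector_step[OF hermitian psd, of n w])
      show "cinner (w i) (w j) = K i j" if "i < n" "j < n" for i j using w that by (simp add: P_def)
      show "Rep_ell2 (w i) m = 0" if "i < n" "n \<le> m" for i m using w that by (simp add: P_def)
    qed blast
    have v': "cinner v (w i) = K n i" if "i < n" for i
      using v(1)[OF that] hermitian[of n i] cinner_commute[of v "w i"] by simp
    have "P (Suc n) (w(n := v))"
      using w v v' unfolding P_def by (auto simp: less_Suc_eq)
    then show "\<exists>w'. P (Suc n) w' \<and> (\<forall>i<n. w' i = w i)" by (intro exI[of _ "w(n := v)"]) auto
  qed
  then obtain W where W: "\<And>n. P n (W n)" "\<And>n i. i < n \<Longrightarrow> W (Suc n) i = W n i" by blast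
  have stable: "W n i = W (Suc i) i" if "i < n" for n i
    using that by (induction n) (auto simp: less_Suc_eq W(2))
  show thesis
  proof
    show "cinner (W (Suc i) i) (W (Suc j) j) = K i j" for i j
    proof -
      define n where "n = Suc (max i j)"
      have ij: "i < n" "j < n" by (auto simp: n_def)
      then have "cinner (W n i) (W n j) = K i j" using W(1)[of n] by (simp add: P_def)
      then show ?thesis using stable ij by metis
    qed
  qed
qed

lemma dense_sequence:
  obtains d :: "nat \<Rightarrow> 'a :: hilbert_space" where "closure (range d) = UNIV"
proof -
  obtain D :: "'a set" where D: "countable D" "\<And>x e. e > 0 \<Longrightarrow> \<exists>d\<in>D. dist d x < e"
    using separable[where 'a = 'a] by blast
  have "D \<noteq> {}" using D(2)[of 1] by auto
  then have "range (from_nat_into D) = D" using D(1) by (simp add: range_from_nat_into)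
  moreover have "closure D = UNIV" using D(2) by (auto simp: closure_approachable)
  ultimately show thesis using that[of "from_nat_into D"] by simp
qed

lemma eq_on_dense:
  fixes F G :: "'a::topological_space \<Rightarrow> 'b::t2_space"
  assumes "closure S = UNIV" "\<And>x. x \<in> S \<Longrightarrow> F x = G x" "continuous_on UNIV F" "continuous_on UNIV G"
  shows "F x = G x"
proof -
  have "closed {x. F x = G x}" using assms(3,4) by (rule closed_Collect_eq)
  then have "closure S \<subseteq> {x. F x = G x}" using assms(2) by (intro closure_minimal) auto
  then show ?thesis using assms(1) by auto
qed

section \<open>The dilation of a distribution function\<close>

context distribution
begin

lemma moment_symmetric: "cinner (blinfun_apply (moment n) x) y = cinner x (blinfun_apply (moment n) y)"
  using \<Phi>_adjoint[of "\<lambda>t. of_real (t ^ n)" x y] by (simp add: continuous_intros)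

lemma moment_quadratic_le: "Re (cinner (blinfun_apply (moment n) x) x) \<le> (norm x)\<^sup>2"
proof -
  have "cmod (complex_of_real (t ^ n)) \<le> 1" if "t \<in> {-1..1}" for t
    using that power_le_one[of "\<bar>t\<bar>" n] by (auto simp: norm_power)
  then have "cmod (cinner (blinfun_apply (moment n) x) x) \<le> 1 * (norm x)\<^sup>2"
    by (intro \<Phi>_quadratic_bound continuous_intros) auto
  then show ?thesis using complex_Re_le_cmod[of "cinner (blinfun_apply (moment n) x) x"] by simp
qed

lemma moment_0: "moment 0 = id_blinfun"
  using \<Phi>_one by simp

lemma moment_diff: "moment n - moment (n + 2) = \<Phi> (\<lambda>t. of_real ((1 - t\<^sup>2) * t ^ n))"
proof -
  have "complex_of_real ((1 - t\<^sup>2) * t ^ n) = of_real (t ^ n) - of_real (t ^ (n + 2))" for t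
    by (simp add: algebra_simps power_add power2_eq_square)
  then show ?thesis by (simp only: \<Phi>_diff continuous_intros)
qed

text \<open>\<open>v n x\<close> will be the \<open>n\<close>-th power of the dilation at the copy
  of \<open>x\<close>. The kernel is first realized for \<open>x\<close> in a dense sequence, where
  countably many vectors suffice; \<open>moment (n + n) \<le> I\<close> makes each
  \<open>v n\<close> contractive there, which extends it, and the Gram identity follows by
  continuity.\<close>

theorem dilation_vectors:
  obtains v :: "nat \<Rightarrow> 'a \<Rightarrow> ell2" where "\<And>n. clinear_on UNIV (v n)"
    "\<And>n m x y. cinner (v n x) (v m y) = cinner (blinfun_apply (moment (n + m)) x) y"
proof -
  obtain d :: "nat \<Rightarrow> 'a" where d: "closure (range d) = UNIV" using dense_sequence .
  \<comment> \<open>A natural number codes a point of the dense sequence together with an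
    exponent.\<close>
  define di where "di k = d (fst (prod_decode k))" for k
  define ni where "ni k = snd (prod_decode k)" for k
  define K where "K k l = cinner (blinfun_apply (moment (ni k + ni l)) (di k)) (di l)" for k l
  obtain w :: "nat \<Rightarrow> ell2" where w: "\<And>k l. cinner (w k) (w l) = K k l"
  proof (rule gram_vectors)
    show "K i j = cnj (K j i)" for i j
      unfolding K_def by (metis moment_symmetric cinner_commute add.commute)
    fix N and a :: "nat \<Rightarrow> complex"
    have "0 \<le> Re (\<Sum>i<N. \<Sum>j<N. cinner (blinfun_apply (\<Phi> (\<lambda>t. of_real (1 * t ^ (ni i + ni j)))) (a i *\<^sub>C di i)) (a j *\<^sub>C di j))"
      by (rule \<Phi>_positive_family) auto
    moreover have "cinner (blinfun_apply (moment (ni i + ni j)) (a i *\<^sub>C di i)) (a j *\<^sub>C di j) = a i * cnj (a j) * K i j" for i j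
    proof -
      have "moment (ni i + ni j) \<in> bounded_ops" by (intro \<Phi>_ops continuous_intros)
      then show ?thesis by (simp add: K_def bounded_opsD cinner_lin mult_ac)
    qed
    ultimately show "0 \<le> Re (\<Sum>i<N. \<Sum>j<N. a i * cnj (a j) * K i j)" by simp
  qed blast
  have "\<exists>T. clinear_on UNIV T \<and> (\<forall>i. T (d i) = w (prod_encode (i, n))) \<and> continuous_on UNIV T" for n
  proof -
    define M where "M = moment (n + n)"
    have M: "M \<in> bounded_ops" unfolding M_def by (intro \<Phi>_ops continuous_intros)
    have bound: "norm (\<Sum>i\<in>I. a i *\<^sub>C w (prod_encode (i, n))) \<le> 1 * norm (\<Sum>i\<in>I. a i *\<^sub>C d i)"
      if "finite I" for I a
    proof -
      let ?W = "\<Sum>i\<in>I. a i *\<^sub>C w (prod_encode (i, n))" and ?X = "\<Sum>i\<in>I. a i *\<^sub>C d i"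
      have "cinner ?W ?W = (\<Sum>i\<in>I. \<Sum>j\<in>I. a i * cnj (a j) * cinner (blinfun_apply M (d i)) (d j))"
        unfolding cinner_sum_left unfolding cinner_sum_right
        by (intro sum.cong refl) (simp add: cinner_lin w K_def di_def ni_def M_def mult_ac)
      also have "\<dots> = cinner (blinfun_apply M ?X) ?X"
        unfolding blinfun.sum_right cinner_sum_left unfolding cinner_sum_right
        by (intro sum.cong refl) (simp add: cinner_lin bounded_opsD[OF M] mult_ac)
      finally have "(norm ?W)\<^sup>2 \<le> (norm ?X)\<^sup>2"
        using moment_quadratic_le[of "n + n" ?X, folded M_def] by (simp add: norm_eq_cinner[of ?W])
      then show ?thesis by (simp add: power2_le_iff_abs_le)
    qed
    have "range d \<subseteq> cspan (range d)" by (rule complex_vector.span_superset)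
    then have U: "closure (cspan (range d)) = UNIV" using closure_mono d by blast
    obtain T where "clinear_on UNIV T" "\<And>i. T (d i) = w (prod_encode (i, n))" "continuous_on UNIV T"
      by (rule extend_from_family[OF bound]) (auto simp: U)
    then show ?thesis by blast
  qed
  then obtain v where v: "\<And>n. clinear_on UNIV (v n)" "\<And>n i. v n (d i) = w (prod_encode (i, n))"
    "\<And>n. continuous_on UNIV (v n)" by metis
  have gram1: "cinner (v n (d i)) (v m y) = cinner (blinfun_apply (moment (n + m)) (d i)) y" for n m i y
  proof (rule eq_on_dense[OF d, where x = y])
    show "cinner (v n (d i)) (v m y) = cinner (blinfun_apply (moment (n + m)) (d i)) y" if "y \<in> range d" for y
      using that by (auto simp: v(2) w K_def di_def ni_def)
  qed (intro continuous_intros v)+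
  have gram: "cinner (v n x) (v m y) = cinner (blinfun_apply (moment (n + m)) x) y" for n m x y
  proof (rule eq_on_dense[OF d, where x = x])
    show "cinner (v n x) (v m y) = cinner (blinfun_apply (moment (n + m)) x) y" if "x \<in> range d" for x
      using that gram1 by auto
  qed (intro continuous_intros v)+
  show thesis using that[OF v(1) gram] .
qed

text \<open>The dilation is the shift taking \<open>v n x\<close> to \<open>v (Suc n) x\<close>. It
  is contractive because the squared norms of a combination and of its shift differ by the positive
  form with weight \<open>1 - t^2\<close>, and symmetric because \<open>moment (n + m)\<close> does
  not see on which side an exponent was raised.\<close>

theorem dilation_exists:
  obtains J :: "'a \<Rightarrow> ell2" and H A where "hilbert_extension J H" "selfadjoint_contraction_on H A"
    "simple_pair J H A" "\<And>n x y. cinner ((A ^^ n) (J x)) (J y) = cinner (blinfun_apply (moment n) x) y"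
proof -
  obtain v :: "nat \<Rightarrow> 'a \<Rightarrow> ell2" where v: "\<And>n. clinear_on UNIV (v n)"
    and gram: "\<And>n m x y. cinner (v n x) (v m y) = cinner (blinfun_apply (moment (n + m)) x) y"
    by (rule dilation_vectors) blast
  define f where "f p = v (snd p) (fst p)" for p :: "'a \<times> nat"
  define g where "g p = v (Suc (snd p)) (fst p)" for p :: "'a \<times> nat"
  define H where "H = closure (cspan (range f))"
  have vH: "v n x \<in> H" for n x
    unfolding H_def using rangeI[of f "(x, n)"] by (intro in_closure_cspan) (simp add: f_def)
  have bound: "norm (\<Sum>i\<in>I. a i *\<^sub>C g i) \<le> 1 * norm (\<Sum>i\<in>I. a i *\<^sub>C f i)" if "finite I" for I a
  proof -
    let ?F = "\<Sum>i\<in>I. a i *\<^sub>C f i" and ?G = "\<Sum>i\<in>I. a i *\<^sub>C g i"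
    let ?y = "\<lambda>i. a i *\<^sub>C fst i" and ?n = "\<lambda>i. snd i"
    define M where "M n = moment n" for n
    have M: "M n \<in> bounded_ops" for n unfolding M_def by (intro \<Phi>_ops continuous_intros)
    have gramM: "cinner (v n x) (v m y) = cinner (blinfun_apply (M (n + m)) x) y" for n m x y
      unfolding M_def by (rule gram)
    have M_diff: "M n - M (Suc (Suc n)) = \<Phi> (\<lambda>t. of_real ((1 - t\<^sup>2) * t ^ n))" for n
      using moment_diff[of n, folded M_def] by simp
    have "cinner ?F ?F - cinner ?G ?G = (\<Sum>i\<in>I. \<Sum>j\<in>I. cinner (blinfun_apply (M (?n i + ?n j)) (?y i)) (?y j)
        - cinner (blinfun_apply (M (Suc (Suc (?n i + ?n j)))) (?y i)) (?y j))"
      unfolding cinner_sum_left unfolding cinner_sum_right sum_subtractf[symmetric]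
      by (intro sum.cong refl) (simp add: cinner_lin f_def g_def gramM bounded_opsD[OF M] mult_ac)
    also have "\<dots> = (\<Sum>i\<in>I. \<Sum>j\<in>I. cinner (blinfun_apply (\<Phi> (\<lambda>t. of_real ((1 - t\<^sup>2) * t ^ (?n i + ?n j)))) (?y i)) (?y j))"
      unfolding M_diff[symmetric] by (simp only: blinfun.diff_left cinner_diff_left)
    also have "Re \<dots> \<ge> 0"
      by (rule \<Phi>_positive_family) (auto intro!: continuous_intros simp: abs_square_le_1)
    finally have "(norm ?G)\<^sup>2 \<le> (norm ?F)\<^sup>2" by (simp add: norm_eq_cinner)
    then show ?thesis by (simp add: power2_le_iff_abs_le)
  qed
  obtain A where A: "clinear_on H A" "\<And>i. A (f i) = g i" "\<And>h. h \<in> H \<Longrightarrow> norm (A h) \<le> 1 * norm h"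
    "continuous_on H A" "A ` H \<subseteq> closure (cspan (range g))"
    unfolding H_def by (rule extend_from_family[OF bound]) auto
  have "range g \<subseteq> range f"
  proof
    fix y assume "y \<in> range g"
    then obtain x n where "y = g (x, n)" by auto
    then have "y = f (x, Suc n)" by (simp add: f_def g_def)
    then show "y \<in> range f" by blast
  qed
  then have "closure (cspan (range g)) \<subseteq> H"
    unfolding H_def by (intro closure_mono complex_vector.span_mono)
  then have AH: "A ` H \<subseteq> H" using A(5) by blast
  have Av: "A (v n x) = v (Suc n) x" for n x using A(2)[of "(x, n)"] by (simp add: f_def g_def)
  have subH: "csubspace H" unfolding H_def by (rule csubspace_closure_cspan)
  have A0: "A 0 = 0" using clinear_on_zero[OF A(1)] csubspaceD(1)[OF subH] .
  have sym1: "cinner (A (f p)) k = cinner (f p) (A k)" if k: "k \<in> H" for k p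
    using k unfolding H_def
  proof (rule closure_cspan_induct)
    show "cinner (A (f p)) x = cinner (f p) (A x)" if "x \<in> range f" for x
      using that by (auto simp: A(2)) (simp add: f_def g_def gram)
    show "cinner (A (f p)) l = cinner (f p) (A l)"
      if X: "\<And>n. X n \<in> closure (cspan (range f))" "\<And>n. cinner (A (f p)) (X n) = cinner (f p) (A (X n))"
        "X \<longlonglongrightarrow> l" "l \<in> closure (cspan (range f))" for X l
    proof -
      have "(\<lambda>n. A (X n)) \<longlonglongrightarrow> A l" using X by (intro continuous_on_seq[OF A(4)]) (auto simp: H_def)
      then have "(\<lambda>n. cinner (f p) (A (X n))) \<longlonglongrightarrow> cinner (f p) (A l)" by (intro tendsto_intros)
      moreover have "(\<lambda>n. cinner (A (f p)) (X n)) \<longlonglongrightarrow> cinner (A (f p)) l" using X(3) by (intro tendsto_intros)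
      ultimately show ?thesis using X(2) LIMSEQ_unique by simp
    qed
  qed (use clinear_onD[OF A(1)] A0 in \<open>auto simp: cinner_lin H_def\<close>)
  have sym: "cinner (A h) k = cinner h (A k)" if h: "h \<in> H" and k: "k \<in> H" for h k
    using h unfolding H_def
  proof (rule closure_cspan_induct)
    show "cinner (A x) k = cinner x (A k)" if "x \<in> range f" for x
      using that sym1[OF k] by auto
    show "cinner (A l) k = cinner l (A k)"
      if X: "\<And>n. X n \<in> closure (cspan (range f))" "\<And>n. cinner (A (X n)) k = cinner (X n) (A k)"
        "X \<longlonglongrightarrow> l" "l \<in> closure (cspan (range f))" for X l
    proof -
      have "(\<lambda>n. A (X n)) \<longlonglongrightarrow> A l" using X by (intro continuous_on_seq[OF A(4)]) (auto simp: H_def)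
      then have "(\<lambda>n. cinner (A (X n)) k) \<longlonglongrightarrow> cinner (A l) k" by (intro tendsto_intros)
      moreover have "(\<lambda>n. cinner (X n) (A k)) \<longlonglongrightarrow> cinner l (A k)" using X(3) by (intro tendsto_intros)
      ultimately show ?thesis using X(2) LIMSEQ_unique by simp
    qed
  qed (use clinear_onD[OF A(1)] A0 in \<open>auto simp: cinner_lin H_def\<close>)
  have pow: "(A ^^ n) (v 0 x) = v n x" for n x by (induction n) (auto simp: Av)
  show thesis
  proof
    show "hilbert_extension (v 0) H"
      unfolding hilbert_extension_def
    proof (intro conjI allI)
      show "norm (v 0 x) = norm x" for x
      proof -
        have "cinner (v 0 x) (v 0 x) = cinner x x" unfolding gram by (simp add: moment_0 del: of_real_power power_0)
        then have "(norm (v 0 x))\<^sup>2 = (norm x)\<^sup>2" by (simp add: norm_eq_cinner)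
        then show ?thesis by (simp add: power2_eq_iff_nonneg)
      qed
    qed (use subH v vH in \<open>auto simp: H_def\<close>)
    show "selfadjoint_contraction_on H A"
      unfolding selfadjoint_contraction_on_def using AH A(1,3) sym by auto
    have "(\<Union>n. (A ^^ n) ` range (v 0)) = range f"
    proof
      show "(\<Union>n. (A ^^ n) ` range (v 0)) \<subseteq> range f"
        using rangeI[of f "(_, _)"] by (auto simp: pow f_def)
      show "range f \<subseteq> (\<Union>n. (A ^^ n) ` range (v 0))"
      proof
        fix y assume "y \<in> range f"
        then obtain x n where "y = f (x, n)" by auto
        then have "y = (A ^^ n) (v 0 x)" by (simp add: pow f_def)
        then show "y \<in> (\<Union>n. (A ^^ n) ` range (v 0))" by blast
      qed
    qed
    then show "simple_pair (v 0) H A" by (simp add: simple_pair_def H_def)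
    show "cinner ((A ^^ n) (v 0 x)) (v 0 y) = cinner (blinfun_apply (moment n) x) y" for n x y
      unfolding pow gram by simp
  qed
qed

end

section \<open>Resolvents of selfadjoint contractions\<close>

locale sa_contraction =
  fixes H :: "'b::hilbert_space set" and A :: "'b \<Rightarrow> 'b"
  assumes subspace: "csubspace H" and closed: "closed H" and A: "selfadjoint_contraction_on H A"
begin

lemmas H = csubspaceD[OF subspace]

lemma A_in: "h \<in> H \<Longrightarrow> A h \<in> H"
  using A by (auto simp: selfadjoint_contraction_on_def)

lemma A_linear: "clinear_on H A"
  using A by (auto simp: selfadjoint_contraction_on_def)

lemmas A_add = clinear_onD(1)[OF A_linear] and A_scale = clinear_onD(2)[OF A_linear]
  and A_diff = clinear_on_diff[OF A_linear subspace]

lemma A_sym: "h \<in> H \<Longrightarrow> k \<in> H \<Longrightarrow> cinner (A h) k = cinner h (A k)"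
  using A by (auto simp: selfadjoint_contraction_on_def)

lemma A_norm: "h \<in> H \<Longrightarrow> norm (A h) \<le> norm h"
  using A by (auto simp: selfadjoint_contraction_on_def)

lemma A_real: "h \<in> H \<Longrightarrow> Im (cinner (A h) h) = 0"
  using A_sym[of h h] arg_cong[OF cinner_commute[of h "A h"], of Im] by simp

lemma pow_in: "h \<in> H \<Longrightarrow> (A ^^ n) h \<in> H"
  by (induction n) (auto intro: A_in)

lemma pow_norm: "h \<in> H \<Longrightarrow> norm ((A ^^ n) h) \<le> norm h"
  by (induction n) (auto intro: order_trans[OF A_norm[OF pow_in]])

lemma pow_sym: "h \<in> H \<Longrightarrow> k \<in> H \<Longrightarrow> cinner ((A ^^ n) h) k = cinner h ((A ^^ n) k)"
proof (induction n arbitrary: k)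
  case (Suc n)
  then show ?case using A_sym[OF pow_in[of h n] Suc.prems(2)] Suc.IH[of "A k"] A_in
    by (simp add: funpow_swap1)
qed simp

definition B where "B z h = h + z *\<^sub>C A h"

lemma B_in: "h \<in> H \<Longrightarrow> B z h \<in> H"
  unfolding B_def by (intro H A_in)

lemma B_linear: "clinear_on H (B z)"
  unfolding clinear_on_def B_def
  by (auto simp: A_add A_scale complex_vector.scale_right_distrib scaleC_scaleC mult.commute)

text \<open>In the slit plane either \<open>z\<close> is real with modulus below \<open>1\<close>,
  and contractivity of \<open>A\<close> suffices, or \<open>z\<close> is not real, and the imaginary
  part of a form bounds \<open>B z\<close> below.\<close>

lemma B_lower:
  assumes z: "z \<in> slit_plane"
  obtains c where "c > 0" "\<And>h. h \<in> H \<Longrightarrow> c * norm h \<le> norm (B z h)"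
proof (cases "Im z = 0")
  case True
  then have z1: "cmod z < 1" using z by (simp add: slit_plane_iff cmod_def)
  have "(1 - cmod z) * norm h \<le> norm (B z h)" if h: "h \<in> H" for h
  proof -
    have "norm h = norm (B z h - z *\<^sub>C A h)" by (simp add: B_def)
    also have "\<dots> \<le> norm (B z h) + cmod z * norm (A h)"
      using norm_triangle_ineq4[of "B z h" "z *\<^sub>C A h"] by (simp add: norm_scaleC)
    also have "cmod z * norm (A h) \<le> cmod z * norm h" by (intro mult_left_mono A_norm h) auto
    finally show ?thesis by (simp add: algebra_simps)
  qed
  then show thesis using z1 by (intro that[of "1 - cmod z"]) auto
next
  case False
  then have z0: "z \<noteq> 0" by auto
  define c where "c = \<bar>Im z\<bar> / cmod z"
  have "c * norm h \<le> norm (B z h)" if h: "h \<in> H" for h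
  proof (cases "h = 0")
    case False
    define \<alpha> where "\<alpha> = Re (cinner (A h) h)"
    have \<alpha>: "cinner (A h) h = of_real \<alpha>" using A_real[OF h] by (simp add: \<alpha>_def complex_eq_iff)
    have e: "cinner (B z h) h = of_real ((norm h)\<^sup>2) + z * of_real \<alpha>"
      by (simp add: B_def cinner_lin cinner_self \<alpha>)
    \<comment> \<open>After multiplication by \<open>cnj z\<close> the term with \<open>A\<close>
      becomes real, and \<open>cnj z * (norm h)\<^sup>2\<close> alone has an imaginary part.\<close>
    have "\<bar>Im z\<bar> * (norm h)\<^sup>2 = \<bar>Im (cnj z * cinner (B z h) h)\<bar>"
      unfolding e by (simp add: algebra_simps abs_mult flip: of_real_power)
    also have "\<dots> \<le> cmod (cnj z * cinner (B z h) h)" by (rule abs_Im_le_cmod)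
    also have "\<dots> \<le> cmod z * (norm (B z h) * norm h)"
      unfolding norm_mult by (simp add: mult_left_mono cinner_bound)
    finally have "\<bar>Im z\<bar> * norm h * norm h \<le> cmod z * norm (B z h) * norm h"
      by (simp add: power2_eq_square mult.assoc)
    then have "\<bar>Im z\<bar> * norm h \<le> cmod z * norm (B z h)" using False by simp
    then show ?thesis using z0 by (simp add: c_def divide_le_eq mult.commute)
  qed (simp add: B_def)
  then show thesis using False z0 by (intro that[of c]) (auto simp: c_def)
qed

lemma B_adjoint: "h \<in> H \<Longrightarrow> k \<in> H \<Longrightarrow> cinner (B z h) k = cinner h (B (cnj z) k)"
  by (simp add: B_def cinner_lin A_sym)

text \<open>The lower bound gives injectivity and closed range. A vector orthogonal to the range is
  annihilated by the adjoint \<open>B (cnj z)\<close>, which has a lower bound of its own, so the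
  range is all of \<open>H\<close>.\<close>

lemma B_bij:
  assumes z: "z \<in> slit_plane"
  shows "bij_betw (B z) H H"
  unfolding bij_betw_def
proof
  obtain c where c: "c > 0" "\<And>h. h \<in> H \<Longrightarrow> c * norm h \<le> norm (B z h)"
    by (rule B_lower[OF z]) blast
  have diff: "c * norm (h - k) \<le> norm (B z h - B z k)" if "h \<in> H" "k \<in> H" for h k
    using c(2)[OF H(4)[OF that]] clinear_on_diff[OF B_linear subspace that] by simp
  show "inj_on (B z) H"
  proof (rule inj_onI)
    fix h k assume hk: "h \<in> H" "k \<in> H" "B z h = B z k"
    then have "c * norm (h - k) \<le> 0" using diff[OF hk(1,2)] by simp
    then show "h = k" using c(1) by (simp add: mult_le_0_iff)
  qed
  have sub: "csubspace (B z ` H)"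
  proof (rule complex_vector.subspaceI)
    show "0 \<in> B z ` H" using clinear_on_zero[OF B_linear H(1)] H(1) by (metis imageI)
    show "x + y \<in> B z ` H" if xy: "x \<in> B z ` H" "y \<in> B z ` H" for x y
    proof -
      obtain h k where "h \<in> H" "x = B z h" "k \<in> H" "y = B z k" using xy by blast
      then have "x + y = B z (h + k)" "h + k \<in> H" using clinear_onD(1)[OF B_linear] H(2) by auto
      then show ?thesis by blast
    qed
    show "a *\<^sub>C x \<in> B z ` H" if x: "x \<in> B z ` H" for a x
    proof -
      obtain h where "h \<in> H" "x = B z h" using x by blast
      then have "a *\<^sub>C x = B z (a *\<^sub>C h)" "a *\<^sub>C h \<in> H" using clinear_onD(2)[OF B_linear] H(3) by auto
      then show ?thesis by blast
    qed
  qed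
  have clos: "closed (B z ` H)"
    unfolding closed_sequential_limits
  proof (intro allI impI, elim conjE)
    fix X l assume X: "\<forall>n. X n \<in> B z ` H" "X \<longlonglongrightarrow> l"
    have "\<exists>h. h \<in> H \<and> X n = B z h" for n using X(1) by blast
    then obtain Y where Y: "\<And>n. Y n \<in> H" "\<And>n. X n = B z (Y n)" by metis
    have "Cauchy Y"
    proof (rule CauchyI)
      fix e :: real assume e: "e > 0"
      then obtain M where M: "\<forall>m\<ge>M. \<forall>n\<ge>M. norm (X m - X n) < c * e"
        using CauchyD[OF LIMSEQ_imp_Cauchy[OF X(2)], of "c * e"] c(1) by auto
      have "norm (Y m - Y n) < e" if "m \<ge> M" "n \<ge> M" for m n
      proof -
        have "c * norm (Y m - Y n) < c * e"
          using diff[OF Y(1) Y(1), of m n] M[rule_format, OF that] by (simp add: Y(2))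
        then show ?thesis using c(1) by simp
      qed
      then show "\<exists>M. \<forall>m\<ge>M. \<forall>n\<ge>M. norm (Y m - Y n) < e" by blast
    qed
    then obtain y where y: "Y \<longlonglongrightarrow> y" using Cauchy_convergent[of Y] unfolding convergent_def by blast
    have yH: "y \<in> H" using closed y Y(1) closed_sequential_limits by blast
    have "(\<lambda>n. A (Y n)) \<longlonglongrightarrow> A y"
    proof (rule Lim_null[THEN iffD2], rule Lim_null_comparison)
      show "\<forall>\<^sub>F n in sequentially. norm (A (Y n) - A y) \<le> norm (Y n - y)"
        using A_norm[OF H(4)[OF Y(1) yH]] A_diff[OF Y(1) yH] by simp
      show "(\<lambda>n. norm (Y n - y)) \<longlonglongrightarrow> 0" using y by (simp add: LIM_zero tendsto_norm_zero)
    qed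
    then have "(\<lambda>n. B z (Y n)) \<longlonglongrightarrow> B z y" unfolding B_def by (intro tendsto_intros y)
    then have "l = B z y" using X(2) LIMSEQ_unique by (simp flip: Y(2))
    then show "l \<in> B z ` H" using yH by blast
  qed
  show "B z ` H = H"
  proof
    show "B z ` H \<subseteq> H" using B_in by blast
    show "H \<subseteq> B z ` H"
    proof
      fix y assume y: "y \<in> H"
      let ?p = "orth_proj (B z ` H) y"
      have p: "?p \<in> B z ` H" "\<And>s. s \<in> B z ` H \<Longrightarrow> cinner (y - ?p) s = 0"
        using orth_proj_in[OF sub clos] orth_proj_orth[OF sub clos] by auto
      let ?r = "y - ?p"
      have r: "?r \<in> H" using y p(1) B_in by (intro H) auto
      have "cinner (B (cnj z) ?r) h = 0" if "h \<in> H" for h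
        using p(2)[of "B z h"] that B_adjoint[OF r that, of "cnj z"] by simp
      then have "B (cnj z) ?r = 0" using cinner_self_zero B_in[OF r] by blast
      moreover obtain c' where c': "c' > 0" "\<And>h. h \<in> H \<Longrightarrow> c' * norm h \<le> norm (B (cnj z) h)"
        using B_lower[of "cnj z"] z by (metis cnj_slit_plane)
      ultimately have "c' * norm ?r \<le> 0" using c'(2)[OF r] by simp
      then have "?r = 0" using c'(1) by (simp add: mult_le_0_iff)
      then show "y \<in> B z ` H" using p(1) by simp
    qed
  qed
qed

definition R where "R z = inv_into H (B z)"

lemma R_in: "z \<in> slit_plane \<Longrightarrow> h \<in> H \<Longrightarrow> R z h \<in> H"
  unfolding R_def using B_bij by (metis bij_betw_imp_surj_on inv_into_into)

lemma B_R: "z \<in> slit_plane \<Longrightarrow> h \<in> H \<Longrightarrow> B z (R z h) = h"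
  unfolding R_def using B_bij by (metis bij_betw_inv_into_right)

lemma R_eqI: "z \<in> slit_plane \<Longrightarrow> k \<in> H \<Longrightarrow> B z k = h \<Longrightarrow> R z h = k"
  unfolding R_def using B_bij by (metis bij_betw_inv_into_left)

lemma R_adjoint:
  assumes "z \<in> slit_plane" "h \<in> H" "k \<in> H"
  shows "cinner (R z h) k = cinner h (R (cnj z) k)"
  using assms R_in[of z h] R_in[of "cnj z" k] B_R[of z h] B_R[of "cnj z" k]
    B_adjoint[of "R z h" "R (cnj z) k" z] by simp

text \<open>The operator form of
  \<open>z * (z + t) / (1 + z * t) = 1 - (1 - z^2) / (1 + z * t)\<close>.\<close>

lemma mobius_R:
  assumes z: "z \<in> slit_plane" and h: "h \<in> H"
  shows "z *\<^sub>C (z *\<^sub>C R z h + A (R z h)) = h - (1 - z\<^sup>2) *\<^sub>C R z h"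
proof -
  have "z *\<^sub>C A (R z h) = h - R z h" using B_R[OF z h] by (simp add: B_def algebra_simps)
  then show ?thesis
    by (simp add: complex_vector.scale_right_distrib complex_vector.scale_left_diff_distrib scaleC_scaleC power2_eq_square)
qed

lemma R_bound_near:
  assumes z0: "z0 \<in> slit_plane"
  obtains c where "c > 0" "\<And>z h. cmod (z - z0) < c \<Longrightarrow> z \<in> slit_plane \<Longrightarrow> h \<in> H \<Longrightarrow> norm (R z h) \<le> norm h / c"
proof -
  obtain c where c: "c > 0" "\<And>h. h \<in> H \<Longrightarrow> c * norm h \<le> norm (B z0 h)"
    by (rule B_lower[OF z0]) blast
  have "norm (R z h) \<le> norm h / (c / 2)" if z: "cmod (z - z0) < c / 2" "z \<in> slit_plane" and h: "h \<in> H" for z h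
  proof -
    let ?r = "R z h"
    have r: "?r \<in> H" using R_in z h by blast
    have "c * norm ?r \<le> norm (B z0 ?r)" by (rule c(2)[OF r])
    also have "B z0 ?r = B z ?r - (z - z0) *\<^sub>C A ?r"
      by (simp add: B_def complex_vector.scale_left_diff_distrib)
    also have "norm \<dots> \<le> norm (B z ?r) + cmod (z - z0) * norm (A ?r)"
      using norm_triangle_ineq4[of "B z ?r" "(z - z0) *\<^sub>C A ?r"] by (simp add: norm_scaleC)
    also have "cmod (z - z0) * norm (A ?r) \<le> (c / 2) * norm ?r"
      using z A_norm[OF r] c(1) by (intro mult_mono) auto
    finally have "(c / 2) * norm ?r \<le> norm h" using B_R[OF z(2) h] by simp
    then show ?thesis using c(1) by (simp add: field_simps)
  qed
  then show thesis using c(1) by (intro that[of "c / 2"]) auto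
qed

lemma R_diff:
  assumes z: "z \<in> slit_plane" and w: "w \<in> slit_plane" and h: "h \<in> H"
  shows "R z h - R w h = (w - z) *\<^sub>C R z (A (R w h))"
proof -
  let ?r = "R w h" and ?s = "R z (A (R w h))"
  have r: "?r \<in> H" and s: "?s \<in> H" using R_in A_in w z h by auto
  have k: "?r + (w - z) *\<^sub>C ?s \<in> H" by (intro H r s)
  have "B z (?r + (w - z) *\<^sub>C ?s) = B z ?r + (w - z) *\<^sub>C B z ?s"
    using clinear_onD[OF B_linear] r s H by metis
  also have "B z ?s = A ?r" by (rule B_R[OF z A_in[OF r]])
  also have "B z ?r + (w - z) *\<^sub>C A ?r = B w ?r"
    by (simp add: B_def complex_vector.scale_left_diff_distrib)
  also have "B w ?r = h" by (rule B_R[OF w h])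
  finally have "R z h = ?r + (w - z) *\<^sub>C ?s" by (intro R_eqI z k)
  then show ?thesis by simp
qed

text \<open>By the resolvent identity the difference quotient is \<open>- cinner (R z u) k\<close>
  with \<open>u = A (R z0 h)\<close>, and the uniform bound on nearby resolvents makes
  \<open>R z u\<close> continuous at \<open>z0\<close>.\<close>

lemma R_holomorphic:
  assumes h: "h \<in> H" and k: "k \<in> H"
  shows "(\<lambda>z. cinner (R z h) k) holomorphic_on slit_plane"
proof (rule holomorphic_onI)
  fix z0 assume z0: "z0 \<in> slit_plane"
  obtain c where c: "c > 0" "\<And>z h. cmod (z - z0) < c \<Longrightarrow> z \<in> slit_plane \<Longrightarrow> h \<in> H \<Longrightarrow> norm (R z h) \<le> norm h / c"
    using R_bound_near[OF z0] by blast
  let ?u = "A (R z0 h)"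
  have u: "?u \<in> H" using A_in R_in z0 h by auto
  have near: "\<forall>\<^sub>F z in at z0 within slit_plane. z \<in> slit_plane \<and> z \<noteq> z0 \<and> cmod (z - z0) < c"
    unfolding eventually_at using c(1) by (auto simp: dist_norm)
  have Ru: "((\<lambda>z. R z ?u) \<longlongrightarrow> R z0 ?u) (at z0 within slit_plane)"
  proof (rule Lim_null[THEN iffD2], rule Lim_null_comparison)
    let ?b = "norm (A (R z0 ?u)) / c"
    show "\<forall>\<^sub>F z in at z0 within slit_plane. norm (R z ?u - R z0 ?u) \<le> cmod (z - z0) * ?b"
      using near
    proof eventually_elim
      case (elim z)
      then have "norm (R z ?u - R z0 ?u) = cmod (z - z0) * norm (R z (A (R z0 ?u)))"
        using R_diff[OF _ z0 u, of z] by (simp add: norm_scaleC norm_minus_commute)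
      also have "\<dots> \<le> cmod (z - z0) * ?b"
        using elim c(2)[of z] A_in R_in z0 u by (intro mult_left_mono) auto
      finally show ?case .
    qed
    show "((\<lambda>z. cmod (z - z0) * ?b) \<longlongrightarrow> 0) (at z0 within slit_plane)"
      using c(1) by (auto intro!: tendsto_eq_intros)
  qed
  have "((\<lambda>z. - cinner (R z ?u) k) \<longlongrightarrow> - cinner (R z0 ?u) k) (at z0 within slit_plane)"
    by (intro tendsto_intros Ru)
  moreover have "\<forall>\<^sub>F z in at z0 within slit_plane.
      - cinner (R z ?u) k = (cinner (R z h) k - cinner (R z0 h) k) / (z - z0)"
    using near
  proof eventually_elim
    case (elim z)
    then have "R z h - R z0 h = (z0 - z) *\<^sub>C R z ?u" using R_diff[OF _ z0 h] by blast
    then have "cinner (R z h) k - cinner (R z0 h) k = (z0 - z) * cinner (R z ?u) k"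
      by (metis cinner_diff_left cinner_scaleC_left)
    also have "\<dots> = - cinner (R z ?u) k * (z - z0)" by (simp add: algebra_simps)
    finally show ?case using elim by (simp add: divide_eq_eq)
  qed
  ultimately have "((\<lambda>z. (cinner (R z h) k - cinner (R z0 h) k) / (z - z0)) \<longlongrightarrow> - cinner (R z0 ?u) k) (at z0 within slit_plane)"
    by (rule tendsto_cong[THEN iffD1, rotated])
  then show "(\<lambda>z. cinner (R z h) k) field_differentiable at z0 within slit_plane"
    unfolding field_differentiable_def has_field_derivative_iff by blast
qed

lemma R_sums:
  assumes z: "cmod z < 1" and h: "h \<in> H"
  shows "(\<lambda>n. (- z) ^ n * cinner ((A ^^ n) h) k) sums cinner (R z h) k"
proof -
  have zs: "z \<in> slit_plane" by (rule slit_planeI[OF z])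
  let ?r = "R z h"
  have r: "?r \<in> H" by (rule R_in[OF zs h])
  \<comment> \<open>The finite geometric sum, obtained by moving one factor of \<open>B z\<close> at
    a time onto the resolvent vector.\<close>
  have step: "(\<Sum>n<m. (- z) ^ n *\<^sub>C (A ^^ n) h) = ?r - (- z) ^ m *\<^sub>C (A ^^ m) ?r" for m
  proof (induction m)
    case (Suc m)
    have "(A ^^ m) h = (A ^^ m) ?r + z *\<^sub>C (A ^^ Suc m) ?r"
    proof -
      have lin: "(A ^^ m) (x + z *\<^sub>C y) = (A ^^ m) x + z *\<^sub>C (A ^^ m) y" if "x \<in> H" "y \<in> H" for x y
        using that by (induction m) (auto simp: A_add A_scale pow_in H)
      have "(A ^^ m) h = (A ^^ m) (?r + z *\<^sub>C A ?r)" using B_R[OF zs h] by (simp add: B_def)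
      then show ?thesis using lin[OF r A_in[OF r]] by (simp add: funpow_swap1)
    qed
    then have "(- z) ^ m *\<^sub>C (A ^^ m) h = (- z) ^ m *\<^sub>C (A ^^ m) ?r - (- z) ^ Suc m *\<^sub>C (A ^^ Suc m) ?r"
      by (simp add: complex_vector.scale_right_distrib scaleC_scaleC mult.commute)
    then show ?case using Suc by simp
  qed simp
  have lim: "(\<lambda>m. ?r - (- z) ^ m *\<^sub>C (A ^^ m) ?r) \<longlonglongrightarrow> ?r - 0"
  proof (intro tendsto_diff tendsto_const, rule Lim_null_comparison)
    show "\<forall>\<^sub>F m in sequentially. norm ((- z) ^ m *\<^sub>C (A ^^ m) ?r) \<le> cmod z ^ m * norm ?r"
      using pow_norm[OF r] by (simp add: norm_scaleC norm_power mult_left_mono)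
    show "(\<lambda>m. cmod z ^ m * norm ?r) \<longlonglongrightarrow> 0"
      using z by (auto intro!: tendsto_eq_intros LIMSEQ_power_zero)
  qed
  have "(\<lambda>m. cinner (\<Sum>n<m. (- z) ^ n *\<^sub>C (A ^^ n) h) k) \<longlonglongrightarrow> cinner ?r k"
    unfolding step using lim by (intro tendsto_cinner tendsto_const) simp
  then show ?thesis by (simp add: sums_def cinner_sum_left cinner_scaleC_left)
qed

end

section \<open>Representations\<close>

text \<open>Norms determine the real inner product; the imaginary part is the real inner product
  with \<open>\<i> *\<^sub>C y\<close>, which a complex-linear map respects.\<close>

lemma isometry_cinner:
  assumes H: "csubspace H" and U: "clinear_on H U" and norm: "\<And>h. h \<in> H \<Longrightarrow> norm (U h) = norm h"
    and h: "h \<in> H" and k: "k \<in> H"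
  shows "cinner (U h) (U k) = cinner h k"
proof -
  have inner: "inner (U h) (U k) = inner h k" if "h \<in> H" "k \<in> H" for h k
  proof -
    have "norm (U h + U k) = norm (h + k)"
      using norm[OF csubspaceD(2)[OF H that]] clinear_onD(1)[OF U that] by simp
    then show ?thesis by (simp add: dot_norm norm that)
  qed
  have Im: "Im (cinner x y) = inner x (\<i> *\<^sub>C y)" for x y :: "'c :: hilbert_space"
    by (simp add: cinner_scaleC_right flip: Re_cinner)
  have "Im (cinner (U h) (U k)) = Im (cinner h k)"
    unfolding Im clinear_onD(2)[OF U k, symmetric] by (rule inner[OF h csubspaceD(3)[OF H k]])
  then show ?thesis using inner[OF h k] by (simp add: complex_eq_iff Re_cinner)
qed

lemma one_minus_square_slit: "z \<in> slit_plane \<Longrightarrow> 1 - z\<^sup>2 \<noteq> 0"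
  by (auto simp: slit_plane_iff power2_eq_1_iff)

locale extension = sa_contraction H A for H :: "'b::hilbert_space set" and A +
  fixes J :: "'a::hilbert_space \<Rightarrow> 'b"
  assumes J: "hilbert_extension J H"
begin

lemma J_linear: "clinear_on UNIV J" and J_norm [simp]: "norm (J x) = norm x" and J_in [simp, intro]: "J x \<in> H"
  using J by (auto simp: hilbert_extension_def)

lemma J_cinner [simp]: "cinner (J x) (J y) = cinner x y"
  by (rule isometry_cinner[OF complex_vector.subspace_UNIV J_linear]) auto

lemma J_diff: "J (x - y) = J x - J y"
  by (rule clinear_on_diff[OF J_linear complex_vector.subspace_UNIV]) auto

lemma range_J: "csubspace (range J)" "closed (range J)"
proof -
  show "csubspace (range J)"
  proof (rule complex_vector.subspaceI)
    show "0 \<in> range J" using clinear_on_zero[OF J_linear] by (metis UNIV_I rangeI)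
    show "x + y \<in> range J" if "x \<in> range J" "y \<in> range J" for x y
      using that clinear_onD(1)[OF J_linear] by (auto simp flip: clinear_onD(1)[OF J_linear])
    show "c *\<^sub>C x \<in> range J" if "x \<in> range J" for c x
      using that by (auto simp flip: clinear_onD(2)[OF J_linear])
  qed
  show "closed (range J)"
    unfolding closed_sequential_limits
  proof (intro allI impI, elim conjE)
    fix X l assume X: "\<forall>n. X n \<in> range J" "X \<longlonglongrightarrow> l"
    then have "\<exists>y. X n = J y" for n by blast
    then obtain Y where Y: "\<And>n. X n = J (Y n)" by metis
    have "norm (Y m - Y n) = norm (X m - X n)" for m n by (simp add: Y flip: J_diff)
    then have "Cauchy Y" using LIMSEQ_imp_Cauchy[OF X(2)] by (simp add: Cauchy_iff)
    then obtain y where y: "Y \<longlonglongrightarrow> y" using Cauchy_convergent[of Y] unfolding convergent_def by blast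
    have "X \<longlonglongrightarrow> J y"
    proof (rule Lim_null[THEN iffD2], rule tendsto_norm_zero_cancel)
      have "(\<lambda>n. norm (Y n - y)) \<longlonglongrightarrow> 0" using y by (simp add: LIM_zero tendsto_norm_zero)
      then show "(\<lambda>n. norm (X n - J y)) \<longlonglongrightarrow> 0" by (simp add: Y flip: J_diff)
    qed
    then show "l \<in> range J" using LIMSEQ_unique[OF X(2)] by blast
  qed
qed

lemma cmod_moment_le: "cmod (cinner ((A ^^ n) (J x)) (J y)) \<le> norm x * norm y"
  using order_trans[OF cinner_bound mult_right_mono[OF pow_norm[of "J x" n], of "norm (J y)"]] by simp

text \<open>The value of the Moebius transform of \<open>A\<close> at \<open>J x\<close> before
  compression; a representation says that its projection to \<open>range J\<close> is the copy of
  \<open>\<Omega> z x\<close>.\<close>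

definition transfer_vector :: "complex \<Rightarrow> 'a \<Rightarrow> 'b" where
  "transfer_vector z x = z *\<^sub>C R z (J x) + A (R z (J x))"

lemma represents_iff:
  "represents \<Omega> J H A \<longleftrightarrow> (\<forall>z\<in>slit_plane. \<forall>x. J (blinfun_apply (\<Omega> z) x) = orth_proj (range J) (transfer_vector z x))"
proof -
  have "B z = (\<lambda>h. h + z *\<^sub>C A h)" for z by (rule ext) (rule B_def)
  then show ?thesis
    unfolding represents_def transfer_vector_def R_def using J A by simp
qed

lemma orth_proj_eq_J_iff: "J w = orth_proj (range J) u \<longleftrightarrow> (\<forall>y. cinner u (J y) = cinner w y)"
proof
  assume w: "J w = orth_proj (range J) u"
  show "\<forall>y. cinner u (J y) = cinner w y"
  proof
    fix y
    have "cinner (u - J w) (J y) = 0" unfolding w by (intro orth_proj_orth range_J rangeI)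
    then show "cinner u (J y) = cinner w y" by (simp add: cinner_diff_left)
  qed
next
  assume *: "\<forall>y. cinner u (J y) = cinner w y"
  have "orth_proj (range J) u = J w"
    by (rule orth_proj_eqI[OF range_J]) (use * in \<open>auto simp: cinner_diff_left\<close>)
  then show "J w = orth_proj (range J) u" by simp
qed

lemma transfer_vector_cinner:
  assumes z: "z \<in> slit_plane"
  shows "z * cinner (transfer_vector z x) (J y) = cinner x y - (1 - z\<^sup>2) * cinner (R z (J x)) (J y)"
proof -
  have "z * cinner (transfer_vector z x) (J y) = cinner (z *\<^sub>C transfer_vector z x) (J y)"
    by (simp add: cinner_scaleC_left)
  also have "z *\<^sub>C transfer_vector z x = J x - (1 - z\<^sup>2) *\<^sub>C R z (J x)"
    unfolding transfer_vector_def by (rule mobius_R[OF z J_in])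
  finally show ?thesis by (simp add: cinner_diff_left cinner_scaleC_left)
qed

text \<open>For real \<open>t\<close> and unimodular \<open>z\<close> one has
  \<open>cmod (z + t) = cmod (1 + z * t)\<close>. Likewise the squared norms of the transfer vector
  and of \<open>B z\<close> at the resolvent vector have the same expansion, and the latter vector
  is \<open>J x\<close>.\<close>

lemma transfer_vector_norm:
  assumes z: "z \<in> slit_plane" and z1: "cmod z = 1"
  shows "norm (transfer_vector z x) = norm x"
proof -
  let ?r = "R z (J x)"
  have r: "?r \<in> H" by (rule R_in[OF z J_in])
  have sym: "cinner ?r (A ?r) = cinner (A ?r) ?r" using A_sym[OF r r] by simp
  have im: "Im (cinner (A ?r) ?r) = 0" by (rule A_real[OF r])
  have zz: "z * cnj z = 1" using complex_norm_square[of z] z1 by simp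
  have "cinner (transfer_vector z x) (transfer_vector z x)
      = (z * cnj z) * cinner ?r ?r + (z + cnj z) * cinner (A ?r) ?r + cinner (A ?r) (A ?r)"
    by (simp add: transfer_vector_def cinner_lin sym algebra_simps)
  moreover have "cinner (B z ?r) (B z ?r)
      = cinner ?r ?r + (z + cnj z) * cinner (A ?r) ?r + (z * cnj z) * cinner (A ?r) (A ?r)"
    by (simp add: B_def cinner_lin sym algebra_simps)
  ultimately have "cinner (transfer_vector z x) (transfer_vector z x) = cinner (B z ?r) (B z ?r)"
    unfolding zz by simp
  also have "B z ?r = J x" by (rule B_R[OF z J_in])
  finally have "(norm (transfer_vector z x))\<^sup>2 = (norm x)\<^sup>2"
    by (simp add: norm_eq_cinner)
  then show ?thesis by (simp add: power2_eq_iff_nonneg)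
qed

end

lemma representsD: "represents \<Omega> J H A \<Longrightarrow> extension H A J"
  by unfold_locales (auto simp: represents_def hilbert_extension_def)

text \<open>The powers of the dilation have the moments of \<open>\<sigma>\<close> as compressions,
  so the compressed resolvent equals the resolvent integral in the disc, and everywhere by
  continuation. Multiplying out \<open>1 - z^2\<close> turns this into the representation, except at
  \<open>z = 0\<close>, where the first moment is compared directly.\<close>

theorem (in distribution) representation_exists:
  assumes \<Omega>: "\<And>z. z \<in> slit_plane \<Longrightarrow> \<Phi> (mobius_kernel z) = \<Omega> z"
  obtains J :: "'a \<Rightarrow> ell2" and H A where "represents \<Omega> J H A" "simple_pair J H A"
proof -
  obtain J :: "'a \<Rightarrow> ell2" and H A where J: "hilbert_extension J H" "selfadjoint_contraction_on H A"
    and simple: "simple_pair J H A"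
    and moments: "\<And>n x y. cinner ((A ^^ n) (J x)) (J y) = cinner (blinfun_apply (moment n) x) y"
    by (rule dilation_exists) blast
  interpret E: extension H A J
    using J by unfold_locales (auto simp: hilbert_extension_def)
  have R: "cinner (E.R z (J x)) (J y) = (cinner x y - z * cinner (blinfun_apply (\<Phi> (mobius_kernel z)) x) y) / (1 - z\<^sup>2)"
    if z: "z \<in> slit_plane" for z x y
  proof (rule slit_plane_identity[where r = 1, OF _ _ _ _ _ z])
    show "(\<lambda>z. cinner (E.R z (J x)) (J y)) holomorphic_on slit_plane"
      by (rule E.R_holomorphic) auto
    have "(\<lambda>z. cinner (blinfun_apply (\<Phi> (mobius_kernel z)) x) y) holomorphic_on slit_plane"
      using op_holomorphic_imp_holomorphic[OF op_holomorphic_\<Phi>, of x y]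
      by (rule holomorphic_transform) simp
    then show "(\<lambda>z. (cinner x y - z * cinner (blinfun_apply (\<Phi> (mobius_kernel z)) x) y) / (1 - z\<^sup>2)) holomorphic_on slit_plane"
      using one_minus_square_slit by (intro holomorphic_intros) auto
    fix w :: complex assume w: "cmod w < 1"
    note ws = slit_planeI[OF w]
    have "(\<lambda>n. (- w) ^ n * cinner (blinfun_apply (moment n) x) y) sums cinner (E.R w (J x)) (J y)"
      using E.R_sums[OF w E.J_in, of x "J y"] by (simp only: moments)
    moreover have "(\<lambda>n. (- w) ^ n * cinner (blinfun_apply (moment n) x) y) sums
        cinner (blinfun_apply (\<Phi> (\<lambda>t. 1 / (1 + w * of_real t))) x) y"
      using bounded_linear.sums[OF bounded_linear_quadratic resolvent_sums[OF w], of x y]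
      by (simp add: cinner_lin del: of_real_power)
    ultimately have "cinner (E.R w (J x)) (J y) = cinner (blinfun_apply (\<Phi> (\<lambda>t. 1 / (1 + w * of_real t))) x) y"
      by (rule sums_unique2)
    moreover have "(1 - w\<^sup>2) * cinner (blinfun_apply (\<Phi> (\<lambda>t. 1 / (1 + w * of_real t))) x) y
        = cinner x y - w * cinner (blinfun_apply (\<Phi> (mobius_kernel w)) x) y"
      using arg_cong[OF resolvent_identity_\<Phi>[OF ws], of "\<lambda>T. cinner (blinfun_apply T x) y"]
      by (simp add: blinfun.diff_left cinner_lin)
    ultimately show "cinner (E.R w (J x)) (J y) = (cinner x y - w * cinner (blinfun_apply (\<Phi> (mobius_kernel w)) x) y) / (1 - w\<^sup>2)"
      using one_minus_square_slit[OF ws] by (simp add: field_simps)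
  qed auto
  have "represents \<Omega> J H A"
    unfolding E.represents_iff E.orth_proj_eq_J_iff
  proof (intro ballI allI)
    fix z x y assume z: "z \<in> slit_plane"
    show "cinner (E.transfer_vector z x) (J y) = cinner (blinfun_apply (\<Omega> z) x) y"
    proof (cases "z = 0")
      case True
      have "E.R 0 (J x) = J x" by (rule E.R_eqI) (auto simp: E.B_def)
      then have "cinner (E.transfer_vector 0 x) (J y) = cinner (blinfun_apply (moment 1) x) y"
        using moments[of 1 x y] by (simp add: E.transfer_vector_def)
      also have "moment 1 = \<Phi> (mobius_kernel 0)" by (simp add: mobius_kernel_def[abs_def])
      finally show ?thesis using \<Omega>[OF z] True by simp
    next
      case False
      have "z * cinner (E.transfer_vector z x) (J y) = z * cinner (blinfun_apply (\<Omega> z) x) y"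
        unfolding E.transfer_vector_cinner[OF z] R[OF z] \<Omega>[OF z]
        using one_minus_square_slit[OF z] by simp
      then show ?thesis using False by simp
    qed
  qed
  then show thesis using simple that by blast
qed

text \<open>The function determines the compressed resolvent for small positive \<open>z\<close>,
  and the Taylor coefficients of that are the signed compressed powers.\<close>

lemma represents_moments_unique:
  assumes 1: "represents \<Omega> J1 H1 A1" and 2: "represents \<Omega> J2 H2 A2"
  shows "cinner ((A1 ^^ n) (J1 x)) (J1 y) = cinner ((A2 ^^ n) (J2 x)) (J2 y)"
proof -
  interpret E1: extension H1 A1 J1 by (rule representsD[OF 1])
  interpret E2: extension H2 A2 J2 by (rule representsD[OF 2])
  let ?a = "\<lambda>n. (- 1) ^ n * cinner ((A1 ^^ n) (J1 x)) (J1 y)"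
  let ?b = "\<lambda>n. (- 1) ^ n * cinner ((A2 ^^ n) (J2 x)) (J2 y)"
  have "?a n = ?b n"
  proof (rule powser_coeff_unique)
    show "cmod (?a n) \<le> norm x * norm y" for n
      using E1.cmod_moment_le[of n x y] by (simp add: norm_mult norm_power)
    show "cmod (?b n) \<le> norm x * norm y" for n
      using E2.cmod_moment_le[of n x y] by (simp add: norm_mult norm_power)
    fix r :: real assume r: "0 < r" "r < 1 / 4"
    let ?z = "complex_of_real r"
    have z: "cmod ?z < 1" using r by simp
    note zs = slit_planeI[OF z]
    have t: "cinner (E1.transfer_vector ?z x) (J1 y) = cinner (E2.transfer_vector ?z x) (J2 y)"
      using 1[unfolded E1.represents_iff E1.orth_proj_eq_J_iff] 2[unfolded E2.represents_iff E2.orth_proj_eq_J_iff] zs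
      by metis
    have "cinner x y - (1 - ?z\<^sup>2) * cinner (E1.R ?z (J1 x)) (J1 y)
        = cinner x y - (1 - ?z\<^sup>2) * cinner (E2.R ?z (J2 x)) (J2 y)"
      by (simp only: E1.transfer_vector_cinner[OF zs, symmetric] E2.transfer_vector_cinner[OF zs, symmetric] t)
    then have "(1 - ?z\<^sup>2) * cinner (E1.R ?z (J1 x)) (J1 y) = (1 - ?z\<^sup>2) * cinner (E2.R ?z (J2 x)) (J2 y)"
      by simp
    then have R: "cinner (E1.R ?z (J1 x)) (J1 y) = cinner (E2.R ?z (J2 x)) (J2 y)"
      using one_minus_square_slit[OF zs] by (metis mult_left_cancel)
    have s: "(\<lambda>n. (- 1) ^ n * m n * ?z ^ n) sums l" if "(\<lambda>n. (- ?z) ^ n * m n) sums l" for m l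
      using that by (simp add: power_minus[of ?z] mult_ac)
    show "(\<Sum>n. ?a n * ?z ^ n) = (\<Sum>n. ?b n * ?z ^ n)"
      using s[OF E1.R_sums[OF z E1.J_in, of x "J1 y"]] s[OF E2.R_sums[OF z E2.J_in, of x "J2 y"]]
      unfolding R by (simp only: sums_iff)
  qed
  then show ?thesis by simp
qed

lemma (in extension) simple_pairD:
  assumes "simple_pair J H A"
  shows "H = closure (cspan (range (\<lambda>p. (A ^^ snd p) (J (fst p)))))"
proof -
  have "(\<Union>n. (A ^^ n) ` range J) = range (\<lambda>p. (A ^^ snd p) (J (fst p)))"
  proof (intro equalityI subsetI)
    fix y assume "y \<in> (\<Union>n. (A ^^ n) ` range J)"
    then obtain n x where "y = (A ^^ n) (J x)" by auto
    then show "y \<in> range (\<lambda>p. (A ^^ snd p) (J (fst p)))"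
      by (intro range_eqI[of _ _ "(x, n)"]) simp
  qed auto
  then show ?thesis using assms by (simp add: simple_pair_def)
qed

lemma (in sa_contraction) continuous_A: "continuous_on H A"
proof (rule lipschitz_on_continuous_on)
  show "1-lipschitz_on H A"
    using A_norm[OF H(4)] by (intro lipschitz_onI) (auto simp: dist_norm simp flip: A_diff)
qed

text \<open>By symmetry a product of two powers is a compressed single power, so the two generating
  families have equal Gram matrices. The correspondence of generators therefore extends
  isometrically in both directions, and by simplicity the extensions are mutually inverse between
  \<open>H1\<close> and \<open>H2\<close>.\<close>

theorem simple_representation_unique:
  assumes 1: "represents \<Omega> (J1 :: 'a::hilbert_space \<Rightarrow> 'b::hilbert_space) H1 A1" "simple_pair J1 H1 A1"
    and 2: "represents \<Omega> (J2 :: 'a \<Rightarrow> 'c::hilbert_space) H2 A2" "simple_pair J2 H2 A2"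
  shows "\<exists>U. unitary_between H1 H2 U \<and> (\<forall>x. U (J1 x) = J2 x) \<and> (\<forall>h\<in>H1. A2 (U h) = U (A1 h))"
proof -
  interpret E1: extension H1 A1 J1 by (rule representsD[OF 1(1)])
  interpret E2: extension H2 A2 J2 by (rule representsD[OF 2(1)])
  define f where "f p = (A1 ^^ snd p) (J1 (fst p))" for p :: "'a \<times> nat"
  define g where "g p = (A2 ^^ snd p) (J2 (fst p))" for p :: "'a \<times> nat"
  have H1: "H1 = closure (cspan (range f))" and H2: "H2 = closure (cspan (range g))"
    unfolding f_def g_def by (rule E1.simple_pairD[OF 1(2)], rule E2.simple_pairD[OF 2(2)])
  have fH: "f p \<in> H1" and gH: "g p \<in> H2" for p by (auto simp: f_def g_def intro: E1.pow_in E2.pow_in)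
  have gram: "cinner (f p) (f q) = cinner (g p) (g q)" for p q
  proof -
    have "cinner (f p) (f q) = cinner ((A1 ^^ (snd q + snd p)) (J1 (fst p))) (J1 (fst q))"
      using E1.pow_sym[OF E1.pow_in[OF E1.J_in] E1.J_in, of "snd q" "snd p" "fst p" "fst q"]
      by (simp add: f_def funpow_add)
    also have "\<dots> = cinner ((A2 ^^ (snd q + snd p)) (J2 (fst p))) (J2 (fst q))"
      by (rule represents_moments_unique[OF 1(1) 2(1)])
    also have "\<dots> = cinner (g p) (g q)"
      using E2.pow_sym[OF E2.pow_in[OF E2.J_in] E2.J_in, of "snd q" "snd p" "fst p" "fst q"]
      by (simp add: g_def funpow_add)
    finally show ?thesis .
  qed
  have norm_eq: "norm (\<Sum>i\<in>I. a i *\<^sub>C g i) = norm (\<Sum>i\<in>I. a i *\<^sub>C f i)" for I a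
  proof -
    have "cinner (\<Sum>i\<in>I. a i *\<^sub>C g i) (\<Sum>i\<in>I. a i *\<^sub>C g i) = cinner (\<Sum>i\<in>I. a i *\<^sub>C f i) (\<Sum>i\<in>I. a i *\<^sub>C f i)"
      unfolding cinner_sum_left unfolding cinner_sum_right by (simp add: cinner_lin gram)
    then have "(norm (\<Sum>i\<in>I. a i *\<^sub>C g i))\<^sup>2 = (norm (\<Sum>i\<in>I. a i *\<^sub>C f i))\<^sup>2" by (simp add: norm_eq_cinner)
    then show ?thesis by (simp add: power2_eq_iff_nonneg)
  qed
  obtain U where U: "clinear_on H1 U" "\<And>i. U (f i) = g i" "\<And>h. h \<in> H1 \<Longrightarrow> norm (U h) \<le> 1 * norm h"
    "continuous_on H1 U" "U ` H1 \<subseteq> H2"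
    unfolding H1 H2 by (rule extend_from_family[of g 1 f]) (auto simp: norm_eq)
  obtain V where V: "clinear_on H2 V" "\<And>i. V (g i) = f i" "\<And>h. h \<in> H2 \<Longrightarrow> norm (V h) \<le> 1 * norm h"
    "continuous_on H2 V" "V ` H2 \<subseteq> H1"
    unfolding H1 H2 by (rule extend_from_family[of f 1 g]) (auto simp: norm_eq)
  have VU: "V (U h) = h" if h: "h \<in> H1" for h
    using h unfolding H1
  proof (rule closure_cspan_induct, fold H1)
    show "V (U l) = l" if X: "\<And>n. X n \<in> H1" "\<And>n. V (U (X n)) = X n" "X \<longlonglongrightarrow> l" "l \<in> H1" for X l
    proof -
      have "(\<lambda>n. V (U (X n))) \<longlonglongrightarrow> V (U l)"
        using X U(5) by (intro continuous_on_seq[OF V(4)] continuous_on_seq[OF U(4)]) auto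
      then show ?thesis using X(2,3) LIMSEQ_unique by simp
    qed
    show "V (U (x + y)) = x + y" if "x \<in> H1" "y \<in> H1" "V (U x) = x" "V (U y) = y" for x y
      using that U(5) by (simp add: clinear_onD(1)[OF U(1)] clinear_onD(1)[OF V(1)] image_subset_iff)
    show "V (U (c *\<^sub>C x)) = c *\<^sub>C x" if "x \<in> H1" "V (U x) = x" for c x
      using that U(5) by (simp add: clinear_onD(2)[OF U(1)] clinear_onD(2)[OF V(1)] image_subset_iff)
    show "V (U 0) = 0"
      using clinear_on_zero[OF U(1) E1.H(1)] clinear_on_zero[OF V(1) E2.H(1)] by simp
  qed (auto simp: U(2) V(2))
  have UV: "U (V k) = k" if k: "k \<in> H2" for k
    using k unfolding H2
  proof (rule closure_cspan_induct, fold H2)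
    show "U (V l) = l" if X: "\<And>n. X n \<in> H2" "\<And>n. U (V (X n)) = X n" "X \<longlonglongrightarrow> l" "l \<in> H2" for X l
    proof -
      have "(\<lambda>n. U (V (X n))) \<longlonglongrightarrow> U (V l)"
        using X V(5) by (intro continuous_on_seq[OF U(4)] continuous_on_seq[OF V(4)]) auto
      then show ?thesis using X(2,3) LIMSEQ_unique by simp
    qed
    show "U (V (x + y)) = x + y" if "x \<in> H2" "y \<in> H2" "U (V x) = x" "U (V y) = y" for x y
      using that V(5) by (simp add: clinear_onD(1)[OF U(1)] clinear_onD(1)[OF V(1)] image_subset_iff)
    show "U (V (c *\<^sub>C x)) = c *\<^sub>C x" if "x \<in> H2" "U (V x) = x" for c x
      using that V(5) by (simp add: clinear_onD(2)[OF U(1)] clinear_onD(2)[OF V(1)] image_subset_iff)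
    show "U (V 0) = 0"
      using clinear_on_zero[OF U(1) E1.H(1)] clinear_on_zero[OF V(1) E2.H(1)] by simp
  qed (auto simp: U(2) V(2))
  have iso: "norm (U h) = norm h" if h: "h \<in> H1" for h
  proof (rule antisym)
    show "norm (U h) \<le> norm h" using U(3)[OF h] by simp
    have "U h \<in> H2" using U(5) h by blast
    from V(3)[OF this] show "norm h \<le> norm (U h)" by (simp add: VU[OF h])
  qed
  have onto: "U ` H1 = H2"
  proof
    show "H2 \<subseteq> U ` H1"
    proof
      fix k assume k: "k \<in> H2"
      then have "V k \<in> H1" using V(5) by blast
      then show "k \<in> U ` H1" using UV[OF k] by (metis imageI)
    qed
  qed (rule U(5))
  have AU: "A2 (U h) = U (A1 h)" if h: "h \<in> H1" for h
    using h unfolding H1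
  proof (rule closure_cspan_induct, fold H1)
    show "A2 (U x) = U (A1 x)" if xf: "x \<in> range f" for x
    proof -
      obtain p where x: "x = f p" using xf by blast
      have "A1 (f p) = f (fst p, Suc (snd p))" "A2 (g p) = g (fst p, Suc (snd p))" by (simp_all add: f_def g_def)
      then show ?thesis by (simp add: x U(2))
    qed
    show "A2 (U l) = U (A1 l)" if X: "\<And>n. X n \<in> H1" "\<And>n. A2 (U (X n)) = U (A1 (X n))" "X \<longlonglongrightarrow> l" "l \<in> H1" for X l
    proof -
      have "(\<lambda>n. A2 (U (X n))) \<longlonglongrightarrow> A2 (U l)"
        using X U(5) by (intro continuous_on_seq[OF E2.continuous_A] continuous_on_seq[OF U(4)]) auto
      moreover have "(\<lambda>n. U (A1 (X n))) \<longlonglongrightarrow> U (A1 l)"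
        using X E1.A_in by (intro continuous_on_seq[OF U(4)] continuous_on_seq[OF E1.continuous_A]) auto
      ultimately show ?thesis using X(2) LIMSEQ_unique by simp
    qed
    show "A2 (U (x + y)) = U (A1 (x + y))" if "x \<in> H1" "y \<in> H1" "A2 (U x) = U (A1 x)" "A2 (U y) = U (A1 y)" for x y
      using that U(5) E1.A_in by (simp add: clinear_onD(1)[OF U(1)] E1.A_add E2.A_add image_subset_iff)
    show "A2 (U (c *\<^sub>C x)) = U (A1 (c *\<^sub>C x))" if "x \<in> H1" "A2 (U x) = U (A1 x)" for c x
      using that U(5) E1.A_in by (simp add: clinear_onD(2)[OF U(1)] E1.A_scale E2.A_scale image_subset_iff)
    show "A2 (U 0) = U (A1 0)"
      using clinear_on_zero[OF U(1) E1.H(1)] clinear_on_zero[OF E1.A_linear E1.H(1)]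
        clinear_on_zero[OF E2.A_linear E2.H(1)] by simp
  qed
  have "U (J1 x) = J2 x" for x using U(2)[of "(x, 0)"] by (simp add: f_def g_def)
  moreover have "unitary_between H1 H2 U"
    unfolding unitary_between_def
    using U(1) onto isometry_cinner[OF E1.subspace U(1) iso] by blast
  ultimately show ?thesis using AU by blast
qed

section \<open>Inner functions\<close>

lemma AE_interval_witness:
  assumes "AE \<theta> in lborel. \<theta> \<in> {a..b} \<longrightarrow> P \<theta>" and "a \<le> c" "c < d" "d \<le> (b::real)"
  shows "\<exists>\<theta>. c < \<theta> \<and> \<theta> < d \<and> P \<theta>"
proof (rule ccontr)
  assume no: "\<not> ?thesis"
  have "AE \<theta> in lborel. \<theta> \<notin> {c<..<d}"
    using assms(1) by eventually_elim (use no assms(2-4) in auto)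
  then have "emeasure lborel {c<..<d} = 0"
    by (subst (asm) AE_iff_measurable[where N = "{c<..<d}"]) auto
  then show False using assms(3) by simp
qed

lemma slit_plane_cis: "sin \<theta> \<noteq> 0 \<Longrightarrow> cis \<theta> \<in> slit_plane"
  by (simp add: slit_plane_iff)

text \<open>Isometry almost everywhere becomes isometry at each point of the circle off
  \<open>\<plusminus>1\<close>, where \<open>\<Omega>\<close> is continuous: a violation at
  \<open>\<theta>\<close> would persist on a punctured interval, which meets the full-measure
  set.\<close>

lemma inner_fun_isometric:
  assumes inner: "inner_fun \<Omega>" and \<theta>: "0 < \<theta>" "\<theta> < 2 * pi" "sin \<theta> \<noteq> 0"
  shows "norm (blinfun_apply (\<Omega> (cis \<theta>)) x) = norm x"
proof (rule ccontr)
  assume ne: "norm (blinfun_apply (\<Omega> (cis \<theta>)) x) \<noteq> norm x"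
  obtain D where "(\<Omega> has_derivative (\<lambda>h. h *\<^sub>C D)) (at (cis \<theta>) within slit_plane)"
    using inner slit_plane_cis[OF \<theta>(3)] unfolding inner_fun_def RS_def op_holomorphic_on_def by blast
  then have "isCont \<Omega> (cis \<theta>)"
    using at_within_open[OF slit_plane_cis[OF \<theta>(3)] open_slit_plane] has_derivative_continuous by metis
  moreover have "isCont cis \<theta>" 
    using continuous_on_cis[OF continuous_on_id, of UNIV] by (simp add: continuous_on_eq_continuous_at)
  ultimately have "isCont (\<lambda>\<phi>. \<Omega> (cis \<phi>)) \<theta>" using isCont_o2 by blast
  then have "isCont (\<lambda>\<phi>. norm (blinfun_apply (\<Omega> (cis \<phi>)) x) - norm x) \<theta>" by (intro continuous_intros)
  then have "\<forall>\<^sub>F \<phi> in at \<theta>. norm (blinfun_apply (\<Omega> (cis \<phi>)) x) - norm x \<noteq> 0"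
    unfolding isCont_def using ne by (intro tendsto_imp_eventually_ne) auto
  then obtain e where e: "e > 0" "\<And>\<phi>. \<phi> \<noteq> \<theta> \<Longrightarrow> dist \<phi> \<theta> < e \<Longrightarrow> norm (blinfun_apply (\<Omega> (cis \<phi>)) x) \<noteq> norm x"
    unfolding eventually_at by auto
  \<comment> \<open>The interval to the right of \<open>\<theta>\<close> is cut off at
    \<open>2 * pi\<close>, where the almost-everywhere statement ends.\<close>
  let ?d = "min (\<theta> + e) (2 * pi)"
  obtain \<phi> where "\<theta> < \<phi>" "\<phi> < ?d" "\<forall>x. norm (blinfun_apply (\<Omega> (cis \<phi>)) x) = norm x"
    using AE_interval_witness[of 0 "2 * pi" "\<lambda>\<phi>. \<forall>x. norm (blinfun_apply (\<Omega> (cis \<phi>)) x) = norm x" \<theta> ?d]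
      inner \<theta> e(1) unfolding inner_fun_def by auto
  then show False using e(2)[of \<phi>] by (auto simp: dist_real_def)
qed

context extension
begin

text \<open>On the circle the transfer vector has the norm of \<open>x\<close>, so an isometric
  value means that projecting it loses no norm: it already lies in \<open>range J\<close>. The
  resolvent vector is a combination of it and \<open>J x\<close>.\<close>

lemma range_J_of_isometric:
  assumes rep: "represents \<Omega> J H A" and z: "z \<in> slit_plane" "cmod z = 1"
    and iso: "norm (blinfun_apply (\<Omega> z) x) = norm x"
  shows "R z (J x) \<in> range J" "A (R z (J x)) \<in> range J"
proof -
  let ?u = "transfer_vector z x" and ?r = "R z (J x)"
  have "J (blinfun_apply (\<Omega> z) x) = orth_proj (range J) ?u"
    using rep z unfolding represents_iff by blast
  then have "norm (orth_proj (range J) ?u) = norm ?u"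
    using transfer_vector_norm[OF z] iso by (metis J_norm)
  then have "?u - orth_proj (range J) ?u = 0"
    using norm_orth_proj[OF range_J, of ?u] by simp
  then have u: "?u \<in> range J" using orth_proj_in[OF range_J, of ?u] by simp
  have "(1 - z\<^sup>2) *\<^sub>C ?r = J x - z *\<^sub>C ?u"
    using mobius_R[OF z(1) J_in, of x] by (simp add: transfer_vector_def)
  also have "\<dots> \<in> range J" by (intro csubspaceD[OF range_J(1)] u rangeI)
  finally have "inverse (1 - z\<^sup>2) *\<^sub>C (1 - z\<^sup>2) *\<^sub>C ?r \<in> range J"
    by (rule csubspaceD(3)[OF range_J(1)])
  then show r: "?r \<in> range J" using one_minus_square_slit[OF z(1)] by (simp add: scaleC_scaleC)
  have "A ?r = ?u - z *\<^sub>C ?r" by (simp add: transfer_vector_def)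
  then show "A ?r \<in> range J" using u r csubspaceD[OF range_J(1)] by metis
qed

text \<open>Let \<open>k\<close> be the part of \<open>B \<i> (J x)\<close> orthogonal to
  \<open>range J\<close>. Then \<open>R \<i> k\<close> lies in \<open>range J\<close>, by invariance
  under \<open>R \<i>\<close>, and is orthogonal to it, by invariance under the adjoint
  \<open>R (- \<i>)\<close>. So \<open>k = 0\<close>, and \<open>A (J x)\<close> is recovered from
  \<open>B \<i> (J x) - J x\<close>.\<close>

lemma A_range_J:
  assumes i: "\<And>x. R \<i> (J x) \<in> range J" "\<And>x. R (- \<i>) (J x) \<in> range J"
  shows "A (J x) \<in> range J"
proof -
  have slit: "\<i> \<in> slit_plane" "- \<i> \<in> slit_plane" by (auto simp: slit_plane_iff)
  let ?h = "B \<i> (J x)" and ?P = "orth_proj (range J) (B \<i> (J x))"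
  have h: "?h \<in> H" by (rule B_in) simp
  have P: "?P \<in> range J" by (rule orth_proj_in[OF range_J])
  then obtain p where p: "?P = J p" by blast
  let ?k = "?h - J p"
  have k: "?k \<in> H" by (intro H h J_in)
  have Rk: "R \<i> ?k = J x - R \<i> (J p)"
  proof (rule R_eqI[OF slit(1)])
    show "J x - R \<i> (J p) \<in> H" by (intro H J_in R_in slit)
    show "B \<i> (J x - R \<i> (J p)) = ?k"
      using clinear_on_diff[OF B_linear subspace J_in R_in[OF slit(1) J_in], of \<i> x p] B_R[OF slit(1) J_in, of p] by simp
  qed
  then have Rk_in: "R \<i> ?k \<in> range J" using i(1) csubspaceD(4)[OF range_J(1)] by auto
  have "cinner (R \<i> ?k) m = 0" if m: "m \<in> range J" for m
  proof -
    obtain y where y: "m = J y" using m by blast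
    have "cinner (R \<i> ?k) m = cinner ?k (R (- \<i>) m)"
      using R_adjoint[OF slit(1) k, of m] y by simp
    also have "\<dots> = 0"
      unfolding p[symmetric] y by (intro orth_proj_orth range_J i)
    finally show ?thesis .
  qed
  then have "R \<i> ?k = 0" using Rk_in cinner_self_zero by blast
  then have "?k = B \<i> 0" using B_R[OF slit(1) k] by simp
  then have "?k = 0" using clinear_on_zero[OF B_linear H(1)] by simp
  then have "?h \<in> range J" by simp
  then have "?h - J x \<in> range J" by (intro csubspaceD[OF range_J(1)] rangeI)
  then have "(- \<i>) *\<^sub>C (?h - J x) \<in> range J" by (rule csubspaceD(3)[OF range_J(1)])
  then show ?thesis by (simp add: B_def scaleC_scaleC)
qed

text \<open>If \<open>\<Omega>\<close> is inner, \<open>range J\<close> is closed and invariant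
  under \<open>A\<close>, so simplicity leaves nothing outside it. Conversely, where
  \<open>range J\<close> is everything the projection is trivial and the transfer vector is
  isometric on the circle.\<close>

theorem inner_fun_iff:
  assumes RS: "\<Omega> \<in> RS" and rep: "represents \<Omega> J H A" and simple: "simple_pair J H A"
  shows "inner_fun \<Omega> \<longleftrightarrow> H = range J"
proof
  assume inner: "inner_fun \<Omega>"
  have c: "cis (pi / 2) = \<i>" "cis (3 / 2 * pi) = - \<i>"
    by (simp, rule complex_eqI) (simp_all only: cis.sel cos_3over2_pi sin_3over2_pi uminus_complex.sel
        imaginary_unit.sel minus_zero)
  have slit: "\<i> \<in> slit_plane" "- \<i> \<in> slit_plane" by (auto simp: slit_plane_iff)
  have "norm (blinfun_apply (\<Omega> \<i>) x) = norm x" "norm (blinfun_apply (\<Omega> (- \<i>)) x) = norm x" for x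
    using inner_fun_isometric[OF inner, of "pi / 2" x]
      inner_fun_isometric[OF inner, of "3 / 2 * pi" x, unfolded c sin_3over2_pi] c(1)
    by simp_all
  then have AJ: "A (J x) \<in> range J" for x
    using range_J_of_isometric(1)[OF rep slit(1)] range_J_of_isometric(1)[OF rep slit(2)]
    by (intro A_range_J) simp_all
  have "(A ^^ n) (J x) \<in> range J" for n x
    by (induction n) (use AJ in auto)
  then have "(\<Union>n. (A ^^ n) ` range J) \<subseteq> range J" by auto
  then have "cspan (\<Union>n. (A ^^ n) ` range J) \<subseteq> range J"
    using range_J(1) by (rule complex_vector.span_minimal)
  then have "closure (cspan (\<Union>n. (A ^^ n) ` range J)) \<subseteq> range J"
    using range_J(2) by (rule closure_minimal)
  then show "H = range J" using simple J_in by (auto simp: simple_pair_def)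
next
  assume H_eq: "H = range J"
  have iso: "norm (blinfun_apply (\<Omega> z) x) = norm x" if z: "z \<in> slit_plane" "cmod z = 1" for z x
  proof -
    have "transfer_vector z x \<in> range J"
      unfolding transfer_vector_def H_eq[symmetric] by (intro H A_in R_in z J_in)
    then have "orth_proj (range J) (transfer_vector z x) = transfer_vector z x"
      by (intro orth_proj_eqI range_J) auto
    then have "J (blinfun_apply (\<Omega> z) x) = transfer_vector z x"
      using rep z(1) unfolding represents_iff by metis
    then show ?thesis using transfer_vector_norm[OF z] by (metis J_norm)
  qed
  \<comment> \<open>At these angles \<open>cis \<theta>\<close> is \<open>\<plusminus>1\<close>,
    outside the slit plane.\<close>
  have "AE \<theta> in lborel. \<theta> \<notin> {0, pi, 2 * pi}"
    by (rule AE_not_in) (intro finite_imp_null_set_lborel, simp)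
  then have "AE \<theta> in lborel. \<theta> \<in> {0..2 * pi} \<longrightarrow> (\<forall>x. norm (blinfun_apply (\<Omega> (cis \<theta>)) x) = norm x)"
  proof eventually_elim
    case (elim \<theta>)
    show ?case
    proof (intro impI allI iso slit_plane_cis)
      assume "\<theta> \<in> {0..2 * pi}"
      then have "0 < \<theta>" "\<theta> < 2 * pi" "\<theta> \<noteq> pi" using elim by auto
      then show "sin \<theta> \<noteq> 0"
        using sin_gt_zero[of \<theta>] sin_lt_zero[of \<theta>] by (cases "\<theta> < pi") auto
    qed simp
  qed
  then show "inner_fun \<Omega>" using RS by (simp add: inner_fun_def)
qed

end

text \<open>A type cannot be quantified existentially, so existence is asserted in the universal
  separable space \<open>ell2\<close>, while the free types \<open>'b\<close> and \<open>'c\<close>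
  let the other claims range over arbitrary extensions. Existence of the integrals is a claim of its
  own because \<open>stieltjes_integral\<close> is a definite description. Elements of
  \<open>RS\<close> are unconstrained off the slit plane; cutting down to
  \<open>extensional slit_plane\<close> makes the correspondence a literal bijection.\<close>

theorem theorem6p3:
  shows
    "(\<forall>\<Omega> \<in> (RS :: (complex \<Rightarrow> ('a::hilbert_space \<Rightarrow>\<^sub>L 'a)) set).
        (\<exists>(J :: 'a \<Rightarrow> ell2) H A. represents \<Omega> J H A) \<and>
        (\<exists>(J :: 'a \<Rightarrow> ell2) H A. represents \<Omega> J H A \<and> simple_pair J H A) \<and>
        (\<forall>(J :: 'a \<Rightarrow> 'b::hilbert_space) H A. represents \<Omega> J H A \<and> simple_pair J H A \<longrightarrow>
          (inner_fun \<Omega> \<longleftrightarrow> H = range J)) \<and>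
        (\<forall>(J1 :: 'a \<Rightarrow> 'b) H1 A1 (J2 :: 'a \<Rightarrow> 'c::hilbert_space) H2 A2.
          represents \<Omega> J1 H1 A1 \<and> simple_pair J1 H1 A1 \<and>
          represents \<Omega> J2 H2 A2 \<and> simple_pair J2 H2 A2 \<longrightarrow>
          (\<exists>U. unitary_between H1 H2 U \<and> (\<forall>x. U (J1 x) = J2 x) \<and>
               (\<forall>h\<in>H1. A2 (U h) = U (A1 h))))) \<and>
     (\<forall>\<sigma> \<in> (distribution_functions :: (real \<Rightarrow> ('a \<Rightarrow>\<^sub>L 'a)) set). \<forall>z\<in>slit_plane.
        \<exists>I. has_stieltjes_integral (mobius_kernel z) \<sigma> I) \<and>
     bij_betw
        (\<lambda>\<sigma>. restrict (\<lambda>z. stieltjes_integral (mobius_kernel z) \<sigma>) slit_plane)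
        (distribution_functions :: (real \<Rightarrow> ('a \<Rightarrow>\<^sub>L 'a)) set)
        (RS \<inter> extensional slit_plane)"
proof (intro conjI ballI)
  fix \<Omega> :: "complex \<Rightarrow> 'a \<Rightarrow>\<^sub>L 'a" assume \<Omega>: "\<Omega> \<in> RS"
  interpret RS_function \<Omega> by unfold_locales (rule \<Omega>)
  obtain \<sigma> where \<sigma>: "distribution \<sigma>" "\<And>z. z \<in> slit_plane \<Longrightarrow> stieltjes_integral (mobius_kernel z) \<sigma> = \<Omega> z"
    by (rule distribution_exists) blast
  obtain J :: "'a \<Rightarrow> ell2" and H A where rep: "represents \<Omega> J H A" "simple_pair J H A"
    by (rule distribution.representation_exists[OF \<sigma>])
  then show "\<exists>(J :: 'a \<Rightarrow> ell2) H A. represents \<Omega> J H A"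
    "\<exists>(J :: 'a \<Rightarrow> ell2) H A. represents \<Omega> J H A \<and> simple_pair J H A"
    by blast+
  show "\<forall>(J :: 'a \<Rightarrow> 'b) H A. represents \<Omega> J H A \<and> simple_pair J H A \<longrightarrow> (inner_fun \<Omega> \<longleftrightarrow> H = range J)"
    using extension.inner_fun_iff[OF representsD \<Omega>] by blast
  show "\<forall>(J1 :: 'a \<Rightarrow> 'b) H1 A1 (J2 :: 'a \<Rightarrow> 'c) H2 A2.
          represents \<Omega> J1 H1 A1 \<and> simple_pair J1 H1 A1 \<and>
          represents \<Omega> J2 H2 A2 \<and> simple_pair J2 H2 A2 \<longrightarrow>
          (\<exists>U. unitary_between H1 H2 U \<and> (\<forall>x. U (J1 x) = J2 x) \<and>
               (\<forall>h\<in>H1. A2 (U h) = U (A1 h)))"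
    using simple_representation_unique by blast
next
  fix \<sigma> :: "real \<Rightarrow> 'a \<Rightarrow>\<^sub>L 'a" and z assume "\<sigma> \<in> distribution_functions" "z \<in> slit_plane"
  then show "\<exists>I. has_stieltjes_integral (mobius_kernel z) \<sigma> I"
    using distribution.has_stieltjes_integral_exists[OF distribution.intro continuous_on_kernel(1)] by blast
next
  let ?T = "\<lambda>\<sigma> :: real \<Rightarrow> 'a \<Rightarrow>\<^sub>L 'a. restrict (\<lambda>z. stieltjes_integral (mobius_kernel z) \<sigma>) slit_plane"
  show "bij_betw ?T distribution_functions (RS \<inter> extensional slit_plane)"
    unfolding bij_betw_def
  proof
    show "inj_on ?T distribution_functions"
    proof (rule inj_onI)
      fix \<sigma> \<tau> :: "real \<Rightarrow> 'a \<Rightarrow>\<^sub>L 'a"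
      assume st: "\<sigma> \<in> distribution_functions" "\<tau> \<in> distribution_functions" and eq: "?T \<sigma> = ?T \<tau>"
      show "\<sigma> = \<tau>"
      proof (rule distribution_eq_of_kernel_integrals)
        show "distribution \<sigma>" "distribution \<tau>" using st by (auto intro: distribution.intro)
        show "stieltjes_integral (mobius_kernel z) \<sigma> = stieltjes_integral (mobius_kernel z) \<tau>" if "z \<in> slit_plane" for z
          using fun_cong[OF eq, of z] that by simp
      qed
    qed
    show "?T ` distribution_functions = RS \<inter> extensional slit_plane"
    proof (intro equalityI subsetI)
      fix \<Omega> assume "\<Omega> \<in> ?T ` distribution_functions"
      then show "\<Omega> \<in> RS \<inter> extensional slit_plane"
        using distribution.RS_of_distribution[OF distribution.intro] by auto
    next
      fix \<Omega> :: "complex \<Rightarrow> 'a \<Rightarrow>\<^sub>L 'a" assume \<Omega>: "\<Omega> \<in> RS \<inter> extensional slit_plane"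
      interpret RS_function \<Omega> by unfold_locales (use \<Omega> in blast)
      obtain \<sigma> where \<sigma>: "distribution \<sigma>" "\<And>z. z \<in> slit_plane \<Longrightarrow> stieltjes_integral (mobius_kernel z) \<sigma> = \<Omega> z"
        by (rule distribution_exists) blast
      have "?T \<sigma> = \<Omega>"
        by (rule extensionalityI[of _ slit_plane]) (use \<Omega> \<sigma>(2) in auto)
      then show "\<Omega> \<in> ?T ` distribution_functions" using distribution.\<sigma>[OF \<sigma>(1)] by blast
    qed
  qed
qed

end
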